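(* Let $T>0$, let $L(t)$ be a square integrable Lévy martingale in $H$ with covariance operator $Q$, and let $\psi\in{\mathcal L}$. Then the processes $$\int_0^tS(t-s)\psi(s)\,dL(s),\qquad \int_0^tS_\lambda(t-s)\psi(s)\,dL(s),\qquad t\in[0,T],\ \lambda>0,$$ have càdlàg modifications and $$\lim_{\lambda\to+\infty}\mathbb{E}\sup_{0\le t\le T}\Big\|\int_0^tS(t-s)\psi(s)\,dL(s)-\int_0^tS_\lambda(t-s)\psi(s)\,dL(s)\Big\|^2=0.$$
   Context: $H$ is a real separable Hilbert space, $A$ is a linear, densely defined, maximal monotone operator in $H$, and $S(\cdot)$ is the $C_0$-semigroup of contractions generated by $-A$. For $\lambda>0$, $A_\lambda=\lambda A(\lambda I+A)^{-1}$ is the Yosida approximation of $A$ and $S_\lambda(\cdot)$ is the semigroup generated by $-A_\lambda$. $L$ is defined on a complete probability space with a normal filtration and $L(0)=0$. $\|\cdot\|_{\rm HS}$ denotes the Hilbert–Schmidt norm. ${\mathcal L}$ is the space of all predictable processes $\psi$ on $[0,T]$ whose values are linear operators from $Q^{1/2}(H)$ into $H$ such that $|\psi|_1=\big(\mathbb{E}\int_0^T\|\psi(s)Q^{1/2}\|_{\rm HS}^2\,ds\big)^{1/2}<+\infty$ (operators coinciding on $Q^{1/2}(H)$ are identified). *)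

theory Defs
  imports "HOL-Probability.Probability"
begin

text \<open>
  A real separable Hilbert space is a type of sort
  \<open>{real_inner, banach, second_countable_topology}\<close>. Bounded operators are elements of
  \<^typ>\<open>'h \<Rightarrow>\<^sub>L 'h\<close>; an unbounded operator is a function together with its domain.
  The time axis is \<open>[0,\<infinity>)\<close>: values of processes, filtrations and semigroups at negative
  times are irrelevant.
\<close>

subsection \<open>Operators\<close>

definition linear_on :: "'b::real_vector set \<Rightarrow> ('b \<Rightarrow> 'c::real_vector) \<Rightarrow> bool" where
  "linear_on V f \<longleftrightarrow> subspace V \<and>
     (\<forall>x\<in>V. \<forall>y\<in>V. f (x + y) = f x + f y) \<and> (\<forall>c. \<forall>x\<in>V. f (c *\<^sub>R x) = c *\<^sub>R f x)"

definition op_graph :: "'b set \<Rightarrow> ('b \<Rightarrow> 'c) \<Rightarrow> ('b \<times> 'c) set" where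
  "op_graph D A = {(x, A x) | x. x \<in> D}"

definition monotone_graph :: "('h::real_inner \<times> 'h) set \<Rightarrow> bool" where
  "monotone_graph G \<longleftrightarrow> (\<forall>(x, u)\<in>G. \<forall>(y, v)\<in>G. 0 \<le> (u - v) \<bullet> (x - y))"

text \<open>Maximality is with respect to inclusion of graphs, among all (also nonlinear and
  multivalued) monotone operators.\<close>

definition maximal_monotone :: "('h::real_inner \<times> 'h) set \<Rightarrow> bool" where
  "maximal_monotone G \<longleftrightarrow> monotone_graph G \<and> (\<forall>G'. monotone_graph G' \<longrightarrow> G \<subseteq> G' \<longrightarrow> G' = G)"

definition yosida :: "'h::real_vector set \<Rightarrow> ('h \<Rightarrow> 'h) \<Rightarrow> real \<Rightarrow> 'h \<Rightarrow> 'h" where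
  "yosida D A l x = l *\<^sub>R A (inv_into D (\<lambda>y. l *\<^sub>R y + A y) x)"

definition C0_semigroup :: "(real \<Rightarrow> 'h::real_normed_vector \<Rightarrow>\<^sub>L 'h) \<Rightarrow> bool" where
  "C0_semigroup S \<longleftrightarrow> S 0 = id_blinfun \<and>
     (\<forall>s\<ge>0. \<forall>t\<ge>0. S (s + t) = S s o\<^sub>L S t) \<and>
     (\<forall>x. ((\<lambda>t. S t x) \<longlongrightarrow> x) (at_right 0))"

definition infinitesimal_generator :: "(real \<Rightarrow> 'h::real_normed_vector \<Rightarrow>\<^sub>L 'h) \<Rightarrow> ('h \<times> 'h) set" where
  "infinitesimal_generator S = {(x, y). ((\<lambda>t. (S t x - x) /\<^sub>R t) \<longlongrightarrow> y) (at_right 0)}"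

text \<open>The nonnegative self-adjoint square root is unique, so that the choice is immaterial.\<close>

definition op_sqrt :: "('h::real_inner \<Rightarrow>\<^sub>L 'h) \<Rightarrow> ('h \<Rightarrow>\<^sub>L 'h)" where
  "op_sqrt Q = (SOME R. R o\<^sub>L R = Q \<and> (\<forall>x y. R x \<bullet> y = x \<bullet> R y) \<and> (\<forall>x. 0 \<le> R x \<bullet> x))"

definition orthonormal_basis :: "'h::real_inner set \<Rightarrow> bool" where
  "orthonormal_basis E \<longleftrightarrow> pairwise orthogonal E \<and> (\<forall>e\<in>E. norm e = 1) \<and> closure (span E) = UNIV"

text \<open>The square of the Hilbert--Schmidt norm, \<open>\<infinity>\<close> if the operator is not Hilbert--Schmidt. For
  bounded operators the sum does not depend on the basis; an unbounded linear operator may vanish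
  on an orthonormal basis and has to be excluded explicitly.\<close>

definition hs_norm_sq :: "('h::real_inner \<Rightarrow> 'h) \<Rightarrow> ennreal" where
  "hs_norm_sq B = (if bounded_linear B
     then (\<Sum>\<^sub>\<infinity>e\<in>(SOME E. orthonormal_basis E). ennreal ((norm (B e))\<^sup>2)) else \<infinity>)"

subsection \<open>Filtrations and Levy martingales\<close>

definition normal_filtration :: "'a measure \<Rightarrow> (real \<Rightarrow> 'a measure) \<Rightarrow> bool" where
  "normal_filtration M F \<longleftrightarrow>
     (\<forall>t\<ge>0. subalgebra M (F t)) \<and>
     (\<forall>s\<ge>0. \<forall>t\<ge>s. sets (F s) \<subseteq> sets (F t)) \<and>
     (\<forall>t\<ge>0. sets (F t) = (\<Inter>s\<in>{t<..}. sets (F s))) \<and>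
     null_sets M \<subseteq> sets (F 0)"

definition adapted :: "(real \<Rightarrow> 'a measure) \<Rightarrow> (real \<Rightarrow> 'a \<Rightarrow> 'h::topological_space) \<Rightarrow> bool" where
  "adapted F X \<longleftrightarrow> (\<forall>t\<ge>0. X t \<in> borel_measurable (F t))"

definition levy_process ::
  "'a measure \<Rightarrow> (real \<Rightarrow> 'a measure) \<Rightarrow>
   (real \<Rightarrow> 'a \<Rightarrow> 'h::{real_normed_vector, second_countable_topology}) \<Rightarrow> bool" where
  "levy_process M F L \<longleftrightarrow> adapted F L \<and>
     (AE \<omega> in M. L 0 \<omega> = 0) \<and>
     (\<forall>s\<ge>0. \<forall>t\<ge>s. prob_space.indep_set M (sets (F s))
        {(\<lambda>\<omega>. L t \<omega> - L s \<omega>) -` B \<inter> space M | B. B \<in> sets borel}) \<and>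
     (\<forall>s\<ge>0. \<forall>t\<ge>s. distr M borel (\<lambda>\<omega>. L t \<omega> - L s \<omega>) = distr M borel (L (t - s))) \<and>
     (\<forall>t\<ge>0. \<forall>\<epsilon>>0. ((\<lambda>s. measure M {\<omega> \<in> space M. norm (L s \<omega> - L t \<omega>) > \<epsilon>}) \<longlongrightarrow> 0)
        (at t within {0..}))"

text \<open>The defining property of the conditional expectation of \<open>X t\<close> given \<open>F s\<close> is written out,
  with Bochner integrals.\<close>

definition martingale ::
  "'a measure \<Rightarrow> (real \<Rightarrow> 'a measure) \<Rightarrow>
   (real \<Rightarrow> 'a \<Rightarrow> 'h::{banach, second_countable_topology}) \<Rightarrow> bool" where
  "martingale M F X \<longleftrightarrow> adapted F X \<and> (\<forall>t\<ge>0. integrable M (X t)) \<and>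
     (\<forall>s\<ge>0. \<forall>t\<ge>s. \<forall>B\<in>sets (F s). (LINT \<omega>:B|M. X t \<omega>) = (LINT \<omega>:B|M. X s \<omega>))"

definition square_integrable_levy_martingale ::
  "'a measure \<Rightarrow> (real \<Rightarrow> 'a measure) \<Rightarrow>
   (real \<Rightarrow> 'a \<Rightarrow> 'h::{banach, second_countable_topology}) \<Rightarrow> bool" where
  "square_integrable_levy_martingale M F L \<longleftrightarrow>
     levy_process M F L \<and> martingale M F L \<and> (\<forall>t\<ge>0. integrable M (\<lambda>\<omega>. (norm (L t \<omega>))\<^sup>2))"

definition covariance_operator ::
  "'a measure \<Rightarrow> (real \<Rightarrow> 'a \<Rightarrow> 'h::real_inner) \<Rightarrow> ('h \<Rightarrow>\<^sub>L 'h) \<Rightarrow> bool" where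
  "covariance_operator M L Q \<longleftrightarrow>
     (\<forall>s\<ge>0. \<forall>t\<ge>0. \<forall>x y. (LINT \<omega>|M. (L t \<omega> \<bullet> x) * (L s \<omega> \<bullet> y)) = min t s * (Q x \<bullet> y))"

subsection \<open>Integrands\<close>

definition predictable_algebra :: "'a measure \<Rightarrow> (real \<Rightarrow> 'a measure) \<Rightarrow> real \<Rightarrow> (real \<times> 'a) measure" where
  "predictable_algebra M F T = sigma ({0..T} \<times> space M)
     ({{s<..t} \<times> B | s t B. 0 \<le> s \<and> s < t \<and> t \<le> T \<and> B \<in> sets (F s)} \<union>
      {{0} \<times> B | B. B \<in> sets (F 0)})"

text \<open>The square of the norm \<open>|\<Psi>|\<^sub>1\<close> on \<open>[0,T]\<close>.\<close>

definition integrand_norm_sq ::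
  "'a measure \<Rightarrow> ('h::real_inner \<Rightarrow>\<^sub>L 'h) \<Rightarrow> real \<Rightarrow> (real \<Rightarrow> 'a \<Rightarrow> 'h \<Rightarrow> 'h) \<Rightarrow> ennreal" where
  "integrand_norm_sq M Q T \<Psi> =
     (\<integral>\<^sup>+\<omega>. (\<integral>\<^sup>+s\<in>{0..T}. hs_norm_sq (\<lambda>x. \<Psi> s \<omega> (op_sqrt Q x)) \<partial>lborel) \<partial>M)"

text \<open>
  The space \<open>\<L>\<close>. Only the values of \<open>\<Psi> s \<omega>\<close> on \<open>Q\<^sup>1\<^sup>/\<^sup>2(H)\<close> enter. Predictability of an operator-valued
  process is predictability of all its evaluations; these generate the Borel sets of the separable
  space of Hilbert--Schmidt operators. Boundedness almost everywhere is part of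
  \<open>|\<Psi>|\<^sub>1 < \<infinity>\<close>, but \<^const>\<open>nn_integral\<close> is a lower integral and would not see a
  nonmeasurable set of exceptional points, hence the explicit clause.
\<close>

definition integrands ::
  "'a measure \<Rightarrow> (real \<Rightarrow> 'a measure) \<Rightarrow> ('h::real_inner \<Rightarrow>\<^sub>L 'h) \<Rightarrow> real \<Rightarrow>
   (real \<Rightarrow> 'a \<Rightarrow> 'h \<Rightarrow> 'h) set" where
  "integrands M F Q T = {\<Psi>.
     (\<forall>s\<in>{0..T}. \<forall>\<omega>\<in>space M. linear_on (range (op_sqrt Q)) (\<Psi> s \<omega>)) \<and>
     (\<forall>x. (\<lambda>(s, \<omega>). \<Psi> s \<omega> (op_sqrt Q x)) \<in> borel_measurable (predictable_algebra M F T)) \<and>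
     (AE (s, \<omega>) in restrict_space lborel {0..T} \<Otimes>\<^sub>M M.
        bounded_linear (\<lambda>x. \<Psi> s \<omega> (op_sqrt Q x))) \<and>
     integrand_norm_sq M Q T \<Psi> < \<infinity>}"

subsection \<open>The stochastic integral\<close>

text \<open>A list of quadruples \<open>(a, b, B, \<Phi>)\<close> stands for the simple process
  \<open>\<Sum> 1\<^sub>B(\<omega>) 1\<^bsub>(a,b]\<^esub>(s) \<Phi>\<close>, whose integral is \<open>\<Sum> 1\<^sub>B \<Phi>(L(b) - L(a))\<close>.\<close>

type_synonym ('a, 'h) simple_integrand = "(real \<times> real \<times> 'a set \<times> ('h \<Rightarrow>\<^sub>L 'h)) list"

definition simple_integrands ::
  "(real \<Rightarrow> 'a measure) \<Rightarrow> real \<Rightarrow> ('a, 'h::real_normed_vector) simple_integrand set" where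
  "simple_integrands F t =
     {ps. \<forall>(a, b, B, \<Phi>)\<in>set ps. 0 \<le> a \<and> a < b \<and> b \<le> t \<and> B \<in> sets (F a)}"

definition simple_process ::
  "('a, 'h::real_normed_vector) simple_integrand \<Rightarrow> real \<Rightarrow> 'a \<Rightarrow> 'h \<Rightarrow> 'h" where
  "simple_process ps s \<omega> x =
     (\<Sum>(a, b, B, \<Phi>)\<leftarrow>ps. (indicator {a<..b} s * indicator B \<omega> :: real) *\<^sub>R blinfun_apply \<Phi> x)"

definition simple_integral ::
  "(real \<Rightarrow> 'a \<Rightarrow> 'h::real_normed_vector) \<Rightarrow> ('a, 'h) simple_integrand \<Rightarrow> 'a \<Rightarrow> 'h" where
  "simple_integral L ps \<omega> =
     (\<Sum>(a, b, B, \<Phi>)\<leftarrow>ps. (indicator B \<omega> :: real) *\<^sub>R blinfun_apply \<Phi> (L b \<omega> - L a \<omega>))"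

text \<open>Extension of the integral over \<open>[0,t]\<close> from simple processes to all integrands by
  the isometry into \<open>L\<^sup>2(\<Omega>; H)\<close>.\<close>

definition is_stoch_integral ::
  "'a measure \<Rightarrow> (real \<Rightarrow> 'a measure) \<Rightarrow> (real \<Rightarrow> 'a \<Rightarrow> 'h::real_inner) \<Rightarrow> ('h \<Rightarrow>\<^sub>L 'h) \<Rightarrow>
   real \<Rightarrow> (real \<Rightarrow> 'a \<Rightarrow> 'h \<Rightarrow> 'h) \<Rightarrow> ('a \<Rightarrow> 'h) \<Rightarrow> bool" where
  "is_stoch_integral M F L Q t \<Psi> X \<longleftrightarrow> X \<in> borel_measurable M \<and>
     (\<exists>ps. (\<forall>n::nat. ps n \<in> simple_integrands F t) \<and>
        (\<lambda>n. integrand_norm_sq M Q t (\<lambda>s \<omega> x. \<Psi> s \<omega> x - simple_process (ps n) s \<omega> x)) \<longlonglongrightarrow> 0 \<and>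
        (\<lambda>n. \<integral>\<^sup>+\<omega>. ennreal ((norm (X \<omega> - simple_integral L (ps n) \<omega>))\<^sup>2) \<partial>M) \<longlonglongrightarrow> 0)"

text \<open>The integral of \<open>\<Psi>\<close> over \<open>[0,t]\<close> is determined up to null sets; this selects a version.\<close>

definition stoch_integral ::
  "'a measure \<Rightarrow> (real \<Rightarrow> 'a measure) \<Rightarrow> (real \<Rightarrow> 'a \<Rightarrow> 'h::real_inner) \<Rightarrow> ('h \<Rightarrow>\<^sub>L 'h) \<Rightarrow>
   real \<Rightarrow> (real \<Rightarrow> 'a \<Rightarrow> 'h \<Rightarrow> 'h) \<Rightarrow> 'a \<Rightarrow> 'h" where
  "stoch_integral M F L Q t \<Psi> = (SOME X. is_stoch_integral M F L Q t \<Psi> X)"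

definition stoch_convolution ::
  "'a measure \<Rightarrow> (real \<Rightarrow> 'a measure) \<Rightarrow> (real \<Rightarrow> 'a \<Rightarrow> 'h::real_inner) \<Rightarrow> ('h \<Rightarrow>\<^sub>L 'h) \<Rightarrow>
   (real \<Rightarrow> 'h \<Rightarrow>\<^sub>L 'h) \<Rightarrow> (real \<Rightarrow> 'a \<Rightarrow> 'h \<Rightarrow> 'h) \<Rightarrow> real \<Rightarrow> 'a \<Rightarrow> 'h" where
  "stoch_convolution M F L Q S \<psi> t = stoch_integral M F L Q t (\<lambda>s \<omega> x. S (t - s) (\<psi> s \<omega> x))"

definition cadlag_on :: "real \<Rightarrow> (real \<Rightarrow> 'h::topological_space) \<Rightarrow> bool" where
  "cadlag_on T f \<longleftrightarrow> (\<forall>t\<in>{0..<T}. (f \<longlongrightarrow> f t) (at_right t)) \<and>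
     (\<forall>t\<in>{0<..T}. \<exists>l. (f \<longlongrightarrow> l) (at_left t))"

definition cadlag_modification ::
  "'a measure \<Rightarrow> real \<Rightarrow> (real \<Rightarrow> 'a \<Rightarrow> 'h::topological_space) \<Rightarrow> (real \<Rightarrow> 'a \<Rightarrow> 'h) \<Rightarrow> bool" where
  "cadlag_modification M T X Y \<longleftrightarrow>
     (\<forall>t\<in>{0..T}. Y t \<in> borel_measurable M \<and> (AE \<omega> in M. Y t \<omega> = X t \<omega>)) \<and>
     (\<forall>\<omega>\<in>space M. cadlag_on T (\<lambda>t. Y t \<omega>))"

end

theory Submission
  imports Defs
begin

text \<open>
  Approximate \<open>\<psi>\<close> by processes of the form \<open>\<Sum> 1\<^sub>B 1\<^bsub>(a,b]\<^esub>(s) S(s - a) \<Phi>\<close> with \<open>\<Phi>\<close> of rank one. Since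
  \<open>S(t - s) S(s - a) = S(t - a)\<close>, their convolutions are finite sums
  \<open>\<Sum> 1\<^sub>B S(t - a) \<Phi> (L(b \<and> t) - L(a \<and> t))\<close>, which are cadlag once \<open>L\<close> is replaced by a cadlag version.
  On a time grid such a convolution satisfies \<open>Y\<^bsub>k+1\<^esub> = C\<^sub>k Y\<^sub>k + d\<^sub>k\<close> with contractions \<open>C\<^sub>k\<close> and
  martingale differences \<open>d\<^sub>k\<close>, and the potential \<open>m\<^sup>2 + \<parallel>Y\<parallel>\<^sup>4 / m\<^sup>2\<close>, with \<open>m\<close> the running maximum, yields
  \<open>E max \<parallel>Y\<^sub>k\<parallel>\<^sup>2 \<le> 18 \<Sum> E \<parallel>d\<^sub>k\<parallel>\<^sup>2\<close>. Hence the convolution depends continuously on the integrand with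
  respect to \<open>E sup \<parallel>\<cdot>\<parallel>\<^sup>2\<close>, with a constant that is the same for all contraction semigroups. This gives
  cadlag modifications as uniform limits and reduces the convergence to a fixed simple process of finite
  rank, where it follows from \<open>S\<^sub>\<lambda>(t) f \<longlongrightarrow> S(t) f\<close> uniformly in \<open>t \<in> [0,T]\<close>.
\<close>

subsection \<open>Orthonormal sequences\<close>

text \<open>The obstacle is that t enters the integrand
  \<open>S (t - s) (\<psi> s \<omega> x)\<close>: the convolution is not a martingale in t, and
  Doob's inequality would become available only after dilating the contractions to a unitary group.
  The recursion on a grid avoids the dilation, and with the identity semigroup the same bound
  becomes an estimate for ordinary stochastic integrals. That estimate is needed because
  \<open>stoch_integral\<close> is a choice among limits in mean square: existence and almost sure
  uniqueness come before any statement about its paths. Two different semigroups do not share such a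
  recursion, so the maximal inequality does not reach the difference of their convolutions. The
  bridge is one list of simple data used for both: each convolution is compared with that of the
  list under its own semigroup, and the two sums for the list are compared path by path. Rank one
  makes this possible, because x \<mapsto> (x \<bullet> g) f meets the semigroup in the single
  vector f, where strong convergence is all that is required.\<close>

text \<open>Zero entries are allowed, so that finite-dimensional spaces need no separate treatment.\<close>

definition orthonormal_seq :: "(nat \<Rightarrow> 'h::real_inner) \<Rightarrow> bool" where
  "orthonormal_seq b \<longleftrightarrow> (\<forall>i j. i \<noteq> j \<longrightarrow> b i \<bullet> b j = 0) \<and> (\<forall>i. b i = 0 \<or> norm (b i) = 1)"

text \<open>\<open>sgn\<close> normalises the residual and sends a zero residual to zero, so a
  vector depending on its predecessors leaves a zero entry and the index set stays the natural
  numbers.\<close>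

function gram_schmidt :: "(nat \<Rightarrow> 'h::real_inner) \<Rightarrow> nat \<Rightarrow> 'h" where
  "gram_schmidt v n = sgn (v n - (\<Sum>i<n. (v n \<bullet> gram_schmidt v i) *\<^sub>R gram_schmidt v i))"
  by auto
termination by (relation "Wellfounded.measure snd") auto

declare gram_schmidt.simps [simp del]

lemma orthonormal_seq_gram_schmidt: "orthonormal_seq (gram_schmidt v)"
proof -
  let ?b = "gram_schmidt v"
  have n01: "?b i = 0 \<or> norm (?b i) = 1" for i
    by (subst (1 2) gram_schmidt.simps) (auto simp: norm_sgn sgn_zero_iff)
  have sq: "(v n \<bullet> ?b j) * (?b j \<bullet> ?b j) = v n \<bullet> ?b j" for n j
    using n01[of j] by (auto simp: norm_eq_1)
  \<comment> \<open>Orthogonality is proved for initial segments, because the residual at index n is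
    orthogonal to its predecessors only once these are known to be orthogonal to one
    another.\<close>
  have lt: "\<forall>i<n. \<forall>j<n. i \<noteq> j \<longrightarrow> ?b i \<bullet> ?b j = 0" for n
  proof (induction n)
    case (Suc n)
    have "?b n \<bullet> ?b j = 0" if "j < n" for j
    proof -
      have "(\<Sum>i<n. (v n \<bullet> ?b i) * (?b i \<bullet> ?b j)) = (\<Sum>i<n. if i = j then v n \<bullet> ?b j else 0)"
        using Suc.IH that sq by (intro sum.cong) auto
      then have "(v n - (\<Sum>i<n. (v n \<bullet> ?b i) *\<^sub>R ?b i)) \<bullet> ?b j = 0"
        using that by (simp add: inner_diff_left inner_sum_left)
      then show ?thesis
        by (subst gram_schmidt.simps) (simp add: sgn_div_norm)
    qed
    then show ?case
      using Suc.IH by (auto simp: less_Suc_eq inner_commute)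
  qed auto
  have "?b i \<bullet> ?b j = 0" if "i \<noteq> j" for i j
    using lt[of "Suc (max i j)"] that by auto
  then show ?thesis
    using n01 by (auto simp: orthonormal_seq_def)
qed

text \<open>Applied to the images of a dense sequence under \<open>R\<close>, this keeps the
  orthonormalised vectors inside the range of \<open>R\<close>, so that each of them has a
  preimage.\<close>

lemma gram_schmidt_in_span: "gram_schmidt v n \<in> span (range v)"
proof (induction n rule: less_induct)
  case (less n)
  then show ?case
    by (subst gram_schmidt.simps, unfold sgn_div_norm, intro span_scale span_diff span_sum)
       (auto intro: span_base)
qed

lemma span_gram_schmidt: "v n \<in> span (range (gram_schmidt v))"
proof -
  define w where "w = v n - (\<Sum>i<n. (v n \<bullet> gram_schmidt v i) *\<^sub>R gram_schmidt v i)"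
  have "w = norm w *\<^sub>R gram_schmidt v n"
    by (subst gram_schmidt.simps, cases "w = 0") (simp_all add: w_def[symmetric] sgn_div_norm)
  then have "v n = norm w *\<^sub>R gram_schmidt v n + (\<Sum>i<n. (v n \<bullet> gram_schmidt v i) *\<^sub>R gram_schmidt v i)"
    by (simp add: w_def)
  also have "\<dots> \<in> span (range (gram_schmidt v))"
    by (intro span_add span_scale span_sum span_base) auto
  finally show ?thesis .
qed

text \<open>\<open>b i \<bullet> b i\<close> is 1 or 0, and in the second case
  \<open>x \<bullet> b i\<close> vanishes as well; the identity replaces normalisation wherever zero
  entries may occur.\<close>

lemma orthonormal_seq_inner_self:
  assumes "orthonormal_seq b" shows "(x \<bullet> b i) * (b i \<bullet> b i) = x \<bullet> b i"
  using assms by (auto simp: orthonormal_seq_def norm_eq_1 dest!: spec[of _ i])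

lemma orthonormal_seq_norm_le: "orthonormal_seq b \<Longrightarrow> norm (b i) \<le> 1"
  unfolding orthonormal_seq_def by (metis norm_zero zero_le_one order_refl)

lemma norm_sum_orthonormal_seq:
  assumes "orthonormal_seq b" "finite I"
  shows "(norm (\<Sum>i\<in>I. c i *\<^sub>R b i))\<^sup>2 = (\<Sum>i\<in>I. (c i)\<^sup>2 * (b i \<bullet> b i))"
proof -
  have "(norm (\<Sum>i\<in>I. c i *\<^sub>R b i))\<^sup>2 = (\<Sum>i\<in>I. \<Sum>j\<in>I. c i * c j * (b i \<bullet> b j))"
    by (simp only: power2_norm_eq_inner inner_sum_left, simp only: inner_sum_right inner_scaleR_left inner_scaleR_right sum_distrib_left mult.assoc mult.left_commute)
  also have "\<dots> = (\<Sum>i\<in>I. \<Sum>j\<in>I. if j = i then (c i)\<^sup>2 * (b i \<bullet> b i) else 0)"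
    using assms(1) by (intro sum.cong) (auto simp: orthonormal_seq_def power2_eq_square)
  finally show ?thesis using assms(2) by simp
qed

text \<open>Pythagoras. Since the left-hand side is nonnegative, Bessel's inequality can be read
  off.\<close>

lemma norm_partial_expansion:
  assumes b: "orthonormal_seq b"
  shows "(norm (x - (\<Sum>i<n. (x \<bullet> b i) *\<^sub>R b i)))\<^sup>2 = (norm x)\<^sup>2 - (\<Sum>i<n. (x \<bullet> b i)\<^sup>2)"
proof -
  have "(\<Sum>i<n. (x \<bullet> b i)\<^sup>2 * (b i \<bullet> b i)) = (\<Sum>i<n. (x \<bullet> b i)\<^sup>2)"
    by (intro sum.cong refl) (simp only: power2_eq_square mult.assoc orthonormal_seq_inner_self[OF b])
  then have 1: "(norm (\<Sum>i<n. (x \<bullet> b i) *\<^sub>R b i))\<^sup>2 = (\<Sum>i<n. (x \<bullet> b i)\<^sup>2)"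
    using norm_sum_orthonormal_seq[OF b, of "{..<n}"] by simp
  have 2: "x \<bullet> (\<Sum>i<n. (x \<bullet> b i) *\<^sub>R b i) = (\<Sum>i<n. (x \<bullet> b i)\<^sup>2)"
    by (simp add: inner_sum_right power2_eq_square)
  show ?thesis
    using 1 2 by (simp add: power2_norm_eq_inner inner_diff_left inner_diff_right inner_commute)
qed

lemma norm_partial_expansion_le:
  assumes b: "orthonormal_seq b"
  shows "norm (\<Sum>i<n. (x \<bullet> b i) *\<^sub>R b i) \<le> norm x"
proof (rule power2_le_imp_le)
  have "(\<Sum>i<n. (x \<bullet> b i)\<^sup>2 * (b i \<bullet> b i)) = (\<Sum>i<n. (x \<bullet> b i)\<^sup>2)"
    by (intro sum.cong refl) (simp only: power2_eq_square mult.assoc orthonormal_seq_inner_self[OF b])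
  then have 1: "(norm (\<Sum>i<n. (x \<bullet> b i) *\<^sub>R b i))\<^sup>2 = (\<Sum>i<n. (x \<bullet> b i)\<^sup>2)"
    using norm_sum_orthonormal_seq[OF b, of "{..<n}"] by simp
  show "(norm (\<Sum>i<n. (x \<bullet> b i) *\<^sub>R b i))\<^sup>2 \<le> (norm x)\<^sup>2"
    using norm_partial_expansion[OF b, of x n] 1
    by (metis diff_ge_0_iff_ge zero_le_power2)
qed simp

text \<open>The partial expansions are contractions, and each element of the span is eventually
  fixed by them; approximating x by such an element then suffices.\<close>

lemma orthonormal_expansion:
  assumes b: "orthonormal_seq b" and x: "x \<in> closure (span (range b))"
  shows "(\<lambda>n. \<Sum>i<n. (x \<bullet> b i) *\<^sub>R b i) \<longlonglongrightarrow> x"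
proof -
  define P where "P n y = (\<Sum>i<n. (y \<bullet> b i) *\<^sub>R b i)" for n y
  have P_diff: "P n y - P n z = P n (y - z)" for n y z
    by (simp add: P_def inner_diff_left scaleR_diff_left sum_subtractf)
  have P_add: "P n (y + z) = P n y + P n z" for n y z
    by (simp add: P_def inner_add_left scaleR_add_left sum.distrib)
  have P_scale: "P n (c *\<^sub>R y) = c *\<^sub>R P n y" for n c y
    by (simp add: P_def scaleR_sum_right)
  have ev: "\<exists>N. \<forall>n\<ge>N. P n y = y" if "y \<in> span (range b)" for y
    using that
  proof (induction rule: span_induct_alt)
    case base
    then show ?case by (auto simp: P_def)
  next
    case (step c z y)
    then obtain k where z: "z = b k" by auto
    from step obtain N where N: "\<forall>n\<ge>N. P n y = y" by auto
    have "P n (b k) = b k" if "n \<ge> Suc k" for n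
    proof -
      have "P n (b k) = (\<Sum>i<n. if i = k then (b k \<bullet> b k) *\<^sub>R b k else 0)"
        unfolding P_def using b by (intro sum.cong) (auto simp: orthonormal_seq_def)
      also have "\<dots> = b k"
        using that b by (auto simp: orthonormal_seq_def norm_eq_1 dest!: spec[of _ k])
      finally show ?thesis .
    qed
    then show ?case
      using N by (intro exI[of _ "max N (Suc k)"]) (auto simp: P_add P_scale z)
  qed
  show ?thesis
    unfolding P_def[symmetric]
  proof (rule LIMSEQ_I)
    fix r :: real assume "r > 0"
    then obtain y where y: "y \<in> span (range b)" "dist y x < r / 2"
      using x by (meson closure_approachable half_gt_zero)
    obtain N where N: "\<forall>n\<ge>N. P n y = y" using ev[OF y(1)] by auto
    have "norm (P n x - x) < r" if "n \<ge> N" for n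
    proof -
      have "P n x - x = P n (x - y) + (y - x)"
        using N that by (simp add: P_diff[symmetric])
      then have "norm (P n x - x) \<le> norm (P n (x - y)) + norm (y - x)"
        by (metis norm_triangle_ineq)
      also have "norm (P n (x - y)) \<le> norm (x - y)"
        unfolding P_def by (rule norm_partial_expansion_le[OF b])
      finally show ?thesis
        using y(2) by (simp add: dist_norm norm_minus_commute)
    qed
    then show "\<exists>N. \<forall>n\<ge>N. norm (P n x - x) < r" by blast
  qed
qed

lemma parseval:
  assumes b: "orthonormal_seq b" and x: "x \<in> closure (span (range b))"
  shows "(\<lambda>i. (x \<bullet> b i)\<^sup>2) sums (norm x)\<^sup>2"
proof -
  have "(\<lambda>n. (norm x)\<^sup>2 - (norm (x - (\<Sum>i<n. (x \<bullet> b i) *\<^sub>R b i)))\<^sup>2) \<longlonglongrightarrow> (norm x)\<^sup>2 - (norm (x - x))\<^sup>2"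
    by (intro tendsto_intros orthonormal_expansion[OF b x])
  then show ?thesis
    by (simp add: norm_partial_expansion[OF b] sums_def)
qed

lemma parseval_ennreal:
  assumes b: "orthonormal_seq b" and x: "x \<in> closure (span (range b))"
  shows "(\<Sum>i. ennreal ((x \<bullet> b i)\<^sup>2)) = ennreal ((norm x)\<^sup>2)"
  using parseval[OF b x] by (intro suminf_ennreal_eq) auto

section \<open>Total orthonormal sequences and the Riesz representation\<close>

lemma ex_dense_seq: "\<exists>d::nat \<Rightarrow> 'h::second_countable_topology. \<forall>X. open X \<longrightarrow> X \<noteq> {} \<longrightarrow> (\<exists>n. d n \<in> X)"
proof -
  obtain D :: "'h set" where D: "countable D" "\<forall>X. open X \<longrightarrow> X \<noteq> {} \<longrightarrow> (\<exists>d\<in>D. d \<in> X)"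
    using countable_dense_exists by blast
  then have "D \<noteq> {}" by (metis ex_in_conv open_UNIV UNIV_not_empty)
  then have "\<exists>n. from_nat_into D n \<in> X" if "open X" "X \<noteq> {}" for X
    using D that by (metis from_nat_into_surj)
  then show ?thesis by blast
qed

lemma ex_total_orthonormal_seq:
  "\<exists>b::nat \<Rightarrow> 'h::{real_inner, second_countable_topology}. orthonormal_seq b \<and> closure (span (range b)) = UNIV"
proof -
  obtain d :: "nat \<Rightarrow> 'h" where d: "\<forall>X. open X \<longrightarrow> X \<noteq> {} \<longrightarrow> (\<exists>n. d n \<in> X)"
    using ex_dense_seq by blast
  have "x \<in> closure (span (range (gram_schmidt d)))" for x
    unfolding closure_approachable
  proof (intro allI impI)
    fix e :: real assume "e > 0"
    then obtain n where "d n \<in> ball x e" using d[rule_format, of "ball x e"] by auto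
    then show "\<exists>y\<in>span (range (gram_schmidt d)). dist y x < e"
      using span_gram_schmidt[of d n] by (auto simp: dist_commute)
  qed
  then show ?thesis using orthonormal_seq_gram_schmidt by blast
qed

text \<open>Pythagoras carries the Cauchy criterion over from the squared coefficients; zero entries
  only make the blocks shorter.\<close>

lemma summable_orthonormal:
  fixes b :: "nat \<Rightarrow> 'h::{real_inner, banach}"
  assumes b: "orthonormal_seq b" and c: "summable (\<lambda>i. (c i)\<^sup>2)"
  shows "summable (\<lambda>i. c i *\<^sub>R b i)"
  unfolding summable_Cauchy
proof (intro allI impI)
  fix e :: real assume "e > 0"
  then obtain N where N: "\<And>m n. m \<ge> N \<Longrightarrow> norm (\<Sum>i=m..<n. (c i)\<^sup>2) < e\<^sup>2"
    using c unfolding summable_Cauchy by (meson zero_less_power)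
  have "norm (\<Sum>i=m..<n. c i *\<^sub>R b i) < e" if "m \<ge> N" for m n
  proof (rule power_less_imp_less_base)
    have "(norm (\<Sum>i=m..<n. c i *\<^sub>R b i))\<^sup>2 = (\<Sum>i=m..<n. (c i)\<^sup>2 * (b i \<bullet> b i))"
      by (rule norm_sum_orthonormal_seq[OF b]) simp
    also have "\<dots> \<le> (\<Sum>i=m..<n. (c i)\<^sup>2)"
    proof (rule sum_mono)
      fix i
      have "b i \<bullet> b i \<le> 1"
        using orthonormal_seq_norm_le[OF b, of i] by (metis norm_le_square inner_eq_zero_iff one_power2 power2_norm_eq_inner norm_ge_zero power_mono)
      then show "(c i)\<^sup>2 * (b i \<bullet> b i) \<le> (c i)\<^sup>2"
        by (simp add: mult_left_le)
    qed
    also have "\<dots> < e\<^sup>2" using N[OF that, of n] by simp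
    finally show "(norm (\<Sum>i=m..<n. c i *\<^sub>R b i))\<^sup>2 < e\<^sup>2" .
  qed (use \<open>e > 0\<close> in auto)
  then show "\<exists>N. \<forall>m\<ge>N. \<forall>n. norm (\<Sum>i=m..<n. c i *\<^sub>R b i) < e" by blast
qed

text \<open>The representing vector is the series of \<open>f (b i) *\<^sub>R b i\<close>. A partial
  sum p satisfies |p|^2 = f p \<le> K |p|, hence |p| \<le> K, so the coefficients are square
  summable.\<close>

theorem riesz_representation:
  fixes f :: "'h::{real_inner, banach, second_countable_topology} \<Rightarrow> real"
  assumes f: "bounded_linear f"
  shows "\<exists>w. \<forall>x. f x = x \<bullet> w"
proof -
  interpret f: bounded_linear f by fact
  obtain b :: "nat \<Rightarrow> 'h" where b: "orthonormal_seq b" "closure (span (range b)) = UNIV"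
    using ex_total_orthonormal_seq by blast
  obtain K where K: "K > 0" "\<And>x. \<bar>f x\<bar> \<le> norm x * K"
    using f.pos_bounded by (auto simp: real_norm_def)
  have f_zero: "f (b i) * (b i \<bullet> b i) = f (b i)" for i
    using b(1) f.zero by (auto simp: orthonormal_seq_def norm_eq_1 dest!: spec[of _ i])
  have "(\<Sum>i<n. (f (b i))\<^sup>2) \<le> K\<^sup>2" for n
  proof -
    define s where "s = (\<Sum>i<n. (f (b i))\<^sup>2)"
    define p where "p = (\<Sum>i<n. f (b i) *\<^sub>R b i)"
    have "(norm p)\<^sup>2 = (\<Sum>i<n. (f (b i))\<^sup>2 * (b i \<bullet> b i))"
      unfolding p_def by (rule norm_sum_orthonormal_seq[OF b(1)]) simp
    then have "(norm p)\<^sup>2 = s"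
      using f_zero by (simp add: s_def power2_eq_square mult.assoc)
    moreover have "f p = s"
      by (simp add: p_def s_def f.sum f.scaleR power2_eq_square)
    moreover have "\<bar>f p\<bar> \<le> norm p * K" by (rule K)
    ultimately have "norm p * norm p \<le> norm p * K" by (simp add: power2_eq_square)
    then have "norm p \<le> K" using K(1) by (cases "norm p = 0") auto
    then have "(norm p)\<^sup>2 \<le> K\<^sup>2" by (simp add: power_mono)
    then show ?thesis using \<open>(norm p)\<^sup>2 = s\<close> by (simp add: s_def)
  qed
  then have "summable (\<lambda>i. (f (b i))\<^sup>2)"
    by (intro summableI_nonneg_bounded) auto
  then have "summable (\<lambda>i. f (b i) *\<^sub>R b i)"
    by (rule summable_orthonormal[OF b(1)])
  then have w: "(\<lambda>n. \<Sum>i<n. f (b i) *\<^sub>R b i) \<longlonglongrightarrow> (\<Sum>i. f (b i) *\<^sub>R b i)"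
    by (rule summable_LIMSEQ)
  have "f x = x \<bullet> (\<Sum>i. f (b i) *\<^sub>R b i)" for x
  proof (rule LIMSEQ_unique)
    show "(\<lambda>n. f (\<Sum>i<n. (x \<bullet> b i) *\<^sub>R b i)) \<longlonglongrightarrow> f x"
      using b by (intro f.tendsto orthonormal_expansion) auto
    have "f (\<Sum>i<n. (x \<bullet> b i) *\<^sub>R b i) = x \<bullet> (\<Sum>i<n. f (b i) *\<^sub>R b i)" for n
      by (simp add: f.sum f.scaleR inner_sum_right mult.commute)
    then show "(\<lambda>n. f (\<Sum>i<n. (x \<bullet> b i) *\<^sub>R b i)) \<longlonglongrightarrow> x \<bullet> (\<Sum>i. f (b i) *\<^sub>R b i)"
      using w by (simp add: tendsto_inner)
  qed
  then show ?thesis by blast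
qed

text \<open>The vector w is the adjoint of B at f. Only single values of the adjoint are ever used,
  so it is not built as an operator.\<close>

lemma ex_adjoint_vector:
  fixes B :: "'h::{real_inner, banach, second_countable_topology} \<Rightarrow> 'g::real_inner"
  assumes "bounded_linear B"
  shows "\<exists>w. \<forall>x. B x \<bullet> f = x \<bullet> w"
  using riesz_representation[OF bounded_linear_compose[OF bounded_linear_inner_left assms], of f] by simp

section \<open>Hilbert--Schmidt sums in different bases\<close>

lemma suminf_swap_ennreal:
  fixes f :: "nat \<Rightarrow> nat \<Rightarrow> ennreal"
  shows "(\<Sum>i. \<Sum>j. f i j) = (\<Sum>j. \<Sum>i. f i j)"
proof -
  have "(\<Sum>i. \<Sum>j. f i j) = (\<integral>\<^sup>+i. (\<Sum>j. f i j) \<partial>count_space UNIV)"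
    by (simp add: nn_integral_count_space_nat)
  also have "\<dots> = (\<Sum>j. \<integral>\<^sup>+i. f i j \<partial>count_space UNIV)"
    by (rule nn_integral_suminf) simp
  finally show ?thesis by (simp add: nn_integral_count_space_nat)
qed

text \<open>Both sides are the double series of (B b_n \<bullet> c_j)^2, summed in the two orders.
  The closed span of b only has to contain the adjoint vectors \<open>w j\<close>, which later
  allows b to be a basis of the range of \<open>R\<close>.\<close>

lemma hs_sum_eq_adjoint:
  fixes B :: "'h::{real_inner, banach, second_countable_topology} \<Rightarrow> 'g::{real_inner}"
  assumes b: "orthonormal_seq b" and c: "orthonormal_seq c" "closure (span (range c)) = UNIV"
    and w: "\<And>j x. B x \<bullet> c j = x \<bullet> w j" "\<And>j. w j \<in> closure (span (range b))"
  shows "(\<Sum>n. ennreal ((norm (B (b n)))\<^sup>2)) = (\<Sum>j. ennreal ((norm (w j))\<^sup>2))"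
proof -
  have "(\<Sum>n. ennreal ((norm (B (b n)))\<^sup>2)) = (\<Sum>n. \<Sum>j. ennreal ((b n \<bullet> w j)\<^sup>2))"
    unfolding w(1)[symmetric] by (subst parseval_ennreal[OF c(1)]) (simp_all add: c(2))
  also have "\<dots> = (\<Sum>j. \<Sum>n. ennreal ((w j \<bullet> b n)\<^sup>2))"
    unfolding inner_commute[of "b _"] by (rule suminf_swap_ennreal)
  also have "\<dots> = (\<Sum>j. ennreal ((norm (w j))\<^sup>2))"
    by (simp only: parseval_ennreal[OF b w(2)])
  finally show ?thesis .
qed

text \<open>For self-adjoint R the orthogonal complement of the kernel lies in the closure of the
  range. Let p be the projection of w onto the closed span of b. Then w - p is orthogonal to that
  span, so |R (w - p)|^2 = R (R (w - p)) \<bullet> (w - p) = 0. Being in the kernel, w - p is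
  orthogonal to w; it is also orthogonal to p, hence zero.\<close>

lemma closed_orthogonal_complement_range:
  fixes R :: "'h::{real_inner, banach, second_countable_topology} \<Rightarrow>\<^sub>L 'h"
  assumes sym: "\<And>x y. R x \<bullet> y = x \<bullet> R y" and w: "\<And>x. R x = 0 \<Longrightarrow> x \<bullet> w = 0"
    and b: "orthonormal_seq b" "range R \<subseteq> closure (span (range b))" "range b \<subseteq> range R"
  shows "w \<in> closure (span (range b))"
proof -
  have bess: "summable (\<lambda>i. (w \<bullet> b i)\<^sup>2)"
  proof (rule summableI_nonneg_bounded)
    show "(\<Sum>i<n. (w \<bullet> b i)\<^sup>2) \<le> (norm w)\<^sup>2" for n
      using norm_partial_expansion[OF b(1), of w n] by (metis diff_ge_0_iff_ge zero_le_power2)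
  qed auto
  have "summable (\<lambda>i. (w \<bullet> b i) *\<^sub>R b i)"
    by (rule summable_orthonormal[OF b(1) bess])
  then have lim: "(\<lambda>n. \<Sum>i<n. (w \<bullet> b i) *\<^sub>R b i) \<longlonglongrightarrow> (\<Sum>i. (w \<bullet> b i) *\<^sub>R b i)"
    by (rule summable_LIMSEQ)
  define p where "p = (\<Sum>i. (w \<bullet> b i) *\<^sub>R b i)"
  have p_cl: "p \<in> closure (span (range b))"
    unfolding closure_sequential p_def using lim
    by (intro exI[of _ "\<lambda>n. \<Sum>i<n. (w \<bullet> b i) *\<^sub>R b i"]) (auto intro!: span_sum span_scale intro: span_base)
  have pb: "(w - p) \<bullet> b k = 0" for k
  proof -
    have "(\<lambda>n. (\<Sum>i<n. (w \<bullet> b i) *\<^sub>R b i) \<bullet> b k) \<longlonglongrightarrow> p \<bullet> b k"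
      unfolding p_def by (intro tendsto_intros lim)
    moreover have "\<forall>\<^sub>F n in sequentially. (\<Sum>i<n. (w \<bullet> b i) *\<^sub>R b i) \<bullet> b k = w \<bullet> b k"
      unfolding eventually_sequentially
    proof (intro exI[of _ "Suc k"] allI impI)
      fix n assume "n \<ge> Suc k"
      have "(\<Sum>i<n. (w \<bullet> b i) *\<^sub>R b i) \<bullet> b k = (\<Sum>i<n. if i = k then w \<bullet> b k else 0)"
        unfolding inner_sum_left inner_scaleR_left
      proof (intro sum.cong refl)
        show "(w \<bullet> b i) * (b i \<bullet> b k) = (if i = k then w \<bullet> b k else 0)" for i
          using b(1) orthonormal_seq_inner_self[OF b(1), of w k]
          by (cases "i = k") (simp_all add: orthonormal_seq_def)
      qed
      then show "(\<Sum>i<n. (w \<bullet> b i) *\<^sub>R b i) \<bullet> b k = w \<bullet> b k" using \<open>n \<ge> Suc k\<close> by simp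
    qed
    ultimately have "p \<bullet> b k = w \<bullet> b k"
      using LIMSEQ_unique[OF _ tendsto_eventually] by blast
    then show ?thesis by (simp add: inner_diff_left)
  qed
  have perp: "y \<bullet> (w - p) = 0" if "y \<in> closure (span (range b))" for y
  proof -
    have "span (range b) \<subseteq> {y. y \<bullet> (w - p) = 0}"
      using pb by (intro span_minimal subspaceI) (auto simp: inner_add_left inner_commute[of "b _"])
    moreover have "closed {y. y \<bullet> (w - p) = 0}"
      by (intro closed_Collect_eq continuous_intros)
    ultimately show ?thesis using closure_minimal that by blast
  qed
  have "R (w - p) = 0"
  proof -
    have "R (w - p) \<bullet> R (w - p) = R (R (w - p)) \<bullet> (w - p)"
      by (simp add: sym)
    also have "\<dots> = 0" using perp b(2) by blast
    finally show ?thesis by simp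
  qed
  then have "(w - p) \<bullet> w = 0" by (rule w)
  moreover have "(w - p) \<bullet> p = 0" using perp[OF p_cl] by (simp add: inner_commute)
  ultimately have "(w - p) \<bullet> (w - p) = 0" by (simp add: inner_diff_right)
  then have "w = p" by simp
  then show ?thesis using p_cl by simp
qed

subsection \<open>Orthonormal bases and the Hilbert--Schmidt norm\<close>

text \<open>Distinct elements are at distance sqrt 2, so the balls of radius 1/2 around them are
  disjoint open sets.\<close>

lemma countable_orthonormal_basis:
  fixes E :: "'h::{real_inner, second_countable_topology} set"
  assumes "orthonormal_basis E" shows "countable E"
proof -
  have d: "dist x y \<ge> 1" if "x \<in> E" "y \<in> E" "x \<noteq> y" for x y
  proof -
    have "(dist x y)\<^sup>2 = 2"
      using assms that
      by (simp add: orthonormal_basis_def pairwise_def orthogonal_def dist_norm power2_norm_eq_inner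
          inner_diff_left inner_diff_right inner_commute norm_eq_1)
    then show ?thesis by (smt (verit) power2_le_imp_le one_power2 zero_le_dist)
  qed
  have "countable ((\<lambda>e. ball e (1/2)) ` E)"
  proof (rule countable_disjoint_open_subsets)
    show "pairwise disjnt ((\<lambda>e. ball e (1/2)) ` E)"
      unfolding pairwise_def
    proof (clarsimp simp: disjnt_iff)
      fix x y z assume *: "x \<in> E" "y \<in> E" "ball x (1/2) \<noteq> ball y (1/2)" "dist x z * 2 < 1" "dist y z * 2 < 1"
      then have "x \<noteq> y" by auto
      then show False using d[of x y] * by (metis dist_commute dist_triangle_half_r less_divide_eq_numeral1(1) linorder_not_less)
    qed
  qed auto
  moreover have "inj_on (\<lambda>e. ball e (1/2)) E"
  proof (rule inj_onI)
    fix x y assume *: "x \<in> E" "y \<in> E" "ball x (1/2) = ball y (1/2)"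
    then have "x \<in> ball y (1/2)" by (metis centre_in_ball half_gt_zero zero_less_one)
    then show "x = y" using d[of x y] * by (fastforce simp: dist_commute)
  qed
  ultimately show ?thesis by (rule countable_image_inj_on)
qed

lemma ex_orthonormal_basis:
  "\<exists>E::'h::{real_inner, second_countable_topology} set. orthonormal_basis E"
proof -
  obtain b :: "nat \<Rightarrow> 'h" where b: "orthonormal_seq b" "closure (span (range b)) = UNIV"
    using ex_total_orthonormal_seq by blast
  have "span (range b - {0}) = span (range b)"
    by (metis insert_Diff_single span_insert_0)
  then have "orthonormal_basis (range b - {0})"
    using b unfolding orthonormal_basis_def orthonormal_seq_def pairwise_def orthogonal_def
    by (smt (verit) Diff_iff image_iff singletonI)
  then show ?thesis by blast
qed

text \<open>Indices that \<open>to_nat_on\<close> does not hit are filled with 0. The condition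
  \<open>f 0 = 0\<close> hides them from the sum, whatever the cardinality of E.\<close>

lemma orthonormal_basis_enum:
  fixes E :: "'h::{real_inner, second_countable_topology} set"
  assumes E: "orthonormal_basis E"
  shows "\<exists>e. orthonormal_seq e \<and> closure (span (range e)) = UNIV \<and>
    (\<forall>f::'h \<Rightarrow> ennreal. f 0 = 0 \<longrightarrow> infsum f E = (\<Sum>n. f (e n)))"
proof -
  have cE: "countable E" by (rule countable_orthonormal_basis[OF E])
  define I where "I = to_nat_on E ` E"
  define e where "e n = (if n \<in> I then from_nat_into E n else 0)" for n
  have inj: "inj_on (from_nat_into E) I"
    using cE by (auto simp: I_def inj_on_def)
  have img: "from_nat_into E ` I = E"
    using cE by (force simp: I_def image_iff)
  have "e i \<bullet> e j = 0" if "i \<noteq> j" for i j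
    using that inj img E unfolding e_def orthonormal_basis_def pairwise_def orthogonal_def inj_on_def
    by (smt (verit) image_eqI inner_zero_left inner_zero_right)
  moreover have "e i = 0 \<or> norm (e i) = 1" for i
    using img E by (auto simp: e_def orthonormal_basis_def)
  ultimately have "orthonormal_seq e" by (auto simp: orthonormal_seq_def)
  moreover have "closure (span (range e)) = UNIV"
  proof -
    have "E \<subseteq> range e" using img by (force simp: e_def image_iff)
    then have "closure (span E) \<subseteq> closure (span (range e))" by (intro closure_mono span_mono)
    then show ?thesis using E by (auto simp: orthonormal_basis_def)
  qed
  moreover have "infsum f E = (\<Sum>n. f (e n))" if "f 0 = 0" for f :: "'h \<Rightarrow> ennreal"
  proof -
    have "infsum f E = infsum (f \<circ> from_nat_into E) I"
      using infsum_reindex[OF inj, of f] img by simp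
    also have "\<dots> = infsum (\<lambda>n. f (e n)) UNIV"
      by (rule infsum_cong_neutral) (auto simp: e_def that)
    also have "\<dots> = (\<Sum>n. f (e n))"
      by (intro sums_unique has_sum_imp_sums has_sum_infsum nonneg_summable_on_complete) simp
    finally show ?thesis .
  qed
  ultimately show ?thesis by blast
qed

text \<open>An enumeration, padded with zeros, of exactly the basis that \<open>hs_norm_sq\<close>
  selects with SOME. The Hilbert--Schmidt norm can thus be unfolded without first proving that it
  does not depend on the basis.\<close>

definition onb_seq :: "nat \<Rightarrow> 'h::{real_inner, second_countable_topology}" where
  "onb_seq = (SOME e. orthonormal_seq e \<and> closure (span (range e)) = UNIV \<and>
    (\<forall>f::'h \<Rightarrow> ennreal. f 0 = 0 \<longrightarrow> infsum f (SOME E. orthonormal_basis E) = (\<Sum>n. f (e n))))"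

lemma onb_seq:
  shows "orthonormal_seq (onb_seq :: nat \<Rightarrow> 'h::{real_inner, second_countable_topology})"
    and "closure (span (range (onb_seq :: nat \<Rightarrow> 'h))) = UNIV"
    and "f 0 = 0 \<Longrightarrow> infsum f (SOME E. orthonormal_basis E) = (\<Sum>n. f (onb_seq n :: 'h) :: ennreal)"
  using someI_ex[OF orthonormal_basis_enum[OF someI_ex[OF ex_orthonormal_basis]], folded onb_seq_def]
  by auto

lemma hs_norm_sq_eq_suminf:
  fixes B :: "'h::{real_inner, second_countable_topology} \<Rightarrow> 'h"
  assumes "bounded_linear B"
  shows "hs_norm_sq B = (\<Sum>n. ennreal ((norm (B (onb_seq n)))\<^sup>2))"
proof -
  have "ennreal ((norm (B 0))\<^sup>2) = 0"
    by (simp add: linear_0[OF bounded_linear.linear[OF assms]])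
  then show ?thesis
    unfolding hs_norm_sq_def using assms onb_seq(3)[of "\<lambda>x. ennreal ((norm (B x))\<^sup>2)"] by presburger
qed

subsection \<open>Square roots of operators\<close>

text \<open>No spectral theory is used. Positivity at the vector x - Q x / c gives |Q x|^2 / c \<le>
  Q x \<bullet> x, and then |x - Q x / c|^2 = |x|^2 - 2 (Q x \<bullet> x) / c + |Q x|^2 / c^2 is at
  most |x|^2.\<close>

lemma norm_le_sq_of_nonneg:
  fixes Q :: "'h::real_inner \<Rightarrow>\<^sub>L 'h"
  assumes sym: "\<And>x y. Q x \<bullet> y = x \<bullet> Q y" and pos: "\<And>x. 0 \<le> Q x \<bullet> x" and c: "c > 0" "norm Q \<le> c"
  shows "norm (id_blinfun - (1/c) *\<^sub>R Q) \<le> 1"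
proof (rule norm_blinfun_bound)
  fix x
  define q where "q = Q x \<bullet> x"
  define n where "n = Q x \<bullet> Q x"
  have "norm (Q (Q x)) \<le> c * norm (Q x)"
    using norm_blinfun[of Q "Q x"] c(2) by (meson mult_right_mono norm_ge_zero order_trans)
  then have "Q (Q x) \<bullet> Q x \<le> c * norm (Q x) * norm (Q x)"
    using norm_cauchy_schwarz[of "Q (Q x)" "Q x"] by (meson mult_right_mono norm_ge_zero order_trans)
  then have 1: "Q (Q x) \<bullet> Q x \<le> c * n"
    by (simp add: n_def power2_norm_eq_inner[symmetric] power2_eq_square)
  have "0 \<le> Q (x - (1/c) *\<^sub>R Q x) \<bullet> (x - (1/c) *\<^sub>R Q x)" by (rule pos)
  also have "\<dots> = Q x \<bullet> x - (1/c) * (Q x \<bullet> Q x) - (1/c) * (Q (Q x) \<bullet> x) + (1/c)\<^sup>2 * (Q (Q x) \<bullet> Q x)"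
    by (simp add: blinfun.diff_right blinfun.scaleR_right inner_diff_left inner_diff_right
        power2_eq_square algebra_simps)
  also have "\<dots> = q - (2/c) * n + (1/c)\<^sup>2 * (Q (Q x) \<bullet> Q x)"
    by (simp only: sym[of "Q x" x] q_def n_def)
  also have "\<dots> \<le> q - (2/c) * n + (1/c)\<^sup>2 * (c * n)"
    using 1 by (intro add_left_mono mult_left_mono) auto
  also have "\<dots> = q - n / c" using c(1) by (simp add: power2_eq_square field_simps)
  finally have 2: "n / c \<le> q" by simp
  have e: "(norm ((id_blinfun - (1/c) *\<^sub>R Q) x))\<^sup>2 = (norm x)\<^sup>2 - 2 * (q / c) + n / c / c"
    by (simp add: blinfun.diff_left blinfun.scaleR_left power2_norm_eq_inner inner_diff_left inner_diff_right
        q_def n_def inner_commute)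
  have 3: "n / c / c \<le> q / c" using divide_right_mono[OF 2, of c] c(1) by simp
  have "0 \<le> q / c" using c(1) pos[of x] by (simp add: q_def)
  then have "(norm ((id_blinfun - (1/c) *\<^sub>R Q) x))\<^sup>2 \<le> (norm x)\<^sup>2" using e 3 by linarith
  then show "norm ((id_blinfun - (1/c) *\<^sub>R Q) x) \<le> 1 * norm x"
    unfolding mult_1 by (rule power2_le_imp_le) (rule norm_ge_zero)
qed simp

text \<open>A fixed point Y = (B + Y^2) / 2 satisfies (1 - Y)^2 = 1 - B, so 1 - Y is a square root
  of 1 - B.\<close>

fun sqrt_iter :: "('h::real_normed_vector \<Rightarrow>\<^sub>L 'h) \<Rightarrow> nat \<Rightarrow> ('h \<Rightarrow>\<^sub>L 'h)" where
  "sqrt_iter B 0 = 0"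
| "sqrt_iter B (Suc n) = (1/2) *\<^sub>R (B + (sqrt_iter B n o\<^sub>L sqrt_iter B n))"

fun sqrt_iter_real :: "nat \<Rightarrow> real" where
  "sqrt_iter_real 0 = 0"
| "sqrt_iter_real (Suc n) = (1 + (sqrt_iter_real n)\<^sup>2) / 2"

lemma sqrt_iter_real_bounds: "0 \<le> sqrt_iter_real n \<and> sqrt_iter_real n \<le> 1"
proof (induction n)
  case (Suc n)
  then have "(sqrt_iter_real n)\<^sup>2 \<le> 1" by (simp add: power_le_one)
  then show ?case by simp
qed simp

lemma sqrt_iter_real_mono: "sqrt_iter_real n \<le> sqrt_iter_real (Suc n)"
proof -
  have "0 \<le> (1 - sqrt_iter_real n)\<^sup>2" by simp
  then show ?thesis by (simp add: power2_eq_square field_simps)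
qed

text \<open>The scalar iteration for the norm bound 1 majorizes the operator iteration, including its
  increments.\<close>

lemma sqrt_iter_bounds:
  assumes B: "norm B \<le> 1"
  shows "norm (sqrt_iter B n) \<le> sqrt_iter_real n \<and>
    norm (sqrt_iter B (Suc n) - sqrt_iter B n) \<le> sqrt_iter_real (Suc n) - sqrt_iter_real n"
proof (induction n)
  case 0
  then show ?case using B by simp
next
  case (Suc n)
  let ?Y = "sqrt_iter B" and ?y = sqrt_iter_real
  have 1: "norm (?Y (Suc n)) \<le> ?y (Suc n)"
  proof -
    have "norm (?Y n o\<^sub>L ?Y n) \<le> norm (?Y n) * norm (?Y n)" by (rule norm_blinfun_compose)
    also have "\<dots> \<le> (?y n)\<^sup>2" unfolding power2_eq_square using Suc.IH sqrt_iter_real_bounds[of n] by (intro mult_mono) auto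
    finally have "norm (B + (?Y n o\<^sub>L ?Y n)) \<le> 1 + (?y n)\<^sup>2"
      using B norm_triangle_ineq[of B "?Y n o\<^sub>L ?Y n"] by linarith
    then show ?thesis by simp
  qed
  have "?Y (Suc (Suc n)) - ?Y (Suc n) =
      (1/2) *\<^sub>R ((?Y (Suc n) o\<^sub>L (?Y (Suc n) - ?Y n)) + ((?Y (Suc n) - ?Y n) o\<^sub>L ?Y n))"
    by (simp only: sqrt_iter.simps(2)[of B "Suc n"] sqrt_iter.simps(2)[of B n] scaleR_diff_right[symmetric])
       (rule blinfun_eqI, simp add: blinfun.bilinear_simps algebra_simps)
  also have "norm \<dots> \<le> (1/2) * (norm (?Y (Suc n)) * norm (?Y (Suc n) - ?Y n) + norm (?Y (Suc n) - ?Y n) * norm (?Y n))"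
  proof -
    have "norm ((?Y (Suc n) o\<^sub>L (?Y (Suc n) - ?Y n)) + ((?Y (Suc n) - ?Y n) o\<^sub>L ?Y n))
      \<le> norm (?Y (Suc n)) * norm (?Y (Suc n) - ?Y n) + norm (?Y (Suc n) - ?Y n) * norm (?Y n)"
      by (rule norm_triangle_le, intro add_mono norm_blinfun_compose)
    then show ?thesis unfolding norm_scaleR by simp
  qed
  also have "\<dots> \<le> (1/2) * (?y (Suc n) * (?y (Suc n) - ?y n) + (?y (Suc n) - ?y n) * ?y n)"
    using 1 Suc sqrt_iter_real_bounds[of "Suc n"] sqrt_iter_real_bounds[of n] sqrt_iter_real_mono[of n]
    by (intro mult_left_mono add_mono mult_mono) auto
  also have "\<dots> = ?y (Suc (Suc n)) - ?y (Suc n)"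
    by (simp only: sqrt_iter_real.simps(2)[of "Suc n"] sqrt_iter_real.simps(2)[of n])
       (simp add: power2_eq_square field_simps)
  finally show ?case using 1 by simp
qed

text \<open>The majorant is increasing and bounded by 1, and its increments dominate those of the
  operator iteration. This also covers norm 1, where the iteration is no uniform
  contraction.\<close>

lemma convergent_sqrt_iter:
  fixes B :: "'h::banach \<Rightarrow>\<^sub>L 'h"
  assumes B: "norm B \<le> 1"
  shows "convergent (sqrt_iter B)"
proof -
  let ?Y = "sqrt_iter B" and ?y = sqrt_iter_real
  have inc: "incseq ?y" by (intro incseq_SucI sqrt_iter_real_mono)
  have "convergent ?y"
    using sqrt_iter_real_bounds inc by (intro Bseq_mono_convergent BseqI'[of _ 1]) (auto simp: incseq_def)
  then have cy: "Cauchy ?y" by (rule convergent_Cauchy)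
  have le: "norm (?Y (n + k) - ?Y n) \<le> ?y (n + k) - ?y n" for n k
  proof (induction k)
    case (Suc k)
    then show ?case
      using sqrt_iter_bounds[OF B, of "n + k"] norm_triangle_ineq[of "?Y (Suc (n + k)) - ?Y (n + k)" "?Y (n + k) - ?Y n"]
      by (simp del: sqrt_iter.simps sqrt_iter_real.simps)
  qed simp
  have "Cauchy ?Y"
  proof (rule CauchyI')
    fix e :: real assume "e > 0"
    then obtain N where N: "\<And>m n. m \<ge> N \<Longrightarrow> n \<ge> N \<Longrightarrow> norm (?y m - ?y n) < e"
      using cy by (meson CauchyD)
    have "norm (?Y m - ?Y n) < e" if "m \<ge> N" "n > m" for m n
      using le[of m "n - m"] N[of n m] that
      by (simp add: norm_minus_commute)
    then show "\<exists>N. \<forall>m\<ge>N. \<forall>n>m. dist (?Y m) (?Y n) < e" by (auto simp: dist_norm)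
  qed
  then show ?thesis by (rule Cauchy_convergent)
qed

text \<open>With B = 1 - Q / c and Y the limit of the iteration, sqrt c (1 - Y) squares to c (1 - B)
  = Q. It inherits symmetry from the iterates and is nonnegative because Y has norm at most
  1.\<close>

lemma ex_op_sqrt:
  fixes Q :: "'h::{real_inner, banach} \<Rightarrow>\<^sub>L 'h"
  assumes sym: "\<And>x y. Q x \<bullet> y = x \<bullet> Q y" and pos: "\<And>x. 0 \<le> Q x \<bullet> x"
  shows "\<exists>R. R o\<^sub>L R = Q \<and> (\<forall>x y. R x \<bullet> y = x \<bullet> R y) \<and> (\<forall>x. 0 \<le> R x \<bullet> x)"
proof -
  \<comment> \<open>Adding 1 keeps c positive also for Q = 0.\<close>
  define c where "c = norm Q + 1"
  have c: "c > 0" "norm Q \<le> c" by (simp_all add: c_def add_nonneg_pos)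
  define B where "B = id_blinfun - (1/c) *\<^sub>R Q"
  have B: "norm B \<le> 1" unfolding B_def by (rule norm_le_sq_of_nonneg[OF sym pos c])
  have Bsym: "B x \<bullet> y = x \<bullet> B y" for x y
    by (simp add: B_def blinfun.bilinear_simps inner_diff_left inner_diff_right sym)
  obtain Y where Y: "sqrt_iter B \<longlonglongrightarrow> Y"
    using convergent_sqrt_iter[OF B] by (auto simp: convergent_def)
  have "(\<lambda>n. sqrt_iter B (Suc n)) \<longlonglongrightarrow> (1/2) *\<^sub>R (B + (Y o\<^sub>L Y))"
    unfolding sqrt_iter.simps
    by (intro tendsto_intros Y bounded_bilinear.tendsto[OF bounded_bilinear_blinfun_compose])
  then have fixp: "Y = (1/2) *\<^sub>R (B + (Y o\<^sub>L Y))"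
    using LIMSEQ_Suc[OF Y] LIMSEQ_unique by blast
  have sq: "Y (Y x) = 2 *\<^sub>R Y x - B x" for x
  proof -
    have "2 *\<^sub>R Y = B + (Y o\<^sub>L Y)"
      using arg_cong[OF fixp, of "\<lambda>Z. 2 *\<^sub>R Z"] by simp
    then have "2 *\<^sub>R Y x = B x + Y (Y x)"
      by (metis (no_types) blinfun.add_left blinfun.scaleR_left blinfun_apply_blinfun_compose)
    then show ?thesis by simp
  qed
  have iter_sym: "sqrt_iter B n x \<bullet> y = x \<bullet> sqrt_iter B n y" for n x y
    by (induction n arbitrary: x y) (simp_all add: blinfun.bilinear_simps inner_add_left inner_add_right Bsym)
  have Ysym: "Y x \<bullet> y = x \<bullet> Y y" for x y
  proof (rule LIMSEQ_unique)
    show "(\<lambda>n. sqrt_iter B n x \<bullet> y) \<longlonglongrightarrow> Y x \<bullet> y"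
      by (intro tendsto_intros Y bounded_bilinear.tendsto[OF bounded_bilinear_blinfun_apply])
    show "(\<lambda>n. sqrt_iter B n x \<bullet> y) \<longlonglongrightarrow> x \<bullet> Y y"
      unfolding iter_sym by (intro tendsto_intros Y bounded_bilinear.tendsto[OF bounded_bilinear_blinfun_apply])
  qed
  have "norm Y \<le> 1"
  proof (rule LIMSEQ_le_const2[OF tendsto_norm[OF Y]])
    show "\<exists>N. \<forall>n\<ge>N. norm (sqrt_iter B n) \<le> 1"
      using sqrt_iter_bounds[OF B] sqrt_iter_real_bounds by (meson order_trans)
  qed
  then have Yn: "Y x \<bullet> x \<le> x \<bullet> x" for x
  proof -
    have "Y x \<bullet> x \<le> norm (Y x) * norm x" by (rule norm_cauchy_schwarz)
    also have "\<dots> \<le> (1 * norm x) * norm x"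
      by (intro mult_right_mono order_trans[OF norm_blinfun]) (auto simp: \<open>norm Y \<le> 1\<close>)
    finally show ?thesis by (simp add: power2_norm_eq_inner[symmetric] power2_eq_square)
  qed
  define R where "R = sqrt c *\<^sub>R (id_blinfun - Y)"
  have "R o\<^sub>L R = Q"
  proof (rule blinfun_eqI)
    fix x
    have "(R o\<^sub>L R) x = (sqrt c * sqrt c) *\<^sub>R (x - 2 *\<^sub>R Y x + Y (Y x))"
      by (simp add: R_def blinfun.bilinear_simps algebra_simps scaleR_2)
    also have "\<dots> = c *\<^sub>R (x - B x)" using c(1) by (simp add: sq)
    also have "\<dots> = Q x" using c(1) by (simp add: B_def blinfun.bilinear_simps)
    finally show "(R o\<^sub>L R) x = Q x" .
  qed
  moreover have "R x \<bullet> y = x \<bullet> R y" for x y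
    by (simp add: R_def blinfun.bilinear_simps inner_diff_left inner_diff_right Ysym)
  moreover have "0 \<le> R x \<bullet> x" for x
    using Yn[of x] c(1) by (simp add: R_def blinfun.bilinear_simps inner_diff_left)
  ultimately show ?thesis by blast
qed

lemma op_sqrt:
  fixes Q :: "'h::{real_inner, banach} \<Rightarrow>\<^sub>L 'h"
  assumes "\<And>x y. Q x \<bullet> y = x \<bullet> Q y" and "\<And>x. 0 \<le> Q x \<bullet> x"
  shows "op_sqrt Q (op_sqrt Q x) = Q x" and "op_sqrt Q x \<bullet> y = x \<bullet> op_sqrt Q y"
  using someI_ex[OF ex_op_sqrt[OF assms], folded op_sqrt_def] by (auto simp: blinfun_apply_blinfun_compose[symmetric])

subsection \<open>Contraction semigroups\<close>

text \<open>Generators provide right derivatives only, so the mean value theorem does not apply. For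
  each e > 0 the last point c with f c \<le> f a + e (c - a) must be b, because otherwise the right
  derivative at c carries the inequality past c.\<close>

lemma right_derivative_nonpos_imp_le:
  fixes f :: "real \<Rightarrow> real"
  assumes ab: "a \<le> b" and cont: "continuous_on {a..b} f"
    and der: "\<And>t. a \<le> t \<Longrightarrow> t < b \<Longrightarrow> \<exists>d\<le>0. ((\<lambda>h. (f (t + h) - f t) / h) \<longlongrightarrow> d) (at_right 0)"
  shows "f b \<le> f a"
proof (rule field_le_epsilon)
  fix e0 :: real assume "e0 > 0"
  \<comment> \<open>The summand 1 covers a = b.\<close>
  define e where "e = e0 / (b - a + 1)"
  have e: "e > 0" using \<open>e0 > 0\<close> ab by (simp add: e_def)
  define g where "g t = f t - f a - e * (t - a)" for t
  define K where "K = {t \<in> {a..b}. g t \<le> 0}"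
  have "closed ({a..b} \<inter> g -` {..0})"
    unfolding g_def by (intro continuous_closed_preimage continuous_intros cont)
  moreover have "K = {a..b} \<inter> g -` {..0}" by (auto simp: K_def)
  ultimately have Kc: "compact K"
    by (simp add: compact_eq_bounded_closed bounded_subset[OF bounded_closed_interval[of a b]])
  have "a \<in> K" using ab by (simp add: K_def g_def)
  then have "\<exists>c\<in>K. \<forall>t\<in>K. t \<le> c" by (intro compact_attains_sup[OF Kc]) blast
  then obtain c where c: "c \<in> K" "\<And>t. t \<in> K \<Longrightarrow> t \<le> c" by blast
  have "c = b"
  proof (rule ccontr)
    assume "c \<noteq> b"
    then have cb: "a \<le> c" "c < b" using c(1) by (auto simp: K_def)
    obtain d where d: "d \<le> 0" "((\<lambda>h. (f (c + h) - f c) / h) \<longlongrightarrow> d) (at_right 0)"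
      using der[OF cb] by blast
    have "\<forall>\<^sub>F h in at_right 0. (f (c + h) - f c) / h < e"
      using order_tendstoD(2)[OF d(2)] d(1) e by auto
    moreover have "\<forall>\<^sub>F h in at_right 0. (h::real) \<in> {0<..<b - c}"
      using cb by (intro eventually_at_right_real) simp
    ultimately have "\<forall>\<^sub>F h in at_right 0. (f (c + h) - f c) / h < e \<and> h \<in> {0<..<b - c}"
      by (rule eventually_conj)
    then obtain h where h: "(f (c + h) - f c) / h < e" "0 < h" "h < b - c"
      using eventually_happens[of _ "at_right (0::real)"] by (auto simp: trivial_limit_at_right_real)
    then have "f (c + h) - f c < e * h" by (simp add: field_simps)
    then have "c + h \<in> K"
      using c(1) h cb by (auto simp: K_def g_def algebra_simps)
    then show False using c(2) h(2) by fastforce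
  qed
  then have "f b \<le> f a + e * (b - a)" using c(1) by (simp add: K_def g_def)
  also have "e * (b - a) \<le> e0" using ab \<open>e0 > 0\<close> by (simp add: e_def field_simps)
  finally show "f b \<le> f a + e0" by simp
qed

text \<open>Strong continuity at 0 bounds each orbit on an interval to the right of 0 that depends
  on the vector, so the closed sets \<open>C n\<close> cover the space. By Baire one of them
  contains a ball, and differences of two of its points bound \<open>S t\<close> on all vectors,
  uniformly for t in one fixed interval.\<close>

lemma C0_semigroup_locally_bounded:
  fixes S :: "real \<Rightarrow> 'h::banach \<Rightarrow>\<^sub>L 'h"
  assumes S: "C0_semigroup S"
  obtains \<delta> K where "\<delta> > 0" "K \<ge> 0" "\<And>t. 0 < t \<Longrightarrow> t \<le> \<delta> \<Longrightarrow> norm (S t) \<le> K"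
proof -
  define C where "C n = {x. \<forall>t\<in>{0<..1 / real (Suc n)}. norm (S t x) \<le> real n}" for n
  have closedC: "closed (C n)" for n
  proof -
    have "C n = (\<Inter>t\<in>{0<..1 / real (Suc n)}. {x. norm (S t x) \<le> real n})"
      by (auto simp: C_def)
    moreover have "closed {x. norm (S t x) \<le> real n}" for t
      by (intro closed_Collect_le continuous_intros)
    ultimately show ?thesis by auto
  qed
  have cover: "\<exists>n. x \<in> C n" for x
  proof -
    have "((\<lambda>t. S t x) \<longlongrightarrow> x) (at_right 0)" using S by (auto simp: C0_semigroup_def)
    then have "((\<lambda>t. norm (S t x)) \<longlongrightarrow> norm x) (at_right 0)" by (rule tendsto_norm)
    then have "\<forall>\<^sub>F t in at_right 0. norm (S t x) < norm x + 1"
      by (rule order_tendstoD) simp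
    then obtain d where d: "d > 0" "\<And>t. 0 < t \<Longrightarrow> t < d \<Longrightarrow> norm (S t x) < norm x + 1"
      by (auto simp: eventually_at_right_field)
    obtain n where n: "real n \<ge> max (norm x + 1) (1 / d)" using real_arch_simple by blast
    have "1 / real (Suc n) < d"
      using n d(1) by (simp add: field_simps)
    then have "x \<in> C n" using d n by (fastforce simp: C_def)
    then show ?thesis by blast
  qed
  have "\<exists>n. interior (C n) \<noteq> {}"
  proof (rule ccontr)
    assume "\<not> ?thesis"
    then have "euclidean interior_of \<Union>(range C) = {}"
      using closedC by (intro Baire_category_alt) (auto simp: completely_metrizable_space_euclidean)
    moreover have "\<Union>(range C) = UNIV" using cover by auto
    ultimately show False by simp
  qed
  then obtain n x r where x: "r > 0" "ball x r \<subseteq> C n"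
    by (meson ex_in_conv mem_interior)
  have "norm (S t) \<le> 4 * real n / r" if t: "0 < t" "t \<le> 1 / real (Suc n)" for t
  proof (rule norm_blinfun_bound)
    show "norm (S t y) \<le> 4 * real n / r * norm y" for y
    proof (cases "y = 0")
      case False
      define z where "z = (r / (2 * norm y)) *\<^sub>R y"
      have nz: "norm z = r / 2" using False x(1) by (simp add: z_def)
      have "x + z \<in> C n" "x \<in> C n" using x nz by (auto simp: dist_norm subset_iff)
      then have "norm (S t (x + z)) \<le> n" "norm (S t x) \<le> n" using t by (auto simp: C_def)
      moreover have "S t z = S t (x + z) - S t x" by (simp add: blinfun.add_right)
      ultimately have "norm (S t z) \<le> 2 * n"
        using norm_triangle_ineq4[of "S t (x + z)" "S t x"] by simp
      moreover have "norm (S t z) = r / (2 * norm y) * norm (S t y)"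
        using x(1) by (simp add: z_def blinfun.scaleR_right)
      ultimately show ?thesis using x(1) False by (simp add: field_simps)
    qed simp
  qed (use x(1) in simp)
  then show ?thesis using x(1) by (intro that[of "1 / real (Suc n)" "4 * real n / r"]) auto
qed

lemma C0_semigroup_bounded_on:
  fixes S :: "real \<Rightarrow> 'h::banach \<Rightarrow>\<^sub>L 'h"
  assumes S: "C0_semigroup S"
  shows "\<exists>K\<ge>0. \<forall>t\<in>{0..b}. norm (S t) \<le> K"
proof -
  obtain \<delta> K where \<delta>: "\<delta> > 0" "K \<ge> 0" "\<And>t. 0 < t \<Longrightarrow> t \<le> \<delta> \<Longrightarrow> norm (S t) \<le> K"
    using C0_semigroup_locally_bounded[OF S] by blast
  have S0: "S 0 = id_blinfun" and Sadd: "\<And>s t. 0 \<le> s \<Longrightarrow> 0 \<le> t \<Longrightarrow> S (s + t) = S s o\<^sub>L S t"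
    using S by (auto simp: C0_semigroup_def)
  \<comment> \<open>At least 1, so that the powers increase and time 0 is included.\<close>
  define K' where "K' = max 1 K"
  have "norm (id_blinfun :: 'h \<Rightarrow>\<^sub>L 'h) \<le> 1" by (rule norm_blinfun_bound) auto
  then have base: "norm (S t) \<le> K'" if "0 \<le> t" "t \<le> \<delta>" for t
    using \<delta>(3)[of t] that S0 by (cases "t = 0") (auto simp: K'_def)
  have "\<forall>t\<in>{0..real n * \<delta>}. norm (S t) \<le> K' ^ n" for n
  proof (induction n)
    case 0
    then show ?case using S0 \<open>norm (id_blinfun :: 'h \<Rightarrow>\<^sub>L 'h) \<le> 1\<close> by simp
  next
    case (Suc n)
    show ?case
    proof
      fix t assume t: "t \<in> {0..real (Suc n) * \<delta>}"
      show "norm (S t) \<le> K' ^ Suc n"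
      proof (cases "t \<le> real n * \<delta>")
        case True
        then have "norm (S t) \<le> K' ^ n" using Suc t by auto
        also have "\<dots> \<le> K' ^ Suc n" by (intro power_increasing) (auto simp: K'_def)
        finally show ?thesis .
      next
        case False
        then have "S t = S (t - real n * \<delta>) o\<^sub>L S (real n * \<delta>)"
          using Sadd[of "t - real n * \<delta>" "real n * \<delta>"] \<delta>(1) by simp
        then have "norm (S t) \<le> norm (S (t - real n * \<delta>)) * norm (S (real n * \<delta>))"
          by (metis norm_blinfun_compose)
        also have "\<dots> \<le> K' * K' ^ n"
          using False t Suc \<delta>(1) by (intro mult_mono base) (auto simp: K'_def algebra_simps)
        finally show ?thesis by simp
      qed
    qed
  qed
  moreover obtain n where "real n * \<delta> \<ge> b"
    using reals_Archimedean3[OF \<delta>(1)] by (meson less_imp_le)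
  ultimately show ?thesis
    by (intro exI[of _ "K' ^ n"]) (force simp: K'_def)
qed

text \<open>The semigroup law reduces continuity at an arbitrary time, from the left as well as from
  the right, to right continuity at 0.\<close>

lemma C0_semigroup_diff_bound:
  fixes S :: "real \<Rightarrow> 'h::real_normed_vector \<Rightarrow>\<^sub>L 'h"
  assumes S: "C0_semigroup S" and K: "\<And>t. 0 \<le> t \<Longrightarrow> t \<le> b \<Longrightarrow> norm (S t) \<le> K"
    and st: "0 \<le> s" "0 \<le> t" "s \<le> b" "t \<le> b"
  shows "norm (S s x - S t x) \<le> K * norm (S \<bar>s - t\<bar> x - x)"
  using st
proof (induction s t rule: linorder_wlog)
  case (le s t)
  have "S t = S s o\<^sub>L S (t - s)"
    using S le by (metis C0_semigroup_def add.commute diff_add_cancel diff_ge_0_iff_ge)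
  then have "S s x - S t x = - S s (S (t - s) x - x)" by (simp add: blinfun.diff_right)
  then have "norm (S s x - S t x) \<le> norm (S s) * norm (S (t - s) x - x)"
    by (metis norm_blinfun norm_minus_cancel)
  also have "\<dots> \<le> K * norm (S (t - s) x - x)" using K le by (intro mult_right_mono) auto
  finally show ?case using le by (simp add: abs_minus_commute)
next
  case (sym s t)
  then show ?case by (simp add: norm_minus_commute abs_minus_commute)
qed

lemma C0_semigroup_continuous:
  fixes S :: "real \<Rightarrow> 'h::banach \<Rightarrow>\<^sub>L 'h"
  assumes S: "C0_semigroup S"
  shows "continuous_on {0..} (\<lambda>t. S t x)"
  unfolding continuous_on_def
proof
  fix t :: real assume t: "t \<in> {0..}"
  obtain K where K: "K \<ge> 0" "\<And>s. 0 \<le> s \<Longrightarrow> s \<le> t + 1 \<Longrightarrow> norm (S s) \<le> K"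
    using C0_semigroup_bounded_on[OF S, of "t + 1"] by auto
  define \<phi> where "\<phi> h = norm (S h x - x)" for h
  have "(\<phi> \<longlongrightarrow> 0) (at_right 0)"
    unfolding \<phi>_def using S by (auto simp: C0_semigroup_def intro!: tendsto_norm_zero LIM_zero)
  moreover have "\<phi> 0 = 0" using S by (simp add: \<phi>_def C0_semigroup_def)
  ultimately have \<phi>: "(\<phi> \<longlongrightarrow> 0) (at 0 within {0..})"
    by (simp add: at_within_Ici_at_right)
  have "((\<lambda>s. \<phi> \<bar>s - t\<bar>) \<longlongrightarrow> \<phi> \<bar>t - t\<bar>) (at t within {0..})"
  proof (rule continuous_within_tendsto_compose'[of _ "{0..}" \<phi>])
    show "((\<lambda>s. \<bar>s - t\<bar>) \<longlongrightarrow> \<bar>t - t\<bar>) (at t within {0..})"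
      by (intro tendsto_intros)
    show "continuous (at \<bar>t - t\<bar> within {0..}) \<phi>" using \<phi> \<open>\<phi> 0 = 0\<close> by (simp add: continuous_within)
  qed auto
  then have lim0: "((\<lambda>s. K * \<phi> \<bar>s - t\<bar>) \<longlongrightarrow> 0) (at t within {0..})"
    using \<open>\<phi> 0 = 0\<close> by (intro tendsto_mult_right_zero) simp
  have le:  "\<forall>\<^sub>F s in at t within {0..}. norm (S s x - S t x) \<le> K * \<phi> \<bar>s - t\<bar>"
  proof -
    have "\<forall>\<^sub>F s in at t within {0..}. s \<in> {0..} \<and> s < t + 1"
      by (intro eventually_conj order_tendstoD(2)[OF tendsto_ident_at])
         (auto simp: eventually_at_filter)
    then show ?thesis
      by (rule eventually_mono) (use t K C0_semigroup_diff_bound[OF S K(2)] in \<open>auto simp: \<phi>_def\<close>)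
  qed
  have "((\<lambda>s. S s x - S t x) \<longlongrightarrow> 0) (at t within {0..})"
    by (rule Lim_null_comparison[OF le lim0])
  then show "((\<lambda>s. S s x) \<longlongrightarrow> S t x) (at t within {0..})"
    by (rule LIM_zero_cancel)
qed

text \<open>The function |u|^2 has right derivative -2 (B u \<bullet> u) \<le> 0. B may be any map;
  the lemma serves for the orbits of \<open>S\<^sub>Y l\<close> and for a commutator.\<close>

lemma dissipative_evolution_norm_le:
  fixes u :: "real \<Rightarrow> 'h::real_inner"
  assumes cont: "continuous_on {0..} u"
    and der: "\<And>t. t \<ge> 0 \<Longrightarrow> ((\<lambda>h. (u (t + h) - u t) /\<^sub>R h) \<longlongrightarrow> - B (u t)) (at_right 0)"
    and diss: "\<And>x. 0 \<le> B x \<bullet> x" and t: "t \<ge> 0"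
  shows "norm (u t) \<le> norm (u 0)"
proof -
  have "(norm (u t))\<^sup>2 \<le> (norm (u 0))\<^sup>2"
  proof (rule right_derivative_nonpos_imp_le[OF t])
    show "continuous_on {0..t} (\<lambda>t. (norm (u t))\<^sup>2)"
      by (intro continuous_intros continuous_on_subset[OF cont]) auto
    fix s assume s: "0 \<le> s" "s < t"
    have lim: "((\<lambda>h. u (s + h)) \<longlongrightarrow> u s) (at_right 0)"
    proof -
      have "((\<lambda>h. h *\<^sub>R ((u (s + h) - u s) /\<^sub>R h) + u s) \<longlongrightarrow> 0 *\<^sub>R (- B (u s)) + u s) (at_right 0)"
        by (intro tendsto_intros der s)
      moreover have "\<forall>\<^sub>F h in at_right 0. h *\<^sub>R ((u (s + h) - u s) /\<^sub>R h) + u s = u (s + h)"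
        by (auto simp: eventually_at_filter)
      ultimately show ?thesis by (simp add: tendsto_cong)
    qed
    have "((\<lambda>h. ((u (s + h) - u s) /\<^sub>R h) \<bullet> (u (s + h) + u s)) \<longlongrightarrow> (- B (u s)) \<bullet> (u s + u s)) (at_right 0)"
      by (intro tendsto_intros der s lim)
    moreover have "((u (s + h) - u s) /\<^sub>R h) \<bullet> (u (s + h) + u s) = ((norm (u (s + h)))\<^sup>2 - (norm (u s))\<^sup>2) / h" for h
      by (simp add: power2_norm_eq_inner inner_diff_left inner_add_right inner_commute[of "u s" "u (s + h)"] divide_inverse_commute distrib_left[symmetric])
    ultimately have "((\<lambda>h. ((norm (u (s + h)))\<^sup>2 - (norm (u s))\<^sup>2) / h) \<longlongrightarrow> (- B (u s)) \<bullet> (u s + u s)) (at_right 0)"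
      by simp
    moreover have "(- B (u s)) \<bullet> (u s + u s) \<le> 0" using diss[of "u s"] by (simp add: inner_add_right)
    ultimately show "\<exists>d\<le>0. ((\<lambda>h. ((norm (u (s + h)))\<^sup>2 - (norm (u s))\<^sup>2) / h) \<longlongrightarrow> d) (at_right 0)"
      by blast
  qed
  then show ?thesis by (rule power2_le_imp_le) simp
qed

text \<open>Contractivity of \<open>S\<^sub>Y l\<close> is not part of the data; it follows from the
  monotonicity of the Yosida approximation.\<close>

locale yosida_setting =
  fixes D :: "'h::{real_inner, banach} set" and A :: "'h \<Rightarrow> 'h"
    and S :: "real \<Rightarrow> 'h \<Rightarrow>\<^sub>L 'h" and S\<^sub>Y :: "real \<Rightarrow> real \<Rightarrow> 'h \<Rightarrow>\<^sub>L 'h"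
  assumes linear_A: "linear_on D A" and dense: "closure D = UNIV"
    and monotone_A: "monotone_graph (op_graph D A)"
    and C0: "C0_semigroup S" and contraction: "\<And>t. t \<ge> 0 \<Longrightarrow> norm (S t) \<le> 1"
    and generator: "infinitesimal_generator S = op_graph D (\<lambda>x. - A x)"
    and C0_Y: "\<And>l. l > 0 \<Longrightarrow> C0_semigroup (S\<^sub>Y l)"
    and generator_Y: "\<And>l. l > 0 \<Longrightarrow> infinitesimal_generator (S\<^sub>Y l) = op_graph UNIV (\<lambda>x. - yosida D A l x)"
begin

section \<open>The semigroup and its generator\<close>

lemma S_norm_le: "t \<ge> 0 \<Longrightarrow> norm (S t x) \<le> norm x"
  using norm_blinfun[of "S t" x] contraction[of t] by (meson mult_left_le_one_le norm_ge_zero order_trans)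

lemma S_add: "s \<ge> 0 \<Longrightarrow> t \<ge> 0 \<Longrightarrow> S (s + t) x = S s (S t x)"
  using C0 by (auto simp: C0_semigroup_def)

lemma D_add: "x \<in> D \<Longrightarrow> y \<in> D \<Longrightarrow> x + y \<in> D \<and> A (x + y) = A x + A y"
  and D_scale: "x \<in> D \<Longrightarrow> c *\<^sub>R x \<in> D \<and> A (c *\<^sub>R x) = c *\<^sub>R A x"
  and D_zero: "0 \<in> D"
  using linear_A by (auto simp: linear_on_def subspace_def)

lemma D_diff: "x \<in> D \<Longrightarrow> y \<in> D \<Longrightarrow> x - y \<in> D \<and> A (x - y) = A x - A y"
  using D_add[of x "(- 1) *\<^sub>R y"] D_scale[of y "- 1"] by simp

lemma A_zero: "A 0 = 0"
  using D_scale[OF D_zero, of 0] by simp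

lemma A_nonneg: "x \<in> D \<Longrightarrow> 0 \<le> A x \<bullet> x"
  using monotone_A D_zero A_zero unfolding monotone_graph_def op_graph_def by fastforce

lemma generatorI: "((\<lambda>t. (S t x - x) /\<^sub>R t) \<longlongrightarrow> y) (at_right 0) \<Longrightarrow> x \<in> D \<and> A x = - y"
proof -
  assume "((\<lambda>t. (S t x - x) /\<^sub>R t) \<longlongrightarrow> y) (at_right 0)"
  then have "(x, y) \<in> infinitesimal_generator S" by (simp add: infinitesimal_generator_def)
  then show ?thesis by (auto simp: generator op_graph_def)
qed

lemma generatorD: "x \<in> D \<Longrightarrow> ((\<lambda>t. (S t x - x) /\<^sub>R t) \<longlongrightarrow> - A x) (at_right 0)"
  using generator unfolding infinitesimal_generator_def op_graph_def by blast

lemma S_commutes_A: assumes "x \<in> D" "s \<ge> 0" shows "S s x \<in> D \<and> A (S s x) = S s (A x)"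
proof -
  have "((\<lambda>t. S s ((S t x - x) /\<^sub>R t)) \<longlongrightarrow> S s (- A x)) (at_right 0)"
    by (intro tendsto_intros generatorD assms)
  moreover have "\<forall>\<^sub>F t in at_right 0. S s ((S t x - x) /\<^sub>R t) = (S t (S s x) - S s x) /\<^sub>R t"
  proof -
    have "\<forall>\<^sub>F t in at_right 0. (t::real) > 0" by (simp add: eventually_at_filter)
    then show ?thesis
    proof (rule eventually_mono)
      fix t :: real assume "t > 0"
      then have "S s (S t x) = S t (S s x)" using assms(2) S_add[of s t x] S_add[of t s x] by (simp add: add.commute)
      then show "S s ((S t x - x) /\<^sub>R t) = (S t (S s x) - S s x) /\<^sub>R t"
        by (simp add: blinfun.scaleR_right blinfun.diff_right)
    qed
  qed
  ultimately have "((\<lambda>t. (S t (S s x) - S s x) /\<^sub>R t) \<longlongrightarrow> S s (- A x)) (at_right 0)"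
    by (rule Lim_transform_eventually)
  from generatorI[OF this] show ?thesis by (simp add: blinfun.minus_right)
qed

text \<open>A finite Laplace integral suffices: with \<open>z - e\<^sup>-\<^sup>l S(1) z = x\<close>, the vector
  \<open>\<integral>\<^sub>0\<^sup>1 e\<^sup>-\<^sup>l\<^sup>t S(t) z dt\<close> is the resolvent of \<open>x\<close>.\<close>

lemma resolvent_surj: assumes l: "l > 0" shows "\<exists>y\<in>D. l *\<^sub>R y + A y = x"
proof -
  have "\<exists>!z. x + exp (- l) *\<^sub>R S 1 z = z"
  proof (rule banach_fix_type[of "exp (- l)"])
    show "\<forall>z w. dist (x + exp (- l) *\<^sub>R S 1 z) (x + exp (- l) *\<^sub>R S 1 w) \<le> exp (- l) * dist z w"
    proof (intro allI)
      fix z w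
      have "dist (x + exp (- l) *\<^sub>R S 1 z) (x + exp (- l) *\<^sub>R S 1 w) = exp (- l) * norm (S 1 (z - w))"
        by (simp add: dist_norm blinfun.diff_right scaleR_diff_right[symmetric])
      then show "dist (x + exp (- l) *\<^sub>R S 1 z) (x + exp (- l) *\<^sub>R S 1 w) \<le> exp (- l) * dist z w"
        using S_norm_le[of 1 "z - w"] by (simp add: dist_norm)
    qed
  qed (use l in auto)
  then obtain z where z: "z = x + exp (- l) *\<^sub>R S 1 z" by metis
  \<comment> \<open>The maximum extends the orbit continuously to negative times, and {-1..3} leaves
    room around [0,2]: the shifted integrals below need an antiderivative that is differentiable
    from both sides at every point of [0,2].\<close>
  define g where "g t = exp (- l * t) *\<^sub>R S (max t 0) z" for t :: real
  have contg: "continuous_on {-1..3} g"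
    unfolding g_def
    by (intro continuous_intros continuous_on_compose2[OF C0_semigroup_continuous[OF C0]]) auto
  obtain G where G: "\<And>t. t \<in> {-1..3} \<Longrightarrow> (G has_vector_derivative g t) (at t within {-1..3})"
    using antiderivative_continuous[OF contg] by blast
  have G': "(G has_vector_derivative g t) (at t)" if "-1 < t" "t < 3" for t
    using G[of t] at_within_Icc_at[of "-1" t 3] that by simp
  have shift: "((\<lambda>t. g (t + h)) has_integral (G (1 + h) - G (0 + h))) {0..1}" if "0 \<le> h" "h \<le> 1" for h
  proof (rule fundamental_theorem_of_calculus[of 0 1 "\<lambda>t. G (t + h)"])
    fix t :: real assume "t \<in> {0..1}"
    then have "(G has_vector_derivative g (t + h)) (at (t + h))" using that by (intro G') auto
    then have "((G \<circ> (\<lambda>t. t + h)) has_vector_derivative 1 *\<^sub>R g (t + h)) (at t within {0..1})"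
      by (intro vector_diff_chain_within) (auto intro!: derivative_eq_intros simp: has_vector_derivative_at_within)
    then show "((\<lambda>t. G (t + h)) has_vector_derivative g (t + h)) (at t within {0..1})"
      by (simp add: o_def)
  qed simp
  define y where "y = G 1 - G 0"
  define p where "p h = exp (l * h) *\<^sub>R (G (1 + h) - G h)" for h
  have y: "(g has_integral y) {0..1}" using shift[of 0] by (simp add: y_def)
  \<comment> \<open>\<open>S h\<close> shifts the orbit by h, up to the factor exp (l h). The
    integral over [0,1] becomes one over [h, 1 + h], an expression in G that can be differentiated
    in h.\<close>
  have Sy: "S h y = p h" if h: "0 \<le> h" "h \<le> 1" for h
  proof (rule has_integral_unique)
    show "((\<lambda>t. S h (g t)) has_integral S h y) {0..1}"
      using has_integral_linear[OF y blinfun.bounded_linear_right[of "S h"]] by (simp add: o_def)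
    have "((\<lambda>t. exp (l * h) *\<^sub>R g (t + h)) has_integral p h) {0..1}"
      using has_integral_cmul[OF shift[OF h], of "exp (l * h)"] by (simp add: p_def)
    moreover have "exp (l * h) *\<^sub>R g (t + h) = S h (g t)" if "t \<in> {0..1}" for t
      using that h S_add[of h t z] by (simp add: g_def blinfun.scaleR_right exp_add[symmetric] algebra_simps)
    ultimately show "((\<lambda>t. S h (g t)) has_integral p h) {0..1}"
      by (rule has_integral_eq[rotated])
  qed
  have "(p has_vector_derivative (exp (l * 0) *\<^sub>R (g 1 - g 0) + (l * exp (l * 0)) *\<^sub>R (G (1 + 0) - G 0))) (at 0)"
  proof -
    have "((G \<circ> (\<lambda>h. 1 + h)) has_vector_derivative 1 *\<^sub>R g (1 + 0)) (at 0)"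
      by (intro vector_diff_chain_at G') (auto intro!: derivative_eq_intros G')
    then have 1: "((\<lambda>h. G (1 + h)) has_vector_derivative g 1) (at 0)" by (simp add: o_def)
    have 2: "((\<lambda>h. exp (l * h)) has_field_derivative l * exp (l * 0)) (at 0)"
      by (auto intro!: derivative_eq_intros)
    show ?thesis
      unfolding p_def
      by (intro has_vector_derivative_scaleR has_vector_derivative_diff 1 2 G') auto
  qed
  then have "(p has_vector_derivative (l *\<^sub>R y - x)) (at 0)"
  proof -
    \<comment> \<open>This is the equation that defines z: the two boundary terms of the finite
      integral combine to - x.\<close>
    have "g 1 - g 0 = - x"
      using z C0 by (simp add: g_def C0_semigroup_def algebra_simps)
    then show ?thesis
      using \<open>(p has_vector_derivative _) (at 0)\<close> by (simp add: y_def)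
  qed
  then have "((\<lambda>h. norm ((p h - p 0 - h *\<^sub>R (l *\<^sub>R y - x)) /\<^sub>R norm h)) \<longlongrightarrow> 0) (at 0)"
    by (intro tendsto_norm_zero) (simp add: has_vector_derivative_def has_derivative_def)
  moreover have "\<forall>\<^sub>F h in at 0. norm ((p h - p 0 - h *\<^sub>R (l *\<^sub>R y - x)) /\<^sub>R norm h) = norm ((p h - p 0) /\<^sub>R h - (l *\<^sub>R y - x))"
    unfolding eventually_at_filter
  proof (intro always_eventually allI impI)
    fix h :: real assume "h \<noteq> 0"
    then have "(p h - p 0) /\<^sub>R h - (l *\<^sub>R y - x) = (p h - p 0 - h *\<^sub>R (l *\<^sub>R y - x)) /\<^sub>R h"
      by (simp add: scaleR_diff_right)
    then show "norm ((p h - p 0 - h *\<^sub>R (l *\<^sub>R y - x)) /\<^sub>R norm h) = norm ((p h - p 0) /\<^sub>R h - (l *\<^sub>R y - x))"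
      by simp
  qed
  ultimately have "((\<lambda>h. norm ((p h - p 0) /\<^sub>R h - (l *\<^sub>R y - x))) \<longlongrightarrow> 0) (at 0)"
    by (rule Lim_transform_eventually)
  then have "((\<lambda>h. (p h - p 0) /\<^sub>R h) \<longlongrightarrow> l *\<^sub>R y - x) (at 0)"
    by (rule LIM_zero_cancel[OF tendsto_norm_zero_cancel])
  then have "((\<lambda>h. (p h - y) /\<^sub>R h) \<longlongrightarrow> l *\<^sub>R y - x) (at_right 0)"
    by (simp add: p_def y_def filterlim_at_split)
  moreover have "\<forall>\<^sub>F h in at_right 0. (p h - y) /\<^sub>R h = (S h y - y) /\<^sub>R h"
    unfolding eventually_at_right_field by (rule exI[of _ 1]) (simp add: Sy)
  ultimately have "((\<lambda>h. (S h y - y) /\<^sub>R h) \<longlongrightarrow> l *\<^sub>R y - x) (at_right 0)"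
    by (rule Lim_transform_eventually)
  from generatorI[OF this] show ?thesis by (intro bexI[of _ y]) auto
qed

section \<open>The resolvent\<close>

definition J :: "real \<Rightarrow> 'h \<Rightarrow> 'h" where
  "J l = inv_into D (\<lambda>y. l *\<^sub>R y + A y)"

lemma J: assumes "l > 0" shows "J l x \<in> D" "l *\<^sub>R J l x + A (J l x) = x"
proof -
  have "x \<in> (\<lambda>y. l *\<^sub>R y + A y) ` D" using resolvent_surj[OF assms, of x] by auto
  then show "J l x \<in> D" "l *\<^sub>R J l x + A (J l x) = x"
    unfolding J_def by (fact inv_into_into, fact f_inv_into_f)
qed

text \<open>The difference z solves l z + A z = 0, and pairing with z forces z = 0 by monotonicity.
  As \<open>J\<close> is merely a choice of preimages, its linearity and its commutation with
  \<open>S s\<close> are derived from this uniqueness.\<close>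

lemma J_unique: assumes l: "l > 0" and y: "y \<in> D" "l *\<^sub>R y + A y = x" shows "J l x = y"
proof -
  define z where "z = J l x - y"
  have z: "z \<in> D" "A z = A (J l x) - A y" unfolding z_def using D_diff[OF J(1)[OF l] y(1)] by auto
  have "l *\<^sub>R z + A z = 0"
    using J(2)[OF l, of x] y(2) unfolding z(2) by (simp add: z_def algebra_simps)
  then have "l * (z \<bullet> z) + A z \<bullet> z = 0" by (metis inner_add_left inner_scaleR_left inner_zero_left)
  then have "l * (z \<bullet> z) \<le> 0" using A_nonneg[OF z(1)] by linarith
  then have "z \<bullet> z \<le> 0" using l by (simp add: mult_le_0_iff)
  then have "z = 0" by (metis inner_ge_zero inner_eq_zero_iff order_antisym)
  then show ?thesis by (simp add: z_def)
qed

lemma J_norm_le: assumes l: "l > 0" shows "norm (J l x) \<le> norm x / l"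
proof -
  have "l * (norm (J l x))\<^sup>2 \<le> x \<bullet> J l x"
    using arg_cong[OF J(2)[OF l, of x], of "\<lambda>v. v \<bullet> J l x"] A_nonneg[OF J(1)[OF l, of x]]
    by (simp add: inner_add_left power2_norm_eq_inner)
  also have "\<dots> \<le> norm x * norm (J l x)" by (rule norm_cauchy_schwarz)
  finally have "(l * norm (J l x)) * norm (J l x) \<le> norm x * norm (J l x)"
    by (simp add: power2_eq_square)
  then have "l * norm (J l x) \<le> norm x" by (cases "J l x = 0") auto
  then show ?thesis using l by (simp add: field_simps)
qed

lemma J_diff: "l > 0 \<Longrightarrow> J l (x - y) = J l x - J l y"
proof (rule J_unique)
  assume l: "l > 0"
  have "l *\<^sub>R (J l x - J l y) + A (J l x - J l y) = (l *\<^sub>R J l x + A (J l x)) - (l *\<^sub>R J l y + A (J l y))"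
    using D_diff[OF J(1)[OF l] J(1)[OF l]] by (simp add: scaleR_diff_right)
  then show "l *\<^sub>R (J l x - J l y) + A (J l x - J l y) = x - y" by (simp only: J(2)[OF l])
qed (auto simp: D_diff J)

lemma J_scale: "l > 0 \<Longrightarrow> J l (c *\<^sub>R x) = c *\<^sub>R J l x"
proof (rule J_unique)
  assume l: "l > 0"
  have "l *\<^sub>R c *\<^sub>R J l x + A (c *\<^sub>R J l x) = c *\<^sub>R (l *\<^sub>R J l x + A (J l x))"
    using D_scale[OF J(1)[OF l]] by (simp add: scaleR_add_right mult.commute)
  then show "l *\<^sub>R c *\<^sub>R J l x + A (c *\<^sub>R J l x) = c *\<^sub>R x" by (simp only: J(2)[OF l])
qed (auto simp: D_scale J)

lemma J_S: "l > 0 \<Longrightarrow> s \<ge> 0 \<Longrightarrow> J l (S s x) = S s (J l x)"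
  using S_commutes_A[OF J(1)] J(2)
  by (intro J_unique) (auto simp: blinfun.add_right[symmetric] blinfun.scaleR_right[symmetric])

text \<open>The form l (1 - l J), in which linearity and commutation with \<open>S s\<close> follow
  from those of \<open>J l\<close>.\<close>

lemma yosida_eq: "l > 0 \<Longrightarrow> yosida D A l x = l *\<^sub>R (x - l *\<^sub>R J l x)"
  unfolding yosida_def J_def[symmetric] using J(2)[of l x] by (metis add_diff_cancel_left')

lemma yosida_nonneg: assumes l: "l > 0" shows "0 \<le> yosida D A l x \<bullet> x"
proof -
  have "yosida D A l x \<bullet> x = l * (A (J l x) \<bullet> (l *\<^sub>R J l x + A (J l x)))"
    using J(2)[OF l, of x] by (simp add: yosida_def J_def)
  also have "\<dots> = l * (l * (A (J l x) \<bullet> J l x) + A (J l x) \<bullet> A (J l x))"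
    by (simp add: inner_add_right)
  also have "\<dots> \<ge> 0" using l A_nonneg[OF J(1)[OF l]] by simp
  finally show ?thesis .
qed

section \<open>The semigroups of the Yosida approximations\<close>

lemma generator_Y_lim: "l > 0 \<Longrightarrow> ((\<lambda>t. (S\<^sub>Y l t x - x) /\<^sub>R t) \<longlongrightarrow> - yosida D A l x) (at_right 0)"
  using generator_Y[of l] unfolding infinitesimal_generator_def op_graph_def by blast

lemma S_Y_add: "l > 0 \<Longrightarrow> s \<ge> 0 \<Longrightarrow> t \<ge> 0 \<Longrightarrow> S\<^sub>Y l (s + t) x = S\<^sub>Y l s (S\<^sub>Y l t x)"
  using C0_Y by (auto simp: C0_semigroup_def)

lemma S_Y_right_derivative:
  assumes "l > 0" "t \<ge> 0"
  shows "((\<lambda>h. (S\<^sub>Y l (t + h) x - S\<^sub>Y l t x) /\<^sub>R h) \<longlongrightarrow> - yosida D A l (S\<^sub>Y l t x)) (at_right 0)"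
proof -
  have "\<forall>\<^sub>F h in at_right 0. (S\<^sub>Y l h (S\<^sub>Y l t x) - S\<^sub>Y l t x) /\<^sub>R h = (S\<^sub>Y l (t + h) x - S\<^sub>Y l t x) /\<^sub>R h"
    unfolding eventually_at_right_field
    using assms by (intro exI[of _ 1]) (simp add: S_Y_add[symmetric] add.commute)
  then show ?thesis
    using generator_Y_lim[OF assms(1)] by (rule Lim_transform_eventually[rotated])
qed

lemma S_Y_norm_le: assumes l: "l > 0" and t: "t \<ge> 0" shows "norm (S\<^sub>Y l t x) \<le> norm x"
proof -
  have "norm (S\<^sub>Y l t x) \<le> norm (S\<^sub>Y l 0 x)"
    by (rule dissipative_evolution_norm_le[where u = "\<lambda>t. S\<^sub>Y l t x" and B = "yosida D A l"])
       (use l t C0_semigroup_continuous[OF C0_Y] S_Y_right_derivative yosida_nonneg in auto)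
  also have "S\<^sub>Y l 0 x = x" using C0_Y[OF l] by (simp add: C0_semigroup_def)
  finally show ?thesis .
qed

lemma S_Y_contraction: "l > 0 \<Longrightarrow> t \<ge> 0 \<Longrightarrow> norm (S\<^sub>Y l t) \<le> 1"
  by (rule norm_blinfun_bound) (auto simp: S_Y_norm_le)

text \<open>The commutator u of the two semigroups at x has right derivative given by minus the
  Yosida approximation of u, since \<open>J l\<close> commutes with \<open>S s\<close>, and it
  starts at 0. Dissipativity keeps it at 0.\<close>

lemma S_S_Y_commute: assumes l: "l > 0" and s: "s \<ge> 0" and t: "t \<ge> 0"
  shows "S s (S\<^sub>Y l t x) = S\<^sub>Y l t (S s x)"
proof -
  define u where "u t = S s (S\<^sub>Y l t x) - S\<^sub>Y l t (S s x)" for t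
  have "norm (u t) \<le> norm (u 0)"
  proof (rule dissipative_evolution_norm_le[where B = "yosida D A l"])
    show "continuous_on {0..} u"
      unfolding u_def by (intro continuous_intros C0_semigroup_continuous C0_Y l)
    fix r :: real assume r: "r \<ge> 0"
    have "((\<lambda>h. S s ((S\<^sub>Y l (r + h) x - S\<^sub>Y l r x) /\<^sub>R h) - (S\<^sub>Y l (r + h) (S s x) - S\<^sub>Y l r (S s x)) /\<^sub>R h)
        \<longlongrightarrow> S s (- yosida D A l (S\<^sub>Y l r x)) - (- yosida D A l (S\<^sub>Y l r (S s x)))) (at_right 0)"
      by (intro tendsto_intros S_Y_right_derivative l r)
    moreover have "S s (- yosida D A l (S\<^sub>Y l r x)) - (- yosida D A l (S\<^sub>Y l r (S s x))) = - yosida D A l (u r)"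
      using l s by (simp add: yosida_eq u_def J_diff J_S blinfun.bilinear_simps algebra_simps)
    moreover have "S s ((S\<^sub>Y l (r + h) x - S\<^sub>Y l r x) /\<^sub>R h) - (S\<^sub>Y l (r + h) (S s x) - S\<^sub>Y l r (S s x)) /\<^sub>R h
        = (u (r + h) - u r) /\<^sub>R h" for h
      by (simp add: u_def blinfun.bilinear_simps scaleR_diff_right[symmetric])
    ultimately show "((\<lambda>h. (u (r + h) - u r) /\<^sub>R h) \<longlongrightarrow> - yosida D A l (u r)) (at_right 0)" by simp
  qed (use t yosida_nonneg[OF l] in auto)
  also have "u 0 = 0" using C0_Y[OF l] by (simp add: u_def C0_semigroup_def)
  finally show ?thesis by (simp add: u_def)
qed

text \<open>The difference of the n-th powers of two commuting contractions telescopes: each of the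
  n terms contains the one-step difference at x, followed by contractions.\<close>

lemma telescope:
  assumes l: "l > 0" and h: "h \<ge> 0"
  shows "norm (S\<^sub>Y l (real n * h) x - S (real n * h) x) \<le> real n * norm (S\<^sub>Y l h x - S h x)"
proof (induction n)
  case 0
  show ?case using C0 C0_Y[OF l] by (simp add: C0_semigroup_def)
next
  case (Suc n)
  have nh: "real n * h \<ge> 0" using h by simp
  have e: "real (Suc n) * h = real n * h + h" by (simp add: algebra_simps)
  have "S\<^sub>Y l (real (Suc n) * h) x - S (real (Suc n) * h) x
      = S\<^sub>Y l (real n * h) (S\<^sub>Y l h x - S h x) + S h (S\<^sub>Y l (real n * h) x - S (real n * h) x)"
    unfolding e S_Y_add[OF l nh h] S_add[OF nh h]
    using S_S_Y_commute[OF l h nh, of x] S_add[OF nh h, of x] S_add[OF h nh, of x]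
    by (simp add: blinfun.bilinear_simps add.commute)
  also have "norm \<dots> \<le> norm (S\<^sub>Y l h x - S h x) + norm (S\<^sub>Y l (real n * h) x - S (real n * h) x)"
    by (intro norm_triangle_le add_mono S_Y_norm_le S_norm_le l h nh)
  also have "\<dots> \<le> real (Suc n) * norm (S\<^sub>Y l h x - S h x)"
    using Suc.IH by (simp add: algebra_simps)
  finally show ?case .
qed

text \<open>With equal steps of length h, \<open>telescope\<close> bounds the distance by t times
  the distance of the two difference quotients at h, and these converge to the two generators as h
  tends to 0. The argument replaces differentiating s \<mapsto> S_Y(t - s) S(s) x.\<close>

lemma S_Y_diff_le:
  assumes l: "l > 0" and x: "x \<in> D" and t: "t \<ge> 0"
  shows "norm (S\<^sub>Y l t x - S t x) \<le> t * norm (A x - yosida D A l x)"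
proof (cases "t = 0")
  case True
  then show ?thesis using C0 C0_Y[OF l] by (simp add: C0_semigroup_def)
next
  case False
  then have t0: "t > 0" using t by simp
  define h where "h n = t / real (Suc n)" for n
  have h0: "filterlim h (at_right 0) sequentially"
    using LIMSEQ_Suc[OF lim_const_over_n[of t]] t0 by (simp add: filterlim_at h_def[abs_def])
  have "((\<lambda>h. t * norm ((S\<^sub>Y l h x - x) /\<^sub>R h - (S h x - x) /\<^sub>R h)) \<longlongrightarrow>
      t * norm (- yosida D A l x - (- A x))) (at_right 0)"
    by (intro tendsto_intros generator_Y_lim generatorD l x)
  from filterlim_compose[OF this h0]
  have "(\<lambda>n. t * norm ((S\<^sub>Y l (h n) x - x) /\<^sub>R h n - (S (h n) x - x) /\<^sub>R h n)) \<longlonglongrightarrow> t * norm (A x - yosida D A l x)"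
    by simp
  moreover have "norm (S\<^sub>Y l t x - S t x) \<le> t * norm ((S\<^sub>Y l (h n) x - x) /\<^sub>R h n - (S (h n) x - x) /\<^sub>R h n)" for n
  proof -
    have hn: "h n > 0" "real (Suc n) * h n = t" "t / h n = real (Suc n)"
      using t0 by (auto simp: h_def)
    have "norm ((S\<^sub>Y l (h n) x - x) /\<^sub>R h n - (S (h n) x - x) /\<^sub>R h n) = norm (S\<^sub>Y l (h n) x - S (h n) x) / h n"
      using hn(1) by (simp add: scaleR_diff_right[symmetric] divide_inverse_commute)
    then have "t * norm ((S\<^sub>Y l (h n) x - x) /\<^sub>R h n - (S (h n) x - x) /\<^sub>R h n)
        = real (Suc n) * norm (S\<^sub>Y l (h n) x - S (h n) x)"
      by (simp only: hn(3)[symmetric] times_divide_eq_right times_divide_eq_left)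
    then show ?thesis using telescope[OF l, of "h n" "Suc n" x] hn by simp
  qed
  ultimately show ?thesis by (intro LIMSEQ_le_const) auto
qed

text \<open>For y in D one has y - l J y = J (A y), of norm at most |A y| / l. The maps l J are
  nonexpansive, so the limit extends from D to its closure.\<close>

lemma lJ_tendsto: "((\<lambda>l. l *\<^sub>R J l x) \<longlongrightarrow> x) at_top"
proof (rule tendstoI)
  fix e :: real assume e: "e > 0"
  have "x \<in> closure D" using dense by simp
  then obtain y where y: "y \<in> D" "dist y x < e / 3"
    using e by (metis closure_approachable divide_pos_pos zero_less_numeral)
  have "\<forall>\<^sub>F l in at_top. norm (A y) / l < e / 3 \<and> l > 0"
  proof (rule eventually_conj)
    have "((\<lambda>l. norm (A y) / l) \<longlongrightarrow> 0) at_top"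
      by (rule tendsto_divide_0[OF tendsto_const filterlim_at_top_imp_at_infinity[OF filterlim_ident]])
    then show "\<forall>\<^sub>F l in at_top. norm (A y) / l < e / 3" using e by (intro order_tendstoD) auto
  qed (rule eventually_gt_at_top)
  then show "\<forall>\<^sub>F l in at_top. dist (l *\<^sub>R J l x) x < e"
  proof (rule eventually_mono)
    fix l :: real assume l: "norm (A y) / l < e / 3 \<and> l > 0"
    have Jy: "J l (l *\<^sub>R y + A y) = y" using l y by (intro J_unique) auto
    have Jl: "J l (l *\<^sub>R y) = l *\<^sub>R J l y" using l by (simp add: J_scale)
    have "y - l *\<^sub>R J l y = J l (A y)"
      using J_diff[of l "l *\<^sub>R y + A y" "l *\<^sub>R y"] Jy Jl l by simp
    then have 1: "norm (l *\<^sub>R J l y - y) < e / 3"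
      using J_norm_le[of l "A y"] l by (metis norm_minus_commute order_le_less_trans)
    have 2: "norm (l *\<^sub>R J l x - l *\<^sub>R J l y) \<le> norm (x - y)"
    proof -
      have "norm (l *\<^sub>R J l x - l *\<^sub>R J l y) = l * norm (J l (x - y))"
        using l by (simp add: J_diff scaleR_diff_right[symmetric])
      also have "\<dots> \<le> l * (norm (x - y) / l)" using l by (intro mult_left_mono J_norm_le) auto
      finally show ?thesis using l by simp
    qed
    have "l *\<^sub>R J l x - x = (l *\<^sub>R J l x - l *\<^sub>R J l y) + (l *\<^sub>R J l y - y) + (y - x)" by simp
    then have "norm (l *\<^sub>R J l x - x) \<le> norm (l *\<^sub>R J l x - l *\<^sub>R J l y) + norm (l *\<^sub>R J l y - y) + norm (y - x)"
      by (metis (no_types) norm_triangle_le norm_triangle_ineq add_right_mono)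
    then show "dist (l *\<^sub>R J l x) x < e" using 1 2 y(2) by (simp add: dist_norm norm_minus_commute)
  qed
qed

text \<open>On D the Yosida approximation equals l J (A x), to which \<open>lJ_tendsto\<close>
  applies.\<close>

lemma yosida_tendsto: assumes x: "x \<in> D" shows "((\<lambda>l. yosida D A l x) \<longlongrightarrow> A x) at_top"
proof (rule Lim_transform_eventually[OF lJ_tendsto])
  have "\<forall>\<^sub>F l in at_top. (l::real) > 0" by (rule eventually_gt_at_top)
  then show "\<forall>\<^sub>F l in at_top. l *\<^sub>R J l (A x) = yosida D A l x"
  proof (rule eventually_mono)
    fix l :: real assume l: "l > 0"
    have Jx: "J l (l *\<^sub>R x + A x) = x" using l x by (intro J_unique) auto
    have Jl: "J l (l *\<^sub>R x) = l *\<^sub>R J l x" using l by (rule J_scale)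
    have "x - l *\<^sub>R J l x = J l (A x)"
      using J_diff[of l "l *\<^sub>R x + A x" "l *\<^sub>R x"] Jx Jl l by simp
    then show "l *\<^sub>R J l (A x) = yosida D A l x" using l by (simp add: yosida_eq)
  qed
qed

text \<open>Uniformity comes from the factor t \<le> |T| in \<open>S_Y_diff_le\<close> on D and
  survives the passage to the closure by contractivity.\<close>

lemma S_Y_tendsto_uniformly:
  assumes e: "e > 0"
  shows "\<forall>\<^sub>F l in at_top. \<forall>t\<in>{0..T}. norm (S\<^sub>Y l t x - S t x) < e"
proof -
  have "x \<in> closure D" using dense by simp
  then obtain y where y: "y \<in> D" "dist y x < e / 3"
    using e by (metis closure_approachable divide_pos_pos zero_less_numeral)
  have "((\<lambda>l. \<bar>T\<bar> * norm (A y - yosida D A l y)) \<longlongrightarrow> \<bar>T\<bar> * norm (A y - A y)) at_top"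
    by (intro tendsto_intros yosida_tendsto y)
  then have "\<forall>\<^sub>F l in at_top. \<bar>T\<bar> * norm (A y - yosida D A l y) < e / 3"
    using e by (intro order_tendstoD) auto
  moreover have "\<forall>\<^sub>F l in at_top. (l::real) > 0" by (rule eventually_gt_at_top)
  ultimately show ?thesis
  proof eventually_elim
    fix l :: real assume l: "\<bar>T\<bar> * norm (A y - yosida D A l y) < e / 3" "l > 0"
    show "\<forall>t\<in>{0..T}. norm (S\<^sub>Y l t x - S t x) < e"
    proof
      fix t assume t: "t \<in> {0..T}"
      have "norm (S\<^sub>Y l t y - S t y) \<le> t * norm (A y - yosida D A l y)"
        using t by (intro S_Y_diff_le l y) auto
      also have "\<dots> \<le> \<bar>T\<bar> * norm (A y - yosida D A l y)" using t by (intro mult_right_mono) auto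
      finally have 1: "norm (S\<^sub>Y l t y - S t y) < e / 3" using l by simp
      have "S\<^sub>Y l t x - S t x = S\<^sub>Y l t (x - y) + (S\<^sub>Y l t y - S t y) + S t (y - x)"
        by (simp add: blinfun.bilinear_simps)
      then have "norm (S\<^sub>Y l t x - S t x) \<le> norm (S\<^sub>Y l t (x - y)) + norm (S\<^sub>Y l t y - S t y) + norm (S t (y - x))"
        by (metis (no_types) norm_triangle_le norm_triangle_ineq add_right_mono)
      then show "norm (S\<^sub>Y l t x - S t x) < e"
        using 1 y(2) S_Y_norm_le[OF l(2), of t "x - y"] S_norm_le[of t "y - x"] t
        by (simp add: dist_norm norm_minus_commute)
    qed
  qed
qed

end

subsection \<open>A maximal inequality for contractive recursions\<close>

text \<open>The weight \<open>m\<^sup>2 + \<parallel>x\<parallel>\<^sup>4 / m\<^sup>2\<close> on pairs (state, running maximum) lies between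
  \<open>m\<^sup>2\<close> and \<open>2 m\<^sup>2\<close>, is nondecreasing in \<open>\<parallel>x\<parallel>\<close>, and grows under a jump \<open>d\<close> by a term
  linear in \<open>d\<close> plus \<open>O(\<parallel>d\<parallel>\<^sup>2)\<close>. This replaces Doob's inequality, which is not available because
  a contraction destroys the submartingale property.\<close>

definition max_potential :: "'h::real_normed_vector \<Rightarrow> real \<Rightarrow> real" where
  "max_potential x m = m\<^sup>2 + (norm x) ^ 4 / m\<^sup>2"

lemma max_potential_mono: "norm x \<le> norm y \<Longrightarrow> max_potential x m \<le> max_potential y m"
  by (auto simp: max_potential_def intro!: divide_right_mono power_mono)

lemma max_potential_ge: "m\<^sup>2 \<le> max_potential x m"
  by (simp add: max_potential_def)

lemma max_potential_le: assumes "norm x \<le> m" shows "max_potential x m \<le> 2 * m\<^sup>2"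
proof (cases "m = 0")
  case False
  have "(norm x) ^ 4 \<le> m ^ 4" using assms by (intro power_mono) auto
  also have "m ^ 4 = m\<^sup>2 * m\<^sup>2" by (simp add: power2_eq_square power4_eq_xxxx)
  finally show ?thesis using False by (simp add: max_potential_def field_simps)
qed (use assms in \<open>simp add: max_potential_def\<close>)

text \<open>The coefficient of x \<bullet> d is that of the derivative of |x|^4 / m^2. Write n =
  |x|^2, p = x \<bullet> d and q = |d|^2. If the maximum does not move, then |d| \<le> 2 m, and the
  remaining terms (2 p + q)^2 / m^2 and 2 n q / m^2 are at most 16 q and 2 q; this is the origin of
  18. If it moves, the new potential is 2 |x + d|^2, and a completed square leaves a
  surplus.\<close>

lemma max_potential_step:
  fixes x d :: "'h::real_inner"
  assumes xm: "norm x \<le> m"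
  shows "max_potential (x + d) (max m (norm (x + d)))
    \<le> max_potential x m + (4 * (norm x)\<^sup>2 / m\<^sup>2) * (x \<bullet> d) + 18 * (norm d)\<^sup>2"
proof (cases "m = 0")
  \<comment> \<open>Here x = 0, and quotients by m^2 are 0 by the convention on division.\<close>
  case True
  have "max_potential d (norm d) \<le> 2 * (norm d)\<^sup>2" by (rule max_potential_le) simp
  also have "\<dots> \<le> 18 * (norm d)\<^sup>2" by simp
  finally show ?thesis using True xm by (simp add: max_potential_def[of "0::'h"])
next
  case False
  then have m: "m > 0" using xm by (metis norm_ge_zero order_le_less order_trans)
  define n p q where "n = (norm x)\<^sup>2" and "p = x \<bullet> d" and "q = (norm d)\<^sup>2"
  have n: "0 \<le> n" "n \<le> m\<^sup>2" using xm by (auto simp: n_def power_mono)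
  have y: "(norm (x + d))\<^sup>2 = n + 2 * p + q"
    by (simp add: n_def p_def q_def power2_norm_eq_inner inner_add_left inner_add_right inner_commute)
  have x4: "norm x ^ 4 = n\<^sup>2" by (simp add: n_def flip: power_mult)
  have y4: "norm (x + d) ^ 4 = (n + 2 * p + q)\<^sup>2" by (simp add: y[symmetric] flip: power_mult)
  have pb: "\<bar>p\<bar> \<le> norm x * norm d" unfolding p_def by (rule Cauchy_Schwarz_ineq2)
  have q: "q \<ge> 0" by (simp add: q_def)
  show ?thesis
  proof (cases "norm (x + d) \<le> m")
    case True
    have "norm d \<le> norm (x + d) + norm x" by (metis add_diff_cancel_left' norm_triangle_ineq4)
    then have d2: "norm d \<le> 2 * m" using True xm by simp
    have "norm d * (2 * norm x + norm d) = 2 * (norm x * norm d) + q"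
      by (simp add: q_def power2_eq_square algebra_simps)
    then have "\<bar>2 * p + q\<bar> \<le> norm d * (2 * norm x + norm d)" using pb q by linarith
    also have "\<dots> \<le> norm d * (4 * m)" using d2 xm by (intro mult_left_mono) auto
    finally have "(2 * p + q)\<^sup>2 \<le> (norm d * (4 * m))\<^sup>2" by (metis abs_le_square_iff abs_ge_zero abs_of_nonneg order_trans)
    then have 1: "(2 * p + q)\<^sup>2 \<le> 16 * m\<^sup>2 * q" by (simp add: q_def power_mult_distrib mult_ac)
    have 2: "2 * n * q \<le> 2 * m\<^sup>2 * q" using n q by (intro mult_right_mono) auto
    have "(n + 2 * p + q)\<^sup>2 = n\<^sup>2 + 4 * n * p + (2 * p + q)\<^sup>2 + 2 * n * q"
      by (simp add: power2_eq_square algebra_simps)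
    also have "\<dots> \<le> n\<^sup>2 + 4 * n * p + 18 * m\<^sup>2 * q" using 1 2 by linarith
    finally have "(n + 2 * p + q)\<^sup>2 / m\<^sup>2 \<le> (n\<^sup>2 + 4 * n * p + 18 * m\<^sup>2 * q) / m\<^sup>2"
      by (rule divide_right_mono) simp
    also have "\<dots> = n\<^sup>2 / m\<^sup>2 + 4 * n / m\<^sup>2 * p + 18 * q"
      using m by (simp add: add_divide_distrib)
    finally show ?thesis
      using True by (simp add: max_potential_def x4 y4 max_absorb1 n_def[symmetric] p_def[symmetric] q_def[symmetric])
  next
    case False
    define a where "a = n / m\<^sup>2"
    have a: "0 \<le> a" "a \<le> 1" "n = a * m\<^sup>2" using n m by (auto simp: a_def)
    have yn: "norm (x + d) \<noteq> 0" using False m by auto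
    have "max_potential (x + d) (norm (x + d)) = 2 * (norm (x + d))\<^sup>2"
      using yn by (simp add: max_potential_def power2_eq_square power4_eq_xxxx)
    then have lhs: "max_potential (x + d) (max m (norm (x + d))) = 2 * (n + 2 * p + q)"
      using False y by (simp add: max_absorb2)
    have rhs: "max_potential x m + 4 * n / m\<^sup>2 * p + 18 * q = m\<^sup>2 + a\<^sup>2 * m\<^sup>2 + 4 * a * p + 18 * q"
      using m by (simp add: max_potential_def x4 a(3) power2_eq_square)
    have "p \<le> m * norm d" using pb xm by (meson abs_le_D1 mult_right_mono norm_ge_zero order_trans)
    then have "(1 - a) * p \<le> (1 - a) * (m * norm d)" using a by (intro mult_left_mono) auto
    moreover have "0 \<le> (m * (1 - a) - 2 * norm d)\<^sup>2" by simp
    moreover have "(m * (1 - a) - 2 * norm d)\<^sup>2 = m\<^sup>2 * (1 - a)\<^sup>2 - 4 * ((1 - a) * (m * norm d)) + 4 * q"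
      by (simp add: q_def power2_eq_square algebra_simps)
    ultimately have "0 \<le> m\<^sup>2 * (1 - a)\<^sup>2 - 4 * ((1 - a) * p) + 16 * q" using q by linarith
    also have "\<dots> = m\<^sup>2 + a\<^sup>2 * m\<^sup>2 + 4 * a * p + 18 * q - 2 * (n + 2 * p + q)"
      by (simp add: a(3) power2_eq_square algebra_simps)
    finally show ?thesis unfolding n_def[symmetric] p_def[symmetric] q_def[symmetric] using lhs rhs by linarith
  qed
qed

section \<open>Square integrable random vectors\<close>

lemma integrable_inner_of_square_integrable:
  fixes X Y :: "'a \<Rightarrow> 'h::{real_inner, banach, second_countable_topology}"
  assumes [measurable]: "X \<in> borel_measurable M" "Y \<in> borel_measurable M"
    and "integrable M (\<lambda>\<omega>. (norm (X \<omega>))\<^sup>2)" "integrable M (\<lambda>\<omega>. (norm (Y \<omega>))\<^sup>2)"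
  shows "integrable M (\<lambda>\<omega>. X \<omega> \<bullet> Y \<omega>)"
proof (rule Bochner_Integration.integrable_bound)
  show "integrable M (\<lambda>\<omega>. (norm (X \<omega>))\<^sup>2 + (norm (Y \<omega>))\<^sup>2)"
    using assms by simp
  have "\<bar>x \<bullet> y\<bar> \<le> (norm x)\<^sup>2 + (norm y)\<^sup>2" for x y :: 'h
  proof -
    have "\<bar>x \<bullet> y\<bar> \<le> norm x * norm y" by (rule Cauchy_Schwarz_ineq2)
    also have "2 * (norm x * norm y) \<le> (norm x)\<^sup>2 + (norm y)\<^sup>2" using sum_squares_bound[of "norm x" "norm y"] by simp
    finally show ?thesis using zero_le_power2[of "norm x"] zero_le_power2[of "norm y"] by linarith
  qed
  then show "AE \<omega> in M. norm (X \<omega> \<bullet> Y \<omega>) \<le> norm ((norm (X \<omega>))\<^sup>2 + (norm (Y \<omega>))\<^sup>2)"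
    by (simp add: abs_of_nonneg)
qed measurable

lemma norm_add_square_le: "(norm (x + y))\<^sup>2 \<le> 2 * (norm x)\<^sup>2 + 2 * (norm y :: real)\<^sup>2" for x y :: "'b::real_normed_vector"
proof -
  have "(norm (x + y))\<^sup>2 \<le> (norm x + norm y)\<^sup>2" by (intro power_mono norm_triangle_ineq) simp
  also have "\<dots> \<le> 2 * (norm x)\<^sup>2 + 2 * (norm y)\<^sup>2"
    using sum_squares_bound[of "norm x" "norm y"] by (simp add: power2_eq_square algebra_simps)
  finally show ?thesis .
qed

lemma square_integrable_add:
  fixes X Y :: "'a \<Rightarrow> 'h::{real_inner, banach, second_countable_topology}"
  assumes [measurable]: "X \<in> borel_measurable M" "Y \<in> borel_measurable M"
    and "integrable M (\<lambda>\<omega>. (norm (X \<omega>))\<^sup>2)" "integrable M (\<lambda>\<omega>. (norm (Y \<omega>))\<^sup>2)"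
  shows "integrable M (\<lambda>\<omega>. (norm (X \<omega> + Y \<omega>))\<^sup>2)"
proof (rule Bochner_Integration.integrable_bound)
  show "integrable M (\<lambda>\<omega>. 2 * (norm (X \<omega>))\<^sup>2 + 2 * (norm (Y \<omega>))\<^sup>2)" using assms by simp
  show "AE \<omega> in M. norm ((norm (X \<omega> + Y \<omega>))\<^sup>2) \<le> norm (2 * (norm (X \<omega>))\<^sup>2 + 2 * (norm (Y \<omega>))\<^sup>2)"
    using norm_add_square_le by (intro AE_I2) (simp add: abs_of_nonneg)
qed measurable

lemma square_integrable_le:
  fixes X :: "'a \<Rightarrow> 'h::{real_inner, banach, second_countable_topology}" and Y :: "'a \<Rightarrow> 'g::{real_inner, banach, second_countable_topology}"
  assumes [measurable]: "X \<in> borel_measurable M" "Y \<in> borel_measurable M"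
    and "\<And>\<omega>. \<omega> \<in> space M \<Longrightarrow> norm (Y \<omega>) \<le> c * norm (X \<omega>)" and "integrable M (\<lambda>\<omega>. (norm (X \<omega>))\<^sup>2)"
  shows "integrable M (\<lambda>\<omega>. (norm (Y \<omega>))\<^sup>2)"
proof (rule Bochner_Integration.integrable_bound)
  show "integrable M (\<lambda>\<omega>. c\<^sup>2 * (norm (X \<omega>))\<^sup>2)" using assms by simp
  have "(norm (Y \<omega>))\<^sup>2 \<le> c\<^sup>2 * (norm (X \<omega>))\<^sup>2" if "\<omega> \<in> space M" for \<omega>
    using power_mono[OF assms(3)[OF that], of 2] by (simp add: power_mult_distrib)
  then show "AE \<omega> in M. norm ((norm (Y \<omega>))\<^sup>2) \<le> norm (c\<^sup>2 * (norm (X \<omega>))\<^sup>2)"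
    by (intro AE_I2) (auto intro: order_trans)
qed measurable

context prob_space
begin

lemma square_integrable_imp_integrable_norm:
  fixes X :: "'a \<Rightarrow> 'h::{real_inner, banach, second_countable_topology}"
  assumes [measurable]: "X \<in> borel_measurable M" and "integrable M (\<lambda>\<omega>. (norm (X \<omega>))\<^sup>2)"
  shows "integrable M X"
proof -
  have "integrable M (\<lambda>\<omega>. norm (X \<omega>))"
    by (rule square_integrable_imp_integrable) (use assms in auto)
  then show ?thesis by (simp add: integrable_norm_iff)
qed

text \<open>V has conditional expectation 0 given G, and Z is measurable with respect to G. The
  identity is clear for simple Z, and approximants dominated by 2 |Z| carry it to the limit. Testing
  V on the sets of G avoids conditional expectations of vector-valued variables.\<close>

lemma integral_inner_orthogonal:
  fixes V Z :: "'a \<Rightarrow> 'h::{real_inner, banach, second_countable_topology}"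
  assumes sub: "subalgebra M G" and V[measurable]: "V \<in> borel_measurable M"
    and V2: "integrable M (\<lambda>\<omega>. (norm (V \<omega>))\<^sup>2)"
    and V0: "\<And>A. A \<in> sets G \<Longrightarrow> (LINT \<omega>:A|M. V \<omega>) = 0"
    and Z: "Z \<in> borel_measurable G" and Z2: "integrable M (\<lambda>\<omega>. (norm (Z \<omega>))\<^sup>2)"
  shows "integrable M (\<lambda>\<omega>. Z \<omega> \<bullet> V \<omega>)" and "(LINT \<omega>|M. Z \<omega> \<bullet> V \<omega>) = 0"
proof -
  have sp: "space G = space M" and sets: "sets G \<subseteq> sets M" using sub by (auto simp: subalgebra_def)
  have ZM[measurable]: "Z \<in> borel_measurable M" by (rule measurable_from_subalg[OF sub Z])
  show int: "integrable M (\<lambda>\<omega>. Z \<omega> \<bullet> V \<omega>)"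
    by (rule integrable_inner_of_square_integrable) (use V2 Z2 in auto)
  obtain f where f: "\<And>i. simple_function G (f i)" "\<And>x. x \<in> space G \<Longrightarrow> (\<lambda>i. f i x) \<longlonglongrightarrow> Z x"
    "\<And>i x. x \<in> space G \<Longrightarrow> dist (f i x) 0 \<le> 2 * dist (Z x) 0"
    using borel_measurable_implies_sequence_metric[OF Z, of 0] by blast
  have fG: "f i \<in> borel_measurable G" for i by (rule borel_measurable_simple_function[OF f(1)])
  have fM[measurable]: "f i \<in> borel_measurable M" for i by (rule measurable_from_subalg[OF sub fG])
  have Vint: "integrable M V" by (rule square_integrable_imp_integrable_norm[OF V V2])
  have zero: "(LINT \<omega>|M. f i \<omega> \<bullet> V \<omega>) = 0" for i
  proof -
    define A where "A y = f i -` {y} \<inter> space M" for y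
    have A: "A y \<in> sets G" "A y \<in> sets M" for y
    proof -
      show "A y \<in> sets G" using simple_functionD(2)[OF f(1)[of i], of "{y}"] by (simp add: A_def sp)
      then show "A y \<in> sets M" using sets by auto
    qed
    have fin: "finite (f i ` space M)" using simple_functionD(1)[OF f(1)[of i]] by (simp add: sp)
    have "(LINT \<omega>|M. f i \<omega> \<bullet> V \<omega>) = (LINT \<omega>|M. (\<Sum>y\<in>f i ` space M. y \<bullet> (indicator (A y) \<omega> *\<^sub>R V \<omega>)))"
    proof (rule Bochner_Integration.integral_cong[OF refl])
      fix \<omega> assume w: "\<omega> \<in> space M"
      have "(\<Sum>y\<in>f i ` space M. y \<bullet> (indicator (A y) \<omega> *\<^sub>R V \<omega>)) = (\<Sum>y\<in>f i ` space M. if y = f i \<omega> then y \<bullet> V \<omega> else 0)"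
        using w by (intro sum.cong) (auto simp: A_def)
      also have "\<dots> = f i \<omega> \<bullet> V \<omega>" using w fin by simp
      finally show "f i \<omega> \<bullet> V \<omega> = (\<Sum>y\<in>f i ` space M. y \<bullet> (indicator (A y) \<omega> *\<^sub>R V \<omega>))" by simp
    qed
    also have "\<dots> = (\<Sum>y\<in>f i ` space M. (LINT \<omega>|M. y \<bullet> (indicator (A y) \<omega> *\<^sub>R V \<omega>)))"
      by (rule Bochner_Integration.integral_sum)
         (intro integrable_inner_right integrable_mult_indicator A Vint)
    also have "\<dots> = (\<Sum>y\<in>f i ` space M. y \<bullet> (LINT \<omega>:A y|M. V \<omega>))"
      unfolding set_lebesgue_integral_def
      by (intro sum.cong refl integral_inner_right integrable_mult_indicator A Vint)
    also have "\<dots> = 0" using V0[OF A(1)] by simp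
    finally show ?thesis .
  qed
  have "(\<lambda>i. LINT \<omega>|M. f i \<omega> \<bullet> V \<omega>) \<longlonglongrightarrow> (LINT \<omega>|M. Z \<omega> \<bullet> V \<omega>)"
  proof (rule integral_dominated_convergence[where w = "\<lambda>\<omega>. 4 * (norm (Z \<omega>))\<^sup>2 + (norm (V \<omega>))\<^sup>2"])
    show "integrable M (\<lambda>\<omega>. 4 * (norm (Z \<omega>))\<^sup>2 + (norm (V \<omega>))\<^sup>2)" using V2 Z2 by simp
    show "AE \<omega> in M. (\<lambda>i. f i \<omega> \<bullet> V \<omega>) \<longlonglongrightarrow> Z \<omega> \<bullet> V \<omega>"
      by (intro AE_I2 tendsto_intros f(2)) (simp add: sp)
    show "AE \<omega> in M. norm (f i \<omega> \<bullet> V \<omega>) \<le> 4 * (norm (Z \<omega>))\<^sup>2 + (norm (V \<omega>))\<^sup>2" for i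
    proof (rule AE_I2)
      fix \<omega> assume w: "\<omega> \<in> space M"
      have "\<bar>f i \<omega> \<bullet> V \<omega>\<bar> \<le> norm (f i \<omega>) * norm (V \<omega>)" by (rule Cauchy_Schwarz_ineq2)
      also have "\<dots> \<le> (2 * norm (Z \<omega>)) * norm (V \<omega>)"
        using f(3)[of \<omega> i] w by (intro mult_right_mono) (auto simp: sp)
      also have "\<dots> \<le> 4 * (norm (Z \<omega>))\<^sup>2 + (norm (V \<omega>))\<^sup>2"
      proof -
        have "2 * (2 * norm (Z \<omega>)) * norm (V \<omega>) \<le> (2 * norm (Z \<omega>))\<^sup>2 + (norm (V \<omega>))\<^sup>2" by (rule sum_squares_bound)
        moreover have "(2 * norm (Z \<omega>))\<^sup>2 = 4 * (norm (Z \<omega>))\<^sup>2" by (simp add: power_mult_distrib)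
        moreover have "0 \<le> norm (Z \<omega>) * norm (V \<omega>)" by simp
        ultimately show ?thesis by linarith
      qed
      finally show "norm (f i \<omega> \<bullet> V \<omega>) \<le> 4 * (norm (Z \<omega>))\<^sup>2 + (norm (V \<omega>))\<^sup>2" by simp
    qed
  qed measurable
  then show "(LINT \<omega>|M. Z \<omega> \<bullet> V \<omega>) = 0" by (simp add: zero LIMSEQ_const_iff)
qed

fun running_max :: "(nat \<Rightarrow> 'a \<Rightarrow> 'h::real_normed_vector) \<Rightarrow> nat \<Rightarrow> 'a \<Rightarrow> real" where
  "running_max Y 0 \<omega> = norm (Y 0 \<omega>)"
| "running_max Y (Suc k) \<omega> = max (running_max Y k \<omega>) (norm (Y (Suc k) \<omega>))"

lemma norm_le_running_max: "j \<le> k \<Longrightarrow> norm (Y j \<omega>) \<le> running_max Y k \<omega>"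
  by (induction k) (auto simp: le_Suc_eq)

lemma running_max_square_le: "(running_max Y k \<omega>)\<^sup>2 \<le> (\<Sum>j\<le>k. (norm (Y j \<omega>))\<^sup>2)"
proof (induction k)
  case (Suc k)
  then show ?case
    by (simp add: max_def) (smt (verit) sum_nonneg zero_le_power2)
qed simp

text \<open>One step first replaces Y_k by C_k Y_k, which does not raise the potential because the
  norm does not grow, and then adds d_k. The linear term pairs d_k with a variable known at stage k
  and has mean zero, so the expected potential grows by at most 18 E |d_k|^2.\<close>

theorem discrete_maximal_inequality:
  fixes Y d :: "nat \<Rightarrow> 'a \<Rightarrow> 'h::{real_inner, banach, second_countable_topology}" and C :: "nat \<Rightarrow> 'h \<Rightarrow>\<^sub>L 'h"
  assumes sub: "\<And>k. subalgebra M (G k)" and mono: "\<And>k. sets (G k) \<subseteq> sets (G (Suc k))"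
    and Y: "\<And>k. Y k \<in> borel_measurable (G k)" and Y2: "\<And>k. integrable M (\<lambda>\<omega>. (norm (Y k \<omega>))\<^sup>2)"
    and d: "\<And>k. d k \<in> borel_measurable M" and d2: "\<And>k. integrable M (\<lambda>\<omega>. (norm (d k \<omega>))\<^sup>2)"
    and d0: "\<And>k A. A \<in> sets (G k) \<Longrightarrow> (LINT \<omega>:A|M. d k \<omega>) = 0"
    and rec: "\<And>k \<omega>. \<omega> \<in> space M \<Longrightarrow> Y (Suc k) \<omega> = C k (Y k \<omega>) + d k \<omega>"
    and C: "\<And>k y. norm (C k y) \<le> norm y"
    and Y0: "\<And>\<omega>. \<omega> \<in> space M \<Longrightarrow> Y 0 \<omega> = 0"
  shows "(\<integral>\<^sup>+\<omega>. (SUP j\<in>{..N}. ennreal ((norm (Y j \<omega>))\<^sup>2)) \<partial>M) \<le> ennreal (18 * (\<Sum>k<N. expectation (\<lambda>\<omega>. (norm (d k \<omega>))\<^sup>2)))"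
proof -
  have sp: "space (G k) = space M" for k using sub by (auto simp: subalgebra_def)
  have YM[measurable]: "Y k \<in> borel_measurable M" for k by (rule measurable_from_subalg[OF sub Y])
  have [measurable]: "d k \<in> borel_measurable M" for k by (rule d)
  let ?m = "running_max Y"
  have G_mono: "j \<le> k \<Longrightarrow> sets (G j) \<subseteq> sets (G k)" for j k
    by (rule lift_Suc_mono_le[of "\<lambda>k. sets (G k)"]) (use mono in auto)
  have Yjk: "j \<le> k \<Longrightarrow> Y j \<in> borel_measurable (G k)" for j k
    using G_mono[of j k] sp by (intro measurable_from_subalg[OF _ Y[of j]]) (auto simp: subalgebra_def)
  have mG: "j \<le> k \<Longrightarrow> ?m j \<in> borel_measurable (G k)" for j k
  proof (induction j)
    case 0
    then show ?case using Yjk[of 0 k] by simp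
  next
    case (Suc j)
    then show ?case using Yjk[of "Suc j" k] by simp
  qed
  have mM[measurable]: "?m k \<in> borel_measurable M" for k
    by (rule measurable_from_subalg[OF sub mG[OF order_refl]])
  have m2: "integrable M (\<lambda>\<omega>. (?m k \<omega>)\<^sup>2)" for k
  proof (rule Bochner_Integration.integrable_bound)
    show "integrable M (\<lambda>\<omega>. \<Sum>j\<le>k. (norm (Y j \<omega>))\<^sup>2)" using Y2 by simp
    show "AE \<omega> in M. norm ((?m k \<omega>)\<^sup>2) \<le> norm (\<Sum>j\<le>k. (norm (Y j \<omega>))\<^sup>2)"
      using running_max_square_le[of Y k] by (simp add: sum_nonneg)
  qed measurable
  define U where "U k \<omega> = max_potential (Y k \<omega>) (?m k \<omega>)" for k \<omega>
  have U_meas[measurable]: "U k \<in> borel_measurable M" for k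
    unfolding U_def max_potential_def by measurable
  have U_nonneg: "0 \<le> U k \<omega>" for k \<omega> by (simp add: U_def max_potential_def)
  have U_le: "U k \<omega> \<le> 2 * (?m k \<omega>)\<^sup>2" for k \<omega>
    unfolding U_def by (rule max_potential_le[OF norm_le_running_max[OF order_refl]])
  have U_int: "integrable M (U k)" for k
  proof (rule Bochner_Integration.integrable_bound)
    show "integrable M (\<lambda>\<omega>. 2 * (?m k \<omega>)\<^sup>2)" using m2 by simp
    show "AE \<omega> in M. norm (U k \<omega>) \<le> norm (2 * (?m k \<omega>)\<^sup>2)"
      by (intro AE_I2) (simp add: U_nonneg U_le)
  qed measurable
  have step: "expectation (U (Suc k)) \<le> expectation (U k) + 18 * expectation (\<lambda>\<omega>. (norm (d k \<omega>))\<^sup>2)" for k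
  proof -
    \<comment> \<open>The gradient term at C_k Y_k. Its norm is at most 4 |Y_k| because |C_k Y_k|
      does not exceed the running maximum, so it is square integrable; where the maximum is 0, so is
      this term.\<close>
    define Z where "Z \<omega> = (4 * (norm (C k (Y k \<omega>)))\<^sup>2 / (?m k \<omega>)\<^sup>2) *\<^sub>R C k (Y k \<omega>)" for \<omega>
    have CY: "(\<lambda>\<omega>. C k (Y k \<omega>)) \<in> borel_measurable (G k)"
      using Y[of k] by (intro borel_measurable_continuous_on[OF linear_continuous_on[OF blinfun.bounded_linear_right]])
    have ZG: "Z \<in> borel_measurable (G k)"
      unfolding Z_def using CY mG[of k k] by simp
    have CYm: "norm (C k (Y k \<omega>)) \<le> ?m k \<omega>" for \<omega>
      using C norm_le_running_max[of k k Y \<omega>] order_trans by blast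
    have Znorm: "norm (Z \<omega>) \<le> 4 * norm (Y k \<omega>)" for \<omega>
    proof -
      have "(norm (C k (Y k \<omega>)))\<^sup>2 / (?m k \<omega>)\<^sup>2 \<le> 1"
        using power_mono[OF CYm[of \<omega>], of 2] by (cases "?m k \<omega> = 0") (auto simp: divide_le_eq_1)
      then have "4 * (norm (C k (Y k \<omega>)))\<^sup>2 / (?m k \<omega>)\<^sup>2 * norm (C k (Y k \<omega>)) \<le> 4 * norm (C k (Y k \<omega>))"
        by (intro mult_right_mono) auto
      also have "\<dots> \<le> 4 * norm (Y k \<omega>)" using C by simp
      finally show ?thesis by (simp add: Z_def)
    qed
    have [measurable]: "Z \<in> borel_measurable M" by (rule measurable_from_subalg[OF sub ZG])
    have Z2: "integrable M (\<lambda>\<omega>. (norm (Z \<omega>))\<^sup>2)"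
      by (rule square_integrable_le[of "Y k" _ _ 4]) (use Y2 Znorm in auto)
    note Zd = integral_inner_orthogonal[OF sub d d2 d0 ZG Z2]
    have "expectation (U (Suc k)) \<le> expectation (\<lambda>\<omega>. U k \<omega> + Z \<omega> \<bullet> d k \<omega> + 18 * (norm (d k \<omega>))\<^sup>2)"
    proof (rule integral_mono)
      show "integrable M (\<lambda>\<omega>. U k \<omega> + Z \<omega> \<bullet> d k \<omega> + 18 * (norm (d k \<omega>))\<^sup>2)"
        using U_int Zd(1) d2 by simp
      fix \<omega> assume w: "\<omega> \<in> space M"
      have "U (Suc k) \<omega> = max_potential (C k (Y k \<omega>) + d k \<omega>) (max (?m k \<omega>) (norm (C k (Y k \<omega>) + d k \<omega>)))"
        using rec[OF w, of k] by (simp add: U_def)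
      also have "\<dots> \<le> max_potential (C k (Y k \<omega>)) (?m k \<omega>) + 4 * (norm (C k (Y k \<omega>)))\<^sup>2 / (?m k \<omega>)\<^sup>2 * (C k (Y k \<omega>) \<bullet> d k \<omega>) + 18 * (norm (d k \<omega>))\<^sup>2"
        by (rule max_potential_step[OF CYm])
      also have "max_potential (C k (Y k \<omega>)) (?m k \<omega>) \<le> U k \<omega>"
        unfolding U_def by (rule max_potential_mono[OF C])
      finally show "U (Suc k) \<omega> \<le> U k \<omega> + Z \<omega> \<bullet> d k \<omega> + 18 * (norm (d k \<omega>))\<^sup>2"
        by (simp add: Z_def)
    qed (rule U_int)
    also have "\<dots> = expectation (U k) + 18 * expectation (\<lambda>\<omega>. (norm (d k \<omega>))\<^sup>2)"
      using U_int Zd d2 by simp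
    finally show ?thesis .
  qed
  have EU: "expectation (U k) \<le> 18 * (\<Sum>k<k. expectation (\<lambda>\<omega>. (norm (d k \<omega>))\<^sup>2))" for k
  proof (induction k)
    case 0
    have "expectation (U 0) = expectation (\<lambda>\<omega>. 0)"
      by (rule Bochner_Integration.integral_cong) (auto simp: U_def max_potential_def Y0)
    then show ?case by simp
  next
    case (Suc k)
    then show ?case using step[of k] by (simp add: algebra_simps)
  qed
  have "(\<integral>\<^sup>+\<omega>. (SUP j\<in>{..N}. ennreal ((norm (Y j \<omega>))\<^sup>2)) \<partial>M) \<le> (\<integral>\<^sup>+\<omega>. ennreal (U N \<omega>) \<partial>M)"
  proof (intro nn_integral_mono SUP_least ennreal_leI)
    fix \<omega> j assume "j \<in> {..N}"
    then have "(norm (Y j \<omega>))\<^sup>2 \<le> (?m N \<omega>)\<^sup>2" by (intro power_mono norm_le_running_max) auto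
    also have "\<dots> \<le> U N \<omega>" unfolding U_def by (rule max_potential_ge)
    finally show "(norm (Y j \<omega>))\<^sup>2 \<le> U N \<omega>" .
  qed
  also have "\<dots> = ennreal (expectation (U N))"
    by (rule nn_integral_eq_integral[OF U_int]) (simp add: U_nonneg)
  also have "\<dots> \<le> ennreal (18 * (\<Sum>k<N. expectation (\<lambda>\<omega>. (norm (d k \<omega>))\<^sup>2)))"
    by (rule ennreal_leI[OF EU])
  finally show ?thesis .
qed

end

subsection \<open>Increments of the Levy martingale\<close>

locale levy_setting = prob_space M for M :: "'a measure" +
  fixes F :: "real \<Rightarrow> 'a measure" and L :: "real \<Rightarrow> 'a \<Rightarrow> 'h::{real_inner, banach, second_countable_topology}"
    and Q :: "'h \<Rightarrow>\<^sub>L 'h"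
  assumes filtration: "normal_filtration M F" and levy: "square_integrable_levy_martingale M F L"
    and cov: "covariance_operator M L Q"
begin

abbreviation R :: "'h \<Rightarrow>\<^sub>L 'h" where "R \<equiv> op_sqrt Q"

lemma F_sub: "0 \<le> t \<Longrightarrow> subalgebra M (F t)"
  and F_mono: "0 \<le> s \<Longrightarrow> s \<le> t \<Longrightarrow> sets (F s) \<subseteq> sets (F t)"
  using filtration unfolding normal_filtration_def by blast+

lemma F_subalgebra_mono: "0 \<le> s \<Longrightarrow> s \<le> t \<Longrightarrow> subalgebra (F t) (F s)"
  using F_sub[of s] F_sub[of t] F_mono[of s t] by (auto simp: subalgebra_def)

lemma F_sets_M: "0 \<le> t \<Longrightarrow> A \<in> sets (F t) \<Longrightarrow> A \<in> sets M"
  using F_sub[of t] by (auto simp: subalgebra_def)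

lemma L_F: "0 \<le> s \<Longrightarrow> s \<le> t \<Longrightarrow> L s \<in> borel_measurable (F t)"
  using levy measurable_from_subalg[OF F_subalgebra_mono[of s t]]
  by (auto simp: square_integrable_levy_martingale_def levy_process_def adapted_def)

lemma L_M[measurable]: "0 \<le> s \<Longrightarrow> L s \<in> borel_measurable M"
  using measurable_from_subalg[OF F_sub L_F] by blast

lemma L_sq: "0 \<le> t \<Longrightarrow> integrable M (\<lambda>\<omega>. (norm (L t \<omega>))\<^sup>2)"
  and L_int: "0 \<le> t \<Longrightarrow> integrable M (L t)"
  using levy by (auto simp: square_integrable_levy_martingale_def martingale_def)

lemma incr_sq:
  assumes "0 \<le> s" "0 \<le> t" shows "integrable M (\<lambda>\<omega>. (norm (L t \<omega> - L s \<omega>))\<^sup>2)"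
  using square_integrable_add[of "L t" M "\<lambda>\<omega>. - L s \<omega>"] L_sq assms by simp

lemma incr_zero:
  assumes "0 \<le> s" "s \<le> t" "A \<in> sets (F s)"
  shows "(LINT \<omega>:A|M. L t \<omega> - L s \<omega>) = 0"
proof -
  have "set_integrable M A (L t)" "set_integrable M A (L s)"
    unfolding set_integrable_def using assms F_sets_M L_int by (auto intro!: integrable_mult_indicator)
  then have "(LINT \<omega>:A|M. L t \<omega> - L s \<omega>) = (LINT \<omega>:A|M. L t \<omega>) - (LINT \<omega>:A|M. L s \<omega>)"
    by (rule set_integral_diff)
  also have "(LINT \<omega>:A|M. L t \<omega>) = (LINT \<omega>:A|M. L s \<omega>)"
    using levy assms unfolding square_integrable_levy_martingale_def martingale_def by blast
  finally show ?thesis by simp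
qed

lemma L_inner_int:
  assumes "0 \<le> s" "0 \<le> t" shows "integrable M (\<lambda>\<omega>. (L t \<omega> \<bullet> x) * (L s \<omega> \<bullet> y))"
proof -
  have *: "integrable M (\<lambda>\<omega>. (norm (L t \<omega> \<bullet> x))\<^sup>2)" if "0 \<le> t" for t x
    by (rule square_integrable_le[of "L t" M _ "norm x"])
       (use that L_sq Cauchy_Schwarz_ineq2[of "L t _" x] in \<open>auto simp: mult.commute[of "norm x"]\<close>)
  show ?thesis
    using integrable_inner_of_square_integrable[OF _ _ *[OF assms(2), of x] *[OF assms(1), of y]] assms by simp
qed

lemma Q_eq: "Q x \<bullet> y = (LINT \<omega>|M. (L 1 \<omega> \<bullet> x) * (L 1 \<omega> \<bullet> y))"
  using cov by (simp add: covariance_operator_def)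

lemma Q_sym: "Q x \<bullet> y = x \<bullet> Q y"
  by (simp add: Q_eq inner_commute[of x "Q y"] mult.commute)

lemma Q_nonneg: "0 \<le> Q x \<bullet> x"
  by (simp add: Q_eq)

lemma R_R: "R (R x) = Q x" and R_sym: "R x \<bullet> y = x \<bullet> R y"
  using op_sqrt[of Q] Q_sym Q_nonneg by auto

lemma incr_cov:
  assumes "0 \<le> s" "s \<le> t"
  shows "(\<integral>\<^sup>+\<omega>. ennreal (((L t \<omega> - L s \<omega>) \<bullet> w)\<^sup>2) \<partial>M) = ennreal ((t - s) * (Q w \<bullet> w))"
proof -
  have t: "0 \<le> t" using assms by simp
  have e: "((L t \<omega> - L s \<omega>) \<bullet> w)\<^sup>2 = (L t \<omega> \<bullet> w) * (L t \<omega> \<bullet> w) - 2 * ((L t \<omega> \<bullet> w) * (L s \<omega> \<bullet> w)) + (L s \<omega> \<bullet> w) * (L s \<omega> \<bullet> w)" for \<omega>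
    by (simp add: inner_diff_left power2_eq_square algebra_simps)
  have c: "(LINT \<omega>|M. (L a \<omega> \<bullet> w) * (L b \<omega> \<bullet> w)) = min a b * (Q w \<bullet> w)" if "0 \<le> a" "0 \<le> b" for a b
    using cov that by (simp add: covariance_operator_def)
  have int: "integrable M (\<lambda>\<omega>. ((L t \<omega> - L s \<omega>) \<bullet> w)\<^sup>2)"
    unfolding e using L_inner_int assms t by simp
  have "(LINT \<omega>|M. ((L t \<omega> - L s \<omega>) \<bullet> w)\<^sup>2) = (t - s) * (Q w \<bullet> w)"
    unfolding e using L_inner_int[of s s w w] L_inner_int[of s t w w] L_inner_int[of t t w w] assms t
    by (simp add: c min_def algebra_simps)
  then show ?thesis by (simp add: nn_integral_eq_integral[OF int])
qed

text \<open>The value is expanded in an orthonormal basis. Its coordinates are increments of L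
  tested against the adjoint vectors \<open>w j\<close>, with second moment (t - s) |R w_j|^2, and
  the sum over j passes from the adjoint of g R to g R itself by
  \<open>hs_sum_eq_adjoint\<close>.\<close>

lemma incr_hs:
  fixes g :: "'h \<Rightarrow>\<^sub>L 'h"
  assumes st: "0 \<le> s" "s \<le> t"
  shows "(\<integral>\<^sup>+\<omega>. ennreal ((norm (g (L t \<omega> - L s \<omega>)))\<^sup>2) \<partial>M)
    = ennreal (t - s) * (\<Sum>n. ennreal ((norm (g (R (onb_seq n))))\<^sup>2))"
proof -
  have [measurable]: "L t \<in> borel_measurable M" "L s \<in> borel_measurable M" using st by auto
  have "\<exists>w. \<forall>x. g x \<bullet> onb_seq j = x \<bullet> w" for j :: nat
    by (rule ex_adjoint_vector[OF blinfun.bounded_linear_right])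
  then obtain w where w: "\<And>j x. g x \<bullet> onb_seq j = x \<bullet> w j" by metis
  have "(\<integral>\<^sup>+\<omega>. ennreal ((norm (g (L t \<omega> - L s \<omega>)))\<^sup>2) \<partial>M) = (\<integral>\<^sup>+\<omega>. (\<Sum>j. ennreal (((L t \<omega> - L s \<omega>) \<bullet> w j)\<^sup>2)) \<partial>M)"
    unfolding w[symmetric] by (subst parseval_ennreal[OF onb_seq(1)]) (simp_all add: onb_seq(2))
  also have "\<dots> = (\<Sum>j. \<integral>\<^sup>+\<omega>. ennreal (((L t \<omega> - L s \<omega>) \<bullet> w j)\<^sup>2) \<partial>M)"
    by (rule nn_integral_suminf) measurable
  also have "\<dots> = (\<Sum>j. ennreal (t - s) * ennreal ((norm (R (w j)))\<^sup>2))"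
  proof -
    have "(norm (R v))\<^sup>2 = Q v \<bullet> v" for v
      unfolding power2_norm_eq_inner by (metis R_R R_sym inner_commute)
    then show ?thesis using st by (simp add: incr_cov ennreal_mult[symmetric] Q_nonneg)
  qed
  also have "\<dots> = ennreal (t - s) * (\<Sum>j. ennreal ((norm (R (w j)))\<^sup>2))" by simp
  also have "(\<Sum>j. ennreal ((norm (R (w j)))\<^sup>2)) = (\<Sum>n. ennreal ((norm (g (R (onb_seq n))))\<^sup>2))"
  proof (rule hs_sum_eq_adjoint[symmetric, where B = "\<lambda>x. g (R x)" and b = onb_seq and c = onb_seq])
    show "g (R x) \<bullet> onb_seq j = x \<bullet> R (w j)" for j x by (simp add: w R_sym)
  qed (simp_all add: onb_seq)
  finally show ?thesis .
qed

text \<open>Read off from the isometry on [0,1]: the sum is the second moment of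
  \<open>g (L 1 \<omega> - L 0 \<omega>)\<close>. For the identity this says that Q is of trace
  class.\<close>

lemma hs_finite:
  fixes g :: "'h \<Rightarrow>\<^sub>L 'h"
  shows "(\<Sum>n. ennreal ((norm (g (R (onb_seq n))))\<^sup>2)) < \<infinity>"
proof -
  have "integrable M (\<lambda>\<omega>. (norm (g (L 1 \<omega> - L 0 \<omega>)))\<^sup>2)"
    by (rule square_integrable_le[of "\<lambda>\<omega>. L 1 \<omega> - L 0 \<omega>" M _ "norm g"])
       (use incr_sq[of 0 1] norm_blinfun in \<open>auto intro!: borel_measurable_continuous_on[OF linear_continuous_on[OF blinfun.bounded_linear_right]]\<close>)
  then have "(\<integral>\<^sup>+\<omega>. ennreal ((norm (g (L 1 \<omega> - L 0 \<omega>)))\<^sup>2) \<partial>M) < \<infinity>"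
    by (simp add: nn_integral_eq_integral)
  then show ?thesis by (simp add: incr_hs)
qed

text \<open>By independence, restricting the measure to A multiplies the law of the increment by the
  probability of A; the identity of laws then extends from sets to integrands.\<close>

lemma nn_integral_indep_increment:
  assumes st: "0 \<le> s" "s \<le> t" and A: "A \<in> sets (F s)" and f[measurable]: "f \<in> borel_measurable borel"
  shows "(\<integral>\<^sup>+\<omega>. indicator A \<omega> * f (L t \<omega> - L s \<omega>) \<partial>M) = emeasure M A * (\<integral>\<^sup>+\<omega>. f (L t \<omega> - L s \<omega>) \<partial>M)"
proof -
  have [measurable]: "L t \<in> borel_measurable M" "L s \<in> borel_measurable M" using st by auto
  have AM[measurable]: "A \<in> sets M" using F_sets_M st A by blast
  define V where "V = (\<lambda>\<omega>. L t \<omega> - L s \<omega>)"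
  have [measurable]: "V \<in> borel_measurable M" unfolding V_def by measurable
  have "distr (density M (indicator A)) borel V = scale_measure (emeasure M A) (distr M borel V)"
  proof (rule measure_eqI)
    fix B assume "B \<in> sets (distr (density M (indicator A)) borel V)"
    then have B[measurable]: "B \<in> sets borel" by simp
    have ind: "indep_set (sets (F s)) {V -` B \<inter> space M | B. B \<in> sets borel}"
      using levy st unfolding square_integrable_levy_martingale_def levy_process_def V_def by blast
    have "emeasure (density M (indicator A)) (V -` B \<inter> space M) = emeasure M (A \<inter> (V -` B \<inter> space M))"
      by (rule emeasure_restricted) measurable
    also have "\<dots> = ennreal (prob A * prob (V -` B \<inter> space M))"
    proof -
      have "V -` B \<inter> space M \<in> {V -` B \<inter> space M | B. B \<in> sets borel}" using B by blast
      from indep_setD[OF ind A this] show ?thesis by (simp only: emeasure_eq_measure)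
    qed
    also have "\<dots> = emeasure M A * emeasure M (V -` B \<inter> space M)"
      by (simp add: emeasure_eq_measure ennreal_mult)
    finally show "emeasure (distr (density M (indicator A)) borel V) B = emeasure (scale_measure (emeasure M A) (distr M borel V)) B"
      by (simp add: emeasure_distr)
  qed simp
  then have "(\<integral>\<^sup>+x. f x \<partial>distr (density M (indicator A)) borel V) = (\<integral>\<^sup>+x. f x \<partial>scale_measure (emeasure M A) (distr M borel V))"
    by simp
  then show ?thesis
    by (simp add: nn_integral_distr nn_integral_density nn_integral_scale_measure V_def)
qed

text \<open>On each level set of G the operator is deterministic, and the level set is independent
  of the increment. Finitely many values are enough for simple processes and avoid measurability in
  the space of bounded operators, which is not separable in general.\<close>

lemma simple_isometry:
  fixes G :: "'a \<Rightarrow> 'h \<Rightarrow>\<^sub>L 'h"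
  assumes st: "0 \<le> s" "s \<le> t" and G: "simple_function (F s) G"
  shows "(\<integral>\<^sup>+\<omega>. ennreal ((norm (G \<omega> (L t \<omega> - L s \<omega>)))\<^sup>2) \<partial>M)
    = ennreal (t - s) * (\<integral>\<^sup>+\<omega>. (\<Sum>n. ennreal ((norm (G \<omega> (R (onb_seq n))))\<^sup>2)) \<partial>M)"
proof -
  have [measurable]: "L t \<in> borel_measurable M" "L s \<in> borel_measurable M" using st by auto
  have sp: "space (F s) = space M" using F_sub[OF st(1)] by (simp add: subalgebra_def)
  define I where "I = G ` space M"
  define A where "A g = G -` {g} \<inter> space M" for g
  have I: "finite I" using simple_functionD(1)[OF G] by (simp add: I_def sp)
  have A: "A g \<in> sets (F s)" for g using simple_functionD(2)[OF G, of "{g}"] by (simp add: A_def sp)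
  have AM[measurable]: "A g \<in> sets M" for g using F_sets_M[OF st(1) A] .
  have split: "f (G \<omega>) = (\<Sum>g\<in>I. indicator (A g) \<omega> * f g)" if "\<omega> \<in> space M" for f :: "_ \<Rightarrow> ennreal" and \<omega>
  proof -
    have "(\<Sum>g\<in>I. indicator (A g) \<omega> * f g) = (\<Sum>g\<in>I. if g = G \<omega> then f g else 0)"
      using that by (intro sum.cong) (auto simp: A_def indicator_def)
    then show ?thesis using that I by (simp add: I_def)
  qed
  have gm[measurable]: "(\<lambda>x. ennreal ((norm (blinfun_apply g x))\<^sup>2)) \<in> borel_measurable borel" for g :: "'h \<Rightarrow>\<^sub>L 'h"
    by (intro measurable_compose[OF _ measurable_ennreal] borel_measurable_continuous_onI continuous_intros)
  have "(\<integral>\<^sup>+\<omega>. ennreal ((norm (G \<omega> (L t \<omega> - L s \<omega>)))\<^sup>2) \<partial>M)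
      = (\<integral>\<^sup>+\<omega>. (\<Sum>g\<in>I. indicator (A g) \<omega> * ennreal ((norm (g (L t \<omega> - L s \<omega>)))\<^sup>2)) \<partial>M)"
  proof (rule nn_integral_cong)
    fix \<omega> assume "\<omega> \<in> space M"
    from split[OF this, of "\<lambda>g. ennreal ((norm (g (L t \<omega> - L s \<omega>)))\<^sup>2)"]
    show "ennreal ((norm (G \<omega> (L t \<omega> - L s \<omega>)))\<^sup>2) = (\<Sum>g\<in>I. indicator (A g) \<omega> * ennreal ((norm (g (L t \<omega> - L s \<omega>)))\<^sup>2))" .
  qed
  also have "\<dots> = (\<Sum>g\<in>I. \<integral>\<^sup>+\<omega>. indicator (A g) \<omega> * ennreal ((norm (g (L t \<omega> - L s \<omega>)))\<^sup>2) \<partial>M)"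
  proof (rule nn_integral_sum)
    fix g :: "'h \<Rightarrow>\<^sub>L 'h"
    have "(\<lambda>\<omega>. ennreal ((norm (g (L t \<omega> - L s \<omega>)))\<^sup>2)) \<in> borel_measurable M"
      by (rule measurable_compose[OF _ gm]) measurable
    then show "(\<lambda>\<omega>. indicator (A g) \<omega> * ennreal ((norm (g (L t \<omega> - L s \<omega>)))\<^sup>2)) \<in> borel_measurable M"
      by measurable
  qed
  also have "\<dots> = (\<Sum>g\<in>I. emeasure M (A g) * (ennreal (t - s) * (\<Sum>n. ennreal ((norm (g (R (onb_seq n))))\<^sup>2))))"
    by (intro sum.cong refl) (simp only: nn_integral_indep_increment[OF st A gm] incr_hs[OF st])
  also have "\<dots> = ennreal (t - s) * (\<Sum>g\<in>I. emeasure M (A g) * (\<Sum>n. ennreal ((norm (g (R (onb_seq n))))\<^sup>2)))"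
    by (simp add: sum_distrib_left mult.left_commute)
  also have "(\<Sum>g\<in>I. emeasure M (A g) * (\<Sum>n. ennreal ((norm (g (R (onb_seq n))))\<^sup>2)))
      = (\<Sum>g\<in>I. \<integral>\<^sup>+\<omega>. indicator (A g) \<omega> * (\<Sum>n. ennreal ((norm (g (R (onb_seq n))))\<^sup>2)) \<partial>M)"
    by (intro sum.cong refl) (subst nn_integral_multc, auto)
  also have "\<dots> = (\<integral>\<^sup>+\<omega>. (\<Sum>g\<in>I. indicator (A g) \<omega> * (\<Sum>n. ennreal ((norm (g (R (onb_seq n))))\<^sup>2))) \<partial>M)"
    by (rule nn_integral_sum[symmetric]) measurable
  also have "\<dots> = (\<integral>\<^sup>+\<omega>. (\<Sum>n. ennreal ((norm (G \<omega> (R (onb_seq n))))\<^sup>2)) \<partial>M)"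
    by (intro nn_integral_cong split[symmetric])
  finally show ?thesis .
qed

end

subsection \<open>Convolutions of simple processes\<close>

definition contraction_semigroup :: "(real \<Rightarrow> 'h::real_normed_vector \<Rightarrow>\<^sub>L 'h) \<Rightarrow> bool" where
  "contraction_semigroup S \<longleftrightarrow> C0_semigroup S \<and> (\<forall>t\<ge>0. norm (S t) \<le> 1)"

lemma contraction_semigroup_add: "contraction_semigroup S \<Longrightarrow> 0 \<le> s \<Longrightarrow> 0 \<le> t \<Longrightarrow> S (s + t) x = S s (S t x)"
  by (auto simp: contraction_semigroup_def C0_semigroup_def)

lemma contraction_semigroup_norm_le:
  assumes "contraction_semigroup S" "0 \<le> t" shows "norm (S t x) \<le> norm x"
  using norm_blinfun[of "S t" x] assms
  by (metis contraction_semigroup_def mult_left_le_one_le norm_ge_zero order_trans)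

lemma contraction_semigroup_continuous:
  fixes S :: "real \<Rightarrow> 'h::banach \<Rightarrow>\<^sub>L 'h"
  shows "contraction_semigroup S \<Longrightarrow> continuous_on {0..} (\<lambda>t. S t x)"
  by (rule C0_semigroup_continuous) (simp add: contraction_semigroup_def)

text \<open>Under the identity semigroup convolutions are stochastic integrals, so the estimates for
  convolutions cover these as well.\<close>

lemma contraction_semigroup_id: "contraction_semigroup (\<lambda>_. id_blinfun :: 'h::real_normed_vector \<Rightarrow>\<^sub>L 'h)"
proof -
  have "norm (id_blinfun :: 'h \<Rightarrow>\<^sub>L 'h) \<le> 1" by (rule norm_blinfun_bound) auto
  then show ?thesis by (auto simp: contraction_semigroup_def C0_semigroup_def intro!: blinfun_eqI)
qed

text \<open>The convolution of the process \<open>conv_process S ps\<close>: on \<open>(a, b]\<close> its integrand is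
  \<open>S(t - s) S(s - a) \<Phi> = S(t - a) \<Phi>\<close>, so that no limit is needed.\<close>

definition conv_simple ::
  "(real \<Rightarrow> 'h \<Rightarrow>\<^sub>L 'h) \<Rightarrow> (real \<Rightarrow> 'a \<Rightarrow> 'h::real_normed_vector) \<Rightarrow> ('a, 'h) simple_integrand \<Rightarrow> real \<Rightarrow> 'a \<Rightarrow> 'h" where
  "conv_simple S L ps t \<omega> =
     (\<Sum>(a, b, B, \<Phi>)\<leftarrow>ps. (indicator B \<omega> :: real) *\<^sub>R blinfun_apply (S (t - min a t)) (blinfun_apply \<Phi> (L (min b t) \<omega> - L (min a t) \<omega>)))"

definition conv_process ::
  "(real \<Rightarrow> 'h::real_normed_vector \<Rightarrow>\<^sub>L 'h) \<Rightarrow> ('a, 'h) simple_integrand \<Rightarrow> real \<Rightarrow> 'a \<Rightarrow> 'h \<Rightarrow> 'h" where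
  "conv_process S ps s \<omega> x =
     (\<Sum>(a, b, B, \<Phi>)\<leftarrow>ps. (indicator {a<..b} s * indicator B \<omega> :: real) *\<^sub>R blinfun_apply (S (s - a)) (blinfun_apply \<Phi> x))"

text \<open>Differences of simple data are again lists, \<open>ps @ neg_simple qs\<close>, so a
  bound for one list yields a bound for differences.\<close>

definition neg_simple :: "('a, 'h::real_normed_vector) simple_integrand \<Rightarrow> ('a, 'h) simple_integrand" where
  "neg_simple ps = map (\<lambda>(a, b, B, \<Phi>). (a, b, B, - \<Phi>)) ps"

lemma conv_simple_Nil: "conv_simple S L [] t \<omega> = 0"
  and conv_simple_Cons: "conv_simple S L ((a, b, B, \<Phi>) # ps) t \<omega> =
    (indicator B \<omega> :: real) *\<^sub>R S (t - min a t) (\<Phi> (L (min b t) \<omega> - L (min a t) \<omega>)) + conv_simple S L ps t \<omega>"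
  and conv_process_Nil: "conv_process S [] s \<omega> x = 0"
  and conv_process_Cons: "conv_process S ((a, b, B, \<Phi>) # ps) s \<omega> x =
    (indicator {a<..b} s * indicator B \<omega> :: real) *\<^sub>R S (s - a) (\<Phi> x) + conv_process S ps s \<omega> x"
  by (simp_all add: conv_simple_def conv_process_def)

lemma conv_simple_append: "conv_simple S L (ps @ qs) t \<omega> = conv_simple S L ps t \<omega> + conv_simple S L qs t \<omega>"
  and conv_process_append: "conv_process S (ps @ qs) s \<omega> x = conv_process S ps s \<omega> x + conv_process S qs s \<omega> x"
  by (simp_all add: conv_simple_def conv_process_def)

lemma conv_simple_neg: "conv_simple S L (neg_simple ps) t \<omega> = - conv_simple S L ps t \<omega>"
  by (induction ps) (auto simp: neg_simple_def conv_simple_def blinfun.minus_left blinfun.minus_right)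

lemma conv_process_neg: "conv_process S (neg_simple ps) s \<omega> x = - conv_process S ps s \<omega> x"
  by (induction ps) (auto simp: neg_simple_def conv_process_def blinfun.minus_left blinfun.minus_right)

lemma simple_integrands_Cons:
  "(a, b, B, \<Phi>) # ps \<in> simple_integrands F t \<longleftrightarrow> (0 \<le> a \<and> a < b \<and> b \<le> t \<and> B \<in> sets (F a)) \<and> ps \<in> simple_integrands F t"
  by (auto simp: simple_integrands_def)

lemma simple_integrands_append:
  "ps @ qs \<in> simple_integrands F t \<longleftrightarrow> ps \<in> simple_integrands F t \<and> qs \<in> simple_integrands F t"
  by (simp add: simple_integrands_def ball_Un)

lemma simple_integrands_neg: "ps \<in> simple_integrands F t \<Longrightarrow> neg_simple ps \<in> simple_integrands F t"
  by (fastforce simp: simple_integrands_def neg_simple_def)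

lemma conv_simple_id:
  assumes "ps \<in> simple_integrands F t"
  shows "conv_simple (\<lambda>_. id_blinfun) L ps t \<omega> = simple_integral L ps \<omega>"
  using assms
  by (induction ps) (auto simp: conv_simple_def simple_integral_def simple_integrands_Cons split: prod.splits)

lemma conv_process_id: "conv_process (\<lambda>_. id_blinfun) ps = simple_process ps"
  by (simp add: fun_eq_iff conv_process_def simple_process_def)

text \<open>Beyond N the sequence repeats the largest point of P; it is thus defined for all
  indices, and no point of P lies strictly between consecutive values.\<close>

lemma ex_grid:
  fixes P :: "real set"
  assumes P: "finite P" "P \<subseteq> {0..}" "0 \<in> P"
  obtains u :: "nat \<Rightarrow> real" and N where "mono u" "u ` {..N} = P" "u 0 = 0" "\<And>k. u k \<in> P"
    "\<And>k p. p \<in> P \<Longrightarrow> p \<le> u k \<or> u (Suc k) \<le> p" "\<And>i j. i < j \<Longrightarrow> j \<le> N \<Longrightarrow> u i < u j"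
proof -
  define xs where "xs = sorted_list_of_set P"
  have xs: "sorted xs" "set xs = P" using P by (auto simp: xs_def)
  then have "xs \<noteq> []" using P by auto
  define N where "N = length xs - 1"
  have N: "i \<le> N \<longleftrightarrow> i < length xs" for i using \<open>xs \<noteq> []\<close> by (cases xs) (auto simp: N_def)
  define u where "u k = xs ! (min k N)" for k
  have mono: "mono u" unfolding u_def by (intro monoI sorted_nth_mono[OF xs(1)]) (auto simp: N[symmetric])
  have inP: "u k \<in> P" for k unfolding u_def xs(2)[symmetric] by (rule nth_mem) (simp add: N[symmetric])
  have img: "u ` {..N} = P"
  proof
    show "P \<subseteq> u ` {..N}"
    proof
      fix p assume "p \<in> P"
      then obtain i where "i < length xs" "xs ! i = p" using xs(2) by (auto simp: in_set_conv_nth)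
      then show "p \<in> u ` {..N}" by (intro image_eqI[of _ _ i]) (auto simp: u_def N min_def)
    qed
  qed (use inP in auto)
  show ?thesis
  proof (rule that[OF mono img _ inP])
    obtain i where "i \<le> N" "u i = 0" using img P(3) by fastforce
    then have "u 0 \<le> 0" using monoD[OF mono, of 0 i] by simp
    then show "u 0 = 0" using inP[of 0] P(2) by force
    fix k p assume "p \<in> P"
    then obtain i where i: "i \<le> N" "u i = p" using img by auto
    show "p \<le> u k \<or> u (Suc k) \<le> p"
      using i monoD[OF mono, of i k] monoD[OF mono, of "Suc k" i] by (cases "i \<le> k") auto
  next
    fix i j assume ij: "i < j" "j \<le> N"
    have "sorted_wrt (<) xs" unfolding xs_def by (rule strict_sorted_list_of_set)
    then show "u i < u j" using ij by (simp add: u_def sorted_wrt_nth_less N[symmetric])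
  qed
qed

context levy_setting
begin

text \<open>The quantity \<open>integrand_norm_sq\<close> without its case distinction on
  boundedness, expanded in \<open>onb_seq\<close>; the two agree if \<Psi> composed with
  \<open>R\<close> is bounded almost everywhere.\<close>

definition process_norm_sq :: "real \<Rightarrow> (real \<Rightarrow> 'a \<Rightarrow> 'h \<Rightarrow> 'h) \<Rightarrow> ennreal" where
  "process_norm_sq T \<Psi> =
     (\<integral>\<^sup>+\<omega>. (\<integral>\<^sup>+s\<in>{0..T}. (\<Sum>n. ennreal ((norm (\<Psi> s \<omega> (R (onb_seq n))))\<^sup>2)) \<partial>lborel) \<partial>M)"

section \<open>Martingale differences and moments of simple convolutions\<close>

definition martingale_difference :: "real \<Rightarrow> ('a \<Rightarrow> 'h) \<Rightarrow> bool" where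
  "martingale_difference s V \<longleftrightarrow> V \<in> borel_measurable M \<and> integrable M (\<lambda>\<omega>. (norm (V \<omega>))\<^sup>2) \<and>
     (\<forall>A\<in>sets (F s). (LINT \<omega>:A|M. V \<omega>) = 0)"

lemma blinfun_measurable[measurable (raw)]:
  fixes g :: "'b::real_normed_vector \<Rightarrow>\<^sub>L 'c::real_normed_vector"
  shows "f \<in> borel_measurable N \<Longrightarrow> (\<lambda>\<omega>. g (f \<omega>)) \<in> borel_measurable N"
  by (rule borel_measurable_continuous_on[OF linear_continuous_on[OF blinfun.bounded_linear_right]])

lemma martingale_difference_zero: "martingale_difference s (\<lambda>_. 0)"
  by (simp add: martingale_difference_def set_lebesgue_integral_def)

lemma martingale_difference_add:
  assumes s: "0 \<le> s" and V: "martingale_difference s V" and W: "martingale_difference s W"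
  shows "martingale_difference s (\<lambda>\<omega>. V \<omega> + W \<omega>)"
proof -
  have [measurable]: "V \<in> borel_measurable M" "W \<in> borel_measurable M"
    and sq: "integrable M (\<lambda>\<omega>. (norm (V \<omega>))\<^sup>2)" "integrable M (\<lambda>\<omega>. (norm (W \<omega>))\<^sup>2)"
    using V W by (auto simp: martingale_difference_def)
  have int: "integrable M V" "integrable M W"
    by (rule square_integrable_imp_integrable_norm; use sq in simp)+
  have "(LINT \<omega>:A|M. V \<omega> + W \<omega>) = 0" if A: "A \<in> sets (F s)" for A
  proof -
    have "A \<in> sets M" using F_sets_M[OF s A] .
    then have "set_integrable M A V" "set_integrable M A W"
      unfolding set_integrable_def using int by (auto intro!: integrable_mult_indicator)
    then have "(LINT \<omega>:A|M. V \<omega> + W \<omega>) = (LINT \<omega>:A|M. V \<omega>) + (LINT \<omega>:A|M. W \<omega>)"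
      by (rule set_integral_add)
    then show ?thesis using V W A by (simp add: martingale_difference_def)
  qed
  then show ?thesis
    using square_integrable_add[of V M W] sq by (simp add: martingale_difference_def)
qed

lemma martingale_difference_increment:
  fixes \<Phi> :: "'h \<Rightarrow>\<^sub>L 'h"
  assumes st: "0 \<le> s" "s \<le> t" and B: "B \<in> sets (F s)"
  shows "martingale_difference s (\<lambda>\<omega>. (indicator B \<omega> :: real) *\<^sub>R \<Phi> (L t \<omega> - L s \<omega>))"
proof -
  have [measurable]: "L t \<in> borel_measurable M" "L s \<in> borel_measurable M" using st by auto
  have BM[measurable]: "B \<in> sets M" using F_sets_M[OF st(1) B] .
  have sq: "integrable M (\<lambda>\<omega>. (norm ((indicator B \<omega> :: real) *\<^sub>R \<Phi> (L t \<omega> - L s \<omega>)))\<^sup>2)"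
  proof (rule square_integrable_le[of "\<lambda>\<omega>. L t \<omega> - L s \<omega>" M _ "norm \<Phi>"])
    show "norm ((indicator B \<omega> :: real) *\<^sub>R \<Phi> (L t \<omega> - L s \<omega>)) \<le> norm \<Phi> * norm (L t \<omega> - L s \<omega>)" for \<omega>
      using norm_blinfun[of \<Phi> "L t \<omega> - L s \<omega>"] by (simp split: split_indicator)
  qed (use incr_sq st in auto)
  have int: "integrable M (\<lambda>\<omega>. L t \<omega> - L s \<omega>)"
    using L_int st by (intro Bochner_Integration.integrable_diff) auto
  have "(LINT \<omega>:A|M. (indicator B \<omega> :: real) *\<^sub>R \<Phi> (L t \<omega> - L s \<omega>)) = 0" if A: "A \<in> sets (F s)" for A
  proof -
    have AB: "A \<inter> B \<in> sets (F s)" using A B by auto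
    then have [measurable]: "A \<inter> B \<in> sets M" using F_sets_M[OF st(1)] by blast
    have "(LINT \<omega>:A|M. (indicator B \<omega> :: real) *\<^sub>R \<Phi> (L t \<omega> - L s \<omega>)) = (LINT \<omega>|M. \<Phi> (indicator (A \<inter> B) \<omega> *\<^sub>R (L t \<omega> - L s \<omega>)))"
      unfolding set_lebesgue_integral_def
      by (intro Bochner_Integration.integral_cong refl) (simp add: blinfun.scaleR_right split: split_indicator)
    also have "\<dots> = \<Phi> (LINT \<omega>:A \<inter> B|M. L t \<omega> - L s \<omega>)"
      unfolding set_lebesgue_integral_def
      by (rule integral_bounded_linear[OF blinfun.bounded_linear_right]) (intro integrable_mult_indicator int, measurable)
    also have "\<dots> = 0" using incr_zero[OF st AB] by simp
    finally show ?thesis .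
  qed
  then show ?thesis using sq unfolding martingale_difference_def by simp
qed

lemma conv_simple_measurable:
  assumes t: "0 \<le> t" and ps: "ps \<in> simple_integrands F T"
  shows "conv_simple S L ps t \<in> borel_measurable (F t)"
  using ps
proof (induction ps)
  case Nil
  then show ?case by (simp add: conv_simple_Nil[abs_def])
next
  case (Cons p ps)
  obtain a b B \<Phi> where p: "p = (a, b, B, \<Phi>)" by (cases p)
  have a: "0 \<le> a" "a < b" "B \<in> sets (F a)" and IH[measurable]: "conv_simple S L ps t \<in> borel_measurable (F t)"
    using Cons by (auto simp: p simple_integrands_Cons)
  have "(\<lambda>\<omega>. (indicator B \<omega> :: real) *\<^sub>R S (t - min a t) (\<Phi> (L (min b t) \<omega> - L (min a t) \<omega>))) \<in> borel_measurable (F t)"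
  proof (cases "a \<le> t")
    case True
    then have [measurable]: "B \<in> sets (F t)" "L (min b t) \<in> borel_measurable (F t)" "L (min a t) \<in> borel_measurable (F t)"
      using a t F_mono[of a t] by (auto intro!: L_F)
    show ?thesis by measurable
  next
    \<comment> \<open>Before time a the set B need not be known, but then the increment is L(t) -
      L(t) = 0.\<close>
    case False
    then have "min a t = t" "min b t = t" using a by auto
    then show ?thesis by (simp add: blinfun.zero_right)
  qed
  then show ?case unfolding p conv_simple_Cons[abs_def] by measurable
qed

lemma conv_simple_measurable_M[measurable]:
  assumes "0 \<le> t" "ps \<in> simple_integrands F T"
  shows "conv_simple S L ps t \<in> borel_measurable M"
  by (rule measurable_from_subalg[OF F_sub conv_simple_measurable]) (use assms in auto)

lemma conv_simple_square_integrable: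
  assumes t: "0 \<le> t" and ps: "ps \<in> simple_integrands F T" and S: "contraction_semigroup S"
  shows "integrable M (\<lambda>\<omega>. (norm (conv_simple S L ps t \<omega>))\<^sup>2)"
  using ps
proof (induction ps)
  case Nil
  then show ?case by (simp add: conv_simple_Nil)
next
  case (Cons p ps)
  obtain a b B \<Phi> where p: "p = (a, b, B, \<Phi>)" by (cases p)
  have a: "0 \<le> a" "a < b" "B \<in> sets (F a)" and ps: "ps \<in> simple_integrands F T"
    using Cons by (auto simp: p simple_integrands_Cons)
  have [measurable]: "B \<in> sets M" "L (min b t) \<in> borel_measurable M" "L (min a t) \<in> borel_measurable M"
    using a t F_sets_M by auto
  show ?case
    unfolding p conv_simple_Cons
  proof (rule square_integrable_add)
    show "integrable M (\<lambda>\<omega>. (norm ((indicator B \<omega> :: real) *\<^sub>R S (t - min a t) (\<Phi> (L (min b t) \<omega> - L (min a t) \<omega>))))\<^sup>2)"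
    proof (rule square_integrable_le[of "\<lambda>\<omega>. L (min b t) \<omega> - L (min a t) \<omega>" M _ "norm \<Phi>"])
      fix \<omega>
      have "norm (S (t - min a t) (\<Phi> (L (min b t) \<omega> - L (min a t) \<omega>))) \<le> norm (\<Phi> (L (min b t) \<omega> - L (min a t) \<omega>))"
        by (rule contraction_semigroup_norm_le[OF S]) simp
      also have "\<dots> \<le> norm \<Phi> * norm (L (min b t) \<omega> - L (min a t) \<omega>)" by (rule norm_blinfun)
      finally show "norm ((indicator B \<omega> :: real) *\<^sub>R S (t - min a t) (\<Phi> (L (min b t) \<omega> - L (min a t) \<omega>)))
          \<le> norm \<Phi> * norm (L (min b t) \<omega> - L (min a t) \<omega>)"
        by (simp split: split_indicator)
    qed (use incr_sq a t in auto)
    show "conv_simple S L ps t \<in> borel_measurable M" by (rule conv_simple_measurable_M[OF t ps])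
  qed (use Cons.IH ps in measurable)
qed

lemma conv_process_measurable:
  fixes S :: "real \<Rightarrow> 'h \<Rightarrow>\<^sub>L 'h"
  assumes S: "contraction_semigroup S" and ps: "ps \<in> simple_integrands F T"
  shows "(\<lambda>(s, \<omega>). conv_process S ps s \<omega> x) \<in> borel_measurable (lborel \<Otimes>\<^sub>M M)"
  using ps
proof (induction ps)
  case Nil
  then show ?case by (simp add: conv_process_Nil)
next
  case (Cons p ps)
  obtain a b B \<Phi> where p: "p = (a, b, B, \<Phi>)" by (cases p)
  have a: "0 \<le> a" "B \<in> sets (F a)" and IH[measurable]: "(\<lambda>(s, \<omega>). conv_process S ps s \<omega> x) \<in> borel_measurable (lborel \<Otimes>\<^sub>M M)"
    using Cons by (auto simp: p simple_integrands_Cons)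
  have [measurable]: "B \<in> sets M" using a F_sets_M by auto
  \<comment> \<open>Continuity of S is available at nonnegative times only, so the argument is cut
    off at 0; the indicator of {a<..b} makes the change invisible.\<close>
  have "continuous_on UNIV (\<lambda>s. S (max 0 (s - a)) (\<Phi> x))"
    by (rule continuous_on_compose2[OF contraction_semigroup_continuous[OF S]]) (auto intro!: continuous_intros)
  then have [measurable]: "(\<lambda>s. S (max 0 (s - a)) (\<Phi> x)) \<in> borel_measurable lborel"
    by (simp add: borel_measurable_continuous_onI)
  have "(\<lambda>(s, \<omega>). (indicator {a<..b} s * indicator B \<omega> :: real) *\<^sub>R S (max 0 (s - a)) (\<Phi> x)) \<in> borel_measurable (lborel \<Otimes>\<^sub>M M)"
    by measurable
  moreover have "(\<lambda>(s, \<omega>). (indicator {a<..b} s * indicator B \<omega> :: real) *\<^sub>R S (max 0 (s - a)) (\<Phi> x))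
      = (\<lambda>(s, \<omega>). (indicator {a<..b} s * indicator B \<omega> :: real) *\<^sub>R S (s - a) (\<Phi> x))"
    by (auto simp: fun_eq_iff max_def split: split_indicator)
  ultimately have "(\<lambda>(s, \<omega>). (indicator {a<..b} s * indicator B \<omega> :: real) *\<^sub>R S (s - a) (\<Phi> x)) \<in> borel_measurable (lborel \<Otimes>\<^sub>M M)"
    by simp
  from borel_measurable_add[OF this IH] show ?case
    unfolding p conv_process_Cons by (simp add: case_prod_unfold)
qed

text \<open>The coefficient of L(w) - L(v) in the convolution at time w, for a grid interval without
  endpoints of \<open>ps\<close> in its interior. It is known at time v.\<close>

definition grid_operator :: "(real \<Rightarrow> 'h \<Rightarrow>\<^sub>L 'h) \<Rightarrow> ('a, 'h) simple_integrand \<Rightarrow> real \<Rightarrow> real \<Rightarrow> 'a \<Rightarrow> 'h \<Rightarrow>\<^sub>L 'h" where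
  "grid_operator S ps v w \<omega> =
    (\<Sum>(a, b, B, \<Phi>)\<leftarrow>ps. (if a \<le> v \<and> w \<le> b then indicator B \<omega> else 0 :: real) *\<^sub>R (S (w - a) o\<^sub>L \<Phi>))"

lemma grid_operator_simps:
  "grid_operator S [] v w \<omega> = 0"
  "grid_operator S ((a, b, B, \<Phi>) # ps) v w \<omega> =
    (if a \<le> v \<and> w \<le> b then indicator B \<omega> else 0 :: real) *\<^sub>R (S (w - a) o\<^sub>L \<Phi>) + grid_operator S ps v w \<omega>"
  by (simp_all add: grid_operator_def)

lemma simple_function_grid_operator:
  assumes v: "0 \<le> v" and ps: "ps \<in> simple_integrands F T"
  shows "simple_function (F v) (grid_operator S ps v w)"
  using ps
proof (induction ps)
  case Nil
  then show ?case by (simp add: grid_operator_simps[abs_def])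
next
  case (Cons p ps)
  obtain a b B \<Phi> where p: "p = (a, b, B, \<Phi>)" by (cases p)
  have a: "0 \<le> a" "B \<in> sets (F a)" and IH: "simple_function (F v) (grid_operator S ps v w)"
    using Cons by (auto simp: p simple_integrands_Cons)
  have "simple_function (F v) (\<lambda>\<omega>. (if a \<le> v \<and> w \<le> b then indicator B \<omega> else 0 :: real) *\<^sub>R (S (w - a) o\<^sub>L \<Phi>))"
  proof (cases "a \<le> v \<and> w \<le> b")
    case True
    then have "B \<in> sets (F v)" using a F_mono[of a v] by auto
    then have "simple_function (F v) (indicator B :: 'a \<Rightarrow> real)" by (rule simple_function_indicator)
    from simple_function_compose1[OF this, of "\<lambda>r. r *\<^sub>R (S (w - a) o\<^sub>L \<Phi>)"] True show ?thesis by simp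
  qed auto
  from simple_function_compose2[OF this IH, of "(+)"] show ?case
    unfolding p grid_operator_simps(2)[abs_def] .
qed

lemma martingale_difference_grid:
  assumes vw: "0 \<le> v" "v \<le> w" and ps: "ps \<in> simple_integrands F T"
  shows "martingale_difference v (\<lambda>\<omega>. grid_operator S ps v w \<omega> (L w \<omega> - L v \<omega>))"
  using ps
proof (induction ps)
  case Nil
  then show ?case by (simp add: grid_operator_simps martingale_difference_zero)
next
  case (Cons p ps)
  obtain a b B \<Phi> where p: "p = (a, b, B, \<Phi>)" by (cases p)
  have a: "0 \<le> a" "B \<in> sets (F a)" and IH: "martingale_difference v (\<lambda>\<omega>. grid_operator S ps v w \<omega> (L w \<omega> - L v \<omega>))"
    using Cons by (auto simp: p simple_integrands_Cons)
  have "martingale_difference v (\<lambda>\<omega>. (if a \<le> v \<and> w \<le> b then indicator B \<omega> else 0 :: real) *\<^sub>R (S (w - a) o\<^sub>L \<Phi>) (L w \<omega> - L v \<omega>))"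
  proof (cases "a \<le> v \<and> w \<le> b")
    case True
    then have "B \<in> sets (F v)" using a F_mono[of a v] by auto
    from martingale_difference_increment[OF vw this, of "S (w - a) o\<^sub>L \<Phi>"] True show ?thesis by simp
  qed (auto simp: martingale_difference_zero)
  from martingale_difference_add[OF vw(1) this IH] show ?case
    unfolding p grid_operator_simps by (simp add: blinfun.add_left blinfun.scaleR_left)
qed

text \<open>On a grid interval each entry has ended, is running throughout, or has not begun. The
  semigroup law carries its value from v to w, and only running entries receive the new
  increment.\<close>

lemma conv_simple_recursion:
  assumes S: "contraction_semigroup S" and vw: "0 \<le> v" "v \<le> w"
    and ps: "ps \<in> simple_integrands F T"
    and grid: "\<And>a b B \<Phi>. (a, b, B, \<Phi>) \<in> set ps \<Longrightarrow> (a \<le> v \<or> w \<le> a) \<and> (b \<le> v \<or> w \<le> b)"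
  shows "conv_simple S L ps w \<omega> = S (w - v) (conv_simple S L ps v \<omega>) + grid_operator S ps v w \<omega> (L w \<omega> - L v \<omega>)"
  using ps grid
proof (induction ps)
  case Nil
  then show ?case by (simp add: conv_simple_Nil grid_operator_simps blinfun.zero_right)
next
  case (Cons p ps)
  obtain a b B \<Phi> where p: "p = (a, b, B, \<Phi>)" by (cases p)
  have a: "0 \<le> a" "a < b" and ps: "ps \<in> simple_integrands F T"
    using Cons.prems by (auto simp: p simple_integrands_Cons)
  have g: "(a \<le> v \<or> w \<le> a) \<and> (b \<le> v \<or> w \<le> b)" using Cons.prems(2)[of a b B \<Phi>] by (simp add: p)
  have IH: "conv_simple S L ps w \<omega> = S (w - v) (conv_simple S L ps v \<omega>) + grid_operator S ps v w \<omega> (L w \<omega> - L v \<omega>)"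
    using Cons.prems by (intro Cons.IH ps) auto
  have add: "S (w - a) x = S (w - v) (S (v - a) x)" if "a \<le> v" for x
    using contraction_semigroup_add[OF S, of "w - v" "v - a" x] that vw by simp
  have "S (w - min a w) (\<Phi> (L (min b w) \<omega> - L (min a w) \<omega>))
      = S (w - v) (S (v - min a v) (\<Phi> (L (min b v) \<omega> - L (min a v) \<omega>)))
        + (if a \<le> v \<and> w \<le> b then 1 else 0 :: real) *\<^sub>R S (w - a) (\<Phi> (L w \<omega> - L v \<omega>))"
  proof (cases "a \<le> v")
    case av: True
    show ?thesis
    proof (cases "w \<le> b")
      case True
      have "S (w - a) (\<Phi> (L w \<omega> - L a \<omega>)) = S (w - a) (\<Phi> (L v \<omega> - L a \<omega>)) + S (w - a) (\<Phi> (L w \<omega> - L v \<omega>))"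
        by (simp add: blinfun.add_right[symmetric])
      then show ?thesis using True av vw add by (simp add: min_absorb1 min_absorb2)
    next
      case False
      then have "b \<le> v" using g by auto
      then show ?thesis using av vw False add by (simp add: min_absorb1)
    qed
  next
    case False
    then have "w \<le> a" using g by auto
    then show ?thesis using False a vw by (simp add: min_absorb2 blinfun.zero_right)
  qed
  then have "(indicator B \<omega> :: real) *\<^sub>R S (w - min a w) (\<Phi> (L (min b w) \<omega> - L (min a w) \<omega>))
      = S (w - v) ((indicator B \<omega> :: real) *\<^sub>R S (v - min a v) (\<Phi> (L (min b v) \<omega> - L (min a v) \<omega>)))
        + (if a \<le> v \<and> w \<le> b then indicator B \<omega> else 0 :: real) *\<^sub>R S (w - a) (\<Phi> (L w \<omega> - L v \<omega>))"
    by (simp add: blinfun.scaleR_right scaleR_add_right split: split_indicator)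
  then show ?case
    unfolding p conv_simple_Cons grid_operator_simps IH
    by (simp add: blinfun.add_left blinfun.add_right blinfun.scaleR_left)
qed

text \<open>Since S(w - a) = S(w - s) S(s - a), the coefficient attached to the right endpoint is
  the image under a contraction of the integrand at any s of the interval. This lets a sum over the
  grid be bounded by an integral over time.\<close>

lemma grid_operator_conv_process:
  fixes S :: "real \<Rightarrow> 'h \<Rightarrow>\<^sub>L 'h"
  assumes S: "contraction_semigroup S" and s: "v < s" "s \<le> w"
    and grid: "\<And>a b B \<Phi>. (a, b, B, \<Phi>) \<in> set ps \<Longrightarrow> (a \<le> v \<or> w \<le> a) \<and> (b \<le> v \<or> w \<le> b)"
  shows "grid_operator S ps v w \<omega> x = S (w - s) (conv_process S ps s \<omega> x)"
  using grid
proof (induction ps)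
  case Nil
  then show ?case by (simp add: grid_operator_simps conv_process_Nil blinfun.zero_right)
next
  case (Cons p ps)
  obtain a b B \<Phi> where p: "p = (a, b, B, \<Phi>)" by (cases p)
  have g: "(a \<le> v \<or> w \<le> a) \<and> (b \<le> v \<or> w \<le> b)" using Cons.prems[of a b B \<Phi>] by (simp add: p)
  have IH: "grid_operator S ps v w \<omega> x = S (w - s) (conv_process S ps s \<omega> x)"
    using Cons.prems by (intro Cons.IH) auto
  have ind: "(a \<le> v \<and> w \<le> b) \<longleftrightarrow> s \<in> {a<..b}" using g s by auto
  have "S (w - a) (\<Phi> x) = S (w - s) (S (s - a) (\<Phi> x))" if "a \<le> v"
    using contraction_semigroup_add[OF S, of "w - s" "s - a"] that s by simp
  then have "(if a \<le> v \<and> w \<le> b then indicator B \<omega> else 0 :: real) *\<^sub>R S (w - a) (\<Phi> x)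
      = S (w - s) ((indicator {a<..b} s * indicator B \<omega> :: real) *\<^sub>R S (s - a) (\<Phi> x))"
    using ind by (cases "a \<le> v \<and> w \<le> b") (auto simp: blinfun.scaleR_right)
  then show ?case
    unfolding p grid_operator_simps conv_process_Cons
    by (simp add: IH blinfun.add_left blinfun.add_right blinfun.scaleR_left)
qed

text \<open>The times of J and the endpoints of \<open>ps\<close> are put into one grid. As the
  bound does not see the grid, it is the same for all finite J, which is what a supremum over all
  times needs later.\<close>

theorem conv_simple_maximal:
  assumes S: "contraction_semigroup S" and ps: "ps \<in> simple_integrands F T" and T: "0 \<le> T"
    and J: "finite J" "J \<subseteq> {0..T}"
  shows "(\<integral>\<^sup>+\<omega>. (SUP t\<in>J. ennreal ((norm (conv_simple S L ps t \<omega>))\<^sup>2)) \<partial>M) \<le> 18 * process_norm_sq T (conv_process S ps)"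
proof -
  define P where "P = J \<union> {0, T} \<union> fst ` set ps \<union> (fst \<circ> snd) ` set ps"
  have psT: "0 \<le> a \<and> a < b \<and> b \<le> T" if "(a, b, B, \<Phi>) \<in> set ps" for a b B \<Phi>
    using ps that by (auto simp: simple_integrands_def)
  have PT: "P \<subseteq> {0..T}" using J T psT by (force simp: P_def)
  have P0: "finite P" "P \<subseteq> {0..}" "0 \<in> P" using PT J(1) by (auto simp: P_def)
  obtain u :: "nat \<Rightarrow> real" and N where u: "mono u" "u ` {..N} = P" "u 0 = 0" "\<And>k. u k \<in> P"
      "\<And>k p. p \<in> P \<Longrightarrow> p \<le> u k \<or> u (Suc k) \<le> p" "\<And>i j. i < j \<Longrightarrow> j \<le> N \<Longrightarrow> u i < u j"
    by (rule ex_grid[OF P0]) (rule that)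
  have uT: "0 \<le> u k" "u k \<le> T" for k using u(4)[of k] PT by auto
  have uS: "u k \<le> u (Suc k)" for k using monoD[OF u(1), of k "Suc k"] by simp
  have grid: "(a \<le> u k \<or> u (Suc k) \<le> a) \<and> (b \<le> u k \<or> u (Suc k) \<le> b)" if "(a, b, B, \<Phi>) \<in> set ps" for a b B \<Phi> k
  proof -
    have "a \<in> fst ` set ps" "b \<in> (fst \<circ> snd) ` set ps" using that by force+
    then show ?thesis using u(5)[of a k] u(5)[of b k] by (auto simp: P_def)
  qed
  define Y where "Y k = conv_simple S L ps (u k)" for k
  define G where "G k = grid_operator S ps (u k) (u (Suc k))" for k
  define d where "d k \<omega> = G k \<omega> (L (u (Suc k)) \<omega> - L (u k) \<omega>)" for k \<omega>
  have d: "martingale_difference (u k) (d k)" for k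
    unfolding d_def G_def by (rule martingale_difference_grid[OF uT(1) uS ps])
  have rec: "Y (Suc k) \<omega> = S (u (Suc k) - u k) (Y k \<omega>) + d k \<omega>" for k \<omega>
    unfolding Y_def d_def G_def by (rule conv_simple_recursion[OF S uT(1) uS ps grid])
  have Y0: "Y 0 \<omega> = 0" for \<omega>
  proof -
    have "conv_simple S L qs 0 \<omega> = 0" if "set qs \<subseteq> set ps" for qs
      using that
    proof (induction qs)
      case (Cons q qs)
      obtain a b B \<Phi> where q: "q = (a, b, B, \<Phi>)" by (cases q)
      have "0 \<le> a" "0 \<le> b" using Cons.prems psT[of a b B \<Phi>] by (auto simp: q)
      then show ?case using Cons by (simp add: q conv_simple_Cons min_absorb2 blinfun.zero_right)
    qed (simp add: conv_simple_Nil)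
    then show ?thesis by (simp add: Y_def u(3))
  qed
  define q where "q s \<omega> = (\<Sum>n. ennreal ((norm (conv_process S ps s \<omega> (R (onb_seq n))))\<^sup>2))" for s \<omega>
  have q_meas[measurable]: "(\<lambda>(s, \<omega>). q s \<omega>) \<in> borel_measurable (lborel \<Otimes>\<^sub>M M)"
  proof -
    have [measurable]: "(\<lambda>(s, \<omega>). conv_process S ps s \<omega> (R (onb_seq n))) \<in> borel_measurable (lborel \<Otimes>\<^sub>M M)" for n
      by (rule conv_process_measurable[OF S ps])
    have "(\<lambda>z. \<Sum>n. ennreal ((norm ((\<lambda>(s, \<omega>). conv_process S ps s \<omega> (R (onb_seq n))) z))\<^sup>2)) \<in> borel_measurable (lborel \<Otimes>\<^sub>M M)"
      by measurable
    then show ?thesis unfolding q_def case_prod_unfold .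
  qed
  have q_swap[measurable]: "(\<lambda>(\<omega>, s). q s \<omega>) \<in> borel_measurable (M \<Otimes>\<^sub>M lborel)"
    using measurable_pair_swap[OF q_meas] unfolding case_prod_unfold by (simp only: fst_conv snd_conv)
  \<comment> \<open>The isometry yields the length of the interval times the norm of the coefficient
    at its right end. By contractivity that norm is at most \<open>q s \<omega>\<close> for every s
    in the interval, so the product is at most the integral of q.\<close>
  have dk: "(\<integral>\<^sup>+\<omega>. ennreal ((norm (d k \<omega>))\<^sup>2) \<partial>M) \<le> (\<integral>\<^sup>+\<omega>. (\<integral>\<^sup>+s. indicator {u k<..u (Suc k)} s * q s \<omega> \<partial>lborel) \<partial>M)" for k
  proof -
    define h where "h \<omega> = (\<Sum>n. ennreal ((norm (G k \<omega> (R (onb_seq n))))\<^sup>2))" for \<omega>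
    have "(\<integral>\<^sup>+\<omega>. ennreal ((norm (d k \<omega>))\<^sup>2) \<partial>M) = ennreal (u (Suc k) - u k) * (\<integral>\<^sup>+\<omega>. h \<omega> \<partial>M)"
      unfolding d_def h_def G_def
      by (rule simple_isometry[OF uT(1) uS simple_function_grid_operator[OF uT(1) ps]])
    also have "\<dots> = (\<integral>\<^sup>+\<omega>. ennreal (u (Suc k) - u k) * h \<omega> \<partial>M)"
    proof (rule nn_integral_cmult[symmetric])
      have "simple_function (F (u k)) (G k)" unfolding G_def by (rule simple_function_grid_operator[OF uT(1) ps])
      from simple_function_compose1[OF this, of "\<lambda>g. \<Sum>n. ennreal ((norm (g (R (onb_seq n))))\<^sup>2)"]
      have "simple_function (F (u k)) h" unfolding h_def[abs_def] .
      then show "h \<in> borel_measurable M"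
        by (intro measurable_from_subalg[OF F_sub[OF uT(1)]] borel_measurable_simple_function)
    qed
    also have "\<dots> \<le> (\<integral>\<^sup>+\<omega>. (\<integral>\<^sup>+s. indicator {u k<..u (Suc k)} s * q s \<omega> \<partial>lborel) \<partial>M)"
    proof (rule nn_integral_mono)
      fix \<omega>
      have "ennreal (u (Suc k) - u k) * h \<omega> = (\<integral>\<^sup>+s. h \<omega> * indicator {u k<..u (Suc k)} s \<partial>lborel)"
        using uS[of k] by (subst nn_integral_cmult_indicator) (auto simp: mult.commute)
      also have "\<dots> \<le> (\<integral>\<^sup>+s. indicator {u k<..u (Suc k)} s * q s \<omega> \<partial>lborel)"
      proof (rule nn_integral_mono)
        fix s
        have "h \<omega> \<le> q s \<omega>" if s: "u k < s" "s \<le> u (Suc k)"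
          unfolding h_def q_def
        proof (intro suminf_le ennreal_leI power_mono)
          fix n
          have "G k \<omega> (R (onb_seq n)) = S (u (Suc k) - s) (conv_process S ps s \<omega> (R (onb_seq n)))"
            unfolding G_def by (rule grid_operator_conv_process[OF S s grid])
          then show "norm (G k \<omega> (R (onb_seq n))) \<le> norm (conv_process S ps s \<omega> (R (onb_seq n)))"
            using contraction_semigroup_norm_le[OF S, of "u (Suc k) - s"] s by simp
        qed auto
        then show "h \<omega> * indicator {u k<..u (Suc k)} s \<le> indicator {u k<..u (Suc k)} s * q s \<omega>"
          by (auto split: split_indicator)
      qed
      finally show "ennreal (u (Suc k) - u k) * h \<omega> \<le> (\<integral>\<^sup>+s. indicator {u k<..u (Suc k)} s * q s \<omega> \<partial>lborel)" .
    qed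
    finally show ?thesis .
  qed
  \<comment> \<open>The half-open grid intervals tile their union, so the bounds add up to one
    integral over time.\<close>
  have ind_sum: "(\<Sum>k<n. indicator {u k<..u (Suc k)} s) = (indicator {u 0<..u n} s :: ennreal)" for s n
  proof (induction n)
    case (Suc n)
    have "u 0 \<le> u n" using monoD[OF u(1)] by simp
    then show ?case using Suc uS[of n] by (auto split: split_indicator)
  qed simp
  have "(\<integral>\<^sup>+\<omega>. (SUP t\<in>J. ennreal ((norm (conv_simple S L ps t \<omega>))\<^sup>2)) \<partial>M)
      \<le> (\<integral>\<^sup>+\<omega>. (SUP j\<in>{..N}. ennreal ((norm (Y j \<omega>))\<^sup>2)) \<partial>M)"
  proof (intro nn_integral_mono SUP_least)
    fix \<omega> t assume "t \<in> J"
    then have "t \<in> u ` {..N}" using u(2) by (auto simp: P_def)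
    then obtain j where "j \<le> N" "t = u j" by auto
    then show "ennreal ((norm (conv_simple S L ps t \<omega>))\<^sup>2) \<le> (SUP j\<in>{..N}. ennreal ((norm (Y j \<omega>))\<^sup>2))"
      by (intro SUP_upper2[of j]) (auto simp: Y_def)
  qed
  also have "\<dots> \<le> ennreal (18 * (\<Sum>k<N. expectation (\<lambda>\<omega>. (norm (d k \<omega>))\<^sup>2)))"
  proof (rule discrete_maximal_inequality[where G = "\<lambda>k. F (u k)" and C = "\<lambda>k. S (u (Suc k) - u k)"])
    show "subalgebra M (F (u k))" for k by (rule F_sub[OF uT(1)])
    show "sets (F (u k)) \<subseteq> sets (F (u (Suc k)))" for k by (rule F_mono[OF uT(1) uS])
    show "Y k \<in> borel_measurable (F (u k))" for k unfolding Y_def by (rule conv_simple_measurable[OF uT(1) ps])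
    show "integrable M (\<lambda>\<omega>. (norm (Y k \<omega>))\<^sup>2)" for k
      unfolding Y_def by (rule conv_simple_square_integrable[OF uT(1) ps S])
    show "norm (S (u (Suc k) - u k) y) \<le> norm y" for k y
      using uS[of k] by (intro contraction_semigroup_norm_le[OF S]) simp
    show "Y (Suc k) \<omega> = S (u (Suc k) - u k) (Y k \<omega>) + d k \<omega>" for k \<omega> by (rule rec)
  qed (use d Y0 in \<open>auto simp: martingale_difference_def\<close>)
  also have "\<dots> = 18 * (\<Sum>k<N. \<integral>\<^sup>+\<omega>. ennreal ((norm (d k \<omega>))\<^sup>2) \<partial>M)"
  proof -
    have "(\<integral>\<^sup>+\<omega>. ennreal ((norm (d k \<omega>))\<^sup>2) \<partial>M) = ennreal (expectation (\<lambda>\<omega>. (norm (d k \<omega>))\<^sup>2))" for k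
      using d[of k] by (intro nn_integral_eq_integral) (auto simp: martingale_difference_def)
    then show ?thesis by (simp add: ennreal_mult' sum_nonneg)
  qed
  also have "\<dots> \<le> 18 * process_norm_sq T (conv_process S ps)"
  proof (intro mult_left_mono)
    have "(\<Sum>k<N. \<integral>\<^sup>+\<omega>. ennreal ((norm (d k \<omega>))\<^sup>2) \<partial>M) \<le> (\<Sum>k<N. (\<integral>\<^sup>+\<omega>. (\<integral>\<^sup>+s. indicator {u k<..u (Suc k)} s * q s \<omega> \<partial>lborel) \<partial>M))"
      by (intro sum_mono dk)
    also have "\<dots> = (\<integral>\<^sup>+\<omega>. (\<Sum>k<N. \<integral>\<^sup>+s. indicator {u k<..u (Suc k)} s * q s \<omega> \<partial>lborel) \<partial>M)"
      by (rule nn_integral_sum[symmetric]) measurable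
    also have "\<dots> = (\<integral>\<^sup>+\<omega>. (\<integral>\<^sup>+s. indicator {u 0<..u N} s * q s \<omega> \<partial>lborel) \<partial>M)"
    proof (rule nn_integral_cong)
      fix \<omega> assume [measurable]: "\<omega> \<in> space M"
      show "(\<Sum>k<N. \<integral>\<^sup>+s. indicator {u k<..u (Suc k)} s * q s \<omega> \<partial>lborel) = (\<integral>\<^sup>+s. indicator {u 0<..u N} s * q s \<omega> \<partial>lborel)"
        by (subst nn_integral_sum[symmetric]) (simp_all add: sum_distrib_right[symmetric] ind_sum)
    qed
    also have "\<dots> \<le> process_norm_sq T (conv_process S ps)"
      unfolding process_norm_sq_def q_def[symmetric]
    proof (intro nn_integral_mono)
      fix \<omega> s
      show "indicator {u 0<..u N} s * q s \<omega> \<le> q s \<omega> * indicator {0..T} s"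
        using uT(2)[of N] by (auto simp: u(3) split: split_indicator)
    qed
    finally show "(\<Sum>k<N. \<integral>\<^sup>+\<omega>. ennreal ((norm (d k \<omega>))\<^sup>2) \<partial>M) \<le> process_norm_sq T (conv_process S ps)" .
  qed simp
  finally show ?thesis .
qed

end

subsection \<open>The norm of integrands and uniqueness of the stochastic integral\<close>

text \<open>Strong continuity gives continuity in time for a fixed vector, and contractivity makes
  the dependence on the vector uniform in time. The maximum with 0 extends the map to all real
  times, so that it can be used as a Borel map.\<close>

lemma continuous_contraction_semigroup_joint:
  fixes S :: "real \<Rightarrow> 'h::banach \<Rightarrow>\<^sub>L 'h"
  assumes S: "contraction_semigroup S"
  shows "continuous_on UNIV (\<lambda>(s, y). S (max 0 s) y)"
  unfolding continuous_on_def
proof (clarsimp simp: case_prod_unfold)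
  fix a :: real and z :: 'h
  have "continuous_on UNIV (\<lambda>s. S (max 0 s) z)"
    by (rule continuous_on_compose2[OF contraction_semigroup_continuous[OF S]]) (auto intro!: continuous_intros)
  then have "isCont (\<lambda>s. S (max 0 s) z) a" by (simp add: continuous_on_eq_continuous_at)
  then have l: "((\<lambda>p. S (max 0 (fst p)) z) \<longlongrightarrow> S (max 0 a) z) (at (a, z))"
    by (rule isCont_tendsto_compose) (rule tendsto_fst[OF tendsto_ident_at, of "(a, z)", unfolded fst_conv])
  have g: "((\<lambda>p. norm (snd p - z) + norm (S (max 0 (fst p)) z - S (max 0 a) z)) \<longlongrightarrow> norm (z - z) + norm (S (max 0 a) z - S (max 0 a) z)) (at (a, z))"
    by (intro tendsto_add tendsto_norm tendsto_diff l tendsto_const)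
       (rule tendsto_snd[OF tendsto_ident_at, of "(a, z)", unfolded snd_conv])
  have le: "norm (S (max 0 (fst p)) (snd p) - S (max 0 a) z) \<le> norm (snd p - z) + norm (S (max 0 (fst p)) z - S (max 0 a) z)" for p
  proof -
    have "S (max 0 (fst p)) (snd p) - S (max 0 a) z = S (max 0 (fst p)) (snd p - z) + (S (max 0 (fst p)) z - S (max 0 a) z)"
      by (simp add: blinfun.diff_right)
    also have "norm \<dots> \<le> norm (S (max 0 (fst p)) (snd p - z)) + norm (S (max 0 (fst p)) z - S (max 0 a) z)"
      by (rule norm_triangle_ineq)
    also have "norm (S (max 0 (fst p)) (snd p - z)) \<le> norm (snd p - z)"
      by (rule contraction_semigroup_norm_le[OF S]) simp
    finally show ?thesis by simp
  qed
  have "((\<lambda>p. S (max 0 (fst p)) (snd p) - S (max 0 a) z) \<longlongrightarrow> 0) (at (a, z))"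
    by (rule Lim_null_comparison[OF always_eventually[OF allI[OF le]]]) (use g in simp)
  then show "((\<lambda>p. S (max 0 (fst p)) (snd p)) \<longlongrightarrow> S (max 0 a) z) (at (a, z))"
    by (rule LIM_zero_cancel)
qed

text \<open>For a fixed t the convolution is the integral over [0,t] of a simple process with the
  operators S(t - a) \<Phi>, constant in s on each interval. Entries with a \<ge> t are dropped
  because a simple integrand must have nonempty intervals inside [0,t].\<close>

definition truncate_simple ::
  "(real \<Rightarrow> 'h::real_normed_vector \<Rightarrow>\<^sub>L 'h) \<Rightarrow> real \<Rightarrow> ('a, 'h) simple_integrand \<Rightarrow> ('a, 'h) simple_integrand" where
  "truncate_simple S t ps =
     map (\<lambda>(a, b, B, \<Phi>). (a, min b t, B, S (t - a) o\<^sub>L \<Phi>)) (filter (\<lambda>(a, b, B, \<Phi>). a < t) ps)"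

lemma truncate_simple_simps:
  "truncate_simple S t [] = []"
  "truncate_simple S t ((a, b, B, \<Phi>) # ps) =
    (if a < t then [(a, min b t, B, S (t - a) o\<^sub>L \<Phi>)] else []) @ truncate_simple S t ps"
  by (simp_all add: truncate_simple_def)

lemma truncate_simple_integrands:
  "ps \<in> simple_integrands F T \<Longrightarrow> truncate_simple S t ps \<in> simple_integrands F t"
  by (induction ps) (auto simp: truncate_simple_simps simple_integrands_Cons simple_integrands_append simple_integrands_def[of _ t])

lemma simple_integral_truncate:
  assumes "ps \<in> simple_integrands F T"
  shows "simple_integral L (truncate_simple S t ps) \<omega> = conv_simple S L ps t \<omega>"
  using assms
proof (induction ps)
  case Nil
  then show ?case by (simp add: truncate_simple_simps simple_integral_def conv_simple_Nil)
next
  case (Cons p ps)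
  obtain a b B \<Phi> where p: "p = (a, b, B, \<Phi>)" by (cases p)
  have a: "a < b" and ps: "ps \<in> simple_integrands F T"
    using Cons.prems by (auto simp: p simple_integrands_Cons)
  show ?case
    using Cons.IH[OF ps] a
    by (cases "a < t") (simp_all add: p truncate_simple_simps conv_simple_Cons simple_integral_def min_def blinfun.zero_right)
qed

lemma simple_process_truncate:
  assumes S: "contraction_semigroup S" and s: "s \<le> t"
  shows "simple_process (truncate_simple S t ps) s \<omega> x = S (t - s) (conv_process S ps s \<omega> x)"
proof (induction ps)
  case Nil
  then show ?case by (simp add: truncate_simple_simps simple_process_def conv_process_Nil blinfun.zero_right)
next
  case (Cons p ps)
  obtain a b B \<Phi> where p: "p = (a, b, B, \<Phi>)" by (cases p)
  have "S (t - a) (\<Phi> x) = S (t - s) (S (s - a) (\<Phi> x))" if "a < s"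
    using contraction_semigroup_add[OF S, of "t - s" "s - a"] that s by simp
  then have "(if a < t then (indicator {a<..min b t} s * indicator B \<omega> :: real) *\<^sub>R S (t - a) (\<Phi> x) else 0)
      = S (t - s) ((indicator {a<..b} s * indicator B \<omega> :: real) *\<^sub>R S (s - a) (\<Phi> x))"
    using s by (auto simp: blinfun.scaleR_right split: split_indicator)
  then show ?case
    using Cons by (simp add: p truncate_simple_simps simple_process_def conv_process_Cons blinfun.add_right split: if_splits)
qed

lemma bounded_linear_conv_process:
  fixes S :: "real \<Rightarrow> 'h::real_normed_vector \<Rightarrow>\<^sub>L 'h"
  shows "bounded_linear (conv_process S ps s \<omega>)"
proof (induction ps)
  case (Cons p ps)
  obtain a b B \<Phi> where p: "p = (a, b, B, \<Phi>)" by (cases p)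
  show ?case
    unfolding p conv_process_Cons[abs_def]
    by (intro bounded_linear_add Cons bounded_linear_const_scaleR
        bounded_linear_compose[OF blinfun.bounded_linear_right blinfun.bounded_linear_right])
qed (simp add: conv_process_Nil[abs_def])

context levy_setting
begin

definition process_measurable :: "real \<Rightarrow> (real \<Rightarrow> 'a \<Rightarrow> 'h \<Rightarrow> 'h) \<Rightarrow> bool" where
  "process_measurable T \<Psi> \<longleftrightarrow>
    (\<forall>n. (\<lambda>(s, \<omega>). (indicator {0..T} s :: real) *\<^sub>R \<Psi> s \<omega> (R (onb_seq n))) \<in> borel_measurable (lborel \<Otimes>\<^sub>M M))"

definition process_density :: "real \<Rightarrow> (real \<Rightarrow> 'a \<Rightarrow> 'h \<Rightarrow> 'h) \<Rightarrow> 'a \<Rightarrow> real \<Rightarrow> ennreal" where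
  "process_density T \<Psi> \<omega> s = (\<Sum>n. ennreal ((norm ((indicator {0..T} s :: real) *\<^sub>R \<Psi> s \<omega> (R (onb_seq n))))\<^sup>2))"

lemma process_norm_sq_eq_density: "process_norm_sq T \<Psi> = (\<integral>\<^sup>+\<omega>. (\<integral>\<^sup>+s. process_density T \<Psi> \<omega> s \<partial>lborel) \<partial>M)"
  unfolding process_norm_sq_def
proof (intro nn_integral_cong)
  fix \<omega> s
  show "(\<Sum>n. ennreal ((norm (\<Psi> s \<omega> (R (onb_seq n))))\<^sup>2)) * indicator {0..T} s = process_density T \<Psi> \<omega> s"
    unfolding process_density_def
    by (cases "s \<in> {0..T}")
       (simp_all only: indicator_simps not_False_eq_True scaleR_one mult_1_right scaleR_zero_left norm_zero power_zero_numeral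
         ennreal_0 suminf_zero mult_zero_right)
qed

lemma process_density_measurable[measurable]:
  assumes "process_measurable T \<Psi>"
  shows "(\<lambda>(\<omega>, s). process_density T \<Psi> \<omega> s) \<in> borel_measurable (M \<Otimes>\<^sub>M lborel)"
proof -
  have [measurable]: "(\<lambda>(s, \<omega>). (indicator {0..T} s :: real) *\<^sub>R \<Psi> s \<omega> (R (onb_seq n))) \<in> borel_measurable (lborel \<Otimes>\<^sub>M M)" for n
    using assms by (simp add: process_measurable_def)
  have "(\<lambda>z. \<Sum>n. ennreal ((norm ((\<lambda>(s, \<omega>). (indicator {0..T} s :: real) *\<^sub>R \<Psi> s \<omega> (R (onb_seq n))) z))\<^sup>2)) \<in> borel_measurable (lborel \<Otimes>\<^sub>M M)"
    by measurable
  then have "(\<lambda>(s, \<omega>). process_density T \<Psi> \<omega> s) \<in> borel_measurable (lborel \<Otimes>\<^sub>M M)"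
    unfolding process_density_def case_prod_unfold .
  from measurable_pair_swap[OF this] show ?thesis
    unfolding case_prod_unfold by (simp only: fst_conv snd_conv)
qed

lemma process_measurable_diff:
  assumes "process_measurable T \<Psi>" "process_measurable T \<Xi>"
  shows "process_measurable T (\<lambda>s \<omega> x. \<Psi> s \<omega> x - \<Xi> s \<omega> x)"
  unfolding process_measurable_def
proof
  fix n
  have "(\<lambda>(s, \<omega>). (indicator {0..T} s :: real) *\<^sub>R \<Psi> s \<omega> (R (onb_seq n))) \<in> borel_measurable (lborel \<Otimes>\<^sub>M M)"
    "(\<lambda>(s, \<omega>). (indicator {0..T} s :: real) *\<^sub>R \<Xi> s \<omega> (R (onb_seq n))) \<in> borel_measurable (lborel \<Otimes>\<^sub>M M)"
    using assms by (auto simp: process_measurable_def)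
  from borel_measurable_diff[OF this]
  show "(\<lambda>(s, \<omega>). (indicator {0..T} s :: real) *\<^sub>R (\<Psi> s \<omega> (R (onb_seq n)) - \<Xi> s \<omega> (R (onb_seq n)))) \<in> borel_measurable (lborel \<Otimes>\<^sub>M M)"
    by (simp add: case_prod_unfold scaleR_diff_right)
qed

lemma process_measurable_conv_process:
  assumes S: "contraction_semigroup S" and ps: "ps \<in> simple_integrands F T"
  shows "process_measurable T' (conv_process S ps)"
  unfolding process_measurable_def
proof
  fix n
  have [measurable]: "(\<lambda>(s, \<omega>). conv_process S ps s \<omega> (R (onb_seq n))) \<in> borel_measurable (lborel \<Otimes>\<^sub>M M)"
    by (rule conv_process_measurable[OF S ps])
  have "(\<lambda>z. (indicator {0..T'} (fst z) :: real) *\<^sub>R (\<lambda>(s, \<omega>). conv_process S ps s \<omega> (R (onb_seq n))) z) \<in> borel_measurable (lborel \<Otimes>\<^sub>M M)"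
    by measurable
  then show "(\<lambda>(s, \<omega>). (indicator {0..T'} s :: real) *\<^sub>R conv_process S ps s \<omega> (R (onb_seq n))) \<in> borel_measurable (lborel \<Otimes>\<^sub>M M)"
    by (simp add: case_prod_unfold)
qed

text \<open>The factor 2 is that of (x + y)^2 \<le> 2 x^2 + 2 y^2. Measurability enters because the
  nonnegative integral is additive only on measurable functions.\<close>

lemma process_norm_sq_triangle:
  assumes m: "process_measurable T \<Psi>" "process_measurable T \<Xi>" "process_measurable T \<Theta>"
  shows "process_norm_sq T (\<lambda>s \<omega> x. \<Psi> s \<omega> x - \<Theta> s \<omega> x)
    \<le> 2 * process_norm_sq T (\<lambda>s \<omega> x. \<Psi> s \<omega> x - \<Xi> s \<omega> x) + 2 * process_norm_sq T (\<lambda>s \<omega> x. \<Xi> s \<omega> x - \<Theta> s \<omega> x)"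
proof -
  let ?f = "process_density T (\<lambda>s \<omega> x. \<Psi> s \<omega> x - \<Xi> s \<omega> x)" and ?g = "process_density T (\<lambda>s \<omega> x. \<Xi> s \<omega> x - \<Theta> s \<omega> x)"
  have [measurable]: "(\<lambda>(\<omega>, s). ?f \<omega> s) \<in> borel_measurable (M \<Otimes>\<^sub>M lborel)" "(\<lambda>(\<omega>, s). ?g \<omega> s) \<in> borel_measurable (M \<Otimes>\<^sub>M lborel)"
    using m by (auto intro!: process_density_measurable process_measurable_diff)
  have le: "process_density T (\<lambda>s \<omega> x. \<Psi> s \<omega> x - \<Theta> s \<omega> x) \<omega> s \<le> 2 * ?f \<omega> s + 2 * ?g \<omega> s" for \<omega> s
  proof -
    have "process_density T (\<lambda>s \<omega> x. \<Psi> s \<omega> x - \<Theta> s \<omega> x) \<omega> s \<le>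
       (\<Sum>n. 2 * ennreal ((norm ((indicator {0..T} s :: real) *\<^sub>R (\<Psi> s \<omega> (R (onb_seq n)) - \<Xi> s \<omega> (R (onb_seq n)))))\<^sup>2)
          + 2 * ennreal ((norm ((indicator {0..T} s :: real) *\<^sub>R (\<Xi> s \<omega> (R (onb_seq n)) - \<Theta> s \<omega> (R (onb_seq n)))))\<^sup>2))"
      unfolding process_density_def
    proof (intro suminf_le)
      fix n
      let ?x = "(indicator {0..T} s :: real) *\<^sub>R (\<Psi> s \<omega> (R (onb_seq n)) - \<Xi> s \<omega> (R (onb_seq n)))"
        and ?y = "(indicator {0..T} s :: real) *\<^sub>R (\<Xi> s \<omega> (R (onb_seq n)) - \<Theta> s \<omega> (R (onb_seq n)))"
      have "ennreal ((norm (?x + ?y))\<^sup>2) \<le> ennreal (2 * (norm ?x)\<^sup>2 + 2 * (norm ?y)\<^sup>2)"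
        by (intro ennreal_leI norm_add_square_le)
      also have "\<dots> = 2 * ennreal ((norm ?x)\<^sup>2) + 2 * ennreal ((norm ?y)\<^sup>2)"
        by (simp add: ennreal_mult del: norm_scaleR)
      also have "?x + ?y = (indicator {0..T} s :: real) *\<^sub>R (\<Psi> s \<omega> (R (onb_seq n)) - \<Theta> s \<omega> (R (onb_seq n)))"
        by (simp add: scaleR_add_right[symmetric])
      finally show "ennreal ((norm ((indicator {0..T} s :: real) *\<^sub>R (\<Psi> s \<omega> (R (onb_seq n)) - \<Theta> s \<omega> (R (onb_seq n)))))\<^sup>2)
        \<le> 2 * ennreal ((norm ?x)\<^sup>2) + 2 * ennreal ((norm ?y)\<^sup>2)" .
    qed auto
    also have "\<dots> = 2 * ?f \<omega> s + 2 * ?g \<omega> s"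
      unfolding process_density_def by (subst suminf_add[symmetric]) auto
    finally show ?thesis .
  qed
  have "process_norm_sq T (\<lambda>s \<omega> x. \<Psi> s \<omega> x - \<Theta> s \<omega> x) \<le> (\<integral>\<^sup>+\<omega>. (\<integral>\<^sup>+s. 2 * ?f \<omega> s + 2 * ?g \<omega> s \<partial>lborel) \<partial>M)"
    unfolding process_norm_sq_eq_density by (intro nn_integral_mono le)
  also have "\<dots> = (\<integral>\<^sup>+\<omega>. 2 * (\<integral>\<^sup>+s. ?f \<omega> s \<partial>lborel) + 2 * (\<integral>\<^sup>+s. ?g \<omega> s \<partial>lborel) \<partial>M)"
  proof (rule nn_integral_cong)
    fix \<omega> assume [measurable]: "\<omega> \<in> space M"
    show "(\<integral>\<^sup>+s. 2 * ?f \<omega> s + 2 * ?g \<omega> s \<partial>lborel) = 2 * (\<integral>\<^sup>+s. ?f \<omega> s \<partial>lborel) + 2 * (\<integral>\<^sup>+s. ?g \<omega> s \<partial>lborel)"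
      by (simp add: nn_integral_add nn_integral_cmult)
  qed
  also have "\<dots> = 2 * process_norm_sq T (\<lambda>s \<omega> x. \<Psi> s \<omega> x - \<Xi> s \<omega> x) + 2 * process_norm_sq T (\<lambda>s \<omega> x. \<Xi> s \<omega> x - \<Theta> s \<omega> x)"
    unfolding process_norm_sq_eq_density by (simp add: nn_integral_add nn_integral_cmult)
  finally show ?thesis .
qed

lemma process_norm_sq_mono:
  assumes "T \<le> T'" "\<And>s \<omega> n. 0 \<le> s \<Longrightarrow> s \<le> T \<Longrightarrow> \<omega> \<in> space M \<Longrightarrow> norm (\<Psi> s \<omega> (R (onb_seq n))) \<le> norm (\<Xi> s \<omega> (R (onb_seq n)))"
  shows "process_norm_sq T \<Psi> \<le> process_norm_sq T' \<Xi>"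
  unfolding process_norm_sq_def
proof (intro nn_integral_mono)
  fix \<omega> s assume "\<omega> \<in> space M"
  then show "(\<Sum>n. ennreal ((norm (\<Psi> s \<omega> (R (onb_seq n))))\<^sup>2)) * indicator {0..T} s
    \<le> (\<Sum>n. ennreal ((norm (\<Xi> s \<omega> (R (onb_seq n))))\<^sup>2)) * indicator {0..T'} s"
  proof (cases "s \<in> {0..T}")
    case True
    then have "s \<in> {0..T'}" using assms(1) by auto
    have "(\<Sum>n. ennreal ((norm (\<Psi> s \<omega> (R (onb_seq n))))\<^sup>2)) \<le> (\<Sum>n. ennreal ((norm (\<Xi> s \<omega> (R (onb_seq n))))\<^sup>2))"
      by (rule suminf_le) (use True assms(2) \<open>\<omega> \<in> space M\<close> in \<open>auto intro!: ennreal_leI power_mono\<close>)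
    then show ?thesis using True \<open>s \<in> {0..T'}\<close> by (simp only: indicator_simps mult_1_right)
  qed (simp only: indicator_simps not_False_eq_True mult_zero_right zero_le)
qed

lemma process_norm_sq_commute:
  "process_norm_sq T (\<lambda>s \<omega> x. \<Psi> s \<omega> x - \<Xi> s \<omega> x) = process_norm_sq T (\<lambda>s \<omega> x. \<Xi> s \<omega> x - \<Psi> s \<omega> x)"
  unfolding process_norm_sq_def by (simp add: norm_minus_commute)

text \<open>The exceptional sets are iterated, in the order of integration of
  \<open>integrand_norm_sq\<close>; the product form in \<open>integrands\<close> is brought to this
  form by Fubini.\<close>

definition process_bounded :: "real \<Rightarrow> (real \<Rightarrow> 'a \<Rightarrow> 'h \<Rightarrow> 'h) \<Rightarrow> bool" where
  "process_bounded T \<Psi> \<longleftrightarrow> (AE \<omega> in M. AE s in lborel. s \<in> {0..T} \<longrightarrow> bounded_linear (\<lambda>x. \<Psi> s \<omega> (R x)))"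

lemma integrand_norm_sq_eq:
  assumes "process_bounded T \<Psi>"
  shows "integrand_norm_sq M Q T \<Psi> = process_norm_sq T \<Psi>"
  unfolding integrand_norm_sq_def process_norm_sq_def
proof (rule nn_integral_cong_AE)
  show "AE \<omega> in M. (\<integral>\<^sup>+s\<in>{0..T}. hs_norm_sq (\<lambda>x. \<Psi> s \<omega> (R x)) \<partial>lborel)
      = (\<integral>\<^sup>+s\<in>{0..T}. (\<Sum>n. ennreal ((norm (\<Psi> s \<omega> (R (onb_seq n))))\<^sup>2)) \<partial>lborel)"
    using assms unfolding process_bounded_def
  proof (rule eventually_mono)
    fix \<omega> assume "AE s in lborel. s \<in> {0..T} \<longrightarrow> bounded_linear (\<lambda>x. \<Psi> s \<omega> (R x))"
    then have "AE s in lborel. hs_norm_sq (\<lambda>x. \<Psi> s \<omega> (R x)) * indicator {0..T} s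
      = (\<Sum>n. ennreal ((norm (\<Psi> s \<omega> (R (onb_seq n))))\<^sup>2)) * indicator {0..T} s"
      by (rule eventually_mono) (auto simp: hs_norm_sq_eq_suminf split: split_indicator)
    then show "(\<integral>\<^sup>+s\<in>{0..T}. hs_norm_sq (\<lambda>x. \<Psi> s \<omega> (R x)) \<partial>lborel)
      = (\<integral>\<^sup>+s\<in>{0..T}. (\<Sum>n. ennreal ((norm (\<Psi> s \<omega> (R (onb_seq n))))\<^sup>2)) \<partial>lborel)"
      by (rule nn_integral_cong_AE)
  qed
qed

lemma process_bounded_diff_conv:
  assumes "process_bounded T \<Psi>"
  shows "process_bounded T (\<lambda>s \<omega> x. \<Psi> s \<omega> x - conv_process S ps s \<omega> x)"
  using assms unfolding process_bounded_def
proof (rule eventually_mono)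
  fix \<omega> assume "AE s in lborel. s \<in> {0..T} \<longrightarrow> bounded_linear (\<lambda>x. \<Psi> s \<omega> (R x))"
  then show "AE s in lborel. s \<in> {0..T} \<longrightarrow> bounded_linear (\<lambda>x. \<Psi> s \<omega> (R x) - conv_process S ps s \<omega> (R x))"
    by (rule eventually_mono)
       (auto intro!: bounded_linear_sub bounded_linear_compose[OF bounded_linear_conv_process blinfun.bounded_linear_right])
qed

lemma integrands_process_bounded:
  assumes \<psi>: "\<psi> \<in> integrands M F Q T"
  shows "process_bounded T \<psi>"
proof -
  have sM: "sigma_finite_measure M" by unfold_locales
  have sL: "sigma_finite_measure (restrict_space lborel {0..T})"
    by (rule sigma_finite_measure_restrict_space[OF sigma_finite_lborel]) simp
  interpret sw: pair_sigma_finite "restrict_space lborel {0..T}" M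
    by (rule pair_sigma_finite.intro[OF sL sM])
  have "AE z in restrict_space lborel {0..T} \<Otimes>\<^sub>M M. bounded_linear (\<lambda>x. \<psi> (fst z) (snd z) (R x))"
    using \<psi> by (simp add: integrands_def case_prod_unfold)
  \<comment> \<open>The coordinates are exchanged so that \<omega> becomes the outer
    variable.\<close>
  then have "AE z in distr (M \<Otimes>\<^sub>M restrict_space lborel {0..T}) (restrict_space lborel {0..T} \<Otimes>\<^sub>M M) (\<lambda>(x, y). (y, x)).
      bounded_linear (\<lambda>x. \<psi> (fst z) (snd z) (R x))"
    by (simp only: sw.distr_pair_swap[symmetric])
  then have "AE z in M \<Otimes>\<^sub>M restrict_space lborel {0..T}. bounded_linear (\<lambda>x. \<psi> (snd z) (fst z) (R x))"
    by (drule_tac AE_distrD[rotated]) (auto simp: case_prod_unfold)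
  then have "AE \<omega> in M. AE s in restrict_space lborel {0..T}. bounded_linear (\<lambda>x. \<psi> s \<omega> (R x))"
    using pair_sigma_finite.AE_pair[OF pair_sigma_finite.intro[OF sM sL], of "\<lambda>z. bounded_linear (\<lambda>x. \<psi> (snd z) (fst z) (R x))"] by simp
  then show ?thesis
    unfolding process_bounded_def by (rule eventually_mono) (simp add: AE_restrict_space_iff)
qed

text \<open>The predictable algebra lives on [0,T] \<times> \<open>space M\<close>, while the
  integrals run over all real times with a cut-off; the indicator extends f by 0.\<close>

lemma predictable_measurable_product:
  assumes f: "f \<in> borel_measurable (predictable_algebra M F T)"
  shows "(\<lambda>(s, \<omega>). (indicator {0..T} s :: real) *\<^sub>R (f (s, \<omega>) :: 'h)) \<in> borel_measurable (lborel \<Otimes>\<^sub>M M)"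
proof -
  define G where "G = {{s<..t} \<times> B | s t B. 0 \<le> s \<and> s < t \<and> t \<le> T \<and> B \<in> sets (F s)} \<union> {{0} \<times> B | B. B \<in> sets (F 0)}"
  let ?\<Omega> = "{0..T} \<times> space M"
  let ?N = "restrict_space (lborel \<Otimes>\<^sub>M M) ?\<Omega>"
  have \<Omega>: "?\<Omega> \<in> sets (lborel \<Otimes>\<^sub>M M)" by auto
  then have \<Omega>': "?\<Omega> \<inter> space (lborel \<Otimes>\<^sub>M M) \<in> sets (lborel \<Otimes>\<^sub>M M)" by auto
  have pr: "predictable_algebra M F T = sigma ?\<Omega> G" by (simp add: predictable_algebra_def G_def)
  have spN: "space ?N = ?\<Omega>" by (auto simp: space_restrict_space space_pair_measure)
  have sub: "sets (sigma ?\<Omega> (G \<inter> Pow ?\<Omega>)) \<subseteq> sets ?N"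
  proof -
    have "G \<inter> Pow ?\<Omega> \<subseteq> sets ?N"
    proof
      fix A assume A: "A \<in> G \<inter> Pow ?\<Omega>"
      then have "A \<in> sets (lborel \<Otimes>\<^sub>M M)"
        using F_sets_M by (auto simp: G_def intro!: pair_measureI)
      then show "A \<in> sets ?N" using A by (auto simp: sets_restrict_space_iff[OF \<Omega>'])
    qed
    then show ?thesis using sets.sigma_sets_subset[of "G \<inter> Pow ?\<Omega>" ?N] by (simp add: spN sets_measure_of)
  qed
  have "f \<in> borel_measurable ?N"
  proof (cases "G \<subseteq> Pow ?\<Omega>")
    case True
    then have "G \<inter> Pow ?\<Omega> = G" by auto
    then have "subalgebra ?N (predictable_algebra M F T)"
      using sub True by (simp add: subalgebra_def pr spN space_measure_of)
    then show ?thesis using f by (rule measurable_from_subalg)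
  next
    \<comment> \<open>This happens for T < 0, where sets {0} \<times> B leave the base set and
      \<open>sigma\<close> collapses to the trivial algebra.\<close>
    case False
    then have "sets (sigma ?\<Omega> G) = {{}, ?\<Omega>}" by (simp add: sets_measure_of_conv)
    then have "subalgebra ?N (predictable_algebra M F T)"
      using sets.top[of ?N] by (simp add: subalgebra_def pr spN space_measure_of_conv)
    then show ?thesis using f by (rule measurable_from_subalg)
  qed
  then have "(\<lambda>z. (indicator ?\<Omega> z :: real) *\<^sub>R f z) \<in> borel_measurable (lborel \<Otimes>\<^sub>M M)"
    by (subst (asm) borel_measurable_restrict_space_iff) (use \<Omega> in auto)
  then show ?thesis
    by (rule measurable_cong[THEN iffD1, rotated]) (auto simp: space_pair_measure split: split_indicator split_indicator_asm)
qed

lemma integrands_process_measurable: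
  assumes \<psi>: "\<psi> \<in> integrands M F Q T" shows "process_measurable T \<psi>"
  unfolding process_measurable_def
proof
  fix n
  have "(\<lambda>(s, \<omega>). \<psi> s \<omega> (R (onb_seq n))) \<in> borel_measurable (predictable_algebra M F T)"
    using \<psi> by (simp add: integrands_def)
  from predictable_measurable_product[OF this]
  show "(\<lambda>(s, \<omega>). (indicator {0..T} s :: real) *\<^sub>R \<psi> s \<omega> (R (onb_seq n))) \<in> borel_measurable (lborel \<Otimes>\<^sub>M M)" by simp
qed

lemma integrands_process_norm_sq: "\<psi> \<in> integrands M F Q T \<Longrightarrow> process_norm_sq T \<psi> < \<infinity>"
  using integrand_norm_sq_eq[OF integrands_process_bounded, of \<psi> T] by (simp add: integrands_def)

text \<open>The operator S(t - s) varies with s, so continuity of each single operator is not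
  enough; joint continuity of (s, y) \<mapsto> S(s) y makes the composition measurable.\<close>

lemma convolution_process_measurable:
  assumes S: "contraction_semigroup S" and m: "process_measurable T \<Psi>" and t: "t \<le> T"
  shows "process_measurable t (\<lambda>s \<omega> x. S (t - s) (\<Psi> s \<omega> x))"
  unfolding process_measurable_def
proof
  fix n
  have [measurable]: "(\<lambda>(s, \<omega>). (indicator {0..T} s :: real) *\<^sub>R \<Psi> s \<omega> (R (onb_seq n))) \<in> borel_measurable (lborel \<Otimes>\<^sub>M M)"
    using m by (simp add: process_measurable_def)
  have "(\<lambda>(s, y). S (max 0 s) y) \<in> borel_measurable borel"
    by (rule borel_measurable_continuous_onI[OF continuous_contraction_semigroup_joint[OF S]])
  then have [measurable]: "(\<lambda>(s, y). S (max 0 s) y) \<in> borel_measurable (borel \<Otimes>\<^sub>M borel)"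
    by (simp add: borel_prod)
  have "(\<lambda>z. (indicator {0..t} (fst z) :: real) *\<^sub>R
      (\<lambda>(s, y). S (max 0 s) y) (t - fst z, (\<lambda>(s, \<omega>). (indicator {0..T} s :: real) *\<^sub>R \<Psi> s \<omega> (R (onb_seq n))) z)) \<in> borel_measurable (lborel \<Otimes>\<^sub>M M)"
    by measurable
  then show "(\<lambda>(s, \<omega>). (indicator {0..t} s :: real) *\<^sub>R S (t - s) (\<Psi> s \<omega> (R (onb_seq n)))) \<in> borel_measurable (lborel \<Otimes>\<^sub>M M)"
    by (rule measurable_cong[THEN iffD1, rotated])
       (use t in \<open>auto simp: space_pair_measure max_def split: split_indicator\<close>)
qed

lemma convolution_process_bounded:
  assumes b: "process_bounded T \<Psi>" and t: "t \<le> T"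
  shows "process_bounded t (\<lambda>s \<omega> x. blinfun_apply (S (t - s)) (\<Psi> s \<omega> x))"
  using b unfolding process_bounded_def
proof (rule eventually_mono)
  fix \<omega> assume "AE s in lborel. s \<in> {0..T} \<longrightarrow> bounded_linear (\<lambda>x. \<Psi> s \<omega> (R x))"
  then show "AE s in lborel. s \<in> {0..t} \<longrightarrow> bounded_linear (\<lambda>x. S (t - s) (\<Psi> s \<omega> (R x)))"
    by (rule eventually_mono) (use t in \<open>auto intro!: bounded_linear_compose[OF blinfun.bounded_linear_right]\<close>)
qed

lemma nn_integral_norm_add_square_le:
  fixes X Y :: "'a \<Rightarrow> 'h"
  assumes [measurable]: "X \<in> borel_measurable M" "Y \<in> borel_measurable M"
  shows "(\<integral>\<^sup>+\<omega>. ennreal ((norm (X \<omega> + Y \<omega>))\<^sup>2) \<partial>M) \<le> 2 * (\<integral>\<^sup>+\<omega>. ennreal ((norm (X \<omega>))\<^sup>2) \<partial>M) + 2 * (\<integral>\<^sup>+\<omega>. ennreal ((norm (Y \<omega>))\<^sup>2) \<partial>M)"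
proof -
  have "(\<integral>\<^sup>+\<omega>. ennreal ((norm (X \<omega> + Y \<omega>))\<^sup>2) \<partial>M) \<le> (\<integral>\<^sup>+\<omega>. 2 * ennreal ((norm (X \<omega>))\<^sup>2) + 2 * ennreal ((norm (Y \<omega>))\<^sup>2) \<partial>M)"
  proof (rule nn_integral_mono)
    fix \<omega>
    have "ennreal ((norm (X \<omega> + Y \<omega>))\<^sup>2) \<le> ennreal (2 * (norm (X \<omega>))\<^sup>2 + 2 * (norm (Y \<omega>))\<^sup>2)"
      by (intro ennreal_leI norm_add_square_le)
    then show "ennreal ((norm (X \<omega> + Y \<omega>))\<^sup>2) \<le> 2 * ennreal ((norm (X \<omega>))\<^sup>2) + 2 * ennreal ((norm (Y \<omega>))\<^sup>2)"
      by (simp add: ennreal_mult)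
  qed
  then show ?thesis by (simp add: nn_integral_add nn_integral_cmult)
qed

text \<open>With the identity semigroup and J = {t}, the maximal inequality bounds the mean square
  distance of two simple integrals by 18 times the distance of the integrands. The size of the
  constant is irrelevant: both approximating sequences converge to \<Psi>, so the distance of X and
  X' is 0.\<close>

lemma is_stoch_integral_unique:
  assumes t: "0 \<le> t" and m: "process_measurable t \<Psi>" and b: "process_bounded t \<Psi>"
    and X: "is_stoch_integral M F L Q t \<Psi> X" and X': "is_stoch_integral M F L Q t \<Psi> X'"
  shows "AE \<omega> in M. X \<omega> = X' \<omega>"
proof -
  have XM[measurable]: "X \<in> borel_measurable M" "X' \<in> borel_measurable M"
    using X X' by (auto simp: is_stoch_integral_def)
  obtain ps where ps: "\<And>n::nat. ps n \<in> simple_integrands F t"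
    "(\<lambda>n. integrand_norm_sq M Q t (\<lambda>s \<omega> x. \<Psi> s \<omega> x - simple_process (ps n) s \<omega> x)) \<longlonglongrightarrow> 0"
    "(\<lambda>n. \<integral>\<^sup>+\<omega>. ennreal ((norm (X \<omega> - simple_integral L (ps n) \<omega>))\<^sup>2) \<partial>M) \<longlonglongrightarrow> 0"
    using X by (auto simp: is_stoch_integral_def)
  obtain qs where qs: "\<And>n::nat. qs n \<in> simple_integrands F t"
    "(\<lambda>n. integrand_norm_sq M Q t (\<lambda>s \<omega> x. \<Psi> s \<omega> x - simple_process (qs n) s \<omega> x)) \<longlonglongrightarrow> 0"
    "(\<lambda>n. \<integral>\<^sup>+\<omega>. ennreal ((norm (X' \<omega> - simple_integral L (qs n) \<omega>))\<^sup>2) \<partial>M) \<longlonglongrightarrow> 0"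
    using X' by (auto simp: is_stoch_integral_def)
  let ?I = "\<lambda>_. id_blinfun :: 'h \<Rightarrow>\<^sub>L 'h"
  have nsq: "integrand_norm_sq M Q t (\<lambda>s \<omega> x. \<Psi> s \<omega> x - simple_process rs s \<omega> x)
      = process_norm_sq t (\<lambda>s \<omega> x. \<Psi> s \<omega> x - simple_process rs s \<omega> x)" for rs :: "('a, 'h) simple_integrand"
    using process_bounded_diff_conv[OF b, of ?I rs] by (intro integrand_norm_sq_eq) (simp add: conv_process_id)
  have sm: "process_measurable t (simple_process rs)" if "rs \<in> simple_integrands F t" for rs
    using process_measurable_conv_process[OF contraction_semigroup_id that] by (simp add: conv_process_id)
  have im: "simple_integral L rs \<in> borel_measurable M" if "rs \<in> simple_integrands F t" for rs
  proof -
    have "conv_simple ?I L rs t = simple_integral L rs" by (rule ext) (rule conv_simple_id[OF that])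
    then show ?thesis using conv_simple_measurable_M[OF t that, of ?I] by (simp only:)
  qed
  define a where "a n = (\<integral>\<^sup>+\<omega>. ennreal ((norm (X \<omega> - simple_integral L (ps n) \<omega>))\<^sup>2) \<partial>M)" for n
  define b' where "b' n = (\<integral>\<^sup>+\<omega>. ennreal ((norm (X' \<omega> - simple_integral L (qs n) \<omega>))\<^sup>2) \<partial>M)" for n
  define c where "c n = process_norm_sq t (\<lambda>s \<omega> x. \<Psi> s \<omega> x - simple_process (ps n) s \<omega> x)" for n
  define e where "e n = process_norm_sq t (\<lambda>s \<omega> x. \<Psi> s \<omega> x - simple_process (qs n) s \<omega> x)" for n
  have bound: "(\<integral>\<^sup>+\<omega>. ennreal ((norm (X \<omega> - X' \<omega>))\<^sup>2) \<partial>M) \<le> 2 * a n + 2 * (2 * (18 * (2 * c n + 2 * e n)) + 2 * b' n)" for n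
  proof -
    have [measurable]: "simple_integral L (ps n) \<in> borel_measurable M" "simple_integral L (qs n) \<in> borel_measurable M"
      using im ps qs by auto
    have rs: "ps n @ neg_simple (qs n) \<in> simple_integrands F t"
      using ps(1) qs(1) by (simp add: simple_integrands_append simple_integrands_neg)
    have "(\<integral>\<^sup>+\<omega>. (SUP r\<in>{t}. ennreal ((norm (conv_simple ?I L (ps n @ neg_simple (qs n)) r \<omega>))\<^sup>2)) \<partial>M)
        \<le> 18 * process_norm_sq t (conv_process ?I (ps n @ neg_simple (qs n)))"
      by (rule conv_simple_maximal[OF contraction_semigroup_id rs t]) (use t in auto)
    then have 1: "(\<integral>\<^sup>+\<omega>. ennreal ((norm (simple_integral L (ps n) \<omega> - simple_integral L (qs n) \<omega>))\<^sup>2) \<partial>M)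
        \<le> 18 * process_norm_sq t (\<lambda>s \<omega> x. simple_process (ps n) s \<omega> x - simple_process (qs n) s \<omega> x)"
    proof -
      have "conv_process ?I (ps n @ neg_simple (qs n)) = (\<lambda>s \<omega> x. simple_process (ps n) s \<omega> x - simple_process (qs n) s \<omega> x)"
        unfolding conv_process_id[symmetric] by (intro ext) (simp add: conv_process_append conv_process_neg)
      moreover have "conv_simple ?I L (ps n @ neg_simple (qs n)) t \<omega> = simple_integral L (ps n) \<omega> - simple_integral L (qs n) \<omega>" for \<omega>
        by (simp add: conv_simple_append conv_simple_neg conv_simple_id[OF ps(1)] conv_simple_id[OF qs(1)])
      ultimately show ?thesis
        using \<open>(\<integral>\<^sup>+\<omega>. (SUP r\<in>{t}. _ r \<omega>) \<partial>M) \<le> _\<close> by simp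
    qed
    have 2: "process_norm_sq t (\<lambda>s \<omega> x. simple_process (ps n) s \<omega> x - simple_process (qs n) s \<omega> x) \<le> 2 * c n + 2 * e n"
      unfolding c_def e_def process_norm_sq_commute[of t \<Psi> "simple_process (ps n)"]
      by (rule process_norm_sq_triangle) (use sm ps qs m in auto)
    have "(\<integral>\<^sup>+\<omega>. ennreal ((norm (X \<omega> - X' \<omega>))\<^sup>2) \<partial>M)
        \<le> 2 * a n + 2 * (\<integral>\<^sup>+\<omega>. ennreal ((norm (simple_integral L (ps n) \<omega> - X' \<omega>))\<^sup>2) \<partial>M)"
      unfolding a_def
      using nn_integral_norm_add_square_le[of "\<lambda>\<omega>. X \<omega> - simple_integral L (ps n) \<omega>" "\<lambda>\<omega>. simple_integral L (ps n) \<omega> - X' \<omega>"] by simp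
    also have "(\<integral>\<^sup>+\<omega>. ennreal ((norm (simple_integral L (ps n) \<omega> - X' \<omega>))\<^sup>2) \<partial>M)
        \<le> 2 * (\<integral>\<^sup>+\<omega>. ennreal ((norm (simple_integral L (ps n) \<omega> - simple_integral L (qs n) \<omega>))\<^sup>2) \<partial>M) + 2 * b' n"
      unfolding b'_def
      using nn_integral_norm_add_square_le[of "\<lambda>\<omega>. simple_integral L (ps n) \<omega> - simple_integral L (qs n) \<omega>" "\<lambda>\<omega>. simple_integral L (qs n) \<omega> - X' \<omega>"]
      by (simp add: norm_minus_commute)
    also have "(\<integral>\<^sup>+\<omega>. ennreal ((norm (simple_integral L (ps n) \<omega> - simple_integral L (qs n) \<omega>))\<^sup>2) \<partial>M) \<le> 18 * (2 * c n + 2 * e n)"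
      using 1 2 by (meson mult_left_mono order_trans zero_le)
    finally show ?thesis by (simp add: add_left_mono mult_left_mono add_right_mono)
  qed
  have "(\<lambda>n. 2 * a n + 2 * (2 * (18 * (2 * c n + 2 * e n)) + 2 * b' n)) \<longlonglongrightarrow> 2 * 0 + 2 * (2 * (18 * (2 * 0 + 2 * 0)) + 2 * 0)"
    using ps(2,3) qs(2,3) unfolding nsq
    by (intro tendsto_add tendsto_mult_ennreal tendsto_const) (auto simp: a_def b'_def c_def e_def)
  then have "(\<integral>\<^sup>+\<omega>. ennreal ((norm (X \<omega> - X' \<omega>))\<^sup>2) \<partial>M) \<le> 0"
    by (intro LIMSEQ_le_const[of _ 0]) (use bound in auto)
  then have "AE \<omega> in M. ennreal ((norm (X \<omega> - X' \<omega>))\<^sup>2) = 0"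
    by (subst nn_integral_0_iff_AE[symmetric]) auto
  then show ?thesis by (rule eventually_mono) (simp add: ennreal_eq_0_iff)
qed

text \<open>The truncations serve as approximating simple processes on [0,t]. Their error is the
  error of \<open>conv_process S (ps n)\<close> after applying S(t - s), so by contractivity one
  sequence \<open>ps\<close> works for every t.\<close>

lemma is_stoch_integral_convolution:
  assumes S: "contraction_semigroup S" and b: "process_bounded T \<psi>"
    and t: "0 \<le> t" "t \<le> T" and ps: "\<And>n::nat. ps n \<in> simple_integrands F T"
    and lim: "(\<lambda>n. process_norm_sq T (\<lambda>s \<omega> x. \<psi> s \<omega> x - conv_process S (ps n) s \<omega> x)) \<longlonglongrightarrow> 0"
    and X: "X \<in> borel_measurable M" "(\<lambda>n. \<integral>\<^sup>+\<omega>. ennreal ((norm (X \<omega> - conv_simple S L (ps n) t \<omega>))\<^sup>2) \<partial>M) \<longlonglongrightarrow> 0"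
  shows "is_stoch_integral M F L Q t (\<lambda>s \<omega> x. S (t - s) (\<psi> s \<omega> x)) X"
  unfolding is_stoch_integral_def
proof (intro conjI exI[of _ "\<lambda>n. truncate_simple S t (ps n)"] allI)
  show "truncate_simple S t (ps n) \<in> simple_integrands F t" for n
    by (rule truncate_simple_integrands[OF ps])
  show "(\<lambda>n. \<integral>\<^sup>+\<omega>. ennreal ((norm (X \<omega> - simple_integral L (truncate_simple S t (ps n)) \<omega>))\<^sup>2) \<partial>M) \<longlonglongrightarrow> 0"
    using X(2) by (simp add: simple_integral_truncate[OF ps])
  show "(\<lambda>n. integrand_norm_sq M Q t (\<lambda>s \<omega> x. S (t - s) (\<psi> s \<omega> x) - simple_process (truncate_simple S t (ps n)) s \<omega> x)) \<longlonglongrightarrow> 0"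
  proof (rule tendsto_sandwich[OF _ _ tendsto_const lim])
    show "\<forall>\<^sub>F n in sequentially. integrand_norm_sq M Q t (\<lambda>s \<omega> x. S (t - s) (\<psi> s \<omega> x) - simple_process (truncate_simple S t (ps n)) s \<omega> x)
        \<le> process_norm_sq T (\<lambda>s \<omega> x. \<psi> s \<omega> x - conv_process S (ps n) s \<omega> x)"
    proof (intro always_eventually allI)
      fix n
      let ?\<Psi> = "\<lambda>s \<omega> x. S (t - s) (\<psi> s \<omega> x) - simple_process (truncate_simple S t (ps n)) s \<omega> x"
      have "process_bounded t ?\<Psi>"
        using process_bounded_diff_conv[OF convolution_process_bounded[OF b t(2)], of S "\<lambda>_. id_blinfun" "truncate_simple S t (ps n)"]
        by (simp add: conv_process_id)
      then have "integrand_norm_sq M Q t ?\<Psi> = process_norm_sq t ?\<Psi>" by (rule integrand_norm_sq_eq)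
      also have "\<dots> \<le> process_norm_sq T (\<lambda>s \<omega> x. \<psi> s \<omega> x - conv_process S (ps n) s \<omega> x)"
      proof (rule process_norm_sq_mono[OF t(2)])
        fix s \<omega> k assume s: "0 \<le> s" "s \<le> t"
        show "norm (?\<Psi> s \<omega> (R (onb_seq k))) \<le> norm (\<psi> s \<omega> (R (onb_seq k)) - conv_process S (ps n) s \<omega> (R (onb_seq k)))"
          using s by (simp add: simple_process_truncate[OF S] blinfun.diff_right[symmetric] contraction_semigroup_norm_le[OF S])
      qed
      finally show "integrand_norm_sq M Q t ?\<Psi> \<le> process_norm_sq T (\<lambda>s \<omega> x. \<psi> s \<omega> x - conv_process S (ps n) s \<omega> x)" .
    qed
  qed simp
qed (rule X)

end

subsection \<open>Approximation of predictable functions by step functions\<close>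

definition step_function :: "(real \<times> real \<times> 'a set \<times> real) list \<Rightarrow> real \<times> 'a \<Rightarrow> real" where
  "step_function rs z = (\<Sum>(a, b, B, r)\<leftarrow>rs. r * indicator ({a<..b} \<times> B) z)"

definition step_lists :: "(real \<Rightarrow> 'a measure) \<Rightarrow> real \<Rightarrow> (real \<times> real \<times> 'a set \<times> real) list set" where
  "step_lists F T = {rs. \<forall>(a, b, B, r)\<in>set rs. 0 \<le> a \<and> a < b \<and> b \<le> T \<and> B \<in> sets (F a)}"

lemma step_function_simps:
  "step_function [] z = 0"
  "step_function ((a, b, B, r) # rs) z = r * indicator ({a<..b} \<times> B) z + step_function rs z"
  by (simp_all add: step_function_def)

lemma step_function_append: "step_function (rs @ qs) z = step_function rs z + step_function qs z"
  by (simp add: step_function_def)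

lemma step_function_scale:
  "step_function (map (\<lambda>(a, b, B, r). (a, b, B, c * r)) rs) z = c * step_function rs z"
  by (induction rs) (auto simp: step_function_def algebra_simps)

lemma step_lists_append: "rs @ qs \<in> step_lists F T \<longleftrightarrow> rs \<in> step_lists F T \<and> qs \<in> step_lists F T"
  by (simp add: step_lists_def ball_Un)

text \<open>The accounting for every approximation in two stages, each with error \<epsilon> / 4 and
  each doubled by (x + y)^2 \<le> 2 x^2 + 2 y^2.\<close>

lemma ennreal_quarters: assumes "0 \<le> \<epsilon>" shows "2 * ennreal (\<epsilon> / 4) + 2 * ennreal (\<epsilon> / 4) = ennreal \<epsilon>"
proof -
  have "2 * ennreal (\<epsilon> / 4) = ennreal (\<epsilon> / 2)" using ennreal_mult'[of 2 "\<epsilon> / 4"] by simp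
  then show ?thesis using assms by (simp add: ennreal_plus[symmetric] del: ennreal_plus)
qed

context levy_setting
begin

definition time_prob :: "real \<Rightarrow> (real \<times> 'a) measure" where
  "time_prob T = restrict_space lborel {0..T} \<Otimes>\<^sub>M M"

lemma space_time_prob: "space (time_prob T) = {0..T} \<times> space M"
  by (simp add: time_prob_def space_pair_measure space_restrict_space)

lemma time_prob_rectangle:
  assumes "A \<in> sets borel" "A \<subseteq> {0..T}" "B \<in> sets M"
  shows "A \<times> B \<in> sets (time_prob T)" "emeasure (time_prob T) (A \<times> B) = emeasure lborel A * emeasure M B"
proof -
  have A: "A \<in> sets (restrict_space lborel {0..T})" using assms by (auto simp: sets_restrict_space_iff)
  show "A \<times> B \<in> sets (time_prob T)" unfolding time_prob_def using A assms by auto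
  have "emeasure (time_prob T) (A \<times> B) = emeasure (restrict_space lborel {0..T}) A * emeasure M B"
    unfolding time_prob_def by (rule emeasure_pair_measure_Times[OF A assms(3)])
  also have "emeasure (restrict_space lborel {0..T}) A = emeasure lborel A"
    using assms by (intro emeasure_restrict_space) auto
  finally show "emeasure (time_prob T) (A \<times> B) = emeasure lborel A * emeasure M B" .
qed

lemma emeasure_time_prob_finite: "emeasure (time_prob T) (space (time_prob T)) < \<infinity>"
proof -
  have "emeasure (time_prob T) ({0..T} \<times> space M) = emeasure lborel {0..T} * emeasure M (space M)"
    by (rule time_prob_rectangle) auto
  then show ?thesis by (simp add: space_time_prob emeasure_space_1 emeasure_lborel_Icc_eq)
qed

lemma predictable_generator:
  "space (predictable_algebra M F T) = {0..T} \<times> space M"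
  "sets (predictable_algebra M F T) = sigma_sets ({0..T} \<times> space M)
    ({{s<..t} \<times> B | s t B. 0 \<le> s \<and> s < t \<and> t \<le> T \<and> B \<in> sets (F s)} \<union> {{0} \<times> B | B. B \<in> sets (F 0)})" if "0 \<le> T"
proof -
  have "{{s<..t} \<times> B | s t B. 0 \<le> s \<and> s < t \<and> t \<le> T \<and> B \<in> sets (F s)} \<union> {{0} \<times> B | B. B \<in> sets (F 0)}
      \<subseteq> Pow ({0..T} \<times> space M)"
    using F_sets_M[THEN sets.sets_into_space] that by fastforce
  then show "space (predictable_algebra M F T) = {0..T} \<times> space M"
    "sets (predictable_algebra M F T) = sigma_sets ({0..T} \<times> space M)
    ({{s<..t} \<times> B | s t B. 0 \<le> s \<and> s < t \<and> t \<le> T \<and> B \<in> sets (F s)} \<union> {{0} \<times> B | B. B \<in> sets (F 0)})"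
    unfolding predictable_algebra_def by (simp_all add: sets_measure_of space_measure_of)
qed

lemma predictable_subalgebra: assumes T: "0 \<le> T" shows "subalgebra (time_prob T) (predictable_algebra M F T)"
proof -
  have "{{s<..t} \<times> B | s t B. 0 \<le> s \<and> s < t \<and> t \<le> T \<and> B \<in> sets (F s)} \<union> {{0} \<times> B | B. B \<in> sets (F 0)} \<subseteq> sets (time_prob T)"
  proof -
    have "{s<..t} \<times> B \<in> sets (time_prob T)" if "0 \<le> s" "t \<le> T" "B \<in> sets (F s)" for s t B
      by (rule time_prob_rectangle) (use that F_sets_M in auto)
    moreover have "{0} \<times> B \<in> sets (time_prob T)" if "B \<in> sets (F 0)" for B
      by (rule time_prob_rectangle) (use that F_sets_M[of 0] T in auto)
    ultimately show ?thesis by blast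
  qed
  then have "sigma_sets (space (time_prob T)) ({{s<..t} \<times> B | s t B. 0 \<le> s \<and> s < t \<and> t \<le> T \<and> B \<in> sets (F s)} \<union> {{0} \<times> B | B. B \<in> sets (F 0)})
      \<subseteq> sets (time_prob T)"
    by (rule sets.sigma_sets_subset)
  then show ?thesis by (simp add: subalgebra_def predictable_generator[OF T] space_time_prob)
qed

lemma step_function_measurable[measurable]:
  assumes "rs \<in> step_lists F T"
  shows "step_function rs \<in> borel_measurable (time_prob T)"
  using assms
proof (induction rs)
  case Nil
  then show ?case by (simp add: step_function_simps[abs_def])
next
  case (Cons p rs)
  obtain a b B r where p: "p = (a, b, B, r)" by (cases p)
  have a: "0 \<le> a" "b \<le> T" "B \<in> sets (F a)" and IH[measurable]: "step_function rs \<in> borel_measurable (time_prob T)"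
    using Cons by (auto simp: p step_lists_def)
  have [measurable]: "{a<..b} \<times> B \<in> sets (time_prob T)"
    by (rule time_prob_rectangle) (use a F_sets_M in auto)
  show ?case unfolding p step_function_simps[abs_def] by measurable
qed

text \<open>The L^2 closure of the predictable step functions.\<close>

definition step_approximable :: "real \<Rightarrow> (real \<times> 'a \<Rightarrow> real) \<Rightarrow> bool" where
  "step_approximable T c \<longleftrightarrow> c \<in> borel_measurable (time_prob T) \<and>
    (\<forall>\<epsilon>>0. \<exists>rs\<in>step_lists F T. (\<integral>\<^sup>+z. ennreal ((c z - step_function rs z)\<^sup>2) \<partial>time_prob T) \<le> ennreal \<epsilon>)"

lemma nn_integral_square_add_le:
  fixes f g :: "'b \<Rightarrow> real"
  assumes [measurable]: "f \<in> borel_measurable N" "g \<in> borel_measurable N"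
  shows "(\<integral>\<^sup>+z. ennreal ((f z + g z)\<^sup>2) \<partial>N) \<le> 2 * (\<integral>\<^sup>+z. ennreal ((f z)\<^sup>2) \<partial>N) + 2 * (\<integral>\<^sup>+z. ennreal ((g z)\<^sup>2) \<partial>N)"
proof -
  have "(\<integral>\<^sup>+z. ennreal ((f z + g z)\<^sup>2) \<partial>N) \<le> (\<integral>\<^sup>+z. 2 * ennreal ((f z)\<^sup>2) + 2 * ennreal ((g z)\<^sup>2) \<partial>N)"
  proof (rule nn_integral_mono)
    fix z
    have "ennreal ((f z + g z)\<^sup>2) \<le> ennreal (2 * (f z)\<^sup>2 + 2 * (g z)\<^sup>2)"
      using norm_add_square_le[of "f z" "g z"] by (intro ennreal_leI) simp
    then show "ennreal ((f z + g z)\<^sup>2) \<le> 2 * ennreal ((f z)\<^sup>2) + 2 * ennreal ((g z)\<^sup>2)"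
      by (simp add: ennreal_mult)
  qed
  then show ?thesis by (simp add: nn_integral_add nn_integral_cmult)
qed

lemma step_approximable_limit:
  assumes c[measurable]: "c \<in> borel_measurable (time_prob T)"
    and lim: "\<And>\<epsilon>::real. \<epsilon> > 0 \<Longrightarrow> \<exists>d. step_approximable T d \<and> (\<integral>\<^sup>+z. ennreal ((c z - d z)\<^sup>2) \<partial>time_prob T) \<le> ennreal \<epsilon>"
  shows "step_approximable T c"
  unfolding step_approximable_def
proof (intro conjI c allI impI)
  fix \<epsilon> :: real assume \<epsilon>: "\<epsilon> > 0"
  obtain d where d: "step_approximable T d" "(\<integral>\<^sup>+z. ennreal ((c z - d z)\<^sup>2) \<partial>time_prob T) \<le> ennreal (\<epsilon> / 4)"
    using lim[of "\<epsilon> / 4"] \<epsilon> by auto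
  then obtain rs where rs: "rs \<in> step_lists F T" "(\<integral>\<^sup>+z. ennreal ((d z - step_function rs z)\<^sup>2) \<partial>time_prob T) \<le> ennreal (\<epsilon> / 4)"
    using \<epsilon> unfolding step_approximable_def by (meson divide_pos_pos zero_less_numeral)
  have [measurable]: "d \<in> borel_measurable (time_prob T)" "step_function rs \<in> borel_measurable (time_prob T)"
    using d rs by (auto simp: step_approximable_def)
  have "(\<integral>\<^sup>+z. ennreal ((c z - step_function rs z)\<^sup>2) \<partial>time_prob T)
      \<le> 2 * (\<integral>\<^sup>+z. ennreal ((c z - d z)\<^sup>2) \<partial>time_prob T) + 2 * (\<integral>\<^sup>+z. ennreal ((d z - step_function rs z)\<^sup>2) \<partial>time_prob T)"
    using nn_integral_square_add_le[of "\<lambda>z. c z - d z" "time_prob T" "\<lambda>z. d z - step_function rs z"] by simp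
  also have "\<dots> \<le> 2 * ennreal (\<epsilon> / 4) + 2 * ennreal (\<epsilon> / 4)"
    using d rs by (intro add_mono mult_left_mono) auto
  also have "\<dots> = ennreal \<epsilon>" using \<epsilon> by (intro ennreal_quarters) simp
  finally show "\<exists>rs\<in>step_lists F T. (\<integral>\<^sup>+z. ennreal ((c z - step_function rs z)\<^sup>2) \<partial>time_prob T) \<le> ennreal \<epsilon>"
    using rs(1) by auto
qed

lemma step_approximable_dominated:
  assumes c[measurable]: "c \<in> borel_measurable (time_prob T)" and d: "\<And>i::nat. step_approximable T (d i)"
    and lim: "\<And>z. z \<in> space (time_prob T) \<Longrightarrow> (\<lambda>i. d i z) \<longlonglongrightarrow> c z"
    and dom: "\<And>i z. z \<in> space (time_prob T) \<Longrightarrow> \<bar>c z - d i z\<bar> \<le> w z"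
    and w[measurable]: "w \<in> borel_measurable (time_prob T)" and wi: "(\<integral>\<^sup>+z. ennreal ((w z)\<^sup>2) \<partial>time_prob T) < \<infinity>"
  shows "step_approximable T c"
proof (rule step_approximable_limit[OF c])
  fix \<epsilon> :: real assume \<epsilon>: "\<epsilon> > 0"
  have [measurable]: "d i \<in> borel_measurable (time_prob T)" for i using d by (simp add: step_approximable_def)
  have "(\<lambda>i. \<integral>\<^sup>+z. ennreal ((c z - d i z)\<^sup>2) \<partial>time_prob T) \<longlonglongrightarrow> (\<integral>\<^sup>+z. 0 \<partial>time_prob T)"
  proof (rule nn_integral_dominated_convergence[where w = "\<lambda>z. ennreal ((w z)\<^sup>2)"])
    show "AE z in time_prob T. (\<lambda>i. ennreal ((c z - d i z)\<^sup>2)) \<longlonglongrightarrow> 0"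
    proof (rule AE_I2)
      fix z assume z: "z \<in> space (time_prob T)"
      have "(\<lambda>i. ennreal ((c z - d i z)\<^sup>2)) \<longlonglongrightarrow> ennreal ((c z - c z)\<^sup>2)"
        by (intro tendsto_ennrealI tendsto_power tendsto_diff tendsto_const lim z)
      then show "(\<lambda>i. ennreal ((c z - d i z)\<^sup>2)) \<longlonglongrightarrow> 0" by simp
    qed
    show "AE z in time_prob T. ennreal ((c z - d i z)\<^sup>2) \<le> ennreal ((w z)\<^sup>2)" for i
    proof (rule AE_I2)
      fix z assume z: "z \<in> space (time_prob T)"
      have "(\<bar>c z - d i z\<bar>)\<^sup>2 \<le> (w z)\<^sup>2" by (rule power_mono[OF dom[OF z]]) simp
      then show "ennreal ((c z - d i z)\<^sup>2) \<le> ennreal ((w z)\<^sup>2)" by (intro ennreal_leI) simp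
    qed
  qed (use wi in simp_all)
  then have "\<forall>\<^sub>F i in sequentially. (\<integral>\<^sup>+z. ennreal ((c z - d i z)\<^sup>2) \<partial>time_prob T) < ennreal \<epsilon>"
    using \<epsilon> by (intro order_tendstoD(2)[of _ 0]) auto
  then obtain i where "(\<integral>\<^sup>+z. ennreal ((c z - d i z)\<^sup>2) \<partial>time_prob T) < ennreal \<epsilon>"
    by (auto simp: eventually_sequentially)
  then show "\<exists>d. step_approximable T d \<and> (\<integral>\<^sup>+z. ennreal ((c z - d z)\<^sup>2) \<partial>time_prob T) \<le> ennreal \<epsilon>"
    using d less_imp_le by blast
qed

lemma step_approximable_add:
  assumes c: "step_approximable T c" and d: "step_approximable T d"
  shows "step_approximable T (\<lambda>z. c z + d z)"
  unfolding step_approximable_def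
proof (intro conjI allI impI)
  have [measurable]: "c \<in> borel_measurable (time_prob T)" "d \<in> borel_measurable (time_prob T)"
    using c d by (auto simp: step_approximable_def)
  show "(\<lambda>z. c z + d z) \<in> borel_measurable (time_prob T)" by measurable
  fix \<epsilon> :: real assume \<epsilon>: "\<epsilon> > 0"
  obtain rs where rs: "rs \<in> step_lists F T" "(\<integral>\<^sup>+z. ennreal ((c z - step_function rs z)\<^sup>2) \<partial>time_prob T) \<le> ennreal (\<epsilon> / 4)"
    using c \<epsilon> unfolding step_approximable_def by (meson divide_pos_pos zero_less_numeral)
  obtain qs where qs: "qs \<in> step_lists F T" "(\<integral>\<^sup>+z. ennreal ((d z - step_function qs z)\<^sup>2) \<partial>time_prob T) \<le> ennreal (\<epsilon> / 4)"
    using d \<epsilon> unfolding step_approximable_def by (meson divide_pos_pos zero_less_numeral)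
  have [measurable]: "step_function rs \<in> borel_measurable (time_prob T)" "step_function qs \<in> borel_measurable (time_prob T)"
    using rs qs by auto
  have "(\<integral>\<^sup>+z. ennreal ((c z + d z - step_function (rs @ qs) z)\<^sup>2) \<partial>time_prob T)
      \<le> 2 * (\<integral>\<^sup>+z. ennreal ((c z - step_function rs z)\<^sup>2) \<partial>time_prob T) + 2 * (\<integral>\<^sup>+z. ennreal ((d z - step_function qs z)\<^sup>2) \<partial>time_prob T)"
    using nn_integral_square_add_le[of "\<lambda>z. c z - step_function rs z" "time_prob T" "\<lambda>z. d z - step_function qs z"]
    by (simp add: step_function_append algebra_simps)
  also have "\<dots> \<le> 2 * ennreal (\<epsilon> / 4) + 2 * ennreal (\<epsilon> / 4)"
    using rs qs by (intro add_mono mult_left_mono) auto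
  also have "\<dots> = ennreal \<epsilon>" using \<epsilon> by (intro ennreal_quarters) simp
  finally show "\<exists>rs\<in>step_lists F T. (\<integral>\<^sup>+z. ennreal ((c z + d z - step_function rs z)\<^sup>2) \<partial>time_prob T) \<le> ennreal \<epsilon>"
    using rs qs by (intro bexI[of _ "rs @ qs"]) (auto simp: step_lists_append)
qed

lemma step_approximable_zero: "step_approximable T (\<lambda>_. 0)"
  unfolding step_approximable_def
  by (intro conjI allI impI bexI[of _ "[]"]) (auto simp: step_function_simps step_lists_def)

lemma step_approximable_scale:
  assumes c: "step_approximable T c"
  shows "step_approximable T (\<lambda>z. r * c z)"
proof (cases "r = 0")
  case True
  then show ?thesis using step_approximable_zero by simp
next
  case False
  have [measurable]: "c \<in> borel_measurable (time_prob T)" using c by (auto simp: step_approximable_def)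
  show ?thesis
    unfolding step_approximable_def
  proof (intro conjI allI impI)
    show "(\<lambda>z. r * c z) \<in> borel_measurable (time_prob T)" by measurable
    fix \<epsilon> :: real assume \<epsilon>: "\<epsilon> > 0"
    then have "\<epsilon> / r\<^sup>2 > 0" using False by simp
    then obtain rs where rs: "rs \<in> step_lists F T" "(\<integral>\<^sup>+z. ennreal ((c z - step_function rs z)\<^sup>2) \<partial>time_prob T) \<le> ennreal (\<epsilon> / r\<^sup>2)"
      using c unfolding step_approximable_def by meson
    have [measurable]: "step_function rs \<in> borel_measurable (time_prob T)" using rs by auto
    define qs where "qs = map (\<lambda>(a, b, B, r'). (a, b, B, r * r')) rs"
    have qs: "qs \<in> step_lists F T" using rs(1) by (fastforce simp: qs_def step_lists_def)
    have "(\<integral>\<^sup>+z. ennreal ((r * c z - step_function qs z)\<^sup>2) \<partial>time_prob T) = (\<integral>\<^sup>+z. ennreal (r\<^sup>2) * ennreal ((c z - step_function rs z)\<^sup>2) \<partial>time_prob T)"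
      by (intro nn_integral_cong)
         (simp add: qs_def step_function_scale ennreal_mult[symmetric] power_mult_distrib[symmetric] right_diff_distrib)
    also have "\<dots> = ennreal (r\<^sup>2) * (\<integral>\<^sup>+z. ennreal ((c z - step_function rs z)\<^sup>2) \<partial>time_prob T)"
      by (rule nn_integral_cmult) measurable
    also have "\<dots> \<le> ennreal (r\<^sup>2) * ennreal (\<epsilon> / r\<^sup>2)" using rs by (intro mult_left_mono) auto
    also have "\<dots> = ennreal \<epsilon>" using False \<epsilon> by (simp add: ennreal_mult[symmetric])
    finally show "\<exists>rs\<in>step_lists F T. (\<integral>\<^sup>+z. ennreal ((r * c z - step_function rs z)\<^sup>2) \<partial>time_prob T) \<le> ennreal \<epsilon>"
      using qs by auto
  qed
qed

lemma step_approximable_sum: "finite I \<Longrightarrow> (\<And>i. i \<in> I \<Longrightarrow> step_approximable T (f i)) \<Longrightarrow> step_approximable T (\<lambda>z. \<Sum>i\<in>I. f i z)"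
  by (induction I rule: finite_induct) (auto intro: step_approximable_zero step_approximable_add)

lemma step_approximable_exact:
  assumes "rs \<in> step_lists F T" "c \<in> borel_measurable (time_prob T)" "AE z in time_prob T. c z = step_function rs z"
  shows "step_approximable T c"
proof -
  have "(\<integral>\<^sup>+z. ennreal ((c z - step_function rs z)\<^sup>2) \<partial>time_prob T) = (\<integral>\<^sup>+z. 0 \<partial>time_prob T)"
    using assms(3) by (intro nn_integral_cong_AE) (auto elim: eventually_mono)
  then show ?thesis
    unfolding step_approximable_def by (intro conjI allI impI bexI[of _ rs] assms) simp
qed

text \<open>Step functions vanish at time 0, while the predictable algebra contains the sets {0}
  \<times> B; these are null for the product measure and can be ignored.\<close>

lemma time_zero_null: assumes "0 \<le> T" "B \<in> sets M" shows "AE z in time_prob T. z \<notin> {0} \<times> B"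
proof -
  have "{0} \<times> B \<in> null_sets (time_prob T)"
    using time_prob_rectangle[of "{0}" T B] assms by (auto simp: null_sets_def)
  then show ?thesis by (rule AE_not_in)
qed

text \<open>Dynkin's argument: the generators are stable under intersection, and the sets with
  approximable indicator are closed under complements and countable disjoint unions.\<close>

lemma step_approximable_predictable_set:
  assumes T: "0 < T" and A: "A \<in> sets (predictable_algebra M F T)"
  shows "step_approximable T (indicator A)"
proof -
  let ?\<Omega> = "{0..T} \<times> space M"
  define G where "G = {{s<..t} \<times> B | s t B. 0 \<le> s \<and> s < t \<and> t \<le> T \<and> B \<in> sets (F s)} \<union> {{0} \<times> B | B. B \<in> sets (F 0)}"
  note pr = predictable_generator[OF less_imp_le[OF T], folded G_def]
  have sub: "A \<in> sigma_sets ?\<Omega> G \<Longrightarrow> A \<in> sets (time_prob T)" for A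
    using predictable_subalgebra[OF less_imp_le[OF T]] by (auto simp: subalgebra_def pr)
  have G_Pow: "G \<subseteq> Pow ?\<Omega>"
    unfolding G_def using F_sets_M[THEN sets.sets_into_space] T by fastforce
  have G_Int: "Int_stable G"
  proof (rule Int_stableI)
    fix X Y assume "X \<in> G" "Y \<in> G"
    have e: "{} \<in> G" unfolding G_def by (rule UnI2) (auto intro!: exI[of _ "{}"])
    consider (1) s t B s' t' B' where "X = {s<..t} \<times> B" "Y = {s'<..t'} \<times> B'" "0 \<le> s" "t \<le> T" "B \<in> sets (F s)" "0 \<le> s'" "t' \<le> T" "B' \<in> sets (F s')"
      | (2) B B' where "X = {0} \<times> B" "Y = {0} \<times> B'" "B \<in> sets (F 0)" "B' \<in> sets (F 0)"
      | (3) "X \<inter> Y = {}"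
      using \<open>X \<in> G\<close> \<open>Y \<in> G\<close> unfolding G_def by fastforce
    then show "X \<inter> Y \<in> G"
    proof cases
      case 1
      show ?thesis
      proof (cases "max s s' < min t t'")
        case True
        have "B \<inter> B' \<in> sets (F (max s s'))"
          using 1 F_mono[of s "max s s'"] F_mono[of s' "max s s'"] by auto
        moreover have "X \<inter> Y = {max s s'<..min t t'} \<times> (B \<inter> B')" using 1 by auto
        ultimately show ?thesis using True 1 unfolding G_def
          by (intro UnI1 CollectI exI[of _ "max s s'"] exI[of _ "min t t'"] exI[of _ "B \<inter> B'"]) auto
      next
        case False
        then have "X \<inter> Y = {}" using 1 by auto
        then show ?thesis using e by simp
      qed
    next
      case 2
      have "X \<inter> Y = {0} \<times> (B \<inter> B')" "B \<inter> B' \<in> sets (F 0)" using 2 by auto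
      then show ?thesis unfolding G_def by blast
    qed (use e in simp)
  qed
  have A': "A \<in> sigma_sets ?\<Omega> G" using A by (simp add: pr)
  \<comment> \<open>The indicator of the whole space is a step function except at time 0.\<close>
  have one: "step_approximable T (indicator ?\<Omega>)"
  proof (rule step_approximable_exact[of "[(0, T, space M, 1)]"])
    show "[(0, T, space M, 1)] \<in> step_lists F T"
      using T F_sub[of 0] sets.top[of "F 0"] by (simp add: step_lists_def subalgebra_def)
    show "indicator ?\<Omega> \<in> borel_measurable (time_prob T)"
      using sub[OF sigma_sets_top] by (rule borel_measurable_indicator)
    show "AE z in time_prob T. indicator ?\<Omega> z = step_function [(0, T, space M, 1)] z"
      using time_zero_null[OF less_imp_le[OF T] sets.top] AE_space
      by eventually_elim (auto simp: step_function_simps space_time_prob split: split_indicator)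
  qed
  from G_Int G_Pow A' show ?thesis
  proof (induction rule: sigma_sets_induct_disjoint)
    case (basic A)
    then consider s t B where "A = {s<..t} \<times> B" "0 \<le> s" "s < t" "t \<le> T" "B \<in> sets (F s)" | B where "A = {0} \<times> B" "B \<in> sets (F 0)"
      unfolding G_def by blast
    then show ?case
    proof cases
      case 1
      show ?thesis
        by (rule step_approximable_exact[of "[(s, t, B, 1)]"])
           (use 1 basic in \<open>auto simp: step_lists_def step_function_simps intro!: borel_measurable_indicator sub\<close>)
    next
      case 2
      show ?thesis
      proof (rule step_approximable_exact[of "[]"])
        show "AE z in time_prob T. indicator A z = step_function [] z"
          using time_zero_null[of T B] T 2 F_sets_M[of 0 B] by (auto simp: step_function_simps elim!: eventually_mono split: split_indicator)
        show "indicator A \<in> borel_measurable (time_prob T)"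
          using basic by (intro borel_measurable_indicator sub) auto
      qed (simp add: step_lists_def)
    qed
  next
    case empty
    then show ?case using step_approximable_zero by simp
  next
    case (compl A)
    have "A \<subseteq> ?\<Omega>" using sigma_sets_into_sp[OF G_Pow compl(1)] .
    then have "(indicator (?\<Omega> - A) :: _ \<Rightarrow> real) = (\<lambda>z. indicator ?\<Omega> z + (- 1) * indicator A z)"
      by (auto simp: fun_eq_iff split: split_indicator)
    then show ?case using step_approximable_add[OF one step_approximable_scale[OF compl(2), of "- 1"]] by simp
  next
    case (union A)
    have Ai: "A i \<in> sets (time_prob T)" for i using union by (intro sub) auto
    \<comment> \<open>By disjointness the partial sums are indicators of partial unions. Their
      errors are dominated by 1, which is square integrable because the measure is finite.\<close>
    show ?case
    proof (rule step_approximable_dominated[where d = "\<lambda>n z. \<Sum>i<n. indicator (A i) z" and w = "\<lambda>_. 1"])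
      show "indicator (\<Union>i. A i) \<in> borel_measurable (time_prob T)" using Ai by (intro borel_measurable_indicator) auto
      show "step_approximable T (\<lambda>z. \<Sum>i<n. indicator (A i) z)" for n
        by (rule step_approximable_sum) (use union in auto)
      have eq: "(\<Sum>i<n. indicator (A i) z) = (indicator (\<Union>i<n. A i) z :: real)" for n z
      proof (induction n)
        case (Suc n)
        have "A n \<inter> A i = {}" if "i < n" for i using disjoint_family_onD[OF union(1), of n i] that by auto
        then have "A n \<inter> (\<Union>i<n. A i) = {}" by auto
        then show ?case using Suc by (auto simp: lessThan_Suc split: split_indicator)
      qed simp
      show "\<bar>indicator (\<Union>i. A i) z - (\<Sum>i<n. indicator (A i) z)\<bar> \<le> (1::real)" for n z
        unfolding eq by (auto split: split_indicator)
      show "(\<lambda>n. \<Sum>i<n. indicator (A i) z) \<longlonglongrightarrow> (indicator (\<Union>i. A i) z :: real)" for z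
        unfolding eq using LIMSEQ_indicator_UN[of A z] by simp
      show "(\<integral>\<^sup>+z. ennreal (1\<^sup>2) \<partial>time_prob T) < \<infinity>" using emeasure_time_prob_finite[of T] by simp
    qed simp
  qed
qed

lemma step_approximable_predictable:
  fixes c :: "real \<times> 'a \<Rightarrow> real"
  assumes T: "0 < T" and c: "c \<in> borel_measurable (predictable_algebra M F T)"
    and fin: "(\<integral>\<^sup>+z. ennreal ((c z)\<^sup>2) \<partial>time_prob T) < \<infinity>"
  shows "step_approximable T c"
proof -
  let ?P = "predictable_algebra M F T"
  have sp: "space ?P = space (time_prob T)" using predictable_generator[of T] T by (simp add: space_time_prob)
  note sub = predictable_subalgebra[OF less_imp_le[OF T]]
  obtain f where f: "\<And>i. simple_function ?P (f i)" "\<And>x. x \<in> space ?P \<Longrightarrow> (\<lambda>i. f i x) \<longlonglongrightarrow> c x"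
    "\<And>i x. x \<in> space ?P \<Longrightarrow> dist (f i x) 0 \<le> 2 * dist (c x) 0"
    using borel_measurable_implies_sequence_metric[OF c, of 0] by blast
  have cm[measurable]: "c \<in> borel_measurable (time_prob T)" by (rule measurable_from_subalg[OF sub c])
  show ?thesis
  \<comment> \<open>The approximants satisfy |f i| \<le> 2 |c|, hence |c - f i| \<le> 3 |c|.\<close>
  proof (rule step_approximable_dominated[where d = f and w = "\<lambda>z. 3 * \<bar>c z\<bar>"])
    show "step_approximable T (f i)" for i
    proof -
      let ?A = "\<lambda>y. f i -` {y} \<inter> space ?P"
      have fm: "f i \<in> borel_measurable (time_prob T)"
        by (rule measurable_from_subalg[OF sub borel_measurable_simple_function[OF f(1)]])
      have 1: "step_approximable T (\<lambda>z. \<Sum>y\<in>f i ` space ?P. y * indicator (?A y) z)"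
      proof (rule step_approximable_sum)
        show "finite (f i ` space ?P)" using simple_functionD(1)[OF f(1)] .
        fix y
        have "?A y \<in> sets ?P" by (rule simple_functionD(2)[OF f(1)])
        then show "step_approximable T (\<lambda>z. y * indicator (?A y) z)"
          by (intro step_approximable_scale step_approximable_predictable_set T)
      qed
      have eq: "f i z = (\<Sum>y\<in>f i ` space ?P. y * indicator (?A y) z)" if z: "z \<in> space (time_prob T)" for z
      proof -
        have "(\<Sum>y\<in>f i ` space ?P. y * indicator (?A y) z) = (\<Sum>y\<in>f i ` space ?P. if y = f i z then y else 0)"
          using z by (intro sum.cong) (auto simp: sp)
        then show ?thesis using z simple_functionD(1)[OF f(1)[of i]] by (simp add: sp)
      qed
      show ?thesis
      proof (rule step_approximable_limit[OF fm])
        fix \<epsilon> :: real assume "\<epsilon> > 0"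
        have "(\<integral>\<^sup>+z. ennreal ((f i z - (\<Sum>y\<in>f i ` space ?P. y * indicator (?A y) z))\<^sup>2) \<partial>time_prob T) = (\<integral>\<^sup>+z. 0 \<partial>time_prob T)"
          by (rule nn_integral_cong) (simp only: eq[symmetric], simp)
        then show "\<exists>d. step_approximable T d \<and> (\<integral>\<^sup>+z. ennreal ((f i z - d z)\<^sup>2) \<partial>time_prob T) \<le> ennreal \<epsilon>"
          using 1 by (intro exI[of _ "\<lambda>z. \<Sum>y\<in>f i ` space ?P. y * indicator (?A y) z"]) auto
      qed
    qed
    show "(\<lambda>i. f i z) \<longlonglongrightarrow> c z" if "z \<in> space (time_prob T)" for z using f(2) that by (simp add: sp)
    show "\<bar>c z - f i z\<bar> \<le> 3 * \<bar>c z\<bar>" if "z \<in> space (time_prob T)" for i z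
      using f(3)[of z i] that by (simp add: sp dist_real_def)
    have "(\<integral>\<^sup>+z. ennreal ((3 * \<bar>c z\<bar>)\<^sup>2) \<partial>time_prob T) = (\<integral>\<^sup>+z. 9 * ennreal ((c z)\<^sup>2) \<partial>time_prob T)"
      by (intro nn_integral_cong) (simp add: power_mult_distrib ennreal_mult')
    also have "\<dots> = 9 * (\<integral>\<^sup>+z. ennreal ((c z)\<^sup>2) \<partial>time_prob T)" by (rule nn_integral_cmult) measurable
    also have "\<dots> < \<infinity>" using fin by (simp add: ennreal_mult_less_top)
    finally show "(\<integral>\<^sup>+z. ennreal ((3 * \<bar>c z\<bar>)\<^sup>2) \<partial>time_prob T) < \<infinity>" .
  qed measurable
qed

end

subsection \<open>Density of simple processes of finite rank\<close>

definition rank_one :: "'h::real_inner \<Rightarrow> 'h \<Rightarrow> 'h \<Rightarrow>\<^sub>L 'h" where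
  "rank_one g f = Blinfun (\<lambda>x. (x \<bullet> g) *\<^sub>R f)"

lemma rank_one_apply [simp]: "rank_one g f x = (x \<bullet> g) *\<^sub>R f"
  unfolding rank_one_def
  by (rule bounded_linear_Blinfun_apply[THEN fun_cong])
     (rule bounded_linear_compose[OF bounded_linear_scaleR_left bounded_linear_inner_left])

lemma scaleR_rank_one: "r *\<^sub>R rank_one g f = rank_one g (r *\<^sub>R f)"
  by (rule blinfun_eqI) (simp add: blinfun.scaleR_left)

text \<open>The semigroups converge only strongly. For x \<mapsto> (x \<bullet> g) f this means
  convergence on the vector f, which turns estimates for operators into estimates for one
  orbit.\<close>

definition finite_rank :: "('a, 'h::real_inner) simple_integrand \<Rightarrow> bool" where
  "finite_rank ps \<longleftrightarrow> (\<forall>(a, b, B, \<Phi>)\<in>set ps. \<exists>g f. \<Phi> = rank_one g f)"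

lemma simple_process_append: "simple_process (ps @ qs) s \<omega> x = simple_process ps s \<omega> x + simple_process qs s \<omega> x"
  by (simp add: simple_process_def)

lemma simple_process_Cons:
  "simple_process ((a, b, B, \<Phi>) # ps) s \<omega> x = (indicator {a<..b} s * indicator B \<omega> :: real) *\<^sub>R \<Phi> x + simple_process ps s \<omega> x"
  by (simp add: simple_process_def)

lemma bounded_linear_simple_process: "bounded_linear (simple_process ps s \<omega>)"
  using bounded_linear_conv_process[of "\<lambda>_. id_blinfun"] by (simp only: conv_process_id)

lemma step_list_to_simple:
  fixes g f :: "'h::real_inner"
  assumes "rs \<in> step_lists F T"
  defines "ps \<equiv> map (\<lambda>(a, b, B, r). (a, b, B, r *\<^sub>R rank_one g f)) rs"
  shows "ps \<in> simple_integrands F T" "finite_rank ps"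
    "simple_process ps s \<omega> x = (step_function rs (s, \<omega>) * (x \<bullet> g)) *\<^sub>R f"
proof -
  show "ps \<in> simple_integrands F T" using assms(1) by (fastforce simp: ps_def simple_integrands_def step_lists_def)
  show "finite_rank ps" by (auto simp: ps_def finite_rank_def scaleR_rank_one)
  show "simple_process ps s \<omega> x = (step_function rs (s, \<omega>) * (x \<bullet> g)) *\<^sub>R f"
    unfolding ps_def
  proof (induction rs)
    case (Cons p rs)
    obtain a b B r where p: "p = (a, b, B, r)" by (cases p)
    show ?case
      using Cons by (simp add: p simple_process_Cons step_function_simps scaleR_add_left blinfun.scaleR_left indicator_times algebra_simps)
  qed (simp add: simple_process_def step_function_simps)
qed

lemma ex_simple_of_steps:
  assumes "\<And>i::nat. i < N \<Longrightarrow> rs i \<in> step_lists F T"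
  shows "\<exists>ps\<in>simple_integrands F T. finite_rank ps \<and>
    (\<forall>s \<omega> x. simple_process ps s \<omega> x = (\<Sum>i<N. (step_function (rs i) (s, \<omega>) * (x \<bullet> g i)) *\<^sub>R f i))"
  using assms
proof (induction N)
  case 0
  show ?case by (rule bexI[of _ "[]"]) (auto simp: finite_rank_def simple_process_def simple_integrands_def)
next
  case (Suc N)
  then obtain ps where ps: "ps \<in> simple_integrands F T" "finite_rank ps"
    "\<forall>s \<omega> x. simple_process ps s \<omega> x = (\<Sum>i<N. (step_function (rs i) (s, \<omega>) * (x \<bullet> g i)) *\<^sub>R f i)" by auto
  have r: "rs N \<in> step_lists F T" using Suc by simp
  let ?qs = "map (\<lambda>(a, b, B, r). (a, b, B, r *\<^sub>R rank_one (g N) (f N))) (rs N)"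
  note qs = step_list_to_simple[OF r, of "g N" "f N"]
  show ?case
  proof (rule bexI[of _ "ps @ ?qs"], intro conjI allI)
    show "ps @ ?qs \<in> simple_integrands F T" using ps qs by (simp add: simple_integrands_append)
    show "finite_rank (ps @ ?qs)" using ps(2) qs(2) by (simp add: finite_rank_def ball_Un)
    show "simple_process (ps @ ?qs) s \<omega> x = (\<Sum>i<Suc N. (step_function (rs i) (s, \<omega>) * (x \<bullet> g i)) *\<^sub>R f i)" for s \<omega> x
      using ps(3) by (simp add: simple_process_append qs(3))
  qed
qed

context levy_setting
begin

text \<open>Only \<psi> composed with \<open>R\<close> is seen by the norm, while simple processes
  carry bounded operators on the whole space. With R g_k = h_k the functional x \<mapsto> R x
  \<bullet> g_k is x \<mapsto> x \<bullet> h_k, so rank-one operators built from \<open>g k\<close>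
  reproduce matrix entries with respect to h. Gram--Schmidt is applied to images under
  \<open>R\<close> so that h lies in the range itself and not just in its closure.\<close>

lemma ex_range_basis:
  "\<exists>h g. orthonormal_seq h \<and> (\<forall>k::nat. R (g k) = h k) \<and> range R \<subseteq> closure (span (range h))"
proof -
  obtain d :: "nat \<Rightarrow> 'h" where d: "\<forall>X. open X \<longrightarrow> X \<noteq> {} \<longrightarrow> (\<exists>n. d n \<in> X)"
    using ex_dense_seq by blast
  define h where "h = gram_schmidt (\<lambda>n. R (d n))"
  have "span (range (\<lambda>n. R (d n))) \<subseteq> range R"
    by (intro span_minimal linear_subspace_image[of R UNIV, simplified] subspace_UNIV) (auto simp: blinfun.bounded_linear_right bounded_linear.linear)
  then have "\<forall>k. \<exists>g. R g = h k"
    unfolding h_def using gram_schmidt_in_span[of "\<lambda>n. R (d n)"] by (metis imageE subsetD)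
  then obtain g where g: "\<forall>k. R (g k) = h k" by metis
  have "R x \<in> closure (span (range h))" for x
    unfolding closure_approachable
  proof (intro allI impI)
    fix e :: real assume e: "e > 0"
    then have "ball x (e / (norm R + 1)) \<noteq> {}" by (simp add: not_le add_nonneg_pos)
    then obtain n where n: "d n \<in> ball x (e / (norm R + 1))" using d open_ball by blast
    have "dist (R (d n)) (R x) \<le> norm R * dist (d n) x"
      using norm_blinfun[of R "d n - x"] by (simp add: dist_norm blinfun.diff_right)
    also have "\<dots> \<le> (norm R + 1) * dist (d n) x" by (intro mult_right_mono) auto
    also have "\<dots> < e" using n by (simp add: dist_commute pos_less_divide_eq add_nonneg_pos mult.commute)
    finally show "\<exists>y\<in>span (range h). dist y (R x) < e"
      using span_gram_schmidt[of "\<lambda>n. R (d n)" n] unfolding h_def by blast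
  qed
  then show ?thesis
    using g orthonormal_seq_gram_schmidt[of "\<lambda>n. R (d n)"] unfolding h_def by blast
qed

text \<open>An operator that vanishes on the kernel of \<open>R\<close> has its adjoint vectors in
  the closed range of \<open>R\<close>, so h may replace the chosen basis.
  \<open>prod_decode\<close> arranges the double series as a single one.\<close>

lemma hs_basis_change:
  assumes h: "orthonormal_seq h" "\<And>k. R (g k) = h k" "range R \<subseteq> closure (span (range h))"
    and B: "bounded_linear B" "\<And>x. R x = 0 \<Longrightarrow> B x = 0"
  shows "(\<Sum>n. ennreal ((norm (B (onb_seq n) :: 'h))\<^sup>2)) = (\<Sum>i. ennreal ((B (h (fst (prod_decode i))) \<bullet> onb_seq (snd (prod_decode i)))\<^sup>2))"
proof -
  have "\<exists>w. \<forall>x. B x \<bullet> onb_seq j = x \<bullet> w" for j :: nat by (rule ex_adjoint_vector[OF B(1)])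
  then obtain w where w: "\<And>j x. B x \<bullet> onb_seq j = x \<bullet> w j" by metis
  have "range h \<subseteq> range R" using h(2) by (metis image_subsetI rangeI)
  then have wh: "w j \<in> closure (span (range h))" for j
    using B(2) w by (intro closed_orthogonal_complement_range[of R] R_sym h) (metis inner_zero_left)+
  have "(\<Sum>n. ennreal ((norm (B (onb_seq n)))\<^sup>2)) = (\<Sum>j. ennreal ((norm (w j))\<^sup>2))"
    by (rule hs_sum_eq_adjoint[OF onb_seq(1) onb_seq(1,2) w]) (simp add: onb_seq(2))
  also have "\<dots> = (\<Sum>k. ennreal ((norm (B (h k)))\<^sup>2))"
    by (rule hs_sum_eq_adjoint[OF h(1) onb_seq(1,2) w wh, symmetric])
  also have "\<dots> = (\<Sum>k. \<Sum>j. ennreal ((B (h k) \<bullet> onb_seq j)\<^sup>2))"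
    by (subst parseval_ennreal[OF onb_seq(1)]) (simp_all add: onb_seq(2))
  also have "\<dots> = (\<Sum>i. ennreal ((B (h (fst (prod_decode i))) \<bullet> onb_seq (snd (prod_decode i)))\<^sup>2))"
    by (rule suminf_ennreal_2dimen[where f = "\<lambda>p. ennreal ((B (h (fst p)) \<bullet> onb_seq (snd p))\<^sup>2)", symmetric]) simp
  finally show ?thesis .
qed

lemma time_prob_measurable:
  assumes "f \<in> borel_measurable (lborel \<Otimes>\<^sub>M M)" shows "f \<in> borel_measurable (time_prob T)"
proof -
  have "(\<lambda>z. (fst z, snd z)) \<in> measurable (time_prob T) (lborel \<Otimes>\<^sub>M M)"
    unfolding time_prob_def
    by (intro measurable_Pair measurable_snd measurable_compose[OF measurable_fst measurable_restrict_space1[OF measurable_ident_sets[OF refl]]])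
  from measurable_compose[OF this assms] show ?thesis by simp
qed

lemma process_norm_sq_time_prob:
  assumes m: "process_measurable T \<Psi>"
  shows "process_norm_sq T \<Psi> = (\<integral>\<^sup>+z. (\<Sum>n. ennreal ((norm (\<Psi> (fst z) (snd z) (R (onb_seq n))))\<^sup>2)) \<partial>time_prob T)"
proof -
  interpret pair_sigma_finite "restrict_space lborel {0..T}" M
    by (intro pair_sigma_finite.intro sigma_finite_measure_restrict_space sigma_finite_lborel) (simp, unfold_locales)
  have [measurable]: "(\<lambda>(s, \<omega>). \<Psi> s \<omega> (R (onb_seq n))) \<in> borel_measurable (time_prob T)" for n
  proof -
    have "(\<lambda>(s, \<omega>). (indicator {0..T} s :: real) *\<^sub>R \<Psi> s \<omega> (R (onb_seq n))) \<in> borel_measurable (time_prob T)"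
      using m by (intro time_prob_measurable) (simp add: process_measurable_def)
    then show ?thesis
      by (rule measurable_cong[THEN iffD1, rotated]) (auto simp: space_time_prob)
  qed
  have "(\<lambda>z. \<Sum>n. ennreal ((norm ((\<lambda>(s, \<omega>). \<Psi> s \<omega> (R (onb_seq n))) z))\<^sup>2)) \<in> borel_measurable (time_prob T)"
    by measurable
  then have meas: "(\<lambda>z. \<Sum>n. ennreal ((norm (\<Psi> (fst z) (snd z) (R (onb_seq n))))\<^sup>2)) \<in> borel_measurable (restrict_space lborel {0..T} \<Otimes>\<^sub>M M)"
    unfolding case_prod_unfold time_prob_def .
  have "(\<integral>\<^sup>+z. (\<Sum>n. ennreal ((norm (\<Psi> (fst z) (snd z) (R (onb_seq n))))\<^sup>2)) \<partial>time_prob T)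
      = (\<integral>\<^sup>+\<omega>. (\<integral>\<^sup>+s. (\<Sum>n. ennreal ((norm (\<Psi> s \<omega> (R (onb_seq n))))\<^sup>2)) \<partial>restrict_space lborel {0..T}) \<partial>M)"
    unfolding time_prob_def using nn_integral_snd[OF meas] by (simp only: fst_conv snd_conv)
  also have "\<dots> = process_norm_sq T \<Psi>"
    unfolding process_norm_sq_def by (intro nn_integral_cong nn_integral_restrict_space) simp
  finally show ?thesis by simp
qed

text \<open>Makes x \<mapsto> \<psi> s \<omega> (R x) vanish on the kernel of \<open>R\<close>, as
  \<open>hs_basis_change\<close> requires.\<close>

lemma integrand_vanishes:
  assumes "\<psi> \<in> integrands M F Q T" "s \<in> {0..T}" "\<omega> \<in> space M" shows "\<psi> s \<omega> 0 = 0"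
proof -
  have "linear_on (range R) (\<psi> s \<omega>)" using assms by (auto simp: integrands_def)
  moreover have "0 \<in> range R" by (rule image_eqI[of _ _ 0]) (simp_all add: blinfun.zero_right)
  ultimately have "\<psi> s \<omega> (0 *\<^sub>R 0) = 0 *\<^sub>R \<psi> s \<omega> 0" unfolding linear_on_def by blast
  then show ?thesis by simp
qed

text \<open>\<psi> composed with \<open>R\<close> is expanded in rank-one operators, with one factor
  from h and the other from \<open>onb_seq\<close>. The coefficients are scalar predictable
  functions whose squared L^2 norms are summable; finitely many are kept, and each of these is
  approximated by a step function.\<close>

theorem simple_processes_dense:
  assumes T: "0 < T" and \<psi>: "\<psi> \<in> integrands M F Q T" and \<epsilon>: "\<epsilon> > 0"
  shows "\<exists>ps\<in>simple_integrands F T. finite_rank ps \<and>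
    process_norm_sq T (\<lambda>s \<omega> x. \<psi> s \<omega> x - simple_process ps s \<omega> x) \<le> ennreal \<epsilon>"
proof -
  obtain h g where h: "orthonormal_seq h" "\<And>k::nat. R (g k) = h k" "range R \<subseteq> closure (span (range h))"
    using ex_range_basis by metis
  define K where "K i = fst (prod_decode i)" for i
  define J where "J i = snd (prod_decode i)" for i
  define c where "c i z = \<psi> (fst z) (snd z) (R (h (K i))) \<bullet> onb_seq (J i)" for i z
  have cp: "c i \<in> borel_measurable (predictable_algebra M F T)" for i
  proof -
    have "(\<lambda>(s, \<omega>). \<psi> s \<omega> (R (h (K i)))) \<in> borel_measurable (predictable_algebra M F T)"
      using \<psi> by (simp add: integrands_def)
    then show ?thesis unfolding c_def case_prod_unfold by (intro borel_measurable_inner) auto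
  qed
  have cm[measurable]: "c i \<in> borel_measurable (time_prob T)" for i
    by (rule measurable_from_subalg[OF predictable_subalgebra cp]) (use T in simp)
  have good: "AE z in time_prob T. bounded_linear (\<lambda>x. \<psi> (fst z) (snd z) (R x)) \<and> z \<in> space (time_prob T)"
    using \<psi> unfolding time_prob_def integrands_def case_prod_unfold by (intro AE_conjI AE_space) blast
  have zero: "\<psi> (fst z) (snd z) 0 = 0" if "z \<in> space (time_prob T)" for z
    using integrand_vanishes[OF \<psi>, of "fst z" "snd z"] that by (auto simp: space_time_prob)
  have "process_norm_sq T \<psi> = (\<integral>\<^sup>+z. (\<Sum>n. ennreal ((norm (\<psi> (fst z) (snd z) (R (onb_seq n))))\<^sup>2)) \<partial>time_prob T)"
    by (rule process_norm_sq_time_prob[OF integrands_process_measurable[OF \<psi>]])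
  also have "\<dots> = (\<integral>\<^sup>+z. (\<Sum>i. ennreal ((c i z)\<^sup>2)) \<partial>time_prob T)"
  proof (rule nn_integral_cong_AE, use good in eventually_elim)
    fix z assume z: "bounded_linear (\<lambda>x. \<psi> (fst z) (snd z) (R x)) \<and> z \<in> space (time_prob T)"
    show "(\<Sum>n. ennreal ((norm (\<psi> (fst z) (snd z) (R (onb_seq n))))\<^sup>2)) = (\<Sum>i. ennreal ((c i z)\<^sup>2))"
      unfolding c_def K_def J_def
      by (rule hs_basis_change[OF h, where B = "\<lambda>x. \<psi> (fst z) (snd z) (R x)"]) (use z zero in auto)
  qed
  also have "\<dots> = (\<Sum>i. \<integral>\<^sup>+z. ennreal ((c i z)\<^sup>2) \<partial>time_prob T)" by (rule nn_integral_suminf) measurable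
  finally have total: "(\<Sum>i. \<integral>\<^sup>+z. ennreal ((c i z)\<^sup>2) \<partial>time_prob T) < \<infinity>"
    using integrands_process_norm_sq[OF \<psi>] by simp
  define r where "r i = enn2real (\<integral>\<^sup>+z. ennreal ((c i z)\<^sup>2) \<partial>time_prob T)" for i
  have fin: "(\<integral>\<^sup>+z. ennreal ((c i z)\<^sup>2) \<partial>time_prob T) < \<infinity>" for i
  proof -
    have "(\<integral>\<^sup>+z. ennreal ((c i z)\<^sup>2) \<partial>time_prob T) \<le> (\<Sum>i. \<integral>\<^sup>+z. ennreal ((c i z)\<^sup>2) \<partial>time_prob T)"
      using sum_le_suminf[of "\<lambda>i. \<integral>\<^sup>+z. ennreal ((c i z)\<^sup>2) \<partial>time_prob T" "{i}"] by simp
    then show ?thesis using total by (rule le_less_trans)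
  qed
  have r: "ennreal (r i) = (\<integral>\<^sup>+z. ennreal ((c i z)\<^sup>2) \<partial>time_prob T)" "0 \<le> r i" for i
    using fin[of i] by (simp_all add: r_def less_top)
  have "summable r" using total r by (intro summable_suminf_not_top) (auto simp: less_top)
  \<comment> \<open>Half of \<epsilon> is spent on the discarded coefficients, the other half on the
    step functions below.\<close>
  then obtain N where N: "norm (\<Sum>i. r (i + N)) < \<epsilon> / 2"
    using suminf_exist_split[of "\<epsilon> / 2" r] \<epsilon> by auto
  have tail: "(\<Sum>i. ennreal (if i < N then 0 else r i)) \<le> ennreal (\<epsilon> / 2)"
  proof -
    have sm: "summable (\<lambda>i. if i < N then 0 else r i)"
      by (rule summable_comparison_test'[OF \<open>summable r\<close>, of 0]) (use r in auto)
    have "(\<Sum>i. if i < N then 0 else r i) = (\<Sum>i. r (i + N))"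
      using suminf_split_initial_segment[OF sm, of N] by simp
    then show ?thesis
      using N r(2) sm by (subst suminf_ennreal2) (auto intro!: ennreal_leI)
  qed
  \<comment> \<open>The N errors add up to at most \<epsilon> / 2; the 1 in the denominator covers N
    = 0.\<close>
  have "\<exists>rs\<in>step_lists F T. (\<integral>\<^sup>+z. ennreal ((c i z - step_function rs z)\<^sup>2) \<partial>time_prob T) \<le> ennreal (\<epsilon> / (2 * (real N + 1)))" for i
  proof -
    have "step_approximable T (c i)" by (rule step_approximable_predictable[OF T cp fin])
    then show ?thesis unfolding step_approximable_def using \<epsilon> by simp
  qed
  then obtain rs where rs: "\<And>i. rs i \<in> step_lists F T"
    "\<And>i. (\<integral>\<^sup>+z. ennreal ((c i z - step_function (rs i) z)\<^sup>2) \<partial>time_prob T) \<le> ennreal (\<epsilon> / (2 * (real N + 1)))"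
    by metis
  obtain ps where ps: "ps \<in> simple_integrands F T" "finite_rank ps"
    "\<And>s \<omega> x. simple_process ps s \<omega> x = (\<Sum>i<N. (step_function (rs i) (s, \<omega>) * (x \<bullet> g (K i))) *\<^sub>R onb_seq (J i))"
    using ex_simple_of_steps[of N rs F T "\<lambda>i. g (K i)" "\<lambda>i. onb_seq (J i)"] rs by blast
  define d where "d i z = (if i < N then step_function (rs i) z else 0)" for i z
  have [measurable]: "step_function (rs i) \<in> borel_measurable (time_prob T)" for i using rs(1) by simp
  have [measurable]: "d i \<in> borel_measurable (time_prob T)" for i unfolding d_def by measurable
  have pm: "process_measurable T (\<lambda>s \<omega> x. \<psi> s \<omega> x - simple_process ps s \<omega> x)"
    using process_measurable_diff[OF integrands_process_measurable[OF \<psi>] process_measurable_conv_process[OF contraction_semigroup_id ps(1)]]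
    by (simp only: conv_process_id)
  \<comment> \<open>Different indices belong to different pairs, so only the term i survives. The
    inner products of the entries with themselves remain, since an entry of h or of
    \<open>onb_seq\<close> may be zero.\<close>
  have key: "(\<psi> (fst z) (snd z) (R (h (K i))) - simple_process ps (fst z) (snd z) (R (h (K i)))) \<bullet> onb_seq (J i)
      = c i z - d i z * ((h (K i) \<bullet> h (K i)) * ((onb_seq (J i) :: 'h) \<bullet> onb_seq (J i)))" for i z
  proof -
    have "simple_process ps (fst z) (snd z) (R (h (K i))) \<bullet> onb_seq (J i)
        = (\<Sum>i'<N. step_function (rs i') z * ((h (K i) \<bullet> h (K i')) * ((onb_seq (J i') :: 'h) \<bullet> onb_seq (J i))))"
      by (simp add: ps(3) inner_sum_left R_sym h(2) mult.assoc)
    also have "\<dots> = (\<Sum>i'<N. if i' = i then step_function (rs i) z * ((h (K i) \<bullet> h (K i)) * ((onb_seq (J i) :: 'h) \<bullet> onb_seq (J i))) else 0)"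
    proof (rule sum.cong[OF refl])
      fix i'
      have "(h (K i) \<bullet> h (K i')) * ((onb_seq (J i') :: 'h) \<bullet> onb_seq (J i)) = 0" if "i' \<noteq> i"
      proof -
        have "prod_decode i' \<noteq> prod_decode i" using that inj_prod_decode[of UNIV] by (auto dest: injD)
        then have "K i' \<noteq> K i \<or> J i' \<noteq> J i" by (auto simp: K_def J_def prod_eq_iff)
        then show ?thesis using h(1) onb_seq(1)[where 'h='h] by (auto simp: orthonormal_seq_def)
      qed
      then show "step_function (rs i') z * ((h (K i) \<bullet> h (K i')) * ((onb_seq (J i') :: 'h) \<bullet> onb_seq (J i)))
        = (if i' = i then step_function (rs i) z * ((h (K i) \<bullet> h (K i)) * ((onb_seq (J i) :: 'h) \<bullet> onb_seq (J i))) else 0)"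
        by simp
    qed
    also have "\<dots> = d i z * ((h (K i) \<bullet> h (K i)) * ((onb_seq (J i) :: 'h) \<bullet> onb_seq (J i)))" by (simp add: d_def)
    finally show ?thesis by (simp add: inner_diff_left c_def)
  qed
  have "process_norm_sq T (\<lambda>s \<omega> x. \<psi> s \<omega> x - simple_process ps s \<omega> x)
      = (\<integral>\<^sup>+z. (\<Sum>n. ennreal ((norm (\<psi> (fst z) (snd z) (R (onb_seq n)) - simple_process ps (fst z) (snd z) (R (onb_seq n))))\<^sup>2)) \<partial>time_prob T)"
    by (rule process_norm_sq_time_prob[OF pm])
  also have "\<dots> \<le> (\<integral>\<^sup>+z. (\<Sum>i. ennreal ((c i z - d i z)\<^sup>2)) \<partial>time_prob T)"
  proof (rule nn_integral_mono_AE, use good in eventually_elim)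
    fix z assume z: "bounded_linear (\<lambda>x. \<psi> (fst z) (snd z) (R x)) \<and> z \<in> space (time_prob T)"
    let ?D = "\<lambda>x. \<psi> (fst z) (snd z) (R x) - simple_process ps (fst z) (snd z) (R x)"
    have lin: "bounded_linear ?D"
      using z by (intro bounded_linear_sub bounded_linear_compose[OF bounded_linear_simple_process blinfun.bounded_linear_right]) auto
    have D0: "?D x = 0" if "R x = 0" for x
      using that z zero linear_0[OF bounded_linear.linear[OF bounded_linear_simple_process]] by simp
    have "(\<Sum>n. ennreal ((norm (?D (onb_seq n)))\<^sup>2)) = (\<Sum>i. ennreal ((?D (h (K i)) \<bullet> onb_seq (J i))\<^sup>2))"
      unfolding K_def J_def by (rule hs_basis_change[OF h lin D0])
    also have "\<dots> \<le> (\<Sum>i. ennreal ((c i z - d i z)\<^sup>2))"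
    proof (intro suminf_le ennreal_leI)
      fix i
      \<comment> \<open>A zero entry makes the left-hand side 0; otherwise both self-products are 1,
        and \<open>key\<close> gives equality.\<close>
      consider "h (K i) = 0" | "onb_seq (J i) = (0::'h)" | "h (K i) \<bullet> h (K i) = 1" "onb_seq (J i) \<bullet> (onb_seq (J i) :: 'h) = 1"
        using h(1) onb_seq(1)[where 'h='h] unfolding orthonormal_seq_def norm_eq_1 by blast
      then show "(?D (h (K i)) \<bullet> onb_seq (J i))\<^sup>2 \<le> (c i z - d i z)\<^sup>2"
      proof cases
        case 1
        then have "?D (h (K i)) = 0" using D0[of "h (K i)"] by (simp add: blinfun.zero_right)
        then show ?thesis by simp
      next
        case 2
        then show ?thesis by simp
      next
        case 3
        then show ?thesis by (simp add: key)
      qed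
    qed auto
    finally show "(\<Sum>n. ennreal ((norm (?D (onb_seq n)))\<^sup>2)) \<le> (\<Sum>i. ennreal ((c i z - d i z)\<^sup>2))" .
  qed
  also have "\<dots> = (\<Sum>i. \<integral>\<^sup>+z. ennreal ((c i z - d i z)\<^sup>2) \<partial>time_prob T)" by (rule nn_integral_suminf) measurable
  also have "\<dots> \<le> (\<Sum>i. ennreal (if i < N then \<epsilon> / (2 * (real N + 1)) else 0) + ennreal (if i < N then 0 else r i))"
    by (intro suminf_le) (use rs(2) r(1) in \<open>auto simp: d_def\<close>)
  also have "\<dots> = (\<Sum>i. ennreal (if i < N then \<epsilon> / (2 * (real N + 1)) else 0)) + (\<Sum>i. ennreal (if i < N then 0 else r i))"
    by (rule suminf_add[symmetric]) auto
  also have "(\<Sum>i. ennreal (if i < N then \<epsilon> / (2 * (real N + 1)) else 0)) = (\<Sum>i<N. ennreal (\<epsilon> / (2 * (real N + 1))))"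
    by (subst suminf_finite[of "{..<N}"]) auto
  also have "(\<Sum>i<N. ennreal (\<epsilon> / (2 * (real N + 1)))) \<le> ennreal (\<epsilon> / 2)"
  proof -
    have "(\<Sum>i<N. ennreal (\<epsilon> / (2 * (real N + 1)))) = ennreal (\<Sum>i<N. \<epsilon> / (2 * (real N + 1)))"
      using \<epsilon> by (intro sum_ennreal) simp
    also have "\<dots> \<le> ennreal (\<epsilon> / 2)" using \<epsilon> by (intro ennreal_leI) (simp add: field_simps)
    finally show ?thesis .
  qed
  also have "ennreal (\<epsilon> / 2) + (\<Sum>i. ennreal (if i < N then 0 else r i)) \<le> ennreal (\<epsilon> / 2) + ennreal (\<epsilon> / 2)"
    by (rule add_left_mono[OF tail])
  also have "\<dots> = ennreal \<epsilon>" using \<epsilon> by (simp add: ennreal_plus[symmetric] del: ennreal_plus)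
  finally have "process_norm_sq T (\<lambda>s \<omega> x. \<psi> s \<omega> x - simple_process ps s \<omega> x) \<le> ennreal \<epsilon>"
    by (simp add: add_right_mono)
  then show ?thesis using ps by blast
qed

text \<open>By symmetry of \<open>R\<close> and Parseval, the squares of R e_n \<bullet> g = e_n
  \<bullet> R g sum to |R g|^2, so a bound on the vector factor of a rank-one operator controls the
  whole norm.\<close>

lemma process_norm_sq_rank_one_le:
  assumes T: "0 \<le> T"
    and le: "\<And>s \<omega> n. s \<in> {0..T} \<Longrightarrow> \<omega> \<in> space M \<Longrightarrow> norm (\<Psi> s \<omega> (R (onb_seq n))) \<le> \<delta> * \<bar>R (onb_seq n) \<bullet> g\<bar>"
  shows "process_norm_sq T \<Psi> \<le> ennreal (T * \<delta>\<^sup>2 * (norm (R g))\<^sup>2)"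
proof -
  have "process_norm_sq T \<Psi> \<le> (\<integral>\<^sup>+\<omega>. (\<integral>\<^sup>+s. ennreal (\<delta>\<^sup>2 * (norm (R g))\<^sup>2) * indicator {0..T} s \<partial>lborel) \<partial>M)"
    unfolding process_norm_sq_def
  proof (intro nn_integral_mono)
    fix \<omega> s assume w: "\<omega> \<in> space M"
    show "(\<Sum>n. ennreal ((norm (\<Psi> s \<omega> (R (onb_seq n))))\<^sup>2)) * indicator {0..T} s \<le> ennreal (\<delta>\<^sup>2 * (norm (R g))\<^sup>2) * indicator {0..T} s"
    proof (cases "s \<in> {0..T}")
      case True
      have "(\<Sum>n. ennreal ((norm (\<Psi> s \<omega> (R (onb_seq n))))\<^sup>2)) \<le> (\<Sum>n. ennreal (\<delta>\<^sup>2) * ennreal ((R g \<bullet> onb_seq n)\<^sup>2))"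
      proof (rule suminf_le)
        fix n
        have "(norm (\<Psi> s \<omega> (R (onb_seq n))))\<^sup>2 \<le> (\<delta> * \<bar>R (onb_seq n) \<bullet> g\<bar>)\<^sup>2"
          by (intro power_mono le True w) simp
        also have "\<dots> = \<delta>\<^sup>2 * (R g \<bullet> onb_seq n)\<^sup>2"
          by (simp only: power_mult_distrib power2_abs R_sym[of "onb_seq n" g] inner_commute[of "onb_seq n" "R g"])
        finally show "ennreal ((norm (\<Psi> s \<omega> (R (onb_seq n))))\<^sup>2) \<le> ennreal (\<delta>\<^sup>2) * ennreal ((R g \<bullet> onb_seq n)\<^sup>2)"
          by (simp only: ennreal_mult[symmetric] zero_le_power2 ennreal_leI)
      qed auto
      also have "\<dots> = ennreal (\<delta>\<^sup>2) * ennreal ((norm (R g))\<^sup>2)"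
        by (subst ennreal_suminf_cmult, subst parseval_ennreal[OF onb_seq(1)]) (simp_all only: onb_seq(2) UNIV_I)
      also have "\<dots> = ennreal (\<delta>\<^sup>2 * (norm (R g))\<^sup>2)" by (simp only: ennreal_mult[symmetric] zero_le_power2)
      finally show ?thesis using True by (simp only: indicator_simps mult_1_right)
    qed (simp only: indicator_simps not_False_eq_True mult_zero_right order_refl)
  qed
  also have "\<dots> = ennreal (\<delta>\<^sup>2 * (norm (R g))\<^sup>2) * ennreal T"
    using T by (simp add: nn_integral_cmult_indicator emeasure_space_1)
  also have "\<dots> = ennreal (T * \<delta>\<^sup>2 * (norm (R g))\<^sup>2)"
    using T by (simp add: ennreal_mult[symmetric] mult_ac)
  finally show ?thesis .
qed

section \<open>Replacing constant operators by restarted semigroups\<close>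

lemma conv_process_map:
  "conv_process S (map (\<lambda>i. (u i, u (Suc i), B, \<Phi>)) [0..<m]) s \<omega> x =
    (\<Sum>i<m. (indicator {u i<..u (Suc i)} s * indicator B \<omega> :: real) *\<^sub>R S (s - u i) (\<Phi> x))"
  by (induction m) (simp_all add: conv_process_Nil conv_process_append conv_process_Cons)

text \<open>The interval is cut into m equal pieces and the semigroup is restarted at each left
  endpoint. Within a piece S(s - u_i) f differs from f by less than \<delta>, by strong continuity
  at 0 on the single vector f.\<close>

lemma refine_rank_one:
  assumes S: "contraction_semigroup S" and ab: "0 \<le> a" "a < b" "b \<le> T" and B: "B \<in> sets (F a)" and \<epsilon>: "\<epsilon> > 0"
  shows "\<exists>qs\<in>simple_integrands F T. finite_rank qs \<and>
    process_norm_sq T (\<lambda>s \<omega> x. simple_process [(a, b, B, rank_one g f)] s \<omega> x - conv_process S qs s \<omega> x) \<le> ennreal \<epsilon>"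
proof -
  have T: "0 \<le> T" using ab by simp
  \<comment> \<open>Chosen to give T \<delta>^2 |R g|^2 \<le> \<epsilon>; the summand 1 covers R g =
    0.\<close>
  define \<delta> where "\<delta> = sqrt (\<epsilon> / (T * (norm (R g))\<^sup>2 + 1))"
  have den: "T * (norm (R g))\<^sup>2 + 1 > 0" using T by (simp add: add_nonneg_pos)
  have \<delta>: "\<delta> > 0" "\<delta>\<^sup>2 = \<epsilon> / (T * (norm (R g))\<^sup>2 + 1)" using \<epsilon> den by (simp_all add: \<delta>_def)
  have small: "T * \<delta>\<^sup>2 * (norm (R g))\<^sup>2 \<le> \<epsilon>" using \<epsilon> den by (simp add: \<delta>(2) field_simps)
  have "((\<lambda>t. S t f) \<longlongrightarrow> f) (at_right 0)" using S by (auto simp: contraction_semigroup_def C0_semigroup_def)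
  then have "\<forall>\<^sub>F t in at_right 0. dist (S t f) f < \<delta>" using \<delta>(1) by (rule tendstoD)
  then obtain \<eta> where \<eta>: "\<eta> > 0" "\<And>t. 0 < t \<Longrightarrow> t < \<eta> \<Longrightarrow> dist (S t f) f < \<delta>"
    by (auto simp: eventually_at_right_field)
  obtain m where m: "real m > (b - a) / \<eta>" using reals_Archimedean2 by blast
  have "(b - a) / \<eta> > 0" using ab \<eta> by simp
  then have m0: "m > 0" using m by (metis less_trans of_nat_0_less_iff)
  define u where "u i = a + real i * ((b - a) / real m)" for i
  have step: "u (Suc i) = u i + (b - a) / real m" for i by (simp add: u_def distrib_right add_divide_distrib)
  have mesh: "(b - a) / real m > 0" "(b - a) / real m < \<eta>" using m m0 ab \<eta> by (auto simp: field_simps)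
  have ua: "a \<le> u i" for i using ab by (simp add: u_def)
  have ub: "u i \<le> b" if "i \<le> m" for i
  proof -
    have "real i * ((b - a) / real m) \<le> real m * ((b - a) / real m)" using that mesh by (intro mult_right_mono) auto
    then show ?thesis using m0 by (simp add: u_def)
  qed
  have um: "u 0 = a" "u m = b" using m0 by (simp_all add: u_def)
  define qs where "qs = map (\<lambda>i. (u i, u (Suc i), B, rank_one g f)) [0..<m]"
  have qs: "qs \<in> simple_integrands F T"
  proof -
    have "0 \<le> u i \<and> u i < u (Suc i) \<and> u (Suc i) \<le> T \<and> B \<in> sets (F (u i))" if "i < m" for i
      using ua[of i] ub[of "Suc i"] that ab mesh B F_mono[of a "u i"] by (auto simp: step)
    then show ?thesis by (auto simp: qs_def simple_integrands_def)
  qed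
  have fr: "finite_rank qs" by (auto simp: qs_def finite_rank_def)
  have ind_sum: "(\<Sum>i<n. indicator {u i<..u (Suc i)} s) = (indicator {u 0<..u n} s :: real)" for s n
  proof (induction n)
    case (Suc n)
    have "u 0 \<le> u n" using ua um by simp
    then show ?case using Suc mesh by (auto simp: step split: split_indicator)
  qed simp
  have "process_norm_sq T (\<lambda>s \<omega> x. simple_process [(a, b, B, rank_one g f)] s \<omega> x - conv_process S qs s \<omega> x) \<le> ennreal (T * \<delta>\<^sup>2 * (norm (R g))\<^sup>2)"
  proof (rule process_norm_sq_rank_one_le[OF T])
    fix s \<omega> n
    let ?x = "R (onb_seq n)"
    let ?I = "\<lambda>i. indicator {u i<..u (Suc i)} s :: real"
    have "simple_process [(a, b, B, rank_one g f)] s \<omega> ?x = (\<Sum>i<m. ?I i *\<^sub>R (indicator B \<omega> * (?x \<bullet> g)) *\<^sub>R f)"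
      unfolding scaleR_sum_left[symmetric] ind_sum um by (simp add: simple_process_def mult.assoc)
    then have "simple_process [(a, b, B, rank_one g f)] s \<omega> ?x - conv_process S qs s \<omega> ?x
        = (\<Sum>i<m. ?I i *\<^sub>R (indicator B \<omega> * (?x \<bullet> g)) *\<^sub>R (f - S (s - u i) f))"
      unfolding qs_def conv_process_map
      by (simp add: sum_subtractf[symmetric] scaleR_diff_right blinfun.scaleR_right mult.assoc)
    also have "norm \<dots> \<le> (\<Sum>i<m. ?I i * (\<delta> * \<bar>?x \<bullet> g\<bar>))"
    proof (rule sum_norm_le)
      fix i
      show "norm (?I i *\<^sub>R (indicator B \<omega> * (?x \<bullet> g)) *\<^sub>R (f - S (s - u i) f)) \<le> ?I i * (\<delta> * \<bar>?x \<bullet> g\<bar>)"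
      proof (cases "s \<in> {u i<..u (Suc i)}")
        case True
        then have "norm (f - S (s - u i) f) \<le> \<delta>"
          using \<eta>(2)[of "s - u i"] mesh by (simp add: step dist_norm norm_minus_commute)
        then have "\<bar>?x \<bullet> g\<bar> * norm (f - S (s - u i) f) \<le> \<bar>?x \<bullet> g\<bar> * \<delta>" by (intro mult_left_mono) auto
        then show ?thesis using True \<delta>(1) by (auto simp: abs_mult mult.commute split: split_indicator)
      qed simp
    qed
    also have "\<dots> \<le> \<delta> * \<bar>?x \<bullet> g\<bar>"
      unfolding sum_distrib_right[symmetric] ind_sum using \<delta>(1) by (simp split: split_indicator)
    finally show "norm (simple_process [(a, b, B, rank_one g f)] s \<omega> ?x - conv_process S qs s \<omega> ?x) \<le> \<delta> * \<bar>?x \<bullet> g\<bar>" .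
  qed
  also have "\<dots> \<le> ennreal \<epsilon>" by (rule ennreal_leI[OF small])
  finally show ?thesis using qs fr by blast
qed

lemma refine_simple:
  assumes S: "contraction_semigroup S" and ps: "ps \<in> simple_integrands F T" "finite_rank ps" and \<epsilon>: "\<epsilon> > 0"
  shows "\<exists>qs\<in>simple_integrands F T. finite_rank qs \<and>
    process_norm_sq T (\<lambda>s \<omega> x. simple_process ps s \<omega> x - conv_process S qs s \<omega> x) \<le> ennreal \<epsilon>"
  using ps \<epsilon>
proof (induction ps arbitrary: \<epsilon>)
  case Nil
  have "process_norm_sq T (\<lambda>s \<omega> x. simple_process [] s \<omega> x - conv_process S [] s \<omega> x) = 0"
    unfolding process_norm_sq_def by (simp add: simple_process_def conv_process_Nil)
  then show ?case by (intro bexI[of _ "[]"]) (auto simp: finite_rank_def simple_integrands_def)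
next
  case (Cons p ps)
  obtain a b B \<Phi> where p: "p = (a, b, B, \<Phi>)" by (cases p)
  have a: "0 \<le> a" "a < b" "b \<le> T" "B \<in> sets (F a)" and ps: "ps \<in> simple_integrands F T" "finite_rank ps"
    using Cons.prems by (auto simp: p simple_integrands_Cons finite_rank_def)
  obtain g f where \<Phi>: "\<Phi> = rank_one g f" using Cons.prems by (auto simp: p finite_rank_def)
  have \<epsilon>4: "\<epsilon> / 4 > 0" using Cons.prems by simp
  obtain q1 where q1: "q1 \<in> simple_integrands F T" "finite_rank q1"
    "process_norm_sq T (\<lambda>s \<omega> x. simple_process [p] s \<omega> x - conv_process S q1 s \<omega> x) \<le> ennreal (\<epsilon> / 4)"
    using refine_rank_one[OF S a \<epsilon>4, of g f] by (auto simp: p \<Phi>)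
  obtain q2 where q2: "q2 \<in> simple_integrands F T" "finite_rank q2"
    "process_norm_sq T (\<lambda>s \<omega> x. simple_process ps s \<omega> x - conv_process S q2 s \<omega> x) \<le> ennreal (\<epsilon> / 4)"
    using Cons.IH[OF ps \<epsilon>4] by auto
  have sm: "process_measurable T (simple_process rs)" if "rs \<in> simple_integrands F T" for rs
    using process_measurable_conv_process[OF contraction_semigroup_id that] by (simp only: conv_process_id)
  have p1: "[p] \<in> simple_integrands F T" using a by (simp add: p simple_integrands_def)
  note cm = process_measurable_conv_process[OF S]
  have neg: "process_measurable T (\<lambda>s \<omega> x. - conv_process S q1 s \<omega> x)"
    using cm[OF simple_integrands_neg[OF q1(1)], of T] by (simp add: conv_process_neg[abs_def])
  \<comment> \<open>The intermediate process has the head already replaced and the tail still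
    constant. The sum is written as a difference so that \<open>process_measurable_diff\<close>
    applies.\<close>
  have m: "process_measurable T (\<lambda>s \<omega> x. simple_process ps s \<omega> x - - conv_process S q1 s \<omega> x)"
    by (rule process_measurable_diff[OF sm[OF ps(1)] neg])
  have "process_norm_sq T (\<lambda>s \<omega> x. simple_process (p # ps) s \<omega> x - conv_process S (q1 @ q2) s \<omega> x)
     \<le> 2 * process_norm_sq T (\<lambda>s \<omega> x. simple_process (p # ps) s \<omega> x - (simple_process ps s \<omega> x - - conv_process S q1 s \<omega> x))
      + 2 * process_norm_sq T (\<lambda>s \<omega> x. (simple_process ps s \<omega> x - - conv_process S q1 s \<omega> x) - conv_process S (q1 @ q2) s \<omega> x)"
    by (rule process_norm_sq_triangle[OF sm m cm]) (use Cons.prems q1 q2 in \<open>auto simp: simple_integrands_append\<close>)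
  also have "(\<lambda>s \<omega> x. simple_process (p # ps) s \<omega> x - (simple_process ps s \<omega> x - - conv_process S q1 s \<omega> x))
      = (\<lambda>s \<omega> x. simple_process [p] s \<omega> x - conv_process S q1 s \<omega> x)"
    using simple_process_append[of "[p]" ps] by (simp add: fun_eq_iff)
  also have "(\<lambda>s \<omega> x. (simple_process ps s \<omega> x - - conv_process S q1 s \<omega> x) - conv_process S (q1 @ q2) s \<omega> x)
      = (\<lambda>s \<omega> x. simple_process ps s \<omega> x - conv_process S q2 s \<omega> x)"
    by (simp add: fun_eq_iff conv_process_append)
  also have "2 * process_norm_sq T (\<lambda>s \<omega> x. simple_process [p] s \<omega> x - conv_process S q1 s \<omega> x)
      + 2 * process_norm_sq T (\<lambda>s \<omega> x. simple_process ps s \<omega> x - conv_process S q2 s \<omega> x) \<le> 2 * ennreal (\<epsilon> / 4) + 2 * ennreal (\<epsilon> / 4)"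
    by (intro add_mono mult_left_mono q1 q2) auto
  also have "\<dots> = ennreal \<epsilon>" using Cons.prems by (intro ennreal_quarters) simp
  finally show ?case
    using q1 q2 by (intro bexI[of _ "q1 @ q2"]) (auto simp: simple_integrands_append finite_rank_def)
qed

theorem conv_processes_dense:
  assumes S: "contraction_semigroup S" and T: "0 < T" and \<psi>: "\<psi> \<in> integrands M F Q T" and \<epsilon>: "\<epsilon> > 0"
  shows "\<exists>ps\<in>simple_integrands F T. finite_rank ps \<and>
    process_norm_sq T (\<lambda>s \<omega> x. \<psi> s \<omega> x - conv_process S ps s \<omega> x) \<le> ennreal \<epsilon>"
proof -
  have \<epsilon>4: "\<epsilon> / 4 > 0" using \<epsilon> by simp
  obtain ps where ps: "ps \<in> simple_integrands F T" "finite_rank ps"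
    "process_norm_sq T (\<lambda>s \<omega> x. \<psi> s \<omega> x - simple_process ps s \<omega> x) \<le> ennreal (\<epsilon> / 4)"
    using simple_processes_dense[OF T \<psi> \<epsilon>4] by auto
  obtain qs where qs: "qs \<in> simple_integrands F T" "finite_rank qs"
    "process_norm_sq T (\<lambda>s \<omega> x. simple_process ps s \<omega> x - conv_process S qs s \<omega> x) \<le> ennreal (\<epsilon> / 4)"
    using refine_simple[OF S ps(1,2) \<epsilon>4] by auto
  have sm: "process_measurable T (simple_process ps)"
    using process_measurable_conv_process[OF contraction_semigroup_id ps(1)] by (simp only: conv_process_id)
  have "process_norm_sq T (\<lambda>s \<omega> x. \<psi> s \<omega> x - conv_process S qs s \<omega> x)
     \<le> 2 * process_norm_sq T (\<lambda>s \<omega> x. \<psi> s \<omega> x - simple_process ps s \<omega> x)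
      + 2 * process_norm_sq T (\<lambda>s \<omega> x. simple_process ps s \<omega> x - conv_process S qs s \<omega> x)"
    by (rule process_norm_sq_triangle[OF integrands_process_measurable[OF \<psi>] sm process_measurable_conv_process[OF S qs(1)]])
  also have "\<dots> \<le> 2 * ennreal (\<epsilon> / 4) + 2 * ennreal (\<epsilon> / 4)"
    by (intro add_mono mult_left_mono ps qs) auto
  also have "\<dots> = ennreal \<epsilon>" using \<epsilon> by (intro ennreal_quarters) simp
  finally show ?thesis using qs by blast
qed

end

subsection \<open>A cadlag version of the Levy martingale\<close>

text \<open>The number of \<open>\<epsilon>\<close>-oscillations of the martingale along a finite grid, counted greedily, has
  expectation at most \<open>\<epsilon>\<^sup>-\<^sup>2\<close> times the final variance: at each reset the squared distance to the
  current reference point exceeds \<open>\<epsilon>\<^sup>2\<close>. This bound is uniform in the grid and yields one-sided limits.\<close>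

fun greedy_ref :: "real \<Rightarrow> (nat \<Rightarrow> 'h::real_normed_vector) \<Rightarrow> nat \<Rightarrow> 'h" where
  "greedy_ref \<epsilon> x 0 = x 0"
| "greedy_ref \<epsilon> x (Suc k) = (if norm (x (Suc k) - greedy_ref \<epsilon> x k) > \<epsilon> then x (Suc k) else greedy_ref \<epsilon> x k)"

fun greedy_count :: "real \<Rightarrow> (nat \<Rightarrow> 'h::real_normed_vector) \<Rightarrow> nat \<Rightarrow> nat" where
  "greedy_count \<epsilon> x 0 = 0"
| "greedy_count \<epsilon> x (Suc k) = greedy_count \<epsilon> x k + (if norm (x (Suc k) - greedy_ref \<epsilon> x k) > \<epsilon> then 1 else 0)"

lemma greedy_ref_close: "0 \<le> \<epsilon> \<Longrightarrow> norm (x k - greedy_ref \<epsilon> x k) \<le> \<epsilon>"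
  by (induction k) auto

lemma greedy_count_eq_card: "greedy_count \<epsilon> x n = card {k. k < n \<and> norm (x (Suc k) - greedy_ref \<epsilon> x k) > \<epsilon>}"
proof (induction n)
  case (Suc n)
  have "{k. k < Suc n \<and> norm (x (Suc k) - greedy_ref \<epsilon> x k) > \<epsilon>} =
    (if norm (x (Suc n) - greedy_ref \<epsilon> x n) > \<epsilon> then insert n {k. k < n \<and> norm (x (Suc k) - greedy_ref \<epsilon> x k) > \<epsilon>}
     else {k. k < n \<and> norm (x (Suc k) - greedy_ref \<epsilon> x k) > \<epsilon>})"
    by (auto simp: less_Suc_eq)
  then show ?case using Suc by simp
qed simp

text \<open>Without a reset both values lie within \<epsilon> of the same reference point.\<close>

lemma greedy_reset_between:
  assumes \<epsilon>: "0 \<le> \<epsilon>" and ij: "i \<le> j" "norm (x i - x j) > 2 * \<epsilon>"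
  shows "\<exists>k. i \<le> k \<and> k < j \<and> norm (x (Suc k) - greedy_ref \<epsilon> x k) > \<epsilon>"
proof (rule ccontr)
  assume no: "\<not> ?thesis"
  have "greedy_ref \<epsilon> x (i + d) = greedy_ref \<epsilon> x i" if "i + d \<le> j" for d
    using that
  proof (induction d)
    case (Suc d)
    have "i \<le> i + d" "i + d < j" using Suc.prems by auto
    then have "\<not> norm (x (Suc (i + d)) - greedy_ref \<epsilon> x (i + d)) > \<epsilon>" using no by blast
    then show ?case using Suc by simp
  qed simp
  then have "greedy_ref \<epsilon> x j = greedy_ref \<epsilon> x i" using ij by (metis le_add_diff_inverse order_refl)
  then have "norm (x i - x j) \<le> \<epsilon> + \<epsilon>"
    using greedy_ref_close[OF \<epsilon>, of x i] greedy_ref_close[OF \<epsilon>, of x j]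
      norm_triangle_ineq4[of "x i - greedy_ref \<epsilon> x i" "x j - greedy_ref \<epsilon> x j"] by simp
  then show False using ij by simp
qed

text \<open>Each of the m pairs encloses a reset, and since the intervals do not overlap, the resets
  are distinct.\<close>

lemma greedy_count_ge:
  fixes f :: "real \<Rightarrow> 'h::real_normed_vector"
  assumes \<epsilon>: "0 \<le> \<epsilon>" and u: "\<And>i j. i < j \<Longrightarrow> j \<le> N \<Longrightarrow> u i < u j"
    and pq: "\<And>i. i < m \<Longrightarrow> p i \<in> u ` {..N} \<and> q i \<in> u ` {..N} \<and> p i < q i \<and> norm (f (p i) - f (q i)) > 2 * \<epsilon>"
    and disj: "\<And>i j. i < j \<Longrightarrow> j < m \<Longrightarrow> q i \<le> p j \<or> q j \<le> p i"
  shows "m \<le> greedy_count \<epsilon> (\<lambda>k. f (u k)) N"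
proof -
  have le: "i \<le> j" if "u i \<le> u j" "i \<le> N" "j \<le> N" for i j
    using u[of j i] that by (metis linorder_not_le)
  define A where "A = {k. k < N \<and> norm (f (u (Suc k)) - greedy_ref \<epsilon> (\<lambda>k. f (u k)) k) > \<epsilon>}"
  have "\<exists>k. k \<in> A \<and> p i \<le> u k \<and> u k < q i" if "i < m" for i
  proof -
    obtain a b where ab: "a \<le> N" "b \<le> N" "p i = u a" "q i = u b" using pq[OF \<open>i < m\<close>] by auto
    have "a \<le> b" using le[of a b] ab pq[OF \<open>i < m\<close>] by auto
    from greedy_reset_between[OF \<epsilon> this, of "\<lambda>k. f (u k)"] obtain k where
      k: "a \<le> k" "k < b" "norm (f (u (Suc k)) - greedy_ref \<epsilon> (\<lambda>k. f (u k)) k) > \<epsilon>"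
      using pq[OF \<open>i < m\<close>] ab by auto
    have "u a \<le> u k" using k ab u[of a k] by (cases "a = k") auto
    moreover have "u k < u b" using k ab u[of k b] by auto
    ultimately show ?thesis using k ab by (intro exI[of _ k]) (auto simp: A_def)
  qed
  then obtain \<kappa> where \<kappa>: "\<And>i. i < m \<Longrightarrow> \<kappa> i \<in> A \<and> p i \<le> u (\<kappa> i) \<and> u (\<kappa> i) < q i" by metis
  have "inj_on \<kappa> {..<m}"
  proof (rule linorder_inj_onI)
    fix i j assume "i < j" "i \<in> {..<m}" "j \<in> {..<m}"
    then show "\<kappa> i \<noteq> \<kappa> j" using \<kappa>[of i] \<kappa>[of j] disj[of i j] by auto
  qed auto
  moreover have "finite A" by (simp add: A_def)
  ultimately have "card {..<m} \<le> card A" using \<kappa> by (intro card_inj_on_le) auto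
  then show ?thesis by (simp add: A_def greedy_count_eq_card)
qed

section \<open>One-sided limits along a dense set of times\<close>

definition right_limits_on :: "real \<Rightarrow> real set \<Rightarrow> (real \<Rightarrow> 'h::topological_space) \<Rightarrow> bool" where
  "right_limits_on T D f \<longleftrightarrow> (\<forall>t\<in>{0..<T}. \<exists>l. (f \<longlongrightarrow> l) (at t within (D \<inter> {t<..})))"

definition left_limits_on :: "real \<Rightarrow> real set \<Rightarrow> (real \<Rightarrow> 'h::topological_space) \<Rightarrow> bool" where
  "left_limits_on T D f \<longleftrightarrow> (\<forall>t\<in>{0<..T}. \<exists>l. (f \<longlongrightarrow> l) (at t within (D \<inter> {..<t})))"

text \<open>At T no point of D lies to the right, so the original value is kept.\<close>

definition regularize :: "real \<Rightarrow> real set \<Rightarrow> (real \<Rightarrow> 'h::t2_space) \<Rightarrow> real \<Rightarrow> 'h" where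
  "regularize T D f t = (if t < T then Lim (at t within (D \<inter> {t<..})) f else f T)"

definition dense_times :: "real \<Rightarrow> real set \<Rightarrow> bool" where
  "dense_times T D \<longleftrightarrow> D \<subseteq> {0..T} \<and> (\<forall>a b. 0 \<le> a \<longrightarrow> a < b \<longrightarrow> b \<le> T \<longrightarrow> (\<exists>d\<in>D. a < d \<and> d < b))"

lemma dense_times_right_nontrivial:
  assumes "dense_times T D" "t \<in> {0..<T}" shows "at t within (D \<inter> {t<..}) \<noteq> bot"
  unfolding trivial_limit_within islimpt_approachable
proof (clarify, goal_cases)
  case 1
  have False if e: "e > 0" "\<forall>x'\<in>D \<inter> {t<..}. x' \<noteq> t \<longrightarrow> \<not> dist x' t < e" for e
  proof -
    obtain d where d: "d \<in> D" "t < d" "d < min T (t + e)"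
      using assms e(1) unfolding dense_times_def by (metis atLeastLessThan_iff less_add_same_cancel1 min.cobounded1 min_less_iff_conj)
    then have "\<not> dist d t < e" using e(2) by auto
    then show False using d by (auto simp: dist_real_def)
  qed
  then show ?case using 1 by blast
qed

lemma dense_times_left_nontrivial:
  assumes "dense_times T D" "t \<in> {0<..T}" shows "at t within (D \<inter> {..<t}) \<noteq> bot"
  unfolding trivial_limit_within islimpt_approachable
proof (clarify, goal_cases)
  case 1
  have False if e: "e > 0" "\<forall>x'\<in>D \<inter> {..<t}. x' \<noteq> t \<longrightarrow> \<not> dist x' t < e" for e
  proof -
    have "0 \<le> max 0 (t - e)" "max 0 (t - e) < t" "t \<le> T" using assms e(1) by auto
    then obtain d where d: "d \<in> D" "max 0 (t - e) < d" "d < t"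
      using assms unfolding dense_times_def by blast
    then have "\<not> dist d t < e" using e(2) by auto
    then show False using d by (auto simp: dist_real_def)
  qed
  then show ?case using 1 by blast
qed

lemma regularize_tendsto:
  assumes "dense_times T D" "right_limits_on T D f" "t \<in> {0..<T}"
  shows "(f \<longlongrightarrow> regularize T D f t) (at t within (D \<inter> {t<..}))"
proof -
  obtain l where l: "(f \<longlongrightarrow> l) (at t within (D \<inter> {t<..}))" using assms unfolding right_limits_on_def by blast
  then have "Lim (at t within (D \<inter> {t<..})) f = l"
    by (rule tendsto_Lim[OF dense_times_right_nontrivial[OF assms(1,3)]])
  then show ?thesis using l assms by (simp add: regularize_def)
qed

lemma cadlag_regularize:
  fixes f :: "real \<Rightarrow> 'h::metric_space"
  assumes D: "dense_times T D" and r: "right_limits_on T D f" and l: "left_limits_on T D f"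
  shows "cadlag_on T (regularize T D f)"
proof -
  let ?g = "regularize T D f"
  \<comment> \<open>A value of the regularised path is a limit of values of f at points of D just to
    the right, so bounds for f on D pass to it.\<close>
  have close: "dist (?g t') y \<le> e" if t': "t' \<in> {0..<T}" "t' < b" and y: "\<And>s. s \<in> D \<Longrightarrow> t' < s \<Longrightarrow> s < b \<Longrightarrow> dist (f s) y \<le> e" for t' b y e
  proof (subst dist_commute, rule Lim_dist_ubound)
    show "at t' within (D \<inter> {t'<..}) \<noteq> bot" by (rule dense_times_right_nontrivial[OF D t'(1)])
    show "(f \<longlongrightarrow> ?g t') (at t' within (D \<inter> {t'<..}))" by (rule regularize_tendsto[OF D r t'(1)])
    show "\<forall>\<^sub>F s in at t' within (D \<inter> {t'<..}). dist y (f s) \<le> e"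
      unfolding eventually_at dist_commute[of y] using t' y by (intro exI[of _ "b - t'"]) (auto simp: dist_real_def)
  qed
  show ?thesis
    unfolding cadlag_on_def
  proof (intro conjI ballI)
    fix t assume t: "t \<in> {0..<T}"
    show "(?g \<longlongrightarrow> ?g t) (at_right t)"
    proof (rule tendstoI)
      fix e :: real assume "e > 0"
      then have "\<forall>\<^sub>F s in at t within (D \<inter> {t<..}). dist (f s) (?g t) < e / 2"
        using regularize_tendsto[OF D r t] by (intro tendstoD) auto
      then obtain \<delta> where \<delta>: "\<delta> > 0" "\<And>s. s \<in> D \<Longrightarrow> t < s \<Longrightarrow> dist s t < \<delta> \<Longrightarrow> dist (f s) (?g t) < e / 2"
        unfolding eventually_at by auto
      have "dist (?g t') (?g t) < e" if "t < t'" "t' < min (t + \<delta>) T" for t'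
      proof -
        have "dist (?g t') (?g t) \<le> e / 2"
          by (rule close[of t' "t + \<delta>"]) (use that t \<delta>(2) in \<open>auto simp: dist_real_def intro!: less_imp_le\<close>)
        then show ?thesis using \<open>e > 0\<close> by simp
      qed
      then show "\<forall>\<^sub>F t' in at_right t. dist (?g t') (?g t) < e"
        unfolding eventually_at_right_field using \<delta>(1) t by (intro exI[of _ "min (t + \<delta>) T"]) auto
    qed
  next
    fix t assume t: "t \<in> {0<..T}"
    obtain l where l: "(f \<longlongrightarrow> l) (at t within (D \<inter> {..<t}))" using l t unfolding left_limits_on_def by blast
    have "(?g \<longlongrightarrow> l) (at_left t)"
    proof (rule tendstoI)
      fix e :: real assume "e > 0"
      then have "\<forall>\<^sub>F s in at t within (D \<inter> {..<t}). dist (f s) l < e / 2"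
        using l by (intro tendstoD) auto
      then obtain \<delta> where \<delta>: "\<delta> > 0" "\<And>s. s \<in> D \<Longrightarrow> s < t \<Longrightarrow> dist s t < \<delta> \<Longrightarrow> dist (f s) l < e / 2"
        unfolding eventually_at by auto
      have "dist (?g t') l < e" if "max 0 (t - \<delta>) < t'" "t' < t" for t'
      proof -
        have "dist (?g t') l \<le> e / 2"
          by (rule close[of t' t]) (use that t \<delta>(2) in \<open>auto simp: dist_real_def intro!: less_imp_le\<close>)
        then show ?thesis using \<open>e > 0\<close> by simp
      qed
      then show "\<forall>\<^sub>F t' in at_left t. dist (?g t') l < e"
        unfolding eventually_at_left_field using \<delta>(1) t by (intro exI[of _ "max 0 (t - \<delta>)"]) auto
    qed
    then show "\<exists>l. (?g \<longlongrightarrow> l) (at_left t)" by blast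
  qed
qed

text \<open>What is excluded are infinitely many oscillations over nonoverlapping intervals. Their
  order is left open because a missing left limit produces an increasing sequence of intervals and a
  missing right limit a decreasing one.\<close>

definition no_oscillation :: "real set \<Rightarrow> real \<Rightarrow> (real \<Rightarrow> 'h::metric_space) \<Rightarrow> bool" where
  "no_oscillation D \<epsilon> f \<longleftrightarrow> \<not> (\<exists>p q :: nat \<Rightarrow> real.
     (\<forall>i. p i \<in> D \<and> q i \<in> D \<and> p i < q i \<and> dist (f (p i)) (f (q i)) > \<epsilon>) \<and>
     (\<forall>i j. i < j \<longrightarrow> q i \<le> p j \<or> q j \<le> p i))"

lemma no_oscillation_mono:
  assumes "no_oscillation D \<epsilon> f" "\<epsilon> \<le> \<epsilon>'" shows "no_oscillation D \<epsilon>' f"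
  unfolding no_oscillation_def
proof (rule notI, elim exE conjE)
  fix p q :: "nat \<Rightarrow> real"
  assume pq: "\<forall>i. p i \<in> D \<and> q i \<in> D \<and> p i < q i \<and> \<epsilon>' < dist (f (p i)) (f (q i))" "\<forall>i j. i < j \<longrightarrow> q i \<le> p j \<or> q j \<le> p i"
  have "\<epsilon> < dist (f (p i)) (f (q i))" for i using pq(1) assms(2) by (meson order_le_less_trans)
  then have "\<not> no_oscillation D \<epsilon> f"
    unfolding no_oscillation_def not_not by (intro exI[of _ p] exI[of _ q]) (use pq in auto)
  then show False using assms(1) by simp
qed

lemma cauchy_filter_tendsto:
  fixes f :: "real \<Rightarrow> 'h::complete_space"
  assumes F: "F \<noteq> bot" and cauchy: "\<And>e. e > 0 \<Longrightarrow> \<exists>P. eventually P F \<and> (\<forall>x y. P x \<and> P y \<longrightarrow> dist (f x) (f y) < e)"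
  shows "\<exists>l. (f \<longlongrightarrow> l) F"
proof -
  have "cauchy_filter (filtermap f F)" unfolding cauchy_filter_metric_filtermap using cauchy by blast
  moreover have "filtermap f F \<noteq> bot" using F by (simp add: filtermap_bot_iff)
  ultimately have "\<exists>l\<in>UNIV. filtermap f F \<le> nhds l"
    using complete_UNIV[where 'a='h] unfolding complete_uniform by auto
  then show ?thesis by (simp add: filterlim_def)
qed

text \<open>If the Cauchy condition fails at t, oscillating pairs can be chosen one after the other,
  each beyond the previous one and still below t; they do not overlap.\<close>

lemma no_oscillation_left_limits:
  fixes f :: "real \<Rightarrow> 'h::complete_space"
  assumes D: "dense_times T D" and no: "\<And>e. e > 0 \<Longrightarrow> no_oscillation D e f"
  shows "left_limits_on T D f"
  unfolding left_limits_on_def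
proof
  fix t assume t: "t \<in> {0<..T}"
  show "\<exists>l. (f \<longlongrightarrow> l) (at t within (D \<inter> {..<t}))"
  proof (rule cauchy_filter_tendsto[OF dense_times_left_nontrivial[OF D t]])
    fix e :: real assume e: "e > 0"
    have "\<exists>a<t. \<forall>p\<in>D. \<forall>q\<in>D. a < p \<longrightarrow> p < q \<longrightarrow> q < t \<longrightarrow> dist (f p) (f q) \<le> e / 2"
    proof (rule ccontr)
      assume "\<not> ?thesis"
      then have ex: "\<exists>pq. fst pq \<in> D \<and> snd pq \<in> D \<and> a < fst pq \<and> fst pq < snd pq \<and> snd pq < t \<and> dist (f (fst pq)) (f (snd pq)) > e / 2"
        if "a < t" for a using that by (metis fst_conv snd_conv linorder_not_le)
      have "\<exists>pq :: nat \<Rightarrow> real \<times> real. \<forall>i. (fst (pq i) \<in> D \<and> snd (pq i) \<in> D \<and> fst (pq i) < snd (pq i) \<and> snd (pq i) < t \<and>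
          dist (f (fst (pq i))) (f (snd (pq i))) > e / 2) \<and> snd (pq i) < fst (pq (Suc i))"
      proof (rule dependent_nat_choice, goal_cases)
        case 1
        show ?case using ex[of 0] t by auto
      next
        case (2 x i)
        then show ?case using ex[of "snd x"] by blast
      qed
      then obtain pq :: "nat \<Rightarrow> real \<times> real" where pq: "\<And>i. fst (pq i) \<in> D \<and> snd (pq i) \<in> D \<and> fst (pq i) < snd (pq i) \<and>
          dist (f (fst (pq i))) (f (snd (pq i))) > e / 2" "\<And>i. snd (pq i) < fst (pq (Suc i))" by blast
      have inc: "snd (pq i) \<le> fst (pq j)" if "i < j" for i j
        using that
      proof (induction j)
        case (Suc j)
        then show ?case using pq[of j] pq(2)[of j] by (cases "i = j") auto
      qed simp
      have "\<not> no_oscillation D (e / 2) f"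
        unfolding no_oscillation_def not_not
        by (rule exI[of _ "\<lambda>i. fst (pq i)"], rule exI[of _ "\<lambda>i. snd (pq i)"]) (use pq inc in auto)
      then show False using no[of "e / 2"] e by simp
    qed
    then obtain a where a: "a < t" "\<And>p q. p \<in> D \<Longrightarrow> q \<in> D \<Longrightarrow> a < p \<Longrightarrow> p < q \<Longrightarrow> q < t \<Longrightarrow> dist (f p) (f q) \<le> e / 2" by blast
    have "dist (f p) (f q) < e" if "p \<in> D" "q \<in> D" "a < p" "a < q" "p < t" "q < t" for p q
      using a(2)[of p q] a(2)[of q p] that e by (cases p q rule: linorder_cases) (auto simp: dist_commute)
    then show "\<exists>P. eventually P (at t within (D \<inter> {..<t})) \<and> (\<forall>x y. P x \<and> P y \<longrightarrow> dist (f x) (f y) < e)"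
      using a(1) by (intro exI[of _ "\<lambda>s. s \<in> D \<and> a < s \<and> s < t"])
        (auto simp: eventually_at dist_real_def intro!: exI[of _ "t - a"])
  qed
qed

lemma no_oscillation_right_limits:
  fixes f :: "real \<Rightarrow> 'h::complete_space"
  assumes D: "dense_times T D" and no: "\<And>e. e > 0 \<Longrightarrow> no_oscillation D e f"
  shows "right_limits_on T D f"
  unfolding right_limits_on_def
proof
  fix t assume t: "t \<in> {0..<T}"
  show "\<exists>l. (f \<longlongrightarrow> l) (at t within (D \<inter> {t<..}))"
  proof (rule cauchy_filter_tendsto[OF dense_times_right_nontrivial[OF D t]])
    fix e :: real assume e: "e > 0"
    have "\<exists>b>t. \<forall>p\<in>D. \<forall>q\<in>D. t < p \<longrightarrow> p < q \<longrightarrow> q < b \<longrightarrow> dist (f p) (f q) \<le> e / 2"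
    proof (rule ccontr)
      assume "\<not> ?thesis"
      then have ex: "\<exists>pq. fst pq \<in> D \<and> snd pq \<in> D \<and> t < fst pq \<and> fst pq < snd pq \<and> snd pq < b \<and> dist (f (fst pq)) (f (snd pq)) > e / 2"
        if "t < b" for b using that by (metis fst_conv snd_conv linorder_not_le)
      have "\<exists>pq :: nat \<Rightarrow> real \<times> real. \<forall>i. (fst (pq i) \<in> D \<and> snd (pq i) \<in> D \<and> fst (pq i) < snd (pq i) \<and> t < fst (pq i) \<and>
          dist (f (fst (pq i))) (f (snd (pq i))) > e / 2) \<and> snd (pq (Suc i)) < fst (pq i)"
      proof (rule dependent_nat_choice, goal_cases)
        case 1
        show ?case using ex[of "t + 1"] by auto
      next
        case (2 x i)
        then show ?case using ex[of "fst x"] by blast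
      qed
      then obtain pq :: "nat \<Rightarrow> real \<times> real" where pq: "\<And>i. fst (pq i) \<in> D \<and> snd (pq i) \<in> D \<and> fst (pq i) < snd (pq i) \<and>
          dist (f (fst (pq i))) (f (snd (pq i))) > e / 2" "\<And>i. snd (pq (Suc i)) < fst (pq i)" by blast
      have inc: "snd (pq j) \<le> fst (pq i)" if "i < j" for i j
        using that
      proof (induction j)
        case (Suc j)
        then show ?case using pq[of j] pq(2)[of j] by (cases "i = j") auto
      qed simp
      have "\<not> no_oscillation D (e / 2) f"
        unfolding no_oscillation_def not_not
        by (rule exI[of _ "\<lambda>i. fst (pq i)"], rule exI[of _ "\<lambda>i. snd (pq i)"]) (use pq inc in auto)
      then show False using no[of "e / 2"] e by simp
    qed
    then obtain b where b: "t < b" "\<And>p q. p \<in> D \<Longrightarrow> q \<in> D \<Longrightarrow> t < p \<Longrightarrow> p < q \<Longrightarrow> q < b \<Longrightarrow> dist (f p) (f q) \<le> e / 2" by blast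
    have "dist (f p) (f q) < e" if "p \<in> D" "q \<in> D" "t < p" "t < q" "p < b" "q < b" for p q
      using b(2)[of p q] b(2)[of q p] that e by (cases p q rule: linorder_cases) (auto simp: dist_commute)
    then show "\<exists>P. eventually P (at t within (D \<inter> {t<..})) \<and> (\<forall>x y. P x \<and> P y \<longrightarrow> dist (f x) (f y) < e)"
      using b(1) by (intro exI[of _ "\<lambda>s. s \<in> D \<and> t < s \<and> s < b"])
        (auto simp: eventually_at dist_real_def intro!: exI[of _ "b - t"])
  qed
qed

context levy_setting
begin

text \<open>The trace of Q, written as the squared Hilbert--Schmidt norm of its square root; the sum
  is finite by \<open>hs_finite\<close>.\<close>

definition total_variance :: real where
  "total_variance = enn2real (\<Sum>n. ennreal ((norm (R (onb_seq n)))\<^sup>2))"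

lemma incr_variance:
  assumes "0 \<le> s" "s \<le> t"
  shows "(\<integral>\<^sup>+\<omega>. ennreal ((norm (L t \<omega> - L s \<omega>))\<^sup>2) \<partial>M) = ennreal ((t - s) * total_variance)"
    and "expectation (\<lambda>\<omega>. (norm (L t \<omega> - L s \<omega>))\<^sup>2) = (t - s) * total_variance"
proof -
  have "ennreal total_variance = (\<Sum>n. ennreal ((norm (R (onb_seq n)))\<^sup>2))"
    unfolding total_variance_def using hs_finite[of id_blinfun] by (intro ennreal_enn2real) simp
  then show 1: "(\<integral>\<^sup>+\<omega>. ennreal ((norm (L t \<omega> - L s \<omega>))\<^sup>2) \<partial>M) = ennreal ((t - s) * total_variance)"
    using incr_hs[OF assms, of id_blinfun] assms by (simp add: ennreal_mult total_variance_def)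
  have "0 \<le> total_variance" by (simp add: total_variance_def)
  then show "expectation (\<lambda>\<omega>. (norm (L t \<omega> - L s \<omega>))\<^sup>2) = (t - s) * total_variance"
    using 1 assms by (intro integral_eq_nn_integral[THEN trans]) auto
qed

lemma greedy_count_expectation:
  assumes \<epsilon>: "\<epsilon> > 0" and u: "mono u" "\<And>k. u k \<in> {0..T}"
  shows "(\<integral>\<^sup>+\<omega>. ennreal (real (greedy_count \<epsilon> (\<lambda>k. L (u k) \<omega>) n)) \<partial>M) \<le> ennreal (T * total_variance / \<epsilon>\<^sup>2)"
    and "(\<lambda>\<omega>. real (greedy_count \<epsilon> (\<lambda>k. L (u k) \<omega>) n)) \<in> borel_measurable M"
proof -
  have u0: "0 \<le> u k" "u k \<le> T" for k using u(2)[of k] by auto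
  have uS: "u k \<le> u (Suc k)" for k using monoD[OF u(1), of k "Suc k"] by simp
  define X where "X k = L (u k)" for k
  define ref where "ref k \<omega> = greedy_ref \<epsilon> (\<lambda>k. X k \<omega>) k" for k \<omega>
  define cnt where "cnt k \<omega> = real (greedy_count \<epsilon> (\<lambda>k. X k \<omega>) k)" for k \<omega>
  have XF: "X k \<in> borel_measurable (F (u k))" for k unfolding X_def using L_F[OF u0(1)] by simp
  have refF: "ref k \<in> borel_measurable (F (u k))" for k
  proof (induction k)
    case 0
    have "ref 0 = X 0" by (simp add: ref_def fun_eq_iff)
    then show ?case using XF by simp
  next
    case (Suc k)
    have [measurable]: "ref k \<in> borel_measurable (F (u (Suc k)))"
      by (rule measurable_from_subalg[OF F_subalgebra_mono[OF u0(1) uS] Suc])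
    have [measurable]: "X (Suc k) \<in> borel_measurable (F (u (Suc k)))" by (rule XF)
    have "ref (Suc k) = (\<lambda>\<omega>. if norm (X (Suc k) \<omega> - ref k \<omega>) > \<epsilon> then X (Suc k) \<omega> else ref k \<omega>)"
      by (simp add: ref_def fun_eq_iff)
    then show ?case by simp
  qed
  have [measurable]: "X k \<in> borel_measurable M" "ref k \<in> borel_measurable M" for k
    using measurable_from_subalg[OF F_sub[OF u0(1)]] XF refF by blast+
  have cntM[measurable]: "cnt k \<in> borel_measurable M" for k
  proof (induction k)
    case (Suc k)
    have "cnt (Suc k) = (\<lambda>\<omega>. cnt k \<omega> + (if norm (X (Suc k) \<omega> - ref k \<omega>) > \<epsilon> then 1 else 0))"
      by (simp add: cnt_def ref_def fun_eq_iff)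
    then show ?case using Suc by simp
  qed (simp add: cnt_def[abs_def])
  show "(\<lambda>\<omega>. real (greedy_count \<epsilon> (\<lambda>k. L (u k) \<omega>) n)) \<in> borel_measurable M"
    using cntM[of n] unfolding cnt_def[abs_def] X_def .
  have cnt_le: "cnt k \<omega> \<le> real k" for k \<omega>
  proof -
    have "card {i. i < k \<and> norm (X (Suc i) \<omega> - greedy_ref \<epsilon> (\<lambda>k. X k \<omega>) i) > \<epsilon>} \<le> card {..<k}"
      by (intro card_mono) auto
    then show ?thesis by (simp add: cnt_def greedy_count_eq_card)
  qed
  have diff_le: "norm (X k \<omega> - ref k \<omega>) \<le> \<epsilon>" for k \<omega>
    unfolding ref_def using greedy_ref_close[of \<epsilon> "\<lambda>k. X k \<omega>" k] \<epsilon> by simp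
  \<comment> \<open>The potential behind the count: a reset turns a squared distance above
    \<epsilon>^2 into 0 and adds \<epsilon>^2 through the counter, so the reset itself never raises
    the value. The reference is known before the next increment, so the cross term has mean zero and
    the expectation grows by at most the variance of that increment.\<close>
  define Z where "Z k \<omega> = (norm (X k \<omega> - ref k \<omega>))\<^sup>2 + \<epsilon>\<^sup>2 * cnt k \<omega>" for k \<omega>
  have Z_bound: "0 \<le> Z k \<omega>" "Z k \<omega> \<le> \<epsilon>\<^sup>2 + \<epsilon>\<^sup>2 * real k" for k \<omega>
    using power_mono[OF diff_le[of k \<omega>], of 2] cnt_le[of k \<omega>] by (auto simp: Z_def cnt_def intro!: add_mono mult_left_mono)
  have [measurable]: "Z k \<in> borel_measurable M" for k unfolding Z_def by measurable
  have Z_int: "integrable M (Z k)" for k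
    by (rule integrable_const_bound[of _ "\<epsilon>\<^sup>2 + \<epsilon>\<^sup>2 * real k"]) (use Z_bound[of k] in \<open>auto intro!: AE_I2\<close>)
  have step: "expectation (Z (Suc k)) \<le> expectation (Z k) + (u (Suc k) - u k) * total_variance" for k
  proof -
    define d where "d \<omega> = X (Suc k) \<omega> - X k \<omega>" for \<omega>
    have d': "d \<in> borel_measurable M" "integrable M (\<lambda>\<omega>. (norm (d \<omega>))\<^sup>2)" "\<And>A. A \<in> sets (F (u k)) \<Longrightarrow> (LINT \<omega>:A|M. d \<omega>) = 0"
      unfolding d_def by (measurable, unfold X_def, rule incr_sq[OF u0(1) u0(1)], rule incr_zero[OF u0(1) uS])
    define W where "W \<omega> = 2 *\<^sub>R (X k \<omega> - ref k \<omega>)" for \<omega>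
    have WF: "W \<in> borel_measurable (F (u k))" unfolding W_def using XF refF by simp
    have [measurable]: "W \<in> borel_measurable M" unfolding W_def by measurable
    have W2: "integrable M (\<lambda>\<omega>. (norm (W \<omega>))\<^sup>2)"
    proof (rule integrable_const_bound[of _ "(2 * \<epsilon>)\<^sup>2"])
      show "AE \<omega> in M. norm ((norm (W \<omega>))\<^sup>2) \<le> (2 * \<epsilon>)\<^sup>2"
        using power_mono[of "norm (W _)" "2 * \<epsilon>" 2] diff_le by (intro AE_I2) (simp add: W_def power_mono)
    qed measurable
    note Wd = integral_inner_orthogonal[OF F_sub[OF u0(1)] d' WF W2]
    have "expectation (Z (Suc k)) \<le> expectation (\<lambda>\<omega>. Z k \<omega> + W \<omega> \<bullet> d \<omega> + (norm (d \<omega>))\<^sup>2)"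
    proof (rule integral_mono[OF Z_int])
      show "integrable M (\<lambda>\<omega>. Z k \<omega> + W \<omega> \<bullet> d \<omega> + (norm (d \<omega>))\<^sup>2)" using Z_int Wd(1) d'(2) by simp
      fix \<omega>
      have e: "(norm (X (Suc k) \<omega> - ref k \<omega>))\<^sup>2 = (norm (X k \<omega> - ref k \<omega>))\<^sup>2 + W \<omega> \<bullet> d \<omega> + (norm (d \<omega>))\<^sup>2"
        by (simp add: power2_norm_eq_inner W_def d_def inner_diff_left inner_diff_right inner_commute algebra_simps)
      show "Z (Suc k) \<omega> \<le> Z k \<omega> + W \<omega> \<bullet> d \<omega> + (norm (d \<omega>))\<^sup>2"
      proof (cases "norm (X (Suc k) \<omega> - ref k \<omega>) > \<epsilon>")
        case True
        then have "\<epsilon>\<^sup>2 \<le> (norm (X (Suc k) \<omega> - ref k \<omega>))\<^sup>2" using \<epsilon> by (intro power_mono) auto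
        moreover have "Z (Suc k) \<omega> = \<epsilon>\<^sup>2 + \<epsilon>\<^sup>2 * cnt k \<omega>"
          using True by (simp add: Z_def cnt_def ref_def algebra_simps)
        ultimately show ?thesis using e by (simp add: Z_def)
      next
        case False
        then have "Z (Suc k) \<omega> = (norm (X (Suc k) \<omega> - ref k \<omega>))\<^sup>2 + \<epsilon>\<^sup>2 * cnt k \<omega>"
          by (simp add: Z_def cnt_def ref_def)
        then show ?thesis using e by (simp add: Z_def)
      qed
    qed
    also have "\<dots> = expectation (Z k) + expectation (\<lambda>\<omega>. (norm (d \<omega>))\<^sup>2)"
      using Z_int Wd d'(2) by simp
    also have "expectation (\<lambda>\<omega>. (norm (d \<omega>))\<^sup>2) = (u (Suc k) - u k) * total_variance"
      unfolding d_def X_def by (rule incr_variance(2)[OF u0(1) uS])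
    finally show ?thesis by simp
  qed
  have "expectation (Z k) \<le> (u k - u 0) * total_variance" for k
  proof (induction k)
    case 0
    have "Z 0 = (\<lambda>\<omega>. 0)" by (simp add: Z_def cnt_def ref_def fun_eq_iff)
    then show ?case by simp
  next
    case (Suc k)
    then show ?case using step[of k] by (simp add: algebra_simps)
  qed
  moreover have "0 \<le> total_variance" by (simp add: total_variance_def)
  ultimately have EZ: "expectation (Z n) \<le> T * total_variance"
    using u0(1)[of 0] u0(2)[of n] by (meson diff_le_eq le_add_same_cancel1 mult_right_mono order_trans)
  have "(\<integral>\<^sup>+\<omega>. ennreal (cnt n \<omega>) \<partial>M) \<le> (\<integral>\<^sup>+\<omega>. ennreal (Z n \<omega> / \<epsilon>\<^sup>2) \<partial>M)"
    using \<epsilon> by (intro nn_integral_mono ennreal_leI) (simp add: Z_def field_simps)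
  also have "\<dots> = ennreal (expectation (Z n) / \<epsilon>\<^sup>2)"
    using Z_int Z_bound(1) by (subst nn_integral_eq_integral) auto
  also have "\<dots> \<le> ennreal (T * total_variance / \<epsilon>\<^sup>2)"
    using EZ by (intro ennreal_leI divide_right_mono) auto
  finally show "(\<integral>\<^sup>+\<omega>. ennreal (real (greedy_count \<epsilon> (\<lambda>k. L (u k) \<omega>) n)) \<partial>M) \<le> ennreal (T * total_variance / \<epsilon>\<^sup>2)"
    by (simp add: cnt_def X_def)
qed

text \<open>The grids \<open>P n\<close> exhaust D. By Fatou the lower limit of the counts has
  finite expectation and is finite almost surely, while infinitely many nonoverlapping oscillations
  would push it to infinity.\<close>

lemma AE_no_oscillation:
  assumes T: "0 < T" and D: "countable D" "D \<subseteq> {0..T}" "0 \<in> D" and \<epsilon>: "\<epsilon> > 0"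
  shows "AE \<omega> in M. no_oscillation D (2 * \<epsilon>) (\<lambda>t. L t \<omega>)"
proof -
  define P where "P n = insert 0 (from_nat_into D ` {..n})" for n
  have PD: "P n \<subseteq> D" for n using D(3) from_nat_into[of D] by (auto simp: P_def)
  have P0: "finite (P n)" "P n \<subseteq> {0..}" "0 \<in> P n" for n
  proof -
    show "P n \<subseteq> {0..}" using subset_trans[OF PD[of n] D(2)] by auto
  qed (auto simp: P_def)
  have "\<exists>(u :: nat \<Rightarrow> real) N. mono u \<and> u ` {..N} = P n \<and> (\<forall>k. u k \<in> P n) \<and> (\<forall>i j. i < j \<longrightarrow> j \<le> N \<longrightarrow> u i < u j)" for n
  proof -
    obtain v K where v: "mono v" "v ` {..K} = P n" "v 0 = 0" "\<And>k. v k \<in> P n"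
      "\<And>k p. p \<in> P n \<Longrightarrow> p \<le> v k \<or> v (Suc k) \<le> p" "\<And>i j. i < j \<Longrightarrow> j \<le> K \<Longrightarrow> v i < v j"
      by (rule ex_grid[OF P0[of n]]) (rule that)
    show ?thesis by (rule exI[of _ v], rule exI[of _ K]) (use v(1,2,4,6) in auto)
  qed
  then obtain u :: "nat \<Rightarrow> nat \<Rightarrow> real" and N where u: "\<And>n. mono (u n)" "\<And>n. u n ` {..N n} = P n" "\<And>n k. u n k \<in> P n" "\<And>n i j. i < j \<Longrightarrow> j \<le> N n \<Longrightarrow> u n i < u n j"
    by metis
  define C where "C n \<omega> = real (greedy_count \<epsilon> (\<lambda>k. L (u n k) \<omega>) (N n))" for n \<omega>
  have uT: "u n k \<in> {0..T}" for n k using u(3)[of n k] PD[of n] D(2) by auto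
  have CM[measurable]: "C n \<in> borel_measurable M" for n
    unfolding C_def by (rule greedy_count_expectation(2)[OF \<epsilon> u(1) uT])
  have "(\<integral>\<^sup>+\<omega>. liminf (\<lambda>n. ennreal (C n \<omega>)) \<partial>M) \<le> liminf (\<lambda>n. \<integral>\<^sup>+\<omega>. ennreal (C n \<omega>) \<partial>M)"
    by (rule nn_integral_liminf) measurable
  also have "\<dots> \<le> liminf (\<lambda>n. ennreal (T * total_variance / \<epsilon>\<^sup>2))"
    unfolding C_def by (intro Liminf_mono always_eventually allI greedy_count_expectation(1)[OF \<epsilon> u(1) uT])
  also have "\<dots> = ennreal (T * total_variance / \<epsilon>\<^sup>2)" by (simp add: Liminf_const)
  finally have "(\<integral>\<^sup>+\<omega>. liminf (\<lambda>n. ennreal (C n \<omega>)) \<partial>M) \<noteq> \<infinity>" by (auto simp: top_unique)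
  then have "AE \<omega> in M. liminf (\<lambda>n. ennreal (C n \<omega>)) \<noteq> \<infinity>"
    by (intro nn_integral_noteq_infinite) measurable
  then show ?thesis
  proof (rule eventually_mono)
    fix \<omega> assume fin: "liminf (\<lambda>n. ennreal (C n \<omega>)) \<noteq> \<infinity>"
    show "no_oscillation D (2 * \<epsilon>) (\<lambda>t. L t \<omega>)"
      unfolding no_oscillation_def
    proof (rule notI, elim exE conjE)
      fix p q :: "nat \<Rightarrow> real"
      assume pq: "\<forall>i. p i \<in> D \<and> q i \<in> D \<and> p i < q i \<and> dist (L (p i) \<omega>) (L (q i) \<omega>) > 2 * \<epsilon>"
        and disj: "\<forall>i j. i < j \<longrightarrow> q i \<le> p j \<or> q j \<le> p i"
      have ge: "\<forall>\<^sub>F n in sequentially. of_nat m \<le> ennreal (C n \<omega>)" for m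
      proof -
        have inP: "\<exists>n0. \<forall>n\<ge>n0. x \<in> P n" if x: "x \<in> D" for x
        proof -
          obtain k where "from_nat_into D k = x" using from_nat_into_surj[OF D(1) x] by blast
          then show ?thesis by (intro exI[of _ k]) (auto simp: P_def)
        qed
        have "\<forall>\<^sub>F n in sequentially. p i \<in> P n \<and> q i \<in> P n" for i
          using inP[of "p i"] inP[of "q i"] pq by (auto simp: eventually_conj_iff eventually_sequentially)
        then have "\<forall>\<^sub>F n in sequentially. \<forall>i\<in>{..<m}. p i \<in> P n \<and> q i \<in> P n"
          by (intro eventually_ball_finite) auto
        then show ?thesis
        proof (rule eventually_mono)
          fix n assume n: "\<forall>i\<in>{..<m}. p i \<in> P n \<and> q i \<in> P n"
          have "m \<le> greedy_count \<epsilon> (\<lambda>k. (\<lambda>t. L t \<omega>) (u n k)) (N n)"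
            by (rule greedy_count_ge[where p = p and q = q])
               (use \<epsilon> u(4) n pq disj u(2) in \<open>auto simp: dist_norm\<close>)
          then show "of_nat m \<le> ennreal (C n \<omega>)"
            by (simp add: C_def ennreal_of_nat_eq_real_of_nat ennreal_leI)
        qed
      qed
      have "of_nat m \<le> liminf (\<lambda>n. ennreal (C n \<omega>))" for m
        by (rule Liminf_bounded[OF ge])
      then have "liminf (\<lambda>n. ennreal (C n \<omega>)) = \<infinity>"
        by (metis ennreal_Ex_less_of_nat infinity_ennreal_def leD less_top)
      then show False using fin by simp
    qed
  qed
qed

text \<open>The path is replaced by its right limits along the rational times, off the null set
  where oscillations accumulate. This is a modification because E |L(s) - L(t)|^2 = (s - t) tr Q
  tends to 0 as s decreases to t, and Fatou transfers the limit.\<close>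

theorem ex_cadlag_levy:
  assumes T: "0 < T"
  shows "\<exists>L'. cadlag_modification M T L L'"
proof -
  define D where "D = insert 0 ({0..T} \<inter> \<rat>)"
  have D: "countable D" "D \<subseteq> {0..T}" "0 \<in> D" using T by (auto simp: D_def countable_rat intro: countable_subset)
  have dense: "dense_times T D"
    unfolding dense_times_def
  proof (intro conjI allI impI)
    fix a b :: real assume ab: "0 \<le> a" "a < b" "b \<le> T"
    obtain r where "a < real_of_rat r" "real_of_rat r < b" using of_rat_dense[OF ab(2)] by blast
    moreover have "real_of_rat r \<in> {0..T}" unfolding atLeastAtMost_iff using ab calculation by (intro conjI) linarith+
    ultimately show "\<exists>d\<in>D. a < d \<and> d < b" by (intro bexI[of _ "real_of_rat r"]) (auto simp: D_def)
  qed (use D in auto)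
  have "AE \<omega> in M. \<forall>k::nat. no_oscillation D (2 * (1 / real (Suc k))) (\<lambda>t. L t \<omega>)"
    unfolding AE_all_countable by (intro allI AE_no_oscillation[OF T D]) simp
  then obtain N where N: "N \<in> null_sets M" "{\<omega> \<in> space M. \<not> (\<forall>k::nat. no_oscillation D (2 * (1 / real (Suc k))) (\<lambda>t. L t \<omega>))} \<subseteq> N"
    unfolding eventually_ae_filter by blast
  have no: "no_oscillation D e (\<lambda>t. L t \<omega>)" if w: "\<omega> \<in> space M - N" and e: "e > 0" for \<omega> e
  proof -
    obtain k where k: "1 / real (Suc k) < e / 2" using reals_Archimedean[of "e / 2"] e by (auto simp: inverse_eq_divide)
    have "no_oscillation D (2 * (1 / real (Suc k))) (\<lambda>t. L t \<omega>)" using N(2) w by blast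
    then show ?thesis by (rule no_oscillation_mono) (use k in simp)
  qed
  define L' where "L' t \<omega> = (if \<omega> \<in> N then 0 else regularize T D (\<lambda>t. L t \<omega>) t)" for t \<omega>
  have lims: "right_limits_on T D (\<lambda>t. L t \<omega>)" "left_limits_on T D (\<lambda>t. L t \<omega>)" if "\<omega> \<in> space M - N" for \<omega>
    using no_oscillation_right_limits[OF dense no[OF that]] no_oscillation_left_limits[OF dense no[OF that]] by auto
  have cad: "cadlag_on T (\<lambda>t. L' t \<omega>)" if w: "\<omega> \<in> space M" for \<omega>
  proof (cases "\<omega> \<in> N")
    case True
    then show ?thesis by (auto simp: L'_def cadlag_on_def)
  next
    case False
    then have "(\<lambda>t. L' t \<omega>) = regularize T D (\<lambda>t. L t \<omega>)" by (simp add: L'_def fun_eq_iff)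
    then show ?thesis using cadlag_regularize[OF dense lims] w False by simp
  qed
  have NM[measurable]: "N \<in> sets M" using N(1) by auto
  have mod: "L' t \<in> borel_measurable M \<and> (AE \<omega> in M. L' t \<omega> = L t \<omega>)" if t: "t \<in> {0..T}" for t
  proof (cases "t < T")
    case False
    then have tT: "t = T" using t by simp
    have eq: "L' T = (\<lambda>\<omega>. if \<omega> \<in> N then 0 else L T \<omega>)" by (simp add: L'_def regularize_def fun_eq_iff)
    have [measurable]: "L T \<in> borel_measurable M" using T by simp
    show ?thesis
      unfolding tT eq using AE_not_in[OF N(1)] by (auto elim: eventually_mono)
  next
    case True
    then have t': "t \<in> {0..<T}" using t by simp
    have "\<exists>s. s \<in> D \<and> t < s \<and> s < t + 1 / real (Suc n)" for n
    proof -
      have "t < min T (t + 1 / real (Suc n))" using True by simp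
      then obtain s where "s \<in> D" "t < s" "s < min T (t + 1 / real (Suc n))"
        using dense t unfolding dense_times_def by (metis atLeastAtMost_iff min.cobounded1)
      then show ?thesis by auto
    qed
    then obtain s where s: "\<And>n. s n \<in> D" "\<And>n. t < s n" "\<And>n. s n < t + 1 / real (Suc n)" by metis
    have s0: "0 \<le> s n" for n using s(1)[of n] D(2) by auto
    have "s \<longlonglongrightarrow> t"
    proof (rule tendsto_sandwich[OF _ _ tendsto_const])
      show "(\<lambda>n. t + 1 / real (Suc n)) \<longlonglongrightarrow> t"
        using tendsto_add[OF tendsto_const[of t] LIMSEQ_Suc[OF lim_const_over_n[of 1]]] by simp
    qed (use s in \<open>auto intro!: always_eventually less_imp_le\<close>)
    then have sf: "filterlim s (at t within (D \<inter> {t<..})) sequentially"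
      using s by (auto simp: filterlim_at intro!: always_eventually less_imp_neq[symmetric])
    have conv: "(\<lambda>n. L (s n) \<omega>) \<longlonglongrightarrow> L' t \<omega>" if w: "\<omega> \<in> space M - N" for \<omega>
    proof -
      have "((\<lambda>t. L t \<omega>) \<longlongrightarrow> regularize T D (\<lambda>t. L t \<omega>) t) (at t within (D \<inter> {t<..}))"
        by (rule regularize_tendsto[OF dense lims(1)[OF w] t'])
      from filterlim_compose[OF this sf] show ?thesis using w by (simp add: L'_def)
    qed
    have [measurable]: "L (s n) \<in> borel_measurable M" "L t \<in> borel_measurable M" for n using s0 t by auto
    have L'M[measurable]: "L' t \<in> borel_measurable M"
    proof (rule borel_measurable_LIMSEQ_metric)
      show "(\<lambda>\<omega>. if \<omega> \<in> N then 0 else L (s n) \<omega>) \<in> borel_measurable M" for n by measurable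
      fix \<omega> assume w: "\<omega> \<in> space M"
      show "(\<lambda>n. if \<omega> \<in> N then 0 else L (s n) \<omega>) \<longlonglongrightarrow> L' t \<omega>"
        using conv[of \<omega>] w by (cases "\<omega> \<in> N") (auto simp: L'_def)
    qed
    have "(\<integral>\<^sup>+\<omega>. ennreal ((norm (L' t \<omega> - L t \<omega>))\<^sup>2) \<partial>M) \<le> (\<integral>\<^sup>+\<omega>. liminf (\<lambda>n. ennreal ((norm (L (s n) \<omega> - L t \<omega>))\<^sup>2)) \<partial>M)"
    proof (rule nn_integral_mono_AE)
      show "AE \<omega> in M. ennreal ((norm (L' t \<omega> - L t \<omega>))\<^sup>2) \<le> liminf (\<lambda>n. ennreal ((norm (L (s n) \<omega> - L t \<omega>))\<^sup>2))"
        using AE_not_in[OF N(1)] AE_space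
      proof eventually_elim
        fix \<omega> assume "\<omega> \<notin> N" "\<omega> \<in> space M"
        then have "(\<lambda>n. ennreal ((norm (L (s n) \<omega> - L t \<omega>))\<^sup>2)) \<longlonglongrightarrow> ennreal ((norm (L' t \<omega> - L t \<omega>))\<^sup>2)"
          by (intro tendsto_ennrealI tendsto_power tendsto_norm tendsto_diff tendsto_const conv) simp
        then show "ennreal ((norm (L' t \<omega> - L t \<omega>))\<^sup>2) \<le> liminf (\<lambda>n. ennreal ((norm (L (s n) \<omega> - L t \<omega>))\<^sup>2))"
          using lim_imp_Liminf[OF trivial_limit_sequentially] by (metis order_refl)
      qed
    qed
    also have "\<dots> \<le> liminf (\<lambda>n. \<integral>\<^sup>+\<omega>. ennreal ((norm (L (s n) \<omega> - L t \<omega>))\<^sup>2) \<partial>M)"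
      by (rule nn_integral_liminf) measurable
    also have "(\<lambda>n. \<integral>\<^sup>+\<omega>. ennreal ((norm (L (s n) \<omega> - L t \<omega>))\<^sup>2) \<partial>M) = (\<lambda>n. ennreal ((s n - t) * total_variance))"
      using s t by (intro ext incr_variance(1)) (auto intro: less_imp_le)
    also have "liminf \<dots> = ennreal ((t - t) * total_variance)"
      by (intro lim_imp_Liminf tendsto_ennrealI tendsto_mult tendsto_diff tendsto_const \<open>s \<longlonglongrightarrow> t\<close>) simp
    finally have "(\<integral>\<^sup>+\<omega>. ennreal ((norm (L' t \<omega> - L t \<omega>))\<^sup>2) \<partial>M) = 0" by simp
    then have "AE \<omega> in M. ennreal ((norm (L' t \<omega> - L t \<omega>))\<^sup>2) = 0"
      by (subst (asm) nn_integral_0_iff_AE) auto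
    then have "AE \<omega> in M. L' t \<omega> = L t \<omega>" by (rule eventually_mono) (simp add: ennreal_eq_0_iff)
    then show ?thesis using L'M by simp
  qed
  show ?thesis
    by (rule exI[of _ L']) (use cad mod in \<open>auto simp: cadlag_modification_def\<close>)
qed

end

subsection \<open>Cadlag paths and their suprema\<close>

lemma cadlag_on_continuous:
  assumes "continuous_on UNIV f" shows "cadlag_on T f"
proof -
  have "(f \<longlongrightarrow> f t) (at t)" for t using assms by (simp add: continuous_on_def)
  then have "(f \<longlongrightarrow> f t) (at_right t)" "(f \<longlongrightarrow> f t) (at_left t)" for t
    by (auto intro: tendsto_mono[OF at_le])
  then show ?thesis by (auto simp: cadlag_on_def)
qed

lemma cadlag_on_compose2:
  fixes f :: "real \<Rightarrow> 'b::t2_space" and g :: "real \<Rightarrow> 'c::t2_space"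
  assumes f: "cadlag_on T f" and g: "cadlag_on T g" and h: "continuous_on UNIV h"
  shows "cadlag_on T (\<lambda>t. h (f t, g t))"
proof -
  have lim: "((\<lambda>t. h (f t, g t)) \<longlongrightarrow> h (a, b)) F" if "(f \<longlongrightarrow> a) F" "(g \<longlongrightarrow> b) F" for a b F
  proof (rule isCont_tendsto_compose[of _ h])
    show "isCont h (a, b)" using h by (simp add: continuous_on_eq_continuous_at)
  qed (rule tendsto_Pair[OF that])
  show ?thesis
    unfolding cadlag_on_def
  proof (intro conjI ballI)
    fix t assume "t \<in> {0..<T}"
    then show "((\<lambda>t. h (f t, g t)) \<longlongrightarrow> h (f t, g t)) (at_right t)"
      using f g by (intro lim) (auto simp: cadlag_on_def)
  next
    fix t assume "t \<in> {0<..T}"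
    then obtain a b where "(f \<longlongrightarrow> a) (at_left t)" "(g \<longlongrightarrow> b) (at_left t)" using f g unfolding cadlag_on_def by blast
    then show "\<exists>l. ((\<lambda>t. h (f t, g t)) \<longlongrightarrow> l) (at_left t)" using lim by blast
  qed
qed

lemma cadlag_on_add:
  fixes f g :: "real \<Rightarrow> 'h::real_normed_vector"
  assumes "cadlag_on T f" "cadlag_on T g" shows "cadlag_on T (\<lambda>t. f t + g t)"
  using cadlag_on_compose2[OF assms, of "\<lambda>p. fst p + snd p"] by (simp add: continuous_intros)

lemma cadlag_on_diff:
  fixes f g :: "real \<Rightarrow> 'h::real_normed_vector"
  assumes "cadlag_on T f" "cadlag_on T g" shows "cadlag_on T (\<lambda>t. f t - g t)"
  using cadlag_on_compose2[OF assms, of "\<lambda>p. fst p - snd p"] by (simp add: continuous_intros)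

lemma cadlag_on_min:
  assumes f: "cadlag_on T f" shows "cadlag_on T (\<lambda>t. f (min b t))"
  unfolding cadlag_on_def
proof (intro conjI ballI)
  fix t assume t: "t \<in> {0..<T}"
  show "((\<lambda>t. f (min b t)) \<longlongrightarrow> f (min b t)) (at_right t)"
  proof (cases "t < b")
    case True
    have "(f \<longlongrightarrow> f t) (at_right t)" using f t by (simp add: cadlag_on_def)
    moreover have "\<forall>\<^sub>F r in at_right t. f r = f (min b r)"
      unfolding eventually_at_right_field using True by (intro exI[of _ b]) auto
    ultimately show ?thesis using True by (simp add: tendsto_cong)
  next
    case False
    have "\<forall>\<^sub>F r in at_right t. f (min b r) = f (min b t)"
      unfolding eventually_at_right_field using False by (intro exI[of _ "t + 1"]) auto
    then show ?thesis by (rule tendsto_eventually)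
  qed
next
  fix t assume t: "t \<in> {0<..T}"
  show "\<exists>l. ((\<lambda>t. f (min b t)) \<longlongrightarrow> l) (at_left t)"
  proof (cases "t \<le> b")
    case True
    obtain l where l: "(f \<longlongrightarrow> l) (at_left t)" using f t unfolding cadlag_on_def by blast
    have "\<forall>\<^sub>F r in at_left t. f (min b r) = f r"
      unfolding eventually_at_left_field using True by (intro exI[of _ "t - 1"]) auto
    then show ?thesis using l by (auto simp: tendsto_cong)
  next
    case False
    have "\<forall>\<^sub>F r in at_left t. f (min b r) = f b"
      unfolding eventually_at_left_field using False by (intro exI[of _ b]) auto
    then show ?thesis by (intro exI[of _ "f b"]) (rule tendsto_eventually)
  qed
qed

lemma cadlag_on_uniform_limit:
  fixes g :: "real \<Rightarrow> 'h::complete_space"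
  assumes f: "\<And>n::nat. cadlag_on T (f n)" and lim: "\<And>e. e > 0 \<Longrightarrow> \<exists>n. \<forall>t\<in>{0..T}. dist (f n t) (g t) < e"
  shows "cadlag_on T g"
  unfolding cadlag_on_def
proof (intro conjI ballI)
  fix t assume t: "t \<in> {0..<T}"
  show "(g \<longlongrightarrow> g t) (at_right t)"
  proof (rule tendstoI)
    fix e :: real assume e: "e > 0"
    obtain n where n: "\<forall>t\<in>{0..T}. dist (f n t) (g t) < e / 3" using lim[of "e / 3"] e by auto
    have "(f n \<longlongrightarrow> f n t) (at_right t)" using f t by (simp add: cadlag_on_def)
    then have "\<forall>\<^sub>F r in at_right t. dist (f n r) (f n t) < e / 3" using e by (intro tendstoD) auto
    moreover have "\<forall>\<^sub>F r in at_right t. r \<in> {t<..<T}" using t by (intro eventually_at_right_real) auto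
    ultimately show "\<forall>\<^sub>F r in at_right t. dist (g r) (g t) < e"
    proof eventually_elim
      fix r assume r: "dist (f n r) (f n t) < e / 3" "r \<in> {t<..<T}"
      have "dist (g r) (g t) \<le> dist (f n r) (g r) + dist (f n r) (f n t) + dist (f n t) (g t)"
        by (metis (no_types) add.commute add_left_mono dist_commute dist_triangle dist_triangle3 order_trans)
      also have "\<dots> < e / 3 + e / 3 + e / 3" using n r t by (intro add_strict_mono) auto
      finally show "dist (g r) (g t) < e" by simp
    qed
  qed
next
  fix t assume t: "t \<in> {0<..T}"
  show "\<exists>l. (g \<longlongrightarrow> l) (at_left t)"
  proof (rule cauchy_filter_tendsto)
    show "at_left t \<noteq> bot" by simp
    fix e :: real assume e: "e > 0"
    obtain n where n: "\<forall>t\<in>{0..T}. dist (f n t) (g t) < e / 4" using lim[of "e / 4"] e by auto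
    obtain l where l: "(f n \<longlongrightarrow> l) (at_left t)" using f t unfolding cadlag_on_def by blast
    have "\<forall>\<^sub>F r in at_left t. dist (f n r) l < e / 4" using l e by (intro tendstoD) auto
    moreover have "\<forall>\<^sub>F r in at_left t. r \<in> {0<..<t}" using t by (intro eventually_at_left_real) auto
    ultimately have "\<forall>\<^sub>F r in at_left t. dist (f n r) l < e / 4 \<and> r \<in> {0..T}"
      by eventually_elim (use t in auto)
    moreover have "dist (g x) (g y) < e" if "dist (f n x) l < e / 4 \<and> x \<in> {0..T}" "dist (f n y) l < e / 4 \<and> y \<in> {0..T}" for x y
    proof -
      have "dist (g x) (g y) \<le> dist (g x) l + dist (g y) l" by (rule dist_triangle2)
      moreover have "dist (g x) l \<le> dist (f n x) (g x) + dist (f n x) l" by (rule dist_triangle3)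
      moreover have "dist (g y) l \<le> dist (f n y) (g y) + dist (f n y) l" by (rule dist_triangle3)
      moreover have "dist (f n x) (g x) < e / 4" "dist (f n y) (g y) < e / 4" using that n by auto
      ultimately show ?thesis using that by linarith
    qed
    ultimately show "\<exists>P. eventually P (at_left t) \<and> (\<forall>x y. P x \<and> P y \<longrightarrow> dist (g x) (g y) < e)"
      by (intro exI[of _ "\<lambda>r. dist (f n r) l < e / 4 \<and> r \<in> {0..T}"]) blast
  qed
qed

section \<open>Suprema of squared norms along a path\<close>

definition path_sup :: "real \<Rightarrow> (real \<Rightarrow> 'h::real_normed_vector) \<Rightarrow> ennreal" where
  "path_sup T f = (SUP t\<in>{0..T}. ennreal ((norm (f t))\<^sup>2))"

lemma path_sup_upper: "t \<in> {0..T} \<Longrightarrow> ennreal ((norm (f t))\<^sup>2) \<le> path_sup T f"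
  unfolding path_sup_def by (rule SUP_upper)

lemma ennreal_norm_add_square_le:
  "ennreal ((norm (x + y))\<^sup>2) \<le> 2 * ennreal ((norm x)\<^sup>2) + 2 * ennreal ((norm y)\<^sup>2)"
proof -
  have "ennreal ((norm (x + y))\<^sup>2) \<le> ennreal (2 * (norm x)\<^sup>2 + 2 * (norm y)\<^sup>2)"
    by (intro ennreal_leI norm_add_square_le)
  then show ?thesis by (simp add: ennreal_mult)
qed

lemma path_sup_add_le: "path_sup T (\<lambda>t. f t + g t) \<le> 2 * path_sup T f + 2 * path_sup T g"
  unfolding path_sup_def[of T "\<lambda>t. f t + g t"]
proof (rule SUP_least)
  fix t assume t: "t \<in> {0..T}"
  have "ennreal ((norm (f t + g t))\<^sup>2) \<le> 2 * ennreal ((norm (f t))\<^sup>2) + 2 * ennreal ((norm (g t))\<^sup>2)"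
    by (rule ennreal_norm_add_square_le)
  also have "\<dots> \<le> 2 * path_sup T f + 2 * path_sup T g"
    by (intro add_mono mult_left_mono path_sup_upper t) auto
  finally show "ennreal ((norm (f t + g t))\<^sup>2) \<le> 2 * path_sup T f + 2 * path_sup T g" .
qed

text \<open>T is added because right continuity gives no access to the value at the right end of the
  interval.\<close>

definition rational_times :: "real \<Rightarrow> real set" where
  "rational_times T = insert T ({0..T} \<inter> \<rat>)"

lemma rational_times: "0 < T \<Longrightarrow> countable (rational_times T)" "0 < T \<Longrightarrow> rational_times T \<subseteq> {0..T}" "0 < T \<Longrightarrow> dense_times T (rational_times T)"
proof -
  assume T: "0 < T"
  show "countable (rational_times T)" by (auto simp: rational_times_def countable_rat intro: countable_subset)
  show sub: "rational_times T \<subseteq> {0..T}" using T by (auto simp: rational_times_def)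
  show "dense_times T (rational_times T)"
    unfolding dense_times_def
  proof (intro conjI allI impI sub)
    fix a b :: real assume ab: "0 \<le> a" "a < b" "b \<le> T"
    obtain r where "a < real_of_rat r" "real_of_rat r < b" using of_rat_dense[OF ab(2)] by blast
    moreover have "real_of_rat r \<in> {0..T}" unfolding atLeastAtMost_iff using ab calculation by (intro conjI) linarith+
    ultimately show "\<exists>d\<in>rational_times T. a < d \<and> d < b"
      by (intro bexI[of _ "real_of_rat r"]) (auto simp: rational_times_def)
  qed
qed

text \<open>Right continuity recovers every earlier value from rational times. The supremum becomes
  countable, which gives its measurability.\<close>

lemma path_sup_eq_rational:
  assumes T: "0 < T" and f: "cadlag_on T f"
  shows "path_sup T f = (SUP t\<in>rational_times T. ennreal ((norm (f t))\<^sup>2))"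
proof (rule antisym)
  show "path_sup T f \<le> (SUP t\<in>rational_times T. ennreal ((norm (f t))\<^sup>2))"
    unfolding path_sup_def
  proof (rule SUP_least)
    fix t assume t: "t \<in> {0..T}"
    show "ennreal ((norm (f t))\<^sup>2) \<le> (SUP t\<in>rational_times T. ennreal ((norm (f t))\<^sup>2))"
    proof (cases "t = T")
      case True
      then show ?thesis by (intro SUP_upper) (simp add: rational_times_def)
    next
      case False
      then have t': "t \<in> {0..<T}" using t by auto
      let ?F = "at t within (rational_times T \<inter> {t<..})"
      have "(f \<longlongrightarrow> f t) ?F" using f t' unfolding cadlag_on_def by (metis tendsto_within_subset inf_le2)
      then have "((\<lambda>r. ennreal ((norm (f r))\<^sup>2)) \<longlongrightarrow> ennreal ((norm (f t))\<^sup>2)) ?F"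
        by (intro tendsto_ennrealI tendsto_power tendsto_norm)
      moreover have "\<forall>\<^sub>F r in ?F. ennreal ((norm (f r))\<^sup>2) \<le> (SUP t\<in>rational_times T. ennreal ((norm (f t))\<^sup>2))"
        unfolding eventually_at by (intro exI[of _ 1]) (auto intro: SUP_upper)
      ultimately show ?thesis
        by (rule tendsto_upperbound) (rule dense_times_right_nontrivial[OF rational_times(3)[OF T] t'])
    qed
  qed
  show "(SUP t\<in>rational_times T. ennreal ((norm (f t))\<^sup>2)) \<le> path_sup T f"
    unfolding path_sup_def by (rule SUP_subset_mono[OF rational_times(2)[OF T]]) simp
qed

lemma path_sup_measurable:
  fixes X :: "real \<Rightarrow> 'a \<Rightarrow> 'h::{real_normed_vector, second_countable_topology}"
  assumes T: "0 < T" and X: "\<And>t. t \<in> {0..T} \<Longrightarrow> X t \<in> borel_measurable M" and cad: "\<And>\<omega>. \<omega> \<in> space M \<Longrightarrow> cadlag_on T (\<lambda>t. X t \<omega>)"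
  shows "(\<lambda>\<omega>. path_sup T (\<lambda>t. X t \<omega>)) \<in> borel_measurable M"
proof -
  have "(\<lambda>\<omega>. SUP t\<in>rational_times T. ennreal ((norm (X t \<omega>))\<^sup>2)) \<in> borel_measurable M"
  proof (rule borel_measurable_SUP[OF rational_times(1)[OF T]])
    fix t assume "t \<in> rational_times T"
    then have [measurable]: "X t \<in> borel_measurable M" using X rational_times(2)[OF T] by auto
    show "(\<lambda>\<omega>. ennreal ((norm (X t \<omega>))\<^sup>2)) \<in> borel_measurable M" by measurable
  qed
  then show ?thesis
    by (rule measurable_cong[THEN iffD2, rotated]) (rule path_sup_eq_rational[OF T cad])
qed

text \<open>A bound that is uniform over finite sets of times passes to the supremum of the path: an
  increasing sequence of finite sets exhausts the rational times, and monotone convergence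
  applies.\<close>

lemma nn_integral_path_sup_le:
  fixes X :: "real \<Rightarrow> 'a \<Rightarrow> 'h::{real_normed_vector, second_countable_topology}"
  assumes T: "0 < T" and X: "\<And>t. t \<in> {0..T} \<Longrightarrow> X t \<in> borel_measurable M" and cad: "\<And>\<omega>. \<omega> \<in> space M \<Longrightarrow> cadlag_on T (\<lambda>t. X t \<omega>)"
    and fin: "\<And>J. finite J \<Longrightarrow> J \<subseteq> {0..T} \<Longrightarrow> (\<integral>\<^sup>+\<omega>. (SUP t\<in>J. ennreal ((norm (X t \<omega>))\<^sup>2)) \<partial>M) \<le> c"
  shows "(\<integral>\<^sup>+\<omega>. path_sup T (\<lambda>t. X t \<omega>) \<partial>M) \<le> c"
proof -
  define d where "d = from_nat_into (rational_times T)"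
  have ne: "rational_times T \<noteq> {}" by (simp add: rational_times_def)
  have rd: "range d = rational_times T" unfolding d_def by (rule range_from_nat_into[OF ne rational_times(1)[OF T]])
  then have dT: "d k \<in> {0..T}" for k using rational_times(2)[OF T] by (metis rangeI subsetD)
  define h where "h n \<omega> = (SUP t\<in>d ` {..n}. ennreal ((norm (X t \<omega>))\<^sup>2))" for n :: nat and \<omega>
  have "(\<integral>\<^sup>+\<omega>. path_sup T (\<lambda>t. X t \<omega>) \<partial>M) = (\<integral>\<^sup>+\<omega>. (SUP n. h n \<omega>) \<partial>M)"
  proof (rule nn_integral_cong)
    fix \<omega> assume "\<omega> \<in> space M"
    then have "path_sup T (\<lambda>t. X t \<omega>) = (SUP t\<in>range d. ennreal ((norm (X t \<omega>))\<^sup>2))"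
      using path_sup_eq_rational[OF T cad] rd by simp
    also have "\<dots> = (SUP n. h n \<omega>)"
    proof (rule antisym)
      show "(SUP t\<in>range d. ennreal ((norm (X t \<omega>))\<^sup>2)) \<le> (SUP n. h n \<omega>)"
      proof (rule SUP_least)
        fix t assume "t \<in> range d"
        then obtain k where "t = d k" by auto
        then have "ennreal ((norm (X t \<omega>))\<^sup>2) \<le> h k \<omega>" unfolding h_def by (intro SUP_upper) auto
        also have "\<dots> \<le> (SUP n. h n \<omega>)" by (rule SUP_upper) simp
        finally show "ennreal ((norm (X t \<omega>))\<^sup>2) \<le> (SUP n. h n \<omega>)" .
      qed
      show "(SUP n. h n \<omega>) \<le> (SUP t\<in>range d. ennreal ((norm (X t \<omega>))\<^sup>2))"
        unfolding h_def by (intro SUP_least SUP_subset_mono) auto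
    qed
    finally show "path_sup T (\<lambda>t. X t \<omega>) = (SUP n. h n \<omega>)" .
  qed
  also have "\<dots> = (SUP n. \<integral>\<^sup>+\<omega>. h n \<omega> \<partial>M)"
  proof (rule nn_integral_monotone_convergence_SUP)
    show "incseq h" unfolding h_def incseq_def le_fun_def by (auto intro!: SUP_subset_mono)
    show "h n \<in> borel_measurable M" for n
      unfolding h_def
    proof (rule borel_measurable_SUP)
      fix t assume "t \<in> d ` {..n}"
      then have [measurable]: "X t \<in> borel_measurable M" using X dT by auto
      show "(\<lambda>\<omega>. ennreal ((norm (X t \<omega>))\<^sup>2)) \<in> borel_measurable M" by measurable
    qed (simp add: countable_finite)
  qed
  also have "\<dots> \<le> c"
    unfolding h_def by (intro SUP_least fin) (use dT in auto)
  finally show ?thesis .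
qed

lemma cadlag_conv_simple:
  fixes S :: "real \<Rightarrow> 'h::banach \<Rightarrow>\<^sub>L 'h"
  assumes S: "contraction_semigroup S" and L: "cadlag_on T (\<lambda>t. L t \<omega>)"
  shows "cadlag_on T (\<lambda>t. conv_simple S L ps t \<omega>)"
proof (induction ps)
  case Nil
  show ?case unfolding conv_simple_Nil by (rule cadlag_on_continuous) (rule continuous_on_const)
next
  case (Cons p ps)
  obtain a b B \<Phi> where p: "p = (a, b, B, \<Phi>)" by (cases p)
  \<comment> \<open>Joint continuity is available with the cut-off at 0; the argument t - min a t
    used below is nonnegative, so the cut-off changes nothing.\<close>
  define h where "h q = (indicator B \<omega> :: real) *\<^sub>R S (max 0 (fst q)) (\<Phi> (snd q))" for q
  have "continuous_on UNIV (\<lambda>q. (\<lambda>(s, y). S (max 0 s) y) (fst q, \<Phi> (snd q)))"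
    by (rule continuous_on_compose2[OF continuous_contraction_semigroup_joint[OF S]]) (auto intro!: continuous_intros)
  then have h: "continuous_on UNIV h" unfolding h_def by (intro continuous_on_scaleR continuous_on_const) simp
  have "cadlag_on T (\<lambda>t. h (t - min a t, L (min b t) \<omega> - L (min a t) \<omega>))"
    by (intro cadlag_on_compose2[OF _ _ h] cadlag_on_diff cadlag_on_min[OF L] cadlag_on_continuous continuous_intros)
  then have "cadlag_on T (\<lambda>t. (indicator B \<omega> :: real) *\<^sub>R S (t - min a t) (\<Phi> (L (min b t) \<omega> - L (min a t) \<omega>)))"
    by (simp add: h_def max_absorb2)
  from cadlag_on_add[OF this Cons] show ?case unfolding p conv_simple_Cons .
qed

text \<open>Nothing is said about adaptedness of \<open>L'\<close>. Moment bounds are therefore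
  proved for \<open>L\<close> and transferred on finite sets of times, where the exceptional null
  sets are harmless.\<close>

locale levy_cadlag = levy_setting M F L Q
  for M :: "'a measure" and F and L :: "real \<Rightarrow> 'a \<Rightarrow> 'h::{real_inner, banach, second_countable_topology}" and Q +
  fixes T :: real and L' :: "real \<Rightarrow> 'a \<Rightarrow> 'h"
  assumes T: "0 < T" and modification: "cadlag_modification M T L L'"
begin

lemma L'_M: "t \<in> {0..T} \<Longrightarrow> L' t \<in> borel_measurable M"
  and L'_AE: "t \<in> {0..T} \<Longrightarrow> AE \<omega> in M. L' t \<omega> = L t \<omega>"
  and L'_cadlag: "\<omega> \<in> space M \<Longrightarrow> cadlag_on T (\<lambda>t. L' t \<omega>)"
  using modification by (auto simp: cadlag_modification_def)

lemma conv_L'_AE: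
  assumes t: "t \<in> {0..T}" and ps: "ps \<in> simple_integrands F T"
  shows "AE \<omega> in M. conv_simple S L' ps t \<omega> = conv_simple S L ps t \<omega>"
  using ps
proof (induction ps)
  case Nil
  then show ?case by (simp add: conv_simple_Nil)
next
  case (Cons p ps)
  obtain a b B \<Phi> where p: "p = (a, b, B, \<Phi>)" by (cases p)
  have a: "0 \<le> a" "a < b" and ps: "ps \<in> simple_integrands F T" using Cons.prems by (auto simp: p simple_integrands_Cons)
  have "min a t \<in> {0..T}" "min b t \<in> {0..T}" using a t by auto
  from L'_AE[OF this(1)] L'_AE[OF this(2)] Cons.IH[OF ps] show ?case
    by eventually_elim (simp add: p conv_simple_Cons)
qed

lemma conv_L'_measurable:
  assumes t: "t \<in> {0..T}" and ps: "ps \<in> simple_integrands F T"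
  shows "conv_simple S L' ps t \<in> borel_measurable M"
  using ps
proof (induction ps)
  case Nil
  then show ?case by (simp add: conv_simple_Nil[abs_def])
next
  case (Cons p ps)
  obtain a b B \<Phi> where p: "p = (a, b, B, \<Phi>)" by (cases p)
  have a: "0 \<le> a" "a < b" "B \<in> sets (F a)" and ps: "ps \<in> simple_integrands F T" using Cons.prems by (auto simp: p simple_integrands_Cons)
  have [measurable]: "L' (min a t) \<in> borel_measurable M" "L' (min b t) \<in> borel_measurable M" "B \<in> sets M" "conv_simple S L' ps t \<in> borel_measurable M"
    using a t Cons.IH[OF ps] F_sets_M by (auto intro!: L'_M)
  show ?case unfolding p conv_simple_Cons[abs_def] by measurable
qed

lemma conv_L'_sup_le:
  assumes S: "contraction_semigroup S" and ps: "ps \<in> simple_integrands F T"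
  shows "(\<integral>\<^sup>+\<omega>. path_sup T (\<lambda>t. conv_simple S L' ps t \<omega>) \<partial>M) \<le> 18 * process_norm_sq T (conv_process S ps)"
proof (rule nn_integral_path_sup_le[OF T])
  show "conv_simple S L' ps t \<in> borel_measurable M" if "t \<in> {0..T}" for t by (rule conv_L'_measurable[OF that ps])
  show "cadlag_on T (\<lambda>t. conv_simple S L' ps t \<omega>)" if "\<omega> \<in> space M" for \<omega>
    by (rule cadlag_conv_simple[OF S]) (rule L'_cadlag[OF that])
  fix J assume J: "finite J" "J \<subseteq> {0..T}"
  have "AE \<omega> in M. \<forall>t\<in>J. conv_simple S L' ps t \<omega> = conv_simple S L ps t \<omega>"
    using J by (intro AE_finite_allI conv_L'_AE[OF _ ps]) auto
  then have "(\<integral>\<^sup>+\<omega>. (SUP t\<in>J. ennreal ((norm (conv_simple S L' ps t \<omega>))\<^sup>2)) \<partial>M) = (\<integral>\<^sup>+\<omega>. (SUP t\<in>J. ennreal ((norm (conv_simple S L ps t \<omega>))\<^sup>2)) \<partial>M)"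
    by (intro nn_integral_cong_AE) (auto elim!: eventually_mono intro!: SUP_cong)
  also have "\<dots> \<le> 18 * process_norm_sq T (conv_process S ps)"
    by (rule conv_simple_maximal[OF S ps _ J]) (use T in simp)
  finally show "(\<integral>\<^sup>+\<omega>. (SUP t\<in>J. ennreal ((norm (conv_simple S L' ps t \<omega>))\<^sup>2)) \<partial>M) \<le> 18 * process_norm_sq T (conv_process S ps)" .
qed

lemma conv_L'_diff_sup_le:
  assumes S: "contraction_semigroup S" and ps: "ps \<in> simple_integrands F T" and qs: "qs \<in> simple_integrands F T"
  shows "(\<integral>\<^sup>+\<omega>. path_sup T (\<lambda>t. conv_simple S L' ps t \<omega> - conv_simple S L' qs t \<omega>) \<partial>M)
    \<le> 18 * process_norm_sq T (\<lambda>s \<omega> x. conv_process S ps s \<omega> x - conv_process S qs s \<omega> x)"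
proof -
  have "ps @ neg_simple qs \<in> simple_integrands F T"
    using ps qs by (simp add: simple_integrands_append simple_integrands_neg)
  from conv_L'_sup_le[OF S this] show ?thesis
    unfolding conv_simple_append conv_simple_neg conv_process_append[abs_def] conv_process_neg by simp
qed

text \<open>On [0,T] the process \<open>L'\<close> is almost surely the convolution of the identity
  semigroup with the constant identity operator on (0,T], so the maximal inequality bounds its
  supremum. This plays the part of Doob's inequality.\<close>

lemma sup_levy_finite: "\<exists>K\<ge>0. (\<integral>\<^sup>+\<omega>. path_sup T (\<lambda>t. L' t \<omega>) \<partial>M) \<le> ennreal K"
proof -
  let ?I = "\<lambda>_. id_blinfun :: 'h \<Rightarrow>\<^sub>L 'h"
  let ?ps = "[(0, T, space M, id_blinfun :: 'h \<Rightarrow>\<^sub>L 'h)]"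
  have "space (F 0) = space M" using F_sub[of 0] by (simp add: subalgebra_def)
  then have sp: "space M \<in> sets (F 0)" by (metis sets.top)
  have ps: "?ps \<in> simple_integrands F T" using T sp by (simp add: simple_integrands_def)
  define \<kappa> where "\<kappa> = (\<Sum>n. ennreal ((norm (R (onb_seq n)))\<^sup>2))"
  have \<kappa>: "\<kappa> < \<infinity>" unfolding \<kappa>_def using hs_finite[of id_blinfun] by simp
  have "process_norm_sq T (conv_process ?I ?ps) \<le> (\<integral>\<^sup>+\<omega>. (\<integral>\<^sup>+s. \<kappa> * indicator {0..T} s \<partial>lborel) \<partial>M)"
    unfolding process_norm_sq_def \<kappa>_def
  proof (intro nn_integral_mono mult_right_mono suminf_le ennreal_leI power_mono)
    fix s \<omega> n
    show "norm (conv_process ?I ?ps s \<omega> (R (onb_seq n))) \<le> norm (R (onb_seq n))"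
      by (simp add: conv_process_Cons conv_process_Nil split: split_indicator)
  qed auto
  also have "\<dots> = \<kappa> * ennreal T" using T by (simp add: nn_integral_cmult_indicator emeasure_space_1)
  also have "\<dots> < \<infinity>" using \<kappa> by (simp add: ennreal_mult_less_top)
  finally have fin: "process_norm_sq T (conv_process ?I ?ps) < \<infinity>" .
  define c where "c = 18 * process_norm_sq T (conv_process ?I ?ps)"
  have c: "c < \<infinity>" using fin by (simp add: c_def ennreal_mult_less_top)
  have "(\<integral>\<^sup>+\<omega>. path_sup T (\<lambda>t. L' t \<omega>) \<partial>M) \<le> (\<integral>\<^sup>+\<omega>. path_sup T (\<lambda>t. conv_simple ?I L' ?ps t \<omega>) \<partial>M)"
  proof (rule nn_integral_mono_AE)
    have "AE \<omega> in M. L 0 \<omega> = 0"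
      using levy by (simp add: square_integrable_levy_martingale_def levy_process_def)
    moreover have "AE \<omega> in M. L' 0 \<omega> = L 0 \<omega>" using T by (intro L'_AE) auto
    ultimately show "AE \<omega> in M. path_sup T (\<lambda>t. L' t \<omega>) \<le> path_sup T (\<lambda>t. conv_simple ?I L' ?ps t \<omega>)"
      using AE_space
    proof eventually_elim
      fix \<omega> assume w: "L 0 \<omega> = 0" "L' 0 \<omega> = L 0 \<omega>" "\<omega> \<in> space M"
      have "conv_simple ?I L' ?ps t \<omega> = L' t \<omega>" if "t \<in> {0..T}" for t
        using that w by (simp add: conv_simple_Cons conv_simple_Nil min_absorb1 min_absorb2)
      then show "path_sup T (\<lambda>t. L' t \<omega>) \<le> path_sup T (\<lambda>t. conv_simple ?I L' ?ps t \<omega>)"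
        unfolding path_sup_def by (intro SUP_mono) force
    qed
  qed
  also have "\<dots> \<le> c" unfolding c_def by (rule conv_L'_sup_le[OF contraction_semigroup_id ps])
  finally show ?thesis using c by (intro exI[of _ "enn2real c"]) (auto simp: less_top)
qed

end

context levy_cadlag
begin

lemma process_norm_sq_conv_diff_le:
  assumes S: "contraction_semigroup S" and \<psi>: "\<psi> \<in> integrands M F Q T"
    and ps: "ps \<in> simple_integrands F T" and qs: "qs \<in> simple_integrands F T"
  shows "process_norm_sq T (\<lambda>s \<omega> x. conv_process S ps s \<omega> x - conv_process S qs s \<omega> x)
    \<le> 2 * process_norm_sq T (\<lambda>s \<omega> x. \<psi> s \<omega> x - conv_process S ps s \<omega> x) + 2 * process_norm_sq T (\<lambda>s \<omega> x. \<psi> s \<omega> x - conv_process S qs s \<omega> x)"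
  unfolding process_norm_sq_commute[of T \<psi> "conv_process S ps"]
  by (rule process_norm_sq_triangle[OF process_measurable_conv_process[OF S ps]
        integrands_process_measurable[OF \<psi>] process_measurable_conv_process[OF S qs]])

text \<open>The integrand is approximated with errors 4^(-n), so the expected suprema of consecutive
  differences are at most 72 times 4^(-n), where 72 = 18 (2 + 2). Even after weighting with 2^n they
  are summable, and almost surely the approximating convolutions converge uniformly in t. The lists
  and the L^2 bound are part of the conclusion so that other modifications can be compared with the
  same approximants.\<close>

theorem cadlag_convolution:
  assumes S: "contraction_semigroup S" and \<psi>: "\<psi> \<in> integrands M F Q T"
  shows "\<exists>ps X. (\<forall>n::nat. ps n \<in> simple_integrands F T) \<and>
    (\<forall>n. process_norm_sq T (\<lambda>s \<omega> x. \<psi> s \<omega> x - conv_process S (ps n) s \<omega> x) \<le> ennreal ((1 / 4) ^ n)) \<and>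
    cadlag_modification M T (stoch_convolution M F L Q S \<psi>) X \<and>
    (\<forall>n. \<forall>t\<in>{0..T}. (\<integral>\<^sup>+\<omega>. ennreal ((norm (X t \<omega> - conv_simple S L' (ps n) t \<omega>))\<^sup>2) \<partial>M) \<le> ennreal (72 * (1 / 4) ^ n))"
proof -
  have "\<exists>ps\<in>simple_integrands F T. finite_rank ps \<and>
      process_norm_sq T (\<lambda>s \<omega> x. \<psi> s \<omega> x - conv_process S ps s \<omega> x) \<le> ennreal ((1 / 4) ^ n)" for n
    by (rule conv_processes_dense[OF S T \<psi>]) simp
  then have "\<forall>n. \<exists>ps. ps \<in> simple_integrands F T \<and>
      process_norm_sq T (\<lambda>s \<omega> x. \<psi> s \<omega> x - conv_process S ps s \<omega> x) \<le> ennreal ((1 / 4) ^ n)"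
    by blast
  from choice[OF this] obtain ps where "\<forall>n::nat. ps n \<in> simple_integrands F T \<and>
      process_norm_sq T (\<lambda>s \<omega> x. \<psi> s \<omega> x - conv_process S (ps n) s \<omega> x) \<le> ennreal ((1 / 4) ^ n)" ..
  then have ps: "\<And>n::nat. ps n \<in> simple_integrands F T"
    and nsq: "\<And>n. process_norm_sq T (\<lambda>s \<omega> x. \<psi> s \<omega> x - conv_process S (ps n) s \<omega> x) \<le> ennreal ((1 / 4) ^ n)"
    by simp_all
  define Y where "Y n t \<omega> = conv_simple S L' (ps n) t \<omega>" for n t \<omega>
  have Y_M: "Y n t \<in> borel_measurable M" if "t \<in> {0..T}" for n t
    unfolding Y_def using conv_L'_measurable[OF that ps] by simp
  have Y_cad: "cadlag_on T (\<lambda>t. Y n t \<omega>)" if "\<omega> \<in> space M" for n \<omega>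
    unfolding Y_def by (rule cadlag_conv_simple[OF S]) (rule L'_cadlag[OF that])
  have sup: "(\<integral>\<^sup>+\<omega>. path_sup T (\<lambda>t. Y m t \<omega> - Y n t \<omega>) \<partial>M) \<le> ennreal (72 * (1 / 4) ^ m)" if "m \<le> n" for m n
  proof -
    have "(\<integral>\<^sup>+\<omega>. path_sup T (\<lambda>t. Y m t \<omega> - Y n t \<omega>) \<partial>M)
        \<le> 18 * process_norm_sq T (\<lambda>s \<omega> x. conv_process S (ps m) s \<omega> x - conv_process S (ps n) s \<omega> x)"
      unfolding Y_def by (rule conv_L'_diff_sup_le[OF S ps ps])
    also have "\<dots> \<le> 18 * (2 * ennreal ((1 / 4) ^ m) + 2 * ennreal ((1 / 4) ^ n))"
      by (intro mult_left_mono order_trans[OF process_norm_sq_conv_diff_le[OF S \<psi> ps ps]] add_mono nsq) auto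
    also have "\<dots> \<le> 18 * (2 * ennreal ((1 / 4) ^ m) + 2 * ennreal ((1 / 4) ^ m))"
      using that by (intro mult_left_mono add_mono ennreal_leI power_decreasing) auto
    also have "\<dots> = ennreal (72 * (1 / 4) ^ m)"
    proof -
      have "2 * ennreal x + 2 * ennreal x = ennreal (4 * x)" if "0 \<le> x" for x
        using ennreal_quarters[of "4 * x"] that by simp
      then have "18 * (2 * ennreal ((1 / 4) ^ m) + 2 * ennreal ((1 / 4) ^ m)) = 18 * ennreal (4 * (1 / 4) ^ m)" by simp
      also have "\<dots> = ennreal (18 * (4 * (1 / 4) ^ m))" using ennreal_mult'[of 18 "4 * (1 / 4) ^ m"] by simp
      finally show ?thesis by simp
    qed
    finally show ?thesis .
  qed
  define D where "D n \<omega> = path_sup T (\<lambda>t. Y n t \<omega> - Y (Suc n) t \<omega>)" for n \<omega>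
  have D_M[measurable]: "D n \<in> borel_measurable M" for n
    unfolding D_def by (rule path_sup_measurable[OF T]) (auto intro!: borel_measurable_diff Y_M cadlag_on_diff Y_cad)
  \<comment> \<open>The weight 2^n lets finiteness of one series give a geometric bound for every
    single D n, with ratio sqrt (1/2) for the norms.\<close>
  have "(\<integral>\<^sup>+\<omega>. (\<Sum>n. 2 ^ n * D n \<omega>) \<partial>M) = (\<Sum>n. \<integral>\<^sup>+\<omega>. 2 ^ n * D n \<omega> \<partial>M)"
    by (rule nn_integral_suminf) measurable
  also have "\<dots> = (\<Sum>n. 2 ^ n * (\<integral>\<^sup>+\<omega>. D n \<omega> \<partial>M))" by (simp add: nn_integral_cmult)
  also have "\<dots> \<le> (\<Sum>n. ennreal (72 * (1 / 2) ^ n))"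
  proof (rule suminf_le)
    fix n
    have p2: "(2 :: ennreal) ^ n = ennreal (2 ^ n)" by (simp add: ennreal_power[symmetric])
    have "2 ^ n * (\<integral>\<^sup>+\<omega>. D n \<omega> \<partial>M) \<le> ennreal (2 ^ n) * ennreal (72 * (1 / 4) ^ n)"
      unfolding D_def p2 by (intro mult_left_mono sup) auto
    also have "ennreal (2 ^ n) * ennreal (72 * (1 / 4) ^ n) = ennreal (2 ^ n * (72 * (1 / 4) ^ n))"
      by (rule ennreal_mult[symmetric]) auto
    also have "(2::real) ^ n * (72 * (1 / 4) ^ n) = 72 * (2 * (1 / 4)) ^ n" unfolding power_mult_distrib by simp
    finally show "2 ^ n * (\<integral>\<^sup>+\<omega>. D n \<omega> \<partial>M) \<le> ennreal (72 * (1 / 2) ^ n)" by simp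
  qed auto
  also have "\<dots> = ennreal (\<Sum>n. 72 * (1 / 2) ^ n)" by (rule suminf_ennreal2) (auto intro!: summable_mult summable_geometric)
  finally have "(\<integral>\<^sup>+\<omega>. (\<Sum>n. 2 ^ n * D n \<omega>) \<partial>M) \<noteq> \<infinity>" by (auto simp: top_unique)
  then have "AE \<omega> in M. (\<Sum>n. 2 ^ n * D n \<omega>) \<noteq> \<infinity>" by (intro nn_integral_noteq_infinite) measurable
  then obtain N where N: "N \<in> null_sets M" "{\<omega> \<in> space M. \<not> (\<Sum>n. 2 ^ n * D n \<omega>) \<noteq> \<infinity>} \<subseteq> N"
    unfolding eventually_ae_filter by blast
  have NM[measurable]: "N \<in> sets M" using N by auto
  define X where "X t \<omega> = (if \<omega> \<in> N then 0 else Y 0 t \<omega> + (\<Sum>i. Y (Suc i) t \<omega> - Y i t \<omega>))" for t \<omega>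
  have unif: "\<exists>n0. \<forall>n\<ge>n0. \<forall>t\<in>{0..T}. dist (Y n t \<omega>) (X t \<omega>) < e" if w: "\<omega> \<in> space M" "\<omega> \<notin> N" and e: "e > 0" for \<omega> e
  proof -
    have fin: "(\<Sum>n. 2 ^ n * D n \<omega>) \<noteq> \<infinity>" using N(2) w by blast
    define k where "k = enn2real (\<Sum>n. 2 ^ n * D n \<omega>)"
    have k: "ennreal k = (\<Sum>n. 2 ^ n * D n \<omega>)" "0 \<le> k" using fin by (auto simp: k_def less_top)
    have bound: "norm (Y (Suc n) t \<omega> - Y n t \<omega>) \<le> sqrt k * sqrt (1 / 2) ^ n" if t: "t \<in> {0..T}" for n t
    proof (rule power2_le_imp_le)
      have "ennreal (2 ^ n * (norm (Y n t \<omega> - Y (Suc n) t \<omega>))\<^sup>2) = 2 ^ n * ennreal ((norm (Y n t \<omega> - Y (Suc n) t \<omega>))\<^sup>2)"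
        by (simp add: ennreal_mult ennreal_power[symmetric])
      also have "\<dots> \<le> 2 ^ n * D n \<omega>" unfolding D_def by (intro mult_left_mono path_sup_upper t) auto
      also have "\<dots> \<le> ennreal k"
        unfolding k(1) using sum_le_suminf[of "\<lambda>n. 2 ^ n * D n \<omega>" "{n}"] by simp
      finally have "2 ^ n * (norm (Y n t \<omega> - Y (Suc n) t \<omega>))\<^sup>2 \<le> k" using k(2) by (simp add: ennreal_le_iff)
      then have "(norm (Y (Suc n) t \<omega> - Y n t \<omega>))\<^sup>2 \<le> k * (1 / 2) ^ n"
        by (simp add: norm_minus_commute field_simps power_one_over)
      also have "\<dots> = (sqrt k * sqrt (1 / 2) ^ n)\<^sup>2"
        using k(2) by (simp add: power_mult_distrib power_mult[symmetric] mult.commute[of n 2] power_mult real_sqrt_divide power_divide)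
      finally show "(norm (Y (Suc n) t \<omega> - Y n t \<omega>))\<^sup>2 \<le> (sqrt k * sqrt (1 / 2) ^ n)\<^sup>2" .
    qed (use k(2) in simp)
    have "uniform_limit {0..T} (\<lambda>n t. \<Sum>i<n. Y (Suc i) t \<omega> - Y i t \<omega>) (\<lambda>t. \<Sum>i. Y (Suc i) t \<omega> - Y i t \<omega>) sequentially"
      by (rule Weierstrass_m_test[OF bound]) (auto intro!: summable_mult summable_geometric real_sqrt_lt_1_iff[THEN iffD2])
    then have "\<forall>\<^sub>F n in sequentially. \<forall>t\<in>{0..T}. dist (\<Sum>i<n. Y (Suc i) t \<omega> - Y i t \<omega>) (\<Sum>i. Y (Suc i) t \<omega> - Y i t \<omega>) < e"
      using e by (rule uniform_limitD)
    then obtain n0 where n0: "\<And>n. n \<ge> n0 \<Longrightarrow> \<forall>t\<in>{0..T}. dist (\<Sum>i<n. Y (Suc i) t \<omega> - Y i t \<omega>) (\<Sum>i. Y (Suc i) t \<omega> - Y i t \<omega>) < e"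
      by (auto simp: eventually_sequentially)
    have "dist (Y n t \<omega>) (X t \<omega>) < e" if "n \<ge> n0" "t \<in> {0..T}" for n t
    proof -
      have tel: "(\<Sum>i<n. Y (Suc i) t \<omega> - Y i t \<omega>) = Y n t \<omega> - Y 0 t \<omega>" by (rule sum_lessThan_telescope)
      have "dist (Y n t \<omega>) (X t \<omega>) = dist (\<Sum>i<n. Y (Suc i) t \<omega> - Y i t \<omega>) (\<Sum>i. Y (Suc i) t \<omega> - Y i t \<omega>)"
        unfolding tel using w by (simp add: X_def dist_norm diff_diff_eq)
      then show ?thesis using n0[OF that(1)] that(2) by simp
    qed
    then show ?thesis by blast
  qed
  have X_cad: "cadlag_on T (\<lambda>t. X t \<omega>)" if w: "\<omega> \<in> space M" for \<omega>
  proof (cases "\<omega> \<in> N")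
    case True
    then show ?thesis by (simp add: X_def cadlag_on_continuous)
  next
    case False
    show ?thesis
      by (rule cadlag_on_uniform_limit[where f = "\<lambda>n t. Y n t \<omega>"]) (use Y_cad[OF w] unif[OF w False] in blast)+
  qed
  have X_lim: "(\<lambda>n. Y n t \<omega>) \<longlonglongrightarrow> X t \<omega>" if "t \<in> {0..T}" "\<omega> \<in> space M" "\<omega> \<notin> N" for t \<omega>
    unfolding lim_sequentially using unif[OF that(2,3)] that(1) by blast
  have X_M: "X t \<in> borel_measurable M" if t: "t \<in> {0..T}" for t
  proof (rule borel_measurable_LIMSEQ_metric)
    have [measurable]: "Y n t \<in> borel_measurable M" for n by (rule Y_M[OF t])
    show "(\<lambda>\<omega>. if \<omega> \<in> N then 0 else Y n t \<omega>) \<in> borel_measurable M" for n by measurable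
    fix \<omega> assume w: "\<omega> \<in> space M"
    show "(\<lambda>n. if \<omega> \<in> N then 0 else Y n t \<omega>) \<longlonglongrightarrow> X t \<omega>"
      using X_lim[OF t w] by (cases "\<omega> \<in> N") (auto simp: X_def)
  qed
  have X_L2: "(\<integral>\<^sup>+\<omega>. ennreal ((norm (X t \<omega> - Y n t \<omega>))\<^sup>2) \<partial>M) \<le> ennreal (72 * (1 / 4) ^ n)" if t: "t \<in> {0..T}" for t n
  proof -
    have [measurable]: "Y n t \<in> borel_measurable M" for n by (rule Y_M[OF t])
    \<comment> \<open>Convergence to X is known only almost surely at this point; Fatou brings the
      L^2 bound to the limit.\<close>
    have "(\<integral>\<^sup>+\<omega>. ennreal ((norm (X t \<omega> - Y n t \<omega>))\<^sup>2) \<partial>M) \<le> (\<integral>\<^sup>+\<omega>. liminf (\<lambda>i. ennreal ((norm (Y (i + n) t \<omega> - Y n t \<omega>))\<^sup>2)) \<partial>M)"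
    proof (rule nn_integral_mono_AE)
      show "AE \<omega> in M. ennreal ((norm (X t \<omega> - Y n t \<omega>))\<^sup>2) \<le> liminf (\<lambda>i. ennreal ((norm (Y (i + n) t \<omega> - Y n t \<omega>))\<^sup>2))"
        using AE_not_in[OF N(1)] AE_space
      proof eventually_elim
        fix \<omega> assume "\<omega> \<notin> N" "\<omega> \<in> space M"
        then have "(\<lambda>i. Y (i + n) t \<omega>) \<longlonglongrightarrow> X t \<omega>" by (intro LIMSEQ_ignore_initial_segment X_lim t)
        then have "(\<lambda>i. ennreal ((norm (Y (i + n) t \<omega> - Y n t \<omega>))\<^sup>2)) \<longlonglongrightarrow> ennreal ((norm (X t \<omega> - Y n t \<omega>))\<^sup>2)"
          by (intro tendsto_ennrealI tendsto_power tendsto_norm tendsto_diff tendsto_const)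
        then show "ennreal ((norm (X t \<omega> - Y n t \<omega>))\<^sup>2) \<le> liminf (\<lambda>i. ennreal ((norm (Y (i + n) t \<omega> - Y n t \<omega>))\<^sup>2))"
          using lim_imp_Liminf[OF trivial_limit_sequentially] by (metis order_refl)
      qed
    qed
    also have "\<dots> \<le> liminf (\<lambda>i. \<integral>\<^sup>+\<omega>. ennreal ((norm (Y (i + n) t \<omega> - Y n t \<omega>))\<^sup>2) \<partial>M)"
      by (rule nn_integral_liminf) measurable
    also have "\<dots> \<le> liminf (\<lambda>i::nat. ennreal (72 * (1 / 4) ^ n))"
    proof (intro Liminf_mono always_eventually allI)
      fix i
      have "(\<integral>\<^sup>+\<omega>. ennreal ((norm (Y (i + n) t \<omega> - Y n t \<omega>))\<^sup>2) \<partial>M) \<le> (\<integral>\<^sup>+\<omega>. path_sup T (\<lambda>t. Y n t \<omega> - Y (i + n) t \<omega>) \<partial>M)"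
        unfolding norm_minus_commute[of "Y (i + n) t _"] by (intro nn_integral_mono path_sup_upper t)
      also have "\<dots> \<le> ennreal (72 * (1 / 4) ^ n)" by (rule sup) simp
      finally show "(\<integral>\<^sup>+\<omega>. ennreal ((norm (Y (i + n) t \<omega> - Y n t \<omega>))\<^sup>2) \<partial>M) \<le> ennreal (72 * (1 / 4) ^ n)" .
    qed
    also have "\<dots> = ennreal (72 * (1 / 4) ^ n)" by (simp add: Liminf_const)
    finally show ?thesis .
  qed
  have geo: "(\<lambda>n. ennreal (c * (1 / 4) ^ n)) \<longlonglongrightarrow> 0" for c :: real
  proof -
    have "(\<lambda>n. c * (1 / 4 :: real) ^ n) \<longlonglongrightarrow> c * 0" by (intro tendsto_mult tendsto_const LIMSEQ_realpow_zero) auto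
    from tendsto_ennrealI[OF this] show ?thesis by simp
  qed
  have mod: "AE \<omega> in M. X t \<omega> = stoch_convolution M F L Q S \<psi> t \<omega>" if t: "t \<in> {0..T}" for t
  proof -
    have t': "0 \<le> t" "t \<le> T" using t by auto
    let ?\<Psi> = "\<lambda>s \<omega> x. S (t - s) (\<psi> s \<omega> x)"
    have int: "is_stoch_integral M F L Q t ?\<Psi> (X t)"
    proof (rule is_stoch_integral_convolution[OF S integrands_process_bounded[OF \<psi>] t' ps _ X_M[OF t]])
      show "(\<lambda>n. process_norm_sq T (\<lambda>s \<omega> x. \<psi> s \<omega> x - conv_process S (ps n) s \<omega> x)) \<longlonglongrightarrow> 0"
        by (rule tendsto_sandwich[OF _ _ tendsto_const geo[of 1]]) (use nsq in \<open>auto intro!: always_eventually\<close>)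
      have "(\<integral>\<^sup>+\<omega>. ennreal ((norm (X t \<omega> - conv_simple S L (ps n) t \<omega>))\<^sup>2) \<partial>M) \<le> ennreal (72 * (1 / 4) ^ n)" for n
      proof -
        have "(\<integral>\<^sup>+\<omega>. ennreal ((norm (X t \<omega> - conv_simple S L (ps n) t \<omega>))\<^sup>2) \<partial>M) = (\<integral>\<^sup>+\<omega>. ennreal ((norm (X t \<omega> - Y n t \<omega>))\<^sup>2) \<partial>M)"
          unfolding Y_def using conv_L'_AE[OF t ps[of n], of S] by (intro nn_integral_cong_AE) (auto elim!: eventually_mono)
        then show ?thesis using X_L2[OF t] by simp
      qed
      then show "(\<lambda>n. \<integral>\<^sup>+\<omega>. ennreal ((norm (X t \<omega> - conv_simple S L (ps n) t \<omega>))\<^sup>2) \<partial>M) \<longlonglongrightarrow> 0"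
        by (intro tendsto_sandwich[OF _ _ tendsto_const geo[of 72]]) (auto intro!: always_eventually)
    qed
    \<comment> \<open>X t is one stochastic integral, so the chosen one is a stochastic integral as
      well, and uniqueness identifies both almost surely.\<close>
    then have "is_stoch_integral M F L Q t ?\<Psi> (stoch_integral M F L Q t ?\<Psi>)"
      unfolding stoch_integral_def by (rule someI[of "is_stoch_integral M F L Q t ?\<Psi>"])
    with int show ?thesis
      unfolding stoch_convolution_def
      by (intro is_stoch_integral_unique[OF t'(1) convolution_process_measurable[OF S integrands_process_measurable[OF \<psi>] t'(2)]
          convolution_process_bounded[OF integrands_process_bounded[OF \<psi>] t'(2)]])
  qed
  show ?thesis
  proof (rule exI[of _ ps], rule exI[of _ X], intro conjI allI ballI)
    show "cadlag_modification M T (stoch_convolution M F L Q S \<psi>) X"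
      unfolding cadlag_modification_def using X_M mod X_cad by blast
    show "(\<integral>\<^sup>+\<omega>. ennreal ((norm (X t \<omega> - conv_simple S L' (ps n) t \<omega>))\<^sup>2) \<partial>M) \<le> ennreal (72 * (1 / 4) ^ n)" if "t \<in> {0..T}" for n t
      using X_L2[OF that] by (simp add: Y_def)
  qed (rule ps nsq)+
qed

text \<open>The modification X is arbitrary, so its exceptional null sets depend on t. For a finite
  J the deviation from the convolution of \<open>ps n\<close> is summed over J, which costs a
  multiple of \<open>card J\<close> that vanishes as n grows; the remaining bound is free of J and
  passes to the supremum.\<close>

theorem cadlag_convolution_approx:
  assumes S: "contraction_semigroup S" and \<psi>: "\<psi> \<in> integrands M F Q T"
    and X: "cadlag_modification M T (stoch_convolution M F L Q S \<psi>) X" and qs: "qs \<in> simple_integrands F T"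
  shows "(\<integral>\<^sup>+\<omega>. path_sup T (\<lambda>t. X t \<omega> - conv_simple S L' qs t \<omega>) \<partial>M)
    \<le> 72 * process_norm_sq T (\<lambda>s \<omega> x. \<psi> s \<omega> x - conv_process S qs s \<omega> x)"
proof -
  obtain ps Z where ps: "\<And>n::nat. ps n \<in> simple_integrands F T"
    "\<And>n. process_norm_sq T (\<lambda>s \<omega> x. \<psi> s \<omega> x - conv_process S (ps n) s \<omega> x) \<le> ennreal ((1 / 4) ^ n)"
    "cadlag_modification M T (stoch_convolution M F L Q S \<psi>) Z"
    "\<And>n t. t \<in> {0..T} \<Longrightarrow> (\<integral>\<^sup>+\<omega>. ennreal ((norm (Z t \<omega> - conv_simple S L' (ps n) t \<omega>))\<^sup>2) \<partial>M) \<le> ennreal (72 * (1 / 4) ^ n)"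
    using cadlag_convolution[OF S \<psi>] by blast
  have X_M: "X t \<in> borel_measurable M" if "t \<in> {0..T}" for t using X that by (simp add: cadlag_modification_def)
  have XZ: "AE \<omega> in M. X t \<omega> = Z t \<omega>" if t: "t \<in> {0..T}" for t
  proof -
    have "AE \<omega> in M. X t \<omega> = stoch_convolution M F L Q S \<psi> t \<omega>" "AE \<omega> in M. Z t \<omega> = stoch_convolution M F L Q S \<psi> t \<omega>"
      using X ps(3) t by (auto simp: cadlag_modification_def)
    then show ?thesis by eventually_elim simp
  qed
  have X_L2: "(\<integral>\<^sup>+\<omega>. ennreal ((norm (X t \<omega> - conv_simple S L' (ps n) t \<omega>))\<^sup>2) \<partial>M) \<le> ennreal (72 * (1 / 4) ^ n)" if t: "t \<in> {0..T}" for t n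
  proof -
    have "(\<integral>\<^sup>+\<omega>. ennreal ((norm (X t \<omega> - conv_simple S L' (ps n) t \<omega>))\<^sup>2) \<partial>M) = (\<integral>\<^sup>+\<omega>. ennreal ((norm (Z t \<omega> - conv_simple S L' (ps n) t \<omega>))\<^sup>2) \<partial>M)"
      using XZ[OF t] by (intro nn_integral_cong_AE) (auto elim!: eventually_mono)
    then show ?thesis using ps(4)[OF t] by simp
  qed
  let ?E = "process_norm_sq T (\<lambda>s \<omega> x. \<psi> s \<omega> x - conv_process S qs s \<omega> x)"
  show ?thesis
  proof (rule nn_integral_path_sup_le[OF T])
    show "(\<lambda>\<omega>. X t \<omega> - conv_simple S L' qs t \<omega>) \<in> borel_measurable M" if "t \<in> {0..T}" for t
      using X_M[OF that] conv_L'_measurable[OF that qs] by (rule borel_measurable_diff)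
    show "cadlag_on T (\<lambda>t. X t \<omega> - conv_simple S L' qs t \<omega>)" if "\<omega> \<in> space M" for \<omega>
    proof (rule cadlag_on_diff)
      show "cadlag_on T (\<lambda>t. X t \<omega>)" using X that by (simp add: cadlag_modification_def)
      show "cadlag_on T (\<lambda>t. conv_simple S L' qs t \<omega>)" by (rule cadlag_conv_simple[OF S]) (rule L'_cadlag[OF that])
    qed
    fix J assume J: "finite J" "J \<subseteq> {0..T}"
    \<comment> \<open>144 is twice 72, for each time of J. Both constants 72 are 2 times 18 times 2,
      one for each term of the triangle inequality.\<close>
    have bound: "(\<integral>\<^sup>+\<omega>. (SUP t\<in>J. ennreal ((norm (X t \<omega> - conv_simple S L' qs t \<omega>))\<^sup>2)) \<partial>M)
        \<le> ennreal ((144 * real (card J) + 72) * (1 / 4) ^ n) + 72 * ?E" for n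
    proof -
      let ?Y = "\<lambda>t \<omega>. conv_simple S L' (ps n) t \<omega>" and ?Z = "\<lambda>t \<omega>. conv_simple S L' qs t \<omega>"
      let ?s = "\<lambda>\<omega>. \<Sum>t\<in>J. ennreal ((norm (X t \<omega> - ?Y t \<omega>))\<^sup>2)" and ?p = "\<lambda>\<omega>. path_sup T (\<lambda>t. ?Y t \<omega> - ?Z t \<omega>)"
      have m1: "(\<lambda>\<omega>. ennreal ((norm (X t \<omega> - ?Y t \<omega>))\<^sup>2)) \<in> borel_measurable M" if "t \<in> J" for t
      proof -
        have [measurable]: "X t \<in> borel_measurable M" "?Y t \<in> borel_measurable M"
          using X_M conv_L'_measurable[OF _ ps(1)] J that by auto
        show ?thesis by measurable
      qed
      have m2: "?p \<in> borel_measurable M"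
      proof (rule path_sup_measurable[OF T])
        show "(\<lambda>\<omega>. ?Y t \<omega> - ?Z t \<omega>) \<in> borel_measurable M" if "t \<in> {0..T}" for t
          by (rule borel_measurable_diff[OF conv_L'_measurable[OF that ps(1)] conv_L'_measurable[OF that qs]])
        show "cadlag_on T (\<lambda>t. ?Y t \<omega> - ?Z t \<omega>)" if "\<omega> \<in> space M" for \<omega>
          by (intro cadlag_on_diff; rule cadlag_conv_simple[OF S]; rule L'_cadlag[OF that])
      qed
      have "(\<integral>\<^sup>+\<omega>. (SUP t\<in>J. ennreal ((norm (X t \<omega> - ?Z t \<omega>))\<^sup>2)) \<partial>M) \<le> (\<integral>\<^sup>+\<omega>. 2 * ?s \<omega> + 2 * ?p \<omega> \<partial>M)"
      proof (intro nn_integral_mono SUP_least)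
        fix \<omega> t assume t: "t \<in> J"
        have "ennreal ((norm ((X t \<omega> - ?Y t \<omega>) + (?Y t \<omega> - ?Z t \<omega>)))\<^sup>2)
            \<le> 2 * ennreal ((norm (X t \<omega> - ?Y t \<omega>))\<^sup>2) + 2 * ennreal ((norm (?Y t \<omega> - ?Z t \<omega>))\<^sup>2)"
          by (rule ennreal_norm_add_square_le)
        also have "\<dots> \<le> 2 * ?s \<omega> + 2 * ?p \<omega>"
          using t J by (intro add_mono mult_left_mono path_sup_upper member_le_sum) auto
        finally show "ennreal ((norm (X t \<omega> - ?Z t \<omega>))\<^sup>2) \<le> 2 * ?s \<omega> + 2 * ?p \<omega>" by simp
      qed
      also have "\<dots> = 2 * (\<Sum>t\<in>J. \<integral>\<^sup>+\<omega>. ennreal ((norm (X t \<omega> - ?Y t \<omega>))\<^sup>2) \<partial>M) + 2 * (\<integral>\<^sup>+\<omega>. ?p \<omega> \<partial>M)"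
      proof -
        have ms: "?s \<in> borel_measurable M" by (rule borel_measurable_sum[OF m1])
        have "(\<integral>\<^sup>+\<omega>. 2 * ?s \<omega> + 2 * ?p \<omega> \<partial>M) = (\<integral>\<^sup>+\<omega>. 2 * ?s \<omega> \<partial>M) + (\<integral>\<^sup>+\<omega>. 2 * ?p \<omega> \<partial>M)"
          by (rule nn_integral_add) (intro borel_measurable_times_ennreal borel_measurable_const ms m2)+
        then show ?thesis by (simp only: nn_integral_cmult[OF ms] nn_integral_cmult[OF m2] nn_integral_sum[OF m1])
      qed
      also have "\<dots> \<le> 2 * (\<Sum>t\<in>J. ennreal (72 * (1 / 4) ^ n)) + 2 * (18 * (2 * ennreal ((1 / 4) ^ n) + 2 * ?E))"
      proof (intro add_mono mult_left_mono sum_mono X_L2)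
        show "(\<integral>\<^sup>+\<omega>. ?p \<omega> \<partial>M) \<le> 18 * (2 * ennreal ((1 / 4) ^ n) + 2 * ?E)"
          by (rule order_trans[OF conv_L'_diff_sup_le[OF S ps(1) qs]],
              intro mult_left_mono order_trans[OF process_norm_sq_conv_diff_le[OF S \<psi> ps(1) qs]] add_mono ps(2)) auto
      qed (use J in auto)
      also have "\<dots> = ennreal ((144 * real (card J) + 72) * (1 / 4) ^ n) + 72 * ?E"
      proof -
        have c: "(\<Sum>t\<in>J. ennreal (72 * (1 / 4) ^ n)) = ennreal (real (card J) * (72 * (1 / 4) ^ n))"
          by (simp add: ennreal_of_nat_eq_real_of_nat ennreal_mult)
        have 2: "2 * ennreal x = ennreal (2 * x)" "18 * ennreal x = ennreal (18 * x)" for x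
          using ennreal_mult'[of 2 x] ennreal_mult'[of 18 x] by simp_all
        have "2 * ennreal (real (card J) * (72 * (1 / 4) ^ n)) + 2 * (18 * (2 * ennreal ((1 / 4) ^ n)))
            = ennreal (2 * (real (card J) * (72 * (1 / 4) ^ n)) + 2 * (18 * (2 * (1 / 4) ^ n)))"
          unfolding 2 by (rule ennreal_plus[symmetric]) auto
        also have "2 * (real (card J) * (72 * (1 / 4) ^ n)) + 2 * (18 * (2 * (1 / 4) ^ n)) = (144 * real (card J) + 72) * (1 / 4 :: real) ^ n"
          by (simp add: algebra_simps)
        finally have e: "2 * ennreal (real (card J) * (72 * (1 / 4) ^ n)) + 2 * (18 * (2 * ennreal ((1 / 4) ^ n)))
            = ennreal ((144 * real (card J) + 72) * (1 / 4) ^ n)" .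
        have "2 * (18 * (2 * ennreal ((1 / 4) ^ n) + 2 * ?E)) = 2 * (18 * (2 * ennreal ((1 / 4) ^ n))) + 72 * ?E"
          by (simp add: distrib_left mult.assoc[symmetric])
        then show ?thesis unfolding c e[symmetric] by (simp add: add.assoc)
      qed
      finally show ?thesis .
    qed
    have "(\<lambda>n. ennreal ((144 * real (card J) + 72) * (1 / 4) ^ n) + 72 * ?E) \<longlonglongrightarrow> ennreal ((144 * real (card J) + 72) * 0) + 72 * ?E"
      by (intro tendsto_add tendsto_ennrealI tendsto_mult tendsto_const LIMSEQ_realpow_zero) auto
    then show "(\<integral>\<^sup>+\<omega>. (SUP t\<in>J. ennreal ((norm (X t \<omega> - conv_simple S L' qs t \<omega>))\<^sup>2)) \<partial>M) \<le> 72 * ?E"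
      by (intro LIMSEQ_le_const[of _ "72 * ?E"]) (use bound in auto)
  qed
qed

end

subsection \<open>Convergence of the convolutions\<close>

context levy_cadlag
begin

text \<open>For one rank-one entry with vector f, the integrands differ by a scalar times the
  difference of two orbits of f, which is uniformly small on [0,T]. The list is then treated entry
  by entry.\<close>

lemma conv_process_semigroup_limit:
  assumes S: "contraction_semigroup S" and S': "\<And>l::real. l > 0 \<Longrightarrow> contraction_semigroup (S' l)"
    and lim: "\<And>x e. e > 0 \<Longrightarrow> \<forall>\<^sub>F l in at_top. \<forall>t\<in>{0..T}. norm (S' l t x - S t x) < e"
    and ps: "ps \<in> simple_integrands F T" "finite_rank ps" and \<epsilon>: "\<epsilon> > 0"
  shows "\<forall>\<^sub>F l in at_top. process_norm_sq T (\<lambda>s \<omega> x. conv_process S ps s \<omega> x - conv_process (S' l) ps s \<omega> x) \<le> ennreal \<epsilon>"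
  using ps \<epsilon>
proof (induction ps arbitrary: \<epsilon>)
  case Nil
  have "process_norm_sq T (\<lambda>s \<omega> x. conv_process S [] s \<omega> x - conv_process (S' l) [] s \<omega> x) = 0" for l
    unfolding process_norm_sq_def by (simp add: conv_process_Nil)
  then show ?case by simp
next
  case (Cons p ps)
  obtain a b B \<Phi> where p: "p = (a, b, B, \<Phi>)" by (cases p)
  have a: "0 \<le> a" "a < b" "b \<le> T" "B \<in> sets (F a)" and ps: "ps \<in> simple_integrands F T" "finite_rank ps"
    using Cons.prems by (auto simp: p simple_integrands_Cons finite_rank_def)
  obtain g f where \<Phi>: "\<Phi> = rank_one g f" using Cons.prems by (auto simp: p finite_rank_def)
  have p1: "[p] \<in> simple_integrands F T" using a by (simp add: p simple_integrands_def)
  have T0: "0 \<le> T" using T by simp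
  have \<epsilon>4: "\<epsilon> / 4 > 0" using Cons.prems by simp
  define \<delta> where "\<delta> = sqrt (\<epsilon> / 4 / (T * (norm (R g))\<^sup>2 + 1))"
  have den: "T * (norm (R g))\<^sup>2 + 1 > 0" using T by (simp add: add_nonneg_pos)
  have \<delta>: "\<delta> > 0" "\<delta>\<^sup>2 = \<epsilon> / 4 / (T * (norm (R g))\<^sup>2 + 1)" using \<epsilon>4 den by (simp_all add: \<delta>_def)
  have small: "T * \<delta>\<^sup>2 * (norm (R g))\<^sup>2 \<le> \<epsilon> / 4" using \<epsilon>4 den by (simp add: \<delta>(2) field_simps)
  have l0: "\<forall>\<^sub>F l in at_top. (l::real) > 0" by (rule eventually_gt_at_top)
  from lim[OF \<delta>(1), of f] l0 Cons.IH[OF ps \<epsilon>4] show ?case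
  proof eventually_elim
    fix l :: real
    assume near: "\<forall>t\<in>{0..T}. norm (S' l t f - S t f) < \<delta>" and l: "l > 0"
      and IH: "process_norm_sq T (\<lambda>s \<omega> x. conv_process S ps s \<omega> x - conv_process (S' l) ps s \<omega> x) \<le> ennreal (\<epsilon> / 4)"
    note S'l = S'[OF l]
    have 1: "process_norm_sq T (\<lambda>s \<omega> x. conv_process S [p] s \<omega> x - conv_process (S' l) [p] s \<omega> x) \<le> ennreal (\<epsilon> / 4)"
    proof (rule order_trans[OF process_norm_sq_rank_one_le[OF T0, of _ \<delta> g] ennreal_leI[OF small]])
      fix s \<omega> n assume s: "s \<in> {0..T}"
      let ?x = "R (onb_seq n)"
      have e: "conv_process S [p] s \<omega> ?x - conv_process (S' l) [p] s \<omega> ?x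
          = (indicator {a<..b} s * indicator B \<omega> * (?x \<bullet> g)) *\<^sub>R (S (s - a) f - S' l (s - a) f)"
        by (simp add: p \<Phi> conv_process_Cons conv_process_Nil blinfun.scaleR_right scaleR_diff_right mult.assoc)
      show "norm (conv_process S [p] s \<omega> ?x - conv_process (S' l) [p] s \<omega> ?x) \<le> \<delta> * \<bar>?x \<bullet> g\<bar>"
      proof (cases "s \<in> {a<..b} \<and> \<omega> \<in> B")
        case True
        then have "norm (S (s - a) f - S' l (s - a) f) \<le> \<delta>"
          using near a s by (auto simp: norm_minus_commute intro!: less_imp_le)
        then have "\<bar>?x \<bullet> g\<bar> * norm (S (s - a) f - S' l (s - a) f) \<le> \<bar>?x \<bullet> g\<bar> * \<delta>" by (intro mult_left_mono) auto
        then show ?thesis unfolding e using True by (simp add: mult.commute)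
      next
        case False
        then show ?thesis unfolding e using \<delta>(1) by (auto split: split_indicator)
      qed
    qed
    \<comment> \<open>A mixed process, with the head under \<open>S' l\<close> and the tail under
      \<open>S\<close>; \<open>neg_simple\<close> writes the sum as a difference.\<close>
    let ?M = "\<lambda>s \<omega> x. conv_process S ps s \<omega> x - conv_process (S' l) (neg_simple [p]) s \<omega> x"
    note cm = process_measurable_conv_process[OF S] and cm' = process_measurable_conv_process[OF S'l]
    have "process_norm_sq T (\<lambda>s \<omega> x. conv_process S (p # ps) s \<omega> x - conv_process (S' l) (p # ps) s \<omega> x)
      \<le> 2 * process_norm_sq T (\<lambda>s \<omega> x. conv_process S (p # ps) s \<omega> x - ?M s \<omega> x)
        + 2 * process_norm_sq T (\<lambda>s \<omega> x. ?M s \<omega> x - conv_process (S' l) (p # ps) s \<omega> x)"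
      by (rule process_norm_sq_triangle[OF cm[OF Cons.prems(1)]
            process_measurable_diff[OF cm[OF ps(1)] cm'[OF simple_integrands_neg[OF p1]]] cm'[OF Cons.prems(1)]])
    also have "(\<lambda>s \<omega> x. conv_process S (p # ps) s \<omega> x - ?M s \<omega> x) = (\<lambda>s \<omega> x. conv_process S [p] s \<omega> x - conv_process (S' l) [p] s \<omega> x)"
      using conv_process_append[of S "[p]" ps] by (simp add: fun_eq_iff conv_process_neg)
    also have "(\<lambda>s \<omega> x. ?M s \<omega> x - conv_process (S' l) (p # ps) s \<omega> x) = (\<lambda>s \<omega> x. conv_process S ps s \<omega> x - conv_process (S' l) ps s \<omega> x)"
      using conv_process_append[of "S' l" "[p]" ps] by (simp add: fun_eq_iff conv_process_neg)
    also have "2 * process_norm_sq T (\<lambda>s \<omega> x. conv_process S [p] s \<omega> x - conv_process (S' l) [p] s \<omega> x)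
        + 2 * process_norm_sq T (\<lambda>s \<omega> x. conv_process S ps s \<omega> x - conv_process (S' l) ps s \<omega> x)
        \<le> 2 * ennreal (\<epsilon> / 4) + 2 * ennreal (\<epsilon> / 4)"
      by (intro add_mono mult_left_mono 1 IH) auto
    also have "\<dots> = ennreal \<epsilon>" using Cons.prems by (intro ennreal_quarters) simp
    finally show "process_norm_sq T (\<lambda>s \<omega> x. conv_process S (p # ps) s \<omega> x - conv_process (S' l) (p # ps) s \<omega> x) \<le> ennreal \<epsilon>" .
  qed
qed

text \<open>The difference of convolutions under two semigroups obeys no contractive recursion, so
  it is estimated path by path: a rank-one entry contributes at most |g| times an increment of
  \<open>L'\<close> times the distance of two orbits of f. This is where the finite expected
  supremum of |L'|^2 is needed.\<close>

lemma conv_simple_semigroup_limit: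
  assumes S: "contraction_semigroup S" and S': "\<And>l::real. l > 0 \<Longrightarrow> contraction_semigroup (S' l)"
    and lim: "\<And>x e. e > 0 \<Longrightarrow> \<forall>\<^sub>F l in at_top. \<forall>t\<in>{0..T}. norm (S' l t x - S t x) < e"
    and ps: "ps \<in> simple_integrands F T" "finite_rank ps" and \<epsilon>: "\<epsilon> > 0"
  shows "\<forall>\<^sub>F l in at_top. (\<integral>\<^sup>+\<omega>. path_sup T (\<lambda>t. conv_simple S L' ps t \<omega> - conv_simple (S' l) L' ps t \<omega>) \<partial>M) \<le> ennreal \<epsilon>"
  using ps \<epsilon>
proof (induction ps arbitrary: \<epsilon>)
  case Nil
  have "path_sup T (\<lambda>t. conv_simple S L' [] t \<omega> - conv_simple (S' l) L' [] t \<omega>) \<le> 0" for l \<omega>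
    unfolding path_sup_def by (rule SUP_least) (simp add: conv_simple_Nil)
  then show ?case by simp
next
  case (Cons p ps)
  obtain a b B \<Phi> where p: "p = (a, b, B, \<Phi>)" by (cases p)
  have a: "0 \<le> a" "a < b" "b \<le> T" "B \<in> sets (F a)" and ps: "ps \<in> simple_integrands F T" "finite_rank ps"
    using Cons.prems by (auto simp: p simple_integrands_Cons finite_rank_def)
  obtain g f where \<Phi>: "\<Phi> = rank_one g f" using Cons.prems by (auto simp: p finite_rank_def)
  have p1: "[p] \<in> simple_integrands F T" using a by (simp add: p simple_integrands_def)
  have \<epsilon>4: "\<epsilon> / 4 > 0" using Cons.prems by simp
  obtain K where K: "K \<ge> 0" "(\<integral>\<^sup>+\<omega>. path_sup T (\<lambda>t. L' t \<omega>) \<partial>M) \<le> ennreal K" using sup_levy_finite by blast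
  \<comment> \<open>Chosen to give 4 \<delta>^2 |g|^2 K \<le> \<epsilon> / 4. The factor 4 bounds
    the squared increment of \<open>L'\<close> by 4 sup |L'|^2, and the summand 1 covers K = 0 or g
    = 0.\<close>
  define \<delta> where "\<delta> = sqrt (\<epsilon> / 4 / (4 * (norm g)\<^sup>2 * K + 1))"
  have den: "4 * (norm g)\<^sup>2 * K + 1 > 0" using K by (simp add: add_nonneg_pos)
  have \<delta>: "\<delta> > 0" "\<delta>\<^sup>2 = \<epsilon> / 4 / (4 * (norm g)\<^sup>2 * K + 1)" using \<epsilon>4 den by (simp_all add: \<delta>_def)
  have small: "(\<delta> * norm g)\<^sup>2 * 4 * K \<le> \<epsilon> / 4"
    using \<epsilon>4 den K(1) by (simp add: power_mult_distrib \<delta>(2) field_simps)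
  have l0: "\<forall>\<^sub>F l in at_top. (l::real) > 0" by (rule eventually_gt_at_top)
  from lim[OF \<delta>(1), of f] l0 Cons.IH[OF ps \<epsilon>4] show ?case
  proof eventually_elim
    fix l :: real
    assume near: "\<forall>t\<in>{0..T}. norm (S' l t f - S t f) < \<delta>" and l: "l > 0"
      and IH: "(\<integral>\<^sup>+\<omega>. path_sup T (\<lambda>t. conv_simple S L' ps t \<omega> - conv_simple (S' l) L' ps t \<omega>) \<partial>M) \<le> ennreal (\<epsilon> / 4)"
    note S'l = S'[OF l]
    have meas: "(\<lambda>\<omega>. path_sup T (\<lambda>t. conv_simple S L' qs t \<omega> - conv_simple (S' l) L' qs t \<omega>)) \<in> borel_measurable M"
      if qs: "qs \<in> simple_integrands F T" for qs
    proof (rule path_sup_measurable[OF T])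
      show "(\<lambda>\<omega>. conv_simple S L' qs t \<omega> - conv_simple (S' l) L' qs t \<omega>) \<in> borel_measurable M" if "t \<in> {0..T}" for t
        by (rule borel_measurable_diff[OF conv_L'_measurable[OF that qs] conv_L'_measurable[OF that qs]])
      show "cadlag_on T (\<lambda>t. conv_simple S L' qs t \<omega> - conv_simple (S' l) L' qs t \<omega>)" if "\<omega> \<in> space M" for \<omega>
        by (rule cadlag_on_diff; rule cadlag_conv_simple[OF S] cadlag_conv_simple[OF S'l]; rule L'_cadlag[OF that])
    qed
    have mL: "(\<lambda>\<omega>. path_sup T (\<lambda>t. L' t \<omega>)) \<in> borel_measurable M"
      by (rule path_sup_measurable[OF T L'_M L'_cadlag])
    have 1: "(\<integral>\<^sup>+\<omega>. path_sup T (\<lambda>t. conv_simple S L' [p] t \<omega> - conv_simple (S' l) L' [p] t \<omega>) \<partial>M) \<le> ennreal (\<epsilon> / 4)"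
    proof -
      have "(\<integral>\<^sup>+\<omega>. path_sup T (\<lambda>t. conv_simple S L' [p] t \<omega> - conv_simple (S' l) L' [p] t \<omega>) \<partial>M)
          \<le> (\<integral>\<^sup>+\<omega>. ennreal ((\<delta> * norm g)\<^sup>2 * 4) * path_sup T (\<lambda>t. L' t \<omega>) \<partial>M)"
      proof (rule nn_integral_mono)
        fix \<omega>
        show "path_sup T (\<lambda>t. conv_simple S L' [p] t \<omega> - conv_simple (S' l) L' [p] t \<omega>) \<le> ennreal ((\<delta> * norm g)\<^sup>2 * 4) * path_sup T (\<lambda>t. L' t \<omega>)"
          unfolding path_sup_def[of T "\<lambda>t. conv_simple S L' [p] t \<omega> - conv_simple (S' l) L' [p] t \<omega>"]
        proof (rule SUP_least)
          fix t assume t: "t \<in> {0..T}"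
          let ?y = "L' (min b t) \<omega> - L' (min a t) \<omega>" and ?r = "t - min a t"
          have r: "?r \<in> {0..T}" using a t by auto
          have "conv_simple S L' [p] t \<omega> - conv_simple (S' l) L' [p] t \<omega> = (indicator B \<omega> * (?y \<bullet> g)) *\<^sub>R (S ?r f - S' l ?r f)"
            by (simp add: p \<Phi> conv_simple_Cons conv_simple_Nil blinfun.scaleR_right scaleR_diff_right)
          then have "norm (conv_simple S L' [p] t \<omega> - conv_simple (S' l) L' [p] t \<omega>) \<le> \<bar>?y \<bullet> g\<bar> * norm (S ?r f - S' l ?r f)"
            by (simp split: split_indicator)
          also have "\<dots> \<le> (norm ?y * norm g) * \<delta>"
            using near r by (intro mult_mono Cauchy_Schwarz_ineq2) (auto simp: norm_minus_commute intro!: less_imp_le)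
          finally have le: "norm (conv_simple S L' [p] t \<omega> - conv_simple (S' l) L' [p] t \<omega>) \<le> (\<delta> * norm g) * norm ?y"
            by (simp add: mult_ac)
          have "ennreal ((norm (conv_simple S L' [p] t \<omega> - conv_simple (S' l) L' [p] t \<omega>))\<^sup>2) \<le> ennreal (((\<delta> * norm g) * norm ?y)\<^sup>2)"
            by (intro ennreal_leI power_mono le) simp
          also have "\<dots> = ennreal ((\<delta> * norm g)\<^sup>2) * ennreal ((norm (L' (min b t) \<omega> + (- L' (min a t) \<omega>)))\<^sup>2)"
            by (simp add: power_mult_distrib ennreal_mult)
          also have "\<dots> \<le> ennreal ((\<delta> * norm g)\<^sup>2) * (2 * ennreal ((norm (L' (min b t) \<omega>))\<^sup>2) + 2 * ennreal ((norm (- L' (min a t) \<omega>))\<^sup>2))"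
            by (intro mult_left_mono ennreal_norm_add_square_le) simp
          also have "\<dots> \<le> ennreal ((\<delta> * norm g)\<^sup>2) * (2 * path_sup T (\<lambda>t. L' t \<omega>) + 2 * path_sup T (\<lambda>t. L' t \<omega>))"
            unfolding norm_minus_cancel using a t
            by (intro mult_left_mono add_mono path_sup_upper[where f = "\<lambda>t. L' t \<omega>"]) auto
          also have "\<dots> = ennreal ((\<delta> * norm g)\<^sup>2) * (4 * path_sup T (\<lambda>t. L' t \<omega>))"
            by (simp add: mult_2[symmetric] mult.assoc[symmetric])
          also have "\<dots> = ennreal ((\<delta> * norm g)\<^sup>2 * 4) * path_sup T (\<lambda>t. L' t \<omega>)"
            by (simp add: ennreal_mult mult.assoc)
          finally show "ennreal ((norm (conv_simple S L' [p] t \<omega> - conv_simple (S' l) L' [p] t \<omega>))\<^sup>2) \<le> ennreal ((\<delta> * norm g)\<^sup>2 * 4) * path_sup T (\<lambda>t. L' t \<omega>)" .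
        qed
      qed
      also have "\<dots> = ennreal ((\<delta> * norm g)\<^sup>2 * 4) * (\<integral>\<^sup>+\<omega>. path_sup T (\<lambda>t. L' t \<omega>) \<partial>M)" by (rule nn_integral_cmult[OF mL])
      also have "\<dots> \<le> ennreal ((\<delta> * norm g)\<^sup>2 * 4) * ennreal K" by (intro mult_left_mono K) simp
      also have "\<dots> = ennreal ((\<delta> * norm g)\<^sup>2 * 4 * K)" using K(1) by (intro ennreal_mult[symmetric]) auto
      also have "\<dots> \<le> ennreal (\<epsilon> / 4)" by (rule ennreal_leI[OF small])
      finally show ?thesis .
    qed
    have "(\<integral>\<^sup>+\<omega>. path_sup T (\<lambda>t. conv_simple S L' (p # ps) t \<omega> - conv_simple (S' l) L' (p # ps) t \<omega>) \<partial>M)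
      \<le> (\<integral>\<^sup>+\<omega>. 2 * path_sup T (\<lambda>t. conv_simple S L' [p] t \<omega> - conv_simple (S' l) L' [p] t \<omega>)
            + 2 * path_sup T (\<lambda>t. conv_simple S L' ps t \<omega> - conv_simple (S' l) L' ps t \<omega>) \<partial>M)"
    proof (rule nn_integral_mono)
      fix \<omega>
      have "(\<lambda>t. conv_simple S L' (p # ps) t \<omega> - conv_simple (S' l) L' (p # ps) t \<omega>)
          = (\<lambda>t. (conv_simple S L' [p] t \<omega> - conv_simple (S' l) L' [p] t \<omega>) + (conv_simple S L' ps t \<omega> - conv_simple (S' l) L' ps t \<omega>))"
        using conv_simple_append[of S L' "[p]" ps] conv_simple_append[of "S' l" L' "[p]" ps] by (simp add: fun_eq_iff)
      then show "path_sup T (\<lambda>t. conv_simple S L' (p # ps) t \<omega> - conv_simple (S' l) L' (p # ps) t \<omega>)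
          \<le> 2 * path_sup T (\<lambda>t. conv_simple S L' [p] t \<omega> - conv_simple (S' l) L' [p] t \<omega>)
            + 2 * path_sup T (\<lambda>t. conv_simple S L' ps t \<omega> - conv_simple (S' l) L' ps t \<omega>)"
        using path_sup_add_le by (simp only:)
    qed
    also have "\<dots> = 2 * (\<integral>\<^sup>+\<omega>. path_sup T (\<lambda>t. conv_simple S L' [p] t \<omega> - conv_simple (S' l) L' [p] t \<omega>) \<partial>M)
        + 2 * (\<integral>\<^sup>+\<omega>. path_sup T (\<lambda>t. conv_simple S L' ps t \<omega> - conv_simple (S' l) L' ps t \<omega>) \<partial>M)"
      using meas[OF p1] meas[OF ps(1)] by (simp add: nn_integral_add nn_integral_cmult)
    also have "\<dots> \<le> 2 * ennreal (\<epsilon> / 4) + 2 * ennreal (\<epsilon> / 4)"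
      by (intro add_mono mult_left_mono 1 IH) auto
    also have "\<dots> = ennreal \<epsilon>" using Cons.prems by (intro ennreal_quarters) simp
    finally show "(\<integral>\<^sup>+\<omega>. path_sup T (\<lambda>t. conv_simple S L' (p # ps) t \<omega> - conv_simple (S' l) L' (p # ps) t \<omega>) \<partial>M) \<le> ennreal \<epsilon>" .
  qed
qed

text \<open>Fixed simple data \<open>ps\<close> approximate \<psi> under \<open>S\<close>, and for
  large l also under \<open>S' l\<close>, because the two processes of \<open>ps\<close> are then
  close. Hence \<open>cadlag_convolution_approx\<close> applies to both convolutions with the same
  list.\<close>

theorem convolution_semigroup_limit:
  assumes S: "contraction_semigroup S" and S': "\<And>l::real. l > 0 \<Longrightarrow> contraction_semigroup (S' l)"
    and lim: "\<And>x e. e > 0 \<Longrightarrow> \<forall>\<^sub>F l in at_top. \<forall>t\<in>{0..T}. norm (S' l t x - S t x) < e"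
    and \<psi>: "\<psi> \<in> integrands M F Q T"
    and X: "cadlag_modification M T (stoch_convolution M F L Q S \<psi>) X"
    and X': "\<And>l. l > 0 \<Longrightarrow> cadlag_modification M T (stoch_convolution M F L Q (S' l) \<psi>) (X' l)"
  shows "((\<lambda>l. \<integral>\<^sup>+\<omega>. path_sup T (\<lambda>t. X t \<omega> - X' l t \<omega>) \<partial>M) \<longlongrightarrow> 0) at_top"
proof -
  have "\<forall>\<^sub>F l in at_top. (\<integral>\<^sup>+\<omega>. path_sup T (\<lambda>t. X t \<omega> - X' l t \<omega>) \<partial>M) \<le> ennreal \<epsilon>" if \<epsilon>: "\<epsilon> > 0" for \<epsilon> :: real
  proof -
    \<comment> \<open>The three contributions below add up to 1300 \<delta>.\<close>
    define \<delta> where "\<delta> = \<epsilon> / 2000"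
    have \<delta>: "\<delta> > 0" using \<epsilon> by (simp add: \<delta>_def)
    obtain ps where ps: "ps \<in> simple_integrands F T" "finite_rank ps"
      "process_norm_sq T (\<lambda>s \<omega> x. \<psi> s \<omega> x - conv_process S ps s \<omega> x) \<le> ennreal \<delta>"
      using conv_processes_dense[OF S T \<psi> \<delta>] by blast
    have l0: "\<forall>\<^sub>F l in at_top. (l::real) > 0" by (rule eventually_gt_at_top)
    have "\<forall>\<^sub>F l in at_top. process_norm_sq T (\<lambda>s \<omega> x. conv_process S ps s \<omega> x - conv_process (S' l) ps s \<omega> x) \<le> ennreal \<delta>"
      by (rule conv_process_semigroup_limit[OF S S' lim ps(1,2) \<delta>])
    moreover have "\<forall>\<^sub>F l in at_top. (\<integral>\<^sup>+\<omega>. path_sup T (\<lambda>t. conv_simple S L' ps t \<omega> - conv_simple (S' l) L' ps t \<omega>) \<partial>M) \<le> ennreal \<delta>"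
      by (rule conv_simple_semigroup_limit[OF S S' lim ps(1,2) \<delta>])
    ultimately show ?thesis using l0
    proof eventually_elim
      fix l :: real
      assume N: "process_norm_sq T (\<lambda>s \<omega> x. conv_process S ps s \<omega> x - conv_process (S' l) ps s \<omega> x) \<le> ennreal \<delta>"
        and B: "(\<integral>\<^sup>+\<omega>. path_sup T (\<lambda>t. conv_simple S L' ps t \<omega> - conv_simple (S' l) L' ps t \<omega>) \<partial>M) \<le> ennreal \<delta>"
        and l: "l > 0"
      note S'l = S'[OF l] and X'l = X'[OF l]
      let ?Y = "\<lambda>t \<omega>. conv_simple S L' ps t \<omega>" and ?Z = "\<lambda>t \<omega>. conv_simple (S' l) L' ps t \<omega>"
      have XM: "X t \<in> borel_measurable M" "X' l t \<in> borel_measurable M" if "t \<in> {0..T}" for t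
        using X X'l that by (simp_all add: cadlag_modification_def)
      have YM: "conv_simple S L' ps t \<in> borel_measurable M" "conv_simple (S' l) L' ps t \<in> borel_measurable M" if "t \<in> {0..T}" for t
        using conv_L'_measurable[OF that ps(1)] by simp_all
      have Xc: "cadlag_on T (\<lambda>t. X t \<omega>)" "cadlag_on T (\<lambda>t. X' l t \<omega>)" if "\<omega> \<in> space M" for \<omega>
        using X X'l that by (simp_all add: cadlag_modification_def)
      have Yc: "cadlag_on T (\<lambda>t. ?Y t \<omega>)" "cadlag_on T (\<lambda>t. ?Z t \<omega>)" if "\<omega> \<in> space M" for \<omega>
        by (rule cadlag_conv_simple[OF S] cadlag_conv_simple[OF S'l]; rule L'_cadlag[OF that])+
      have m1: "(\<lambda>\<omega>. path_sup T (\<lambda>t. X t \<omega> - ?Y t \<omega>)) \<in> borel_measurable M"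
        by (rule path_sup_measurable[OF T borel_measurable_diff[OF XM(1) YM(1)] cadlag_on_diff[OF Xc(1) Yc(1)]])
      have m2: "(\<lambda>\<omega>. path_sup T (\<lambda>t. ?Y t \<omega> - ?Z t \<omega>)) \<in> borel_measurable M"
        by (rule path_sup_measurable[OF T borel_measurable_diff[OF YM(1) YM(2)] cadlag_on_diff[OF Yc(1) Yc(2)]])
      have m3: "(\<lambda>\<omega>. path_sup T (\<lambda>t. X' l t \<omega> - ?Z t \<omega>)) \<in> borel_measurable M"
        by (rule path_sup_measurable[OF T borel_measurable_diff[OF XM(2) YM(2)] cadlag_on_diff[OF Xc(2) Yc(2)]])
      have "process_norm_sq T (\<lambda>s \<omega> x. \<psi> s \<omega> x - conv_process (S' l) ps s \<omega> x)
          \<le> 2 * process_norm_sq T (\<lambda>s \<omega> x. \<psi> s \<omega> x - conv_process S ps s \<omega> x)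
            + 2 * process_norm_sq T (\<lambda>s \<omega> x. conv_process S ps s \<omega> x - conv_process (S' l) ps s \<omega> x)"
        by (rule process_norm_sq_triangle[OF integrands_process_measurable[OF \<psi>]
              process_measurable_conv_process[OF S ps(1)] process_measurable_conv_process[OF S'l ps(1)]])
      also have "\<dots> \<le> 2 * ennreal \<delta> + 2 * ennreal \<delta>" by (intro add_mono mult_left_mono ps N) auto
      also have "\<dots> = ennreal (4 * \<delta>)" using ennreal_quarters[of "4 * \<delta>"] \<delta> by simp
      finally have nsq: "process_norm_sq T (\<lambda>s \<omega> x. \<psi> s \<omega> x - conv_process (S' l) ps s \<omega> x) \<le> ennreal (4 * \<delta>)" .
      have k: "72 * ennreal x = ennreal (72 * x)" "2 * ennreal x = ennreal (2 * x)" for x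
        using ennreal_mult'[of 72 x] ennreal_mult'[of 2 x] by simp_all
      have 1: "(\<integral>\<^sup>+\<omega>. path_sup T (\<lambda>t. X t \<omega> - ?Y t \<omega>) \<partial>M) \<le> ennreal (72 * \<delta>)"
        unfolding k(1)[symmetric] by (rule order_trans[OF cadlag_convolution_approx[OF S \<psi> X ps(1)]], intro mult_left_mono ps) simp
      have 3: "(\<integral>\<^sup>+\<omega>. path_sup T (\<lambda>t. X' l t \<omega> - ?Z t \<omega>) \<partial>M) \<le> ennreal (72 * (4 * \<delta>))"
        unfolding k(1)[symmetric] by (rule order_trans[OF cadlag_convolution_approx[OF S'l \<psi> X'l ps(1)]], intro mult_left_mono nsq) simp
      have "(\<integral>\<^sup>+\<omega>. path_sup T (\<lambda>t. X t \<omega> - X' l t \<omega>) \<partial>M)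
          \<le> (\<integral>\<^sup>+\<omega>. 2 * path_sup T (\<lambda>t. X t \<omega> - ?Y t \<omega>) + 2 * (2 * path_sup T (\<lambda>t. ?Y t \<omega> - ?Z t \<omega>) + 2 * path_sup T (\<lambda>t. X' l t \<omega> - ?Z t \<omega>)) \<partial>M)"
      proof (rule nn_integral_mono)
        fix \<omega>
        have "path_sup T (\<lambda>t. (X t \<omega> - ?Y t \<omega>) + ((?Y t \<omega> - ?Z t \<omega>) + (?Z t \<omega> - X' l t \<omega>)))
            \<le> 2 * path_sup T (\<lambda>t. X t \<omega> - ?Y t \<omega>) + 2 * path_sup T (\<lambda>t. (?Y t \<omega> - ?Z t \<omega>) + (?Z t \<omega> - X' l t \<omega>))"
          by (rule path_sup_add_le)
        also have "\<dots> \<le> 2 * path_sup T (\<lambda>t. X t \<omega> - ?Y t \<omega>) + 2 * (2 * path_sup T (\<lambda>t. ?Y t \<omega> - ?Z t \<omega>) + 2 * path_sup T (\<lambda>t. ?Z t \<omega> - X' l t \<omega>))"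
          by (intro add_left_mono mult_left_mono path_sup_add_le) simp
        also have "path_sup T (\<lambda>t. ?Z t \<omega> - X' l t \<omega>) = path_sup T (\<lambda>t. X' l t \<omega> - ?Z t \<omega>)"
          unfolding path_sup_def by (simp add: norm_minus_commute)
        finally show "path_sup T (\<lambda>t. X t \<omega> - X' l t \<omega>)
            \<le> 2 * path_sup T (\<lambda>t. X t \<omega> - ?Y t \<omega>) + 2 * (2 * path_sup T (\<lambda>t. ?Y t \<omega> - ?Z t \<omega>) + 2 * path_sup T (\<lambda>t. X' l t \<omega> - ?Z t \<omega>))"
          by simp
      qed
      also have "\<dots> = 2 * (\<integral>\<^sup>+\<omega>. path_sup T (\<lambda>t. X t \<omega> - ?Y t \<omega>) \<partial>M)
          + 2 * (2 * (\<integral>\<^sup>+\<omega>. path_sup T (\<lambda>t. ?Y t \<omega> - ?Z t \<omega>) \<partial>M) + 2 * (\<integral>\<^sup>+\<omega>. path_sup T (\<lambda>t. X' l t \<omega> - ?Z t \<omega>) \<partial>M))"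
        using m1 m2 m3 by (simp add: nn_integral_add nn_integral_cmult)
      also have "\<dots> \<le> 2 * ennreal (72 * \<delta>) + 2 * (2 * ennreal \<delta> + 2 * ennreal (72 * (4 * \<delta>)))"
        by (intro add_mono mult_left_mono 1 3 B) auto
      also have "\<dots> = ennreal (2 * (72 * \<delta>) + 2 * (2 * \<delta> + 2 * (72 * (4 * \<delta>))))"
      proof -
        have "2 * ennreal \<delta> + 2 * ennreal (72 * (4 * \<delta>)) = ennreal (2 * \<delta> + 2 * (72 * (4 * \<delta>)))"
          unfolding k(2) using \<delta> by (intro ennreal_plus[symmetric]) auto
        then have "2 * ennreal (72 * \<delta>) + 2 * (2 * ennreal \<delta> + 2 * ennreal (72 * (4 * \<delta>)))
            = ennreal (2 * (72 * \<delta>)) + ennreal (2 * (2 * \<delta> + 2 * (72 * (4 * \<delta>))))" by (simp only: k(2))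
        also have "\<dots> = ennreal (2 * (72 * \<delta>) + 2 * (2 * \<delta> + 2 * (72 * (4 * \<delta>))))"
          using \<delta> by (intro ennreal_plus[symmetric]) auto
        finally show ?thesis .
      qed
      also have "\<dots> \<le> ennreal \<epsilon>" using \<epsilon> by (intro ennreal_leI) (simp add: \<delta>_def)
      finally show "(\<integral>\<^sup>+\<omega>. path_sup T (\<lambda>t. X t \<omega> - X' l t \<omega>) \<partial>M) \<le> ennreal \<epsilon>" .
    qed
  qed
  then show ?thesis
  proof (intro order_tendstoI)
    fix y :: ennreal assume all: "\<And>\<epsilon>. 0 < \<epsilon> \<Longrightarrow> \<forall>\<^sub>F l in at_top. (\<integral>\<^sup>+\<omega>. path_sup T (\<lambda>t. X t \<omega> - X' l t \<omega>) \<partial>M) \<le> ennreal \<epsilon>" and "0 < y"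
    then obtain \<epsilon> :: real where \<epsilon>: "0 < \<epsilon>" "ennreal \<epsilon> < y"
    proof -
      obtain z where z: "0 < z" "z < y" using dense[OF \<open>0 < y\<close>] by blast
      then have "z < top" using top_greatest less_le_trans by blast
      then show ?thesis
        using z by (intro that[of "enn2real z"]) (auto simp: enn2real_positive_iff)
    qed
    from all[OF \<epsilon>(1)] show "\<forall>\<^sub>F l in at_top. (\<integral>\<^sup>+\<omega>. path_sup T (\<lambda>t. X t \<omega> - X' l t \<omega>) \<partial>M) < y"
      by (rule eventually_mono) (rule le_less_trans[OF _ \<epsilon>(2)])
  qed simp
qed

end

theorem proposition3p3:
  fixes M :: "'a measure" and F :: "real \<Rightarrow> 'a measure"
    and D :: "'h::{real_inner, banach, second_countable_topology} set" and A :: "'h \<Rightarrow> 'h"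
    and S :: "real \<Rightarrow> 'h \<Rightarrow>\<^sub>L 'h" and S\<^sub>Y :: "real \<Rightarrow> real \<Rightarrow> 'h \<Rightarrow>\<^sub>L 'h"
    and L :: "real \<Rightarrow> 'a \<Rightarrow> 'h" and Q :: "'h \<Rightarrow>\<^sub>L 'h"
    and \<psi> :: "real \<Rightarrow> 'a \<Rightarrow> 'h \<Rightarrow> 'h" and T :: real
  assumes "prob_space M" and "complete_measure M" and "normal_filtration M F"
    and "linear_on D A" and "closure D = UNIV" and "maximal_monotone (op_graph D A)"
    and "C0_semigroup S" and "\<forall>t\<ge>0. norm (S t) \<le> 1"
    and "infinitesimal_generator S = op_graph D (\<lambda>x. - A x)"
    and "\<forall>l>0. C0_semigroup (S\<^sub>Y l) \<and>
           infinitesimal_generator (S\<^sub>Y l) = op_graph UNIV (\<lambda>x. - yosida D A l x)"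
    and "T > 0"
    and "square_integrable_levy_martingale M F L" and "covariance_operator M L Q"
    and "\<psi> \<in> integrands M F Q T"
  shows "(\<exists>X. cadlag_modification M T (stoch_convolution M F L Q S \<psi>) X) \<and>
    (\<forall>l>0. \<exists>X. cadlag_modification M T (stoch_convolution M F L Q (S\<^sub>Y l) \<psi>) X) \<and>
    (\<forall>X X\<^sub>Y. cadlag_modification M T (stoch_convolution M F L Q S \<psi>) X \<longrightarrow>
       (\<forall>l>0. cadlag_modification M T (stoch_convolution M F L Q (S\<^sub>Y l) \<psi>) (X\<^sub>Y l)) \<longrightarrow>
       ((\<lambda>l. \<integral>\<^sup>+\<omega>. (SUP t\<in>{0..T}. ennreal ((norm (X t \<omega> - X\<^sub>Y l t \<omega>))\<^sup>2)) \<partial>M)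
          \<longlongrightarrow> 0) at_top)"
proof -
  interpret prob_space M by fact
  interpret levy_setting M F L Q
    by unfold_locales (use assms in auto)
  interpret yosida_setting D A S S\<^sub>Y
    by unfold_locales (use assms in \<open>auto simp: maximal_monotone_def\<close>)
  \<comment> \<open>The cadlag version of the integrator is auxiliary and does not occur in the
    conclusion.\<close>
  obtain L' where L': "cadlag_modification M T L L'" using ex_cadlag_levy[OF \<open>T > 0\<close>] by blast
  interpret levy_cadlag M F L Q T L' by unfold_locales (use L' \<open>T > 0\<close> in auto)
  have S: "contraction_semigroup S" using C0 contraction by (simp add: contraction_semigroup_def)
  have S_Y: "contraction_semigroup (S\<^sub>Y l)" if "l > 0" for l
    using C0_Y[OF that] S_Y_contraction[OF that] by (simp add: contraction_semigroup_def)
  have \<psi>: "\<psi> \<in> integrands M F Q T" by fact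
  show ?thesis
  proof (intro conjI allI impI)
    show "\<exists>X. cadlag_modification M T (stoch_convolution M F L Q S \<psi>) X"
      using cadlag_convolution[OF S \<psi>] by blast
    show "\<exists>X. cadlag_modification M T (stoch_convolution M F L Q (S\<^sub>Y l) \<psi>) X" if "l > 0" for l
      using cadlag_convolution[OF S_Y[OF that] \<psi>] by blast
    fix X X\<^sub>Y
    assume X: "cadlag_modification M T (stoch_convolution M F L Q S \<psi>) X"
      and X\<^sub>Y: "\<forall>l>0. cadlag_modification M T (stoch_convolution M F L Q (S\<^sub>Y l) \<psi>) (X\<^sub>Y l)"
    from convolution_semigroup_limit[OF S S_Y S_Y_tendsto_uniformly \<psi> X, of X\<^sub>Y] X\<^sub>Y
    show "((\<lambda>l. \<integral>\<^sup>+\<omega>. (SUP t\<in>{0..T}. ennreal ((norm (X t \<omega> - X\<^sub>Y l t \<omega>))\<^sup>2)) \<partial>M) \<longlongrightarrow> 0) at_top"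
      by (simp add: path_sup_def)
  qed
qed

end
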